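(* Let $k$ be an algebraically closed field of characteristic zero. Let $J=(f_1,f_2,f_3)\subseteq R=k[x_1,\ldots,x_n]$, $n\ge3$, be a $d$-equigenerated ideal (minimally generated by three homogeneous forms of degree $d$) with $\mathrm{ht}(J)=2$, and let $e=\mathrm{indeg}(\mathrm{Syz}(J))$ (in the standard grading). Then the following are equivalent: (a) $\mathrm{Bour}(J)=e^2$. (b) The minimal graded free resolution of $R/J$ is $$0\to R(-2d-e)\to R(-d-e)\oplus R(-2d)^2\to R(-d)^3\to R\to R/J\to0.$$
   Context: Here $\mathrm{Syz}(J)=\{(a_1,a_2,a_3)\in R^3: a_1f_1+a_2f_2+a_3f_3=0\}$ is graded as a submodule of $R^3$ (standard grading), so a syzygy of degree $e$ has all nonzero coordinates of degree $e$; $\mathrm{indeg}(\mathrm{Syz}(J))$ is the least degree of a nonzero homogeneous syzygy. $\deg(R/J)$ is the multiplicity of $R/J$. Bourbaki degree: let $\nu$ be a minimal generator of $\mathrm{Syz}(J)$ of degree $e=\mathrm{indeg}(\mathrm{Syz}(J))$. If $J$ is perfect of height two (i.e. $R/J$ is Cohen--Macaulay), put $\mathrm{Bour}(J)=0$. Otherwise $\mathrm{Syz}(J)/R\nu$ is isomorphic, up to shift, to an unmixed homogeneous ideal $I_\nu\subseteq R$ of height $2$, and $\mathrm{Bour}(J)=\deg(R/I_\nu)$. This is independent of $\nu$, and in all cases $\mathrm{Bour}(J)=d^2-ed+e^2-\deg(R/J)$. *)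

theory Defs
  imports
    "HOL-Library.Poly_Mapping"
    "HOL-Library.Extended_Nat"
    "HOL-Library.Cardinality"
    "HOL-Computational_Algebra.Polynomial"
    "Jordan_Normal_Form.Matrix_Kernel"
begin

section \<open>The standard graded polynomial ring\<close>

text \<open>
  The ring \<open>k[x\<^sub>1,\<dots>,x\<^sub>n]\<close> with the variables indexed by a finite linearly ordered type \<open>'n\<close>,
  so that \<open>n = CARD('n)\<close>. The order plays no mathematical role (each \<open>n \<ge> 1\<close> is the cardinality
  of such a type); it makes the library's integral domain instance available.
\<close>

type_synonym ('n, 'k) mpoly = "('n \<Rightarrow>\<^sub>0 nat) \<Rightarrow>\<^sub>0 'k"

definition monom_degree :: "('n::finite \<Rightarrow>\<^sub>0 nat) \<Rightarrow> nat" where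
  "monom_degree m = (\<Sum>i\<in>UNIV. Poly_Mapping.lookup m i)"

text \<open>Degrees are integers, to allow for twists. The zero polynomial is homogeneous of every
  degree, and it is the only homogeneous polynomial of a negative degree.\<close>

definition homogeneous :: "int \<Rightarrow> ('n::finite, 'k::field) mpoly \<Rightarrow> bool" where
  "homogeneous t p \<longleftrightarrow> (\<forall>m\<in>Poly_Mapping.keys p. int (monom_degree m) = t)"

definition homogeneous_vec :: "int \<Rightarrow> ('n::finite, 'k::field) mpoly vec \<Rightarrow> bool" where
  "homogeneous_vec t v \<longleftrightarrow> (\<forall>i<dim_vec v. homogeneous t (v $ i))"


section \<open>Ideals, height and grade\<close>

text \<open>An ideal of a commutative ring is a submodule of the ring over itself.\<close>

abbreviation is_ideal :: "'a::comm_ring_1 set \<Rightarrow> bool" where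
  "is_ideal \<equiv> Modules.module.subspace (*)"

abbreviation ideal_span :: "'a::comm_ring_1 set \<Rightarrow> 'a set" where
  "ideal_span \<equiv> Modules.module.span (*)"

definition minimally_generates :: "'a::comm_ring_1 set \<Rightarrow> 'a set \<Rightarrow> bool" where
  "minimally_generates G I \<longleftrightarrow> ideal_span G = I \<and> (\<forall>G'. G' \<subset> G \<longrightarrow> ideal_span G' \<noteq> I)"

definition prime_ideal :: "'a::comm_ring_1 set \<Rightarrow> bool" where
  "prime_ideal P \<longleftrightarrow> is_ideal P \<and> 1 \<notin> P \<and> (\<forall>a b. a * b \<in> P \<longrightarrow> a \<in> P \<or> b \<in> P)"

definition prime_height :: "'a::comm_ring_1 set \<Rightarrow> enat" where
  "prime_height P =
     (SUP k\<in>{k. \<exists>C. (\<forall>i\<le>k. prime_ideal (C i)) \<and> (\<forall>i<k. C i \<subset> C (Suc i)) \<and> C k = P}. enat k)"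

definition ideal_height :: "'a::comm_ring_1 set \<Rightarrow> enat" where
  "ideal_height I = (INF P\<in>{P. prime_ideal P \<and> I \<subseteq> P}. prime_height P)"

definition associated_prime :: "'a::comm_ring_1 set \<Rightarrow> 'a set \<Rightarrow> bool" where
  "associated_prime I P \<longleftrightarrow> prime_ideal P \<and> (\<exists>x. P = {r. r * x \<in> I})"

definition unmixed :: "'a::comm_ring_1 set \<Rightarrow> bool" where
  "unmixed I \<longleftrightarrow> (\<forall>P. associated_prime I P \<longrightarrow> prime_height P = ideal_height I)"

definition regular_sequence :: "'a::comm_ring_1 list \<Rightarrow> bool" where
  "regular_sequence xs \<longleftrightarrow>
     1 \<notin> ideal_span (set xs) \<and>
     (\<forall>i<length xs. \<forall>r. xs ! i * r \<in> ideal_span (set (take i xs)) \<longrightarrow> r \<in> ideal_span (set (take i xs)))"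

definition grade :: "'a::comm_ring_1 set \<Rightarrow> enat" where
  "grade I = (SUP xs\<in>{xs. set xs \<subseteq> I \<and> regular_sequence xs}. enat (length xs))"


section \<open>Multiplicity\<close>

definition homogeneous_ideal :: "('n::{finite,linorder}, 'k::field) mpoly set \<Rightarrow> bool" where
  "homogeneous_ideal I \<longleftrightarrow> ideal_span {p \<in> I. \<exists>t. homogeneous t p} = I"

abbreviation dim_over_field :: "('n::{finite,linorder}, 'k::field) mpoly set \<Rightarrow> nat" where
  "dim_over_field \<equiv> Vector_Spaces.vector_space.dim (\<lambda>c p. Poly_Mapping.single 0 c * p)"

text \<open>The Hilbert function of \<open>R/I\<close> for a homogeneous ideal \<open>I\<close>, using \<open>(R/I)\<^sub>t = R\<^sub>t/I\<^sub>t\<close>.\<close>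

definition hilbert_function :: "('n::{finite,linorder}, 'k::field) mpoly set \<Rightarrow> nat \<Rightarrow> nat" where
  "hilbert_function I t =
     dim_over_field {p :: ('n, 'k) mpoly. homogeneous (int t) p}
       - dim_over_field {p \<in> I. homogeneous (int t) p}"

definition hilbert_polynomial :: "('n::{finite,linorder}, 'k::field) mpoly set \<Rightarrow> rat poly" where
  "hilbert_polynomial I =
     (THE P. \<forall>\<^sub>F t in sequentially. poly P (of_nat t) = of_nat (hilbert_function I t))"

text \<open>The multiplicity \<open>deg(R/I)\<close>. The Hilbert polynomial has degree \<open>dim(R/I) - 1\<close> when
  \<open>dim(R/I) > 0\<close>, and it is zero when \<open>dim(R/I) = 0\<close>, where the multiplicity is the length.\<close>

definition ideal_multiplicity :: "('n::{finite,linorder}, 'k::field) mpoly set \<Rightarrow> rat" where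
  "ideal_multiplicity I =
     (let P = hilbert_polynomial I in
      if P = 0 then of_nat (\<Sum>t | hilbert_function I t \<noteq> 0. hilbert_function I t)
      else fact (Polynomial.degree P) * lead_coeff P)"


section \<open>Graded free resolutions and perfect ideals\<close>

definition mat_image :: "'a::comm_ring_1 mat \<Rightarrow> 'a vec set" where
  "mat_image A = {A *\<^sub>v w | w. w \<in> carrier_vec (dim_col A)}"

text \<open>
  A finite graded free resolution \<open>0 \<rightarrow> F\<^sub>l \<rightarrow> \<dots> \<rightarrow> F\<^sub>1 \<rightarrow> F\<^sub>0 = R \<rightarrow> R/I \<rightarrow> 0\<close>. The list \<open>D ! i\<close>
  contains the degrees of the basis of \<open>F\<^sub>i\<close>, i.e. \<open>F\<^sub>i\<close> is the direct sum of the \<open>R(-a)\<close> for \<open>a\<close> in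
  \<open>D ! i\<close>, and \<open>As ! i\<close> is the matrix of the homogeneous (degree 0) map \<open>F\<^sub>i\<^sub>+\<^sub>1 \<rightarrow> F\<^sub>i\<close>.
  The set \<open>im i\<close> is the image of the incoming map of \<open>F\<^sub>i\<close>, which is zero for \<open>i = l\<close>.
\<close>

definition graded_free_resolution ::
  "('n::{finite,linorder}, 'k::field) mpoly set \<Rightarrow> int list list \<Rightarrow> ('n, 'k) mpoly mat list \<Rightarrow> bool"
where
  "graded_free_resolution I D As \<longleftrightarrow>
     length D = Suc (length As) \<and> D ! 0 = [0] \<and>
     (\<forall>i<length As. As ! i \<in> carrier_mat (length (D ! i)) (length (D ! Suc i))) \<and>
     (\<forall>i<length As. \<forall>p<length (D ! i). \<forall>q<length (D ! Suc i).
        homogeneous (D ! Suc i ! q - D ! i ! p) (As ! i $$ (p, q))) \<and>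
     (let im = (\<lambda>i. if i < length As then mat_image (As ! i) else {0\<^sub>v (length (D ! i))}) in
        im 0 = {v \<in> carrier_vec 1. v $ 0 \<in> I} \<and>
        (\<forall>i<length As. mat_kernel (As ! i) = im (Suc i)))"

text \<open>Minimality: each map has its image in \<open>\<mm> F\<^sub>i\<close>, where \<open>\<mm>\<close> is generated by the variables,
  i.e. consists of the polynomials with zero constant term.\<close>

definition minimal_graded_free_resolution ::
  "('n::{finite,linorder}, 'k::field) mpoly set \<Rightarrow> int list list \<Rightarrow> ('n, 'k) mpoly mat list \<Rightarrow> bool"
where
  "minimal_graded_free_resolution I D As \<longleftrightarrow>
     graded_free_resolution I D As \<and>
     (\<forall>A\<in>set As. \<forall>p<dim_row A. \<forall>q<dim_col A. Poly_Mapping.lookup (A $$ (p, q)) 0 = 0)"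

text \<open>The projective dimension of \<open>R/I\<close> for a homogeneous ideal \<open>I\<close>; finitely generated graded
  projective \<open>R\<close>-modules are graded free.\<close>

definition proj_dim_quotient :: "('n::{finite,linorder}, 'k::field) mpoly set \<Rightarrow> enat" where
  "proj_dim_quotient I = (INF As\<in>{As. \<exists>D. graded_free_resolution I D As}. enat (length As))"

definition perfect_ideal :: "('n::{finite,linorder}, 'k::field) mpoly set \<Rightarrow> bool" where
  "perfect_ideal I \<longleftrightarrow> 1 \<notin> I \<and> proj_dim_quotient I = grade I"


section \<open>Syzygies and the Bourbaki degree\<close>

definition syzygies ::
  "('n::{finite,linorder}, 'k::field) mpoly \<Rightarrow> ('n, 'k) mpoly \<Rightarrow> ('n, 'k) mpoly \<Rightarrow> ('n, 'k) mpoly vec set"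
where
  "syzygies f1 f2 f3 = {a \<in> carrier_vec 3. a $ 0 * f1 + a $ 1 * f2 + a $ 2 * f3 = 0}"

definition indeg :: "('n::{finite,linorder}, 'k::field) mpoly vec set \<Rightarrow> nat" where
  "indeg M = (LEAST t. \<exists>v\<in>M. v \<noteq> 0\<^sub>v (dim_vec v) \<and> homogeneous_vec (int t) v)"

text \<open>\<open>v\<close> belongs to some minimal system of homogeneous generators of the graded submodule \<open>M\<close>
  of \<open>R\<^sup>r\<close>.\<close>

definition minimal_generator ::
  "nat \<Rightarrow> ('n::{finite,linorder}, 'k::field) mpoly vec set \<Rightarrow> ('n, 'k) mpoly vec \<Rightarrow> bool"
where
  "minimal_generator r M v \<longleftrightarrow>
     (\<exists>us. v \<in> set us \<and> set us \<subseteq> carrier_vec r \<and> (\<forall>u\<in>set us. \<exists>t. homogeneous_vec t u) \<and>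
       mat_image (mat_of_cols r us) = M \<and>
       (\<forall>i<length us. mat_image (mat_of_cols r (take i us @ drop (Suc i) us)) \<noteq> M))"

text \<open>
  \<open>M/R\<nu>\<close> is isomorphic, up to shift, to the unmixed homogeneous ideal \<open>I\<close> of height two. The
  isomorphism is given as an exact sequence \<open>0 \<rightarrow> R\<nu> \<rightarrow> M \<rightarrow> I \<rightarrow> 0\<close> (a Bourbaki sequence) whose
  second map \<open>\<phi>\<close>, only relevant on \<open>M\<close>, is homogeneous of some degree \<open>s\<close>.
\<close>

definition bourbaki_ideal ::
  "('n::{finite,linorder}, 'k::field) mpoly vec set \<Rightarrow> ('n, 'k) mpoly vec \<Rightarrow> ('n, 'k) mpoly set \<Rightarrow> bool"
where
  "bourbaki_ideal M \<nu> I \<longleftrightarrow>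
     is_ideal I \<and> homogeneous_ideal I \<and> ideal_height I = 2 \<and> unmixed I \<and>
     (\<exists>(\<phi> :: ('n, 'k) mpoly vec \<Rightarrow> ('n, 'k) mpoly) (s :: int).
        (\<forall>u\<in>M. \<forall>v\<in>M. \<phi> (u + v) = \<phi> u + \<phi> v) \<and>
        (\<forall>p. \<forall>v\<in>M. \<phi> (p \<cdot>\<^sub>v v) = p * \<phi> v) \<and>
        (\<forall>t. \<forall>v\<in>M. homogeneous_vec t v \<longrightarrow> homogeneous (t + s) (\<phi> v)) \<and>
        \<phi> ` M = I \<and>
        {v \<in> M. \<phi> v = 0} = {p \<cdot>\<^sub>v \<nu> | p. True})"

text \<open>The Bourbaki degree of \<open>(f\<^sub>1, f\<^sub>2, f\<^sub>3)\<close>. The description in the second case is independent of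
  the choice of the minimal generator \<open>\<nu>\<close> of initial degree and of the ideal \<open>I\<close>.\<close>

definition bourbaki_degree ::
  "('n::{finite,linorder}, 'k::field) mpoly \<Rightarrow> ('n, 'k) mpoly \<Rightarrow> ('n, 'k) mpoly \<Rightarrow> rat"
where
  "bourbaki_degree f1 f2 f3 =
     (let J = ideal_span {f1, f2, f3}; M = syzygies f1 f2 f3 in
      if perfect_ideal J \<and> ideal_height J = 2 then 0
      else (THE b. \<exists>\<nu> I. minimal_generator 3 M \<nu> \<and> homogeneous_vec (int (indeg M)) \<nu> \<and>
                     bourbaki_ideal M \<nu> I \<and> b = ideal_multiplicity I))"

end

theory Submission
  imports Defs "HOL-Library.Function_Algebras"
begin

text \<open>
  Let \<open>\<nu>\<close> be a nonzero syzygy of the minimal degree \<open>e\<close>. Taking the cross product with \<open>\<nu>\<close>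
  sends a syzygy \<open>u\<close> to a multiple \<open>h f\<close> of \<open>f = (f\<^sub>1, f\<^sub>2, f\<^sub>3)\<close>, and \<open>u \<mapsto> h\<close> has kernel \<open>R\<nu>\<close>, so its image is the
  Bourbaki ideal \<open>I\<close>. It contains all the coordinates of \<open>\<nu>\<close>, and two general combinations \<open>a, b\<close> of these
  have no common factor. If \<open>I\<close> has multiplicity \<open>e\<^sup>2\<close>, it is equal to \<open>(a, b)\<close>: an additional form would
  generate a free module of rank one over a polynomial ring in \<open>n - 2\<close> variables modulo \<open>(a, b)\<close>, which
  lowers the multiplicity. So \<open>Syz(J)\<close> is generated by \<open>\<nu>\<close> and two lifts of \<open>a\<close> and \<open>b\<close> of degree \<open>d\<close>, and the
  only relation comes from the Koszul relation of \<open>a\<close> and \<open>b\<close>. Conversely the resolution determines the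
  Hilbert function of \<open>I\<close>, which is that of a complete intersection of two forms of degree \<open>e\<close>, and its
  minimality excludes that \<open>J\<close> is perfect.
\<close>

section \<open>Unique factorization in polynomial rings\<close>

text \<open>The overview leaves open why an additional form generates a free module over n - 2
  variables, and why I is unmixed of height two. Both ideals in question come from a matrix whose
  kernel is free of rank one: h lies in I iff h f is in the image of \<nu> \<times> -, with kernel
  R\<nu>, and (a, b) is the image of a row with kernel generated by (b, -a). The cokernel then has
  projective dimension at most two, so none of its nonzero elements is annihilated by a regular
  sequence of length three; hence every proper colon ideal leaves n - 2 variables algebraically
  independent. This one fact gives the height of I, its unmixedness and the drop of the
  multiplicity. Everything else is counting. Chains of primes are bounded by the growth of spaces of
  polynomials, Hilbert polynomials exist because monomial ideals can be counted, and the
  multiplicity of I is the same for every \<nu> because the dimensions of its graded parts are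
  determined by J and e.\<close>

definition subring_set :: "'a::comm_ring_1 set \<Rightarrow> bool" where
  "subring_set S \<longleftrightarrow> 0 \<in> S \<and> 1 \<in> S \<and> (\<forall>a\<in>S. - a \<in> S) \<and> (\<forall>a\<in>S. \<forall>b\<in>S. a + b \<in> S \<and> a * b \<in> S)"

text \<open>The rings k[V], with V a set of variables, are subsets of one type. Divisibility and
  primality are therefore relative to a subset, which allows induction on V.\<close>

definition sdvd :: "'a::comm_ring_1 set \<Rightarrow> 'a \<Rightarrow> 'a \<Rightarrow> bool" where
  "sdvd S a b \<longleftrightarrow> (\<exists>c\<in>S. b = a * c)"

definition sprime :: "'a::comm_ring_1 set \<Rightarrow> 'a \<Rightarrow> bool" where
  "sprime S p \<longleftrightarrow> p \<in> S \<and> p \<noteq> 0 \<and> \<not> sdvd S p 1 \<and>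
     (\<forall>a\<in>S. \<forall>b\<in>S. sdvd S p (a * b) \<longrightarrow> sdvd S p a \<or> sdvd S p b)"

text \<open>Existence of factorizations into prime elements characterizes factorial domains, as
  uniqueness is automatic for primes.\<close>

definition sfactorial :: "'a::comm_ring_1 set \<Rightarrow> bool" where
  "sfactorial S \<longleftrightarrow> subring_set S \<and>
     (\<forall>a\<in>S. a \<noteq> 0 \<longrightarrow> (\<exists>u ps. u \<in> S \<and> sdvd S u 1 \<and> (\<forall>p\<in>set ps. sprime S p) \<and> a = u * prod_list ps))"

definition polys_over :: "'a::comm_ring_1 set \<Rightarrow> 'a poly set" where
  "polys_over S = {p. \<forall>i. coeff p i \<in> S}"

lemma subring_setD:
  assumes "subring_set S"
  shows "0 \<in> S" "1 \<in> S" "a \<in> S \<Longrightarrow> - a \<in> S" "a \<in> S \<Longrightarrow> b \<in> S \<Longrightarrow> a + b \<in> S"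
    "a \<in> S \<Longrightarrow> b \<in> S \<Longrightarrow> a * b \<in> S" "a \<in> S \<Longrightarrow> b \<in> S \<Longrightarrow> a - b \<in> S"
  using assms unfolding subring_set_def
  by (auto simp del: add_uminus_conv_diff simp add: add_uminus_conv_diff[symmetric])

lemma subring_sum: "subring_set S \<Longrightarrow> (\<And>i. i \<in> A \<Longrightarrow> f i \<in> S) \<Longrightarrow> sum f A \<in> S"
  by (induction A rule: infinite_finite_induct) (auto simp: subring_setD)

lemma subring_power: "subring_set S \<Longrightarrow> a \<in> S \<Longrightarrow> a ^ n \<in> S"
  by (induction n) (auto simp: subring_setD)

lemma subring_prod_list: "subring_set S \<Longrightarrow> set ps \<subseteq> S \<Longrightarrow> prod_list ps \<in> S"
  by (induction ps) (auto simp: subring_setD)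

lemma subring_polys_over:
  assumes "subring_set S" shows "subring_set (polys_over S)"
proof -
  have "0 \<in> polys_over S" "1 \<in> polys_over S" using assms by (auto simp: polys_over_def subring_setD)
  moreover have "a * b \<in> polys_over S" if "a \<in> polys_over S" "b \<in> polys_over S" for a b
    using that assms by (auto simp: polys_over_def subring_setD coeff_mult intro!: subring_sum)
  ultimately show ?thesis using assms unfolding subring_set_def[of "polys_over S"]
    by (auto simp: polys_over_def subring_setD)
qed

lemma polys_over_const: "subring_set S \<Longrightarrow> [:c:] \<in> polys_over S \<longleftrightarrow> c \<in> S"
  by (auto simp: polys_over_def coeff_pCons subring_setD split: nat.splits)

lemma polys_over_smult: "subring_set S \<Longrightarrow> c \<in> S \<Longrightarrow> p \<in> polys_over S \<Longrightarrow> Polynomial.smult c p \<in> polys_over S"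
  by (auto simp: polys_over_def subring_setD)

lemma sdvd_const_poly:
  assumes S: "subring_set S"
  shows "sdvd (polys_over S) [:c:] p \<longleftrightarrow> (\<forall>i. sdvd S c (coeff p i))"
proof
  assume "sdvd (polys_over S) [:c:] p"
  then show "\<forall>i. sdvd S c (coeff p i)" by (auto simp: sdvd_def polys_over_def)
next
  assume a: "\<forall>i. sdvd S c (coeff p i)"
  \<comment> \<open>The quotients are chosen coefficient by coefficient; the value 0 at the
    vanishing coefficients of p keeps the support finite, so that \<open>Abs_poly\<close>
    applies.\<close>
  define h where "h = (\<lambda>i. if coeff p i = 0 then 0 else (SOME d. d \<in> S \<and> coeff p i = c * d))"
  have h: "h i \<in> S \<and> coeff p i = c * h i" for i
    using someI_ex[of "\<lambda>d. d \<in> S \<and> coeff p i = c * d"] a S unfolding h_def sdvd_def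
    by (auto simp: subring_setD)
  have "finite {i. h i \<noteq> 0}"
    by (rule finite_subset[of _ "{..Polynomial.degree p}"]) (auto simp: h_def intro: le_degree)
  then have "coeff (Abs_poly h) = h"
    by (simp add: Abs_poly_inverse MOST_iff_cofinite)
  then have "p = [:c:] * Abs_poly h" "Abs_poly h \<in> polys_over S"
    using h by (auto simp: poly_eq_iff polys_over_def)
  then show "sdvd (polys_over S) [:c:] p" unfolding sdvd_def by blast
qed

lemma sdvd_zero: "subring_set S \<Longrightarrow> sdvd S a 0"
  unfolding sdvd_def by (metis mult_zero_right subring_setD(1))

lemma sdvd_add: "subring_set S \<Longrightarrow> sdvd S a b \<Longrightarrow> sdvd S a c \<Longrightarrow> sdvd S a (b + c)"
  unfolding sdvd_def by (metis distrib_left subring_setD(4))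

lemma sdvd_mult: "subring_set S \<Longrightarrow> sdvd S a b \<Longrightarrow> c \<in> S \<Longrightarrow> sdvd S a (b * c)"
  unfolding sdvd_def by (metis mult.assoc subring_setD(5))

lemma sdvd_minus: "subring_set S \<Longrightarrow> sdvd S a b \<Longrightarrow> sdvd S a (- b)"
  unfolding sdvd_def by (metis minus_mult_right subring_setD(3))

lemma sdvd_sum: "subring_set S \<Longrightarrow> (\<And>i. i \<in> A \<Longrightarrow> sdvd S a (f i)) \<Longrightarrow> sdvd S a (sum f A)"
  by (induction A rule: infinite_finite_induct) (auto intro: sdvd_add simp: sdvd_zero)

text \<open>Gauss's lemma. If c divides neither g nor h, let i and j be the first indices whose
  coefficients c does not divide; in the coefficient of g h at i + j all terms but one are divisible
  by c.\<close>

lemma sprime_const_poly: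
  fixes c :: "'a::idom"
  assumes S: "subring_set S" and c: "sprime S c"
  shows "sprime (polys_over S) [:c:]"
  unfolding sprime_def
proof (intro conjI ballI impI)
  show "[:c:] \<in> polys_over S" using c S by (simp add: polys_over_const sprime_def)
  show "[:c:] \<noteq> 0" using c by (simp add: sprime_def)
  show "\<not> sdvd (polys_over S) [:c:] 1"
    using c sdvd_const_poly[OF S, of c 1] by (auto simp: sprime_def dest: spec[of _ 0])
next
  fix g h assume g: "g \<in> polys_over S" and h: "h \<in> polys_over S" and d: "sdvd (polys_over S) [:c:] (g * h)"
  show "sdvd (polys_over S) [:c:] g \<or> sdvd (polys_over S) [:c:] h"
  proof (rule ccontr)
    assume "\<not> ?thesis"
    then have 1: "\<exists>i. \<not> sdvd S c (coeff g i)" "\<exists>i. \<not> sdvd S c (coeff h i)"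
      using sdvd_const_poly[OF S] by auto
    define i where "i = (LEAST i. \<not> sdvd S c (coeff g i))"
    define j where "j = (LEAST i. \<not> sdvd S c (coeff h i))"
    have i: "\<not> sdvd S c (coeff g i)" "\<And>k. k < i \<Longrightarrow> sdvd S c (coeff g k)"
      using LeastI_ex[OF 1(1)] not_less_Least unfolding i_def by blast+
    have j: "\<not> sdvd S c (coeff h j)" "\<And>k. k < j \<Longrightarrow> sdvd S c (coeff h k)"
      using LeastI_ex[OF 1(2)] not_less_Least unfolding j_def by blast+
    have "coeff (g * h) (i + j) = (\<Sum>k\<le>i+j. coeff g k * coeff h (i + j - k))" by (simp add: coeff_mult)
    also have "\<dots> = coeff g i * coeff h j + (\<Sum>k\<in>{..i+j} - {i}. coeff g k * coeff h (i + j - k))"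
      by (subst sum.remove[of _ i]) auto
    finally have e: "coeff g i * coeff h j = coeff (g * h) (i + j) + - (\<Sum>k\<in>{..i+j} - {i}. coeff g k * coeff h (i + j - k))"
      by simp
    have "sdvd S c (coeff g i * coeff h j)" unfolding e
    proof (intro sdvd_add sdvd_minus sdvd_sum S)
      show "sdvd S c (coeff (g * h) (i + j))" using d sdvd_const_poly[OF S] by blast
      fix k assume k: "k \<in> {..i+j} - {i}"
      show "sdvd S c (coeff g k * coeff h (i + j - k))"
      proof (cases "k < i")
        case True
        then show ?thesis using i(2) h S by (auto intro!: sdvd_mult simp: polys_over_def)
      next
        case False
        then have "i + j - k < j" using k by auto
        then have "sdvd S c (coeff h (i + j - k) * coeff g k)" using j(2) g S by (auto intro!: sdvd_mult simp: polys_over_def)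
        then show ?thesis by (simp add: mult.commute)
      qed
    qed
    then show False using c i(1) j(1) g h by (auto simp: sprime_def polys_over_def)
  qed
qed

text \<open>By Gauss's lemma each prime of the constant divides r or q, so the primes are cancelled
  one by one. Recording that r and q change only by constant factors preserves their
  degrees.\<close>

lemma cancel_primes:
  fixes f :: "'a::idom poly"
  assumes S: "subring_set S" and "\<forall>p\<in>set ps. sprime S p" "u \<in> S" "sdvd S u 1"
    and "r \<in> polys_over S" "q \<in> polys_over S" "f \<in> polys_over S"
    and "Polynomial.smult (u * prod_list ps) f = r * q"
  shows "\<exists>r' q' a b. r' \<in> polys_over S \<and> q' \<in> polys_over S \<and> a \<in> S \<and> b \<in> S \<and> a \<noteq> 0 \<and> b \<noteq> 0 \<and>
     f = r' * q' \<and> r = Polynomial.smult a r' \<and> q = Polynomial.smult b q'"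
  using assms
proof (induction ps arbitrary: r q)
  case Nil
  obtain v where v: "v \<in> S" "1 = u * v" using Nil by (auto simp: sdvd_def)
  have "Polynomial.smult v (Polynomial.smult u f) = Polynomial.smult v r * q" using Nil by simp
  then have "f = Polynomial.smult v r * q" using v by (metis smult_smult mult.commute smult_1_left)
  moreover have "r = Polynomial.smult u (Polynomial.smult v r)" using v by simp
  ultimately show ?case using Nil v
    by (intro exI[of _ "Polynomial.smult v r"] exI[of _ q] exI[of _ u] exI[of _ 1])
      (auto simp: polys_over_smult subring_setD)
next
  case (Cons p ps)
  have p: "sprime S p" using Cons by simp
  have pp: "sprime (polys_over S) [:p:]" using sprime_const_poly[OF S p] .
  have fS: "Polynomial.smult (u * prod_list ps) f \<in> polys_over S"
    using Cons.prems S by (intro polys_over_smult subring_setD(5) subring_prod_list) (auto simp: sprime_def)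
  have e: "r * q = [:p:] * Polynomial.smult (u * prod_list ps) f" using Cons.prems by (simp add: mult_ac)
  then have "sdvd (polys_over S) [:p:] (r * q)" using fS unfolding sdvd_def by blast
  then consider "sdvd (polys_over S) [:p:] r" | "sdvd (polys_over S) [:p:] q"
    using pp Cons.prems by (auto simp: sprime_def)
  then show ?case
  proof cases
    case 1
    then obtain r1 where r1: "r1 \<in> polys_over S" "r = [:p:] * r1" unfolding sdvd_def by blast
    have "[:p:] * Polynomial.smult (u * prod_list ps) f = [:p:] * (r1 * q)" using e r1 by (simp add: mult_ac)
    then have "Polynomial.smult (u * prod_list ps) f = r1 * q" using p by (subst (asm) mult_cancel_left) (auto simp: sprime_def)
    then obtain r' q' a b where "r' \<in> polys_over S \<and> q' \<in> polys_over S \<and> a \<in> S \<and> b \<in> S \<and> a \<noteq> 0 \<and> b \<noteq> 0 \<and>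
     f = r' * q' \<and> r1 = Polynomial.smult a r' \<and> q = Polynomial.smult b q'" using Cons.IH[of r1 q] Cons.prems r1 by auto
    then show ?thesis using r1 p S
      by (intro exI[of _ r'] exI[of _ q'] exI[of _ "p * a"] exI[of _ b]) (auto simp: sprime_def subring_setD mult.commute)
  next
    case 2
    then obtain r1 where r1: "r1 \<in> polys_over S" "q = [:p:] * r1" unfolding sdvd_def by blast
    have "[:p:] * Polynomial.smult (u * prod_list ps) f = [:p:] * (r * r1)" using e r1 by (simp add: mult_ac)
    then have "Polynomial.smult (u * prod_list ps) f = r * r1" using p by (subst (asm) mult_cancel_left) (auto simp: sprime_def)
    then obtain r' q' a b where "r' \<in> polys_over S \<and> q' \<in> polys_over S \<and> a \<in> S \<and> b \<in> S \<and> a \<noteq> 0 \<and> b \<noteq> 0 \<and>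
     f = r' * q' \<and> r = Polynomial.smult a r' \<and> r1 = Polynomial.smult b q'" using Cons.IH[of r r1] Cons.prems r1 by auto
    then show ?thesis using r1 p S
      by (intro exI[of _ r'] exI[of _ q'] exI[of _ a] exI[of _ "p * b"]) (auto simp: sprime_def subring_setD mult.commute)
  qed
qed

text \<open>Cancelling the primes of c in c h = f k gives h = r' q' and f = a r'. A prime factor of
  a would divide f, so a is a unit.\<close>

lemma cancel_const:
  fixes f :: "'a::idom poly"
  assumes S: "sfactorial S" and "f \<in> polys_over S" "h \<in> polys_over S" "c \<in> S" "c \<noteq> 0"
    and np: "\<And>p. sprime S p \<Longrightarrow> \<not> sdvd (polys_over S) [:p:] f"
    and "sdvd (polys_over S) f (Polynomial.smult c h)"
  shows "sdvd (polys_over S) f h"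
proof -
  have sr: "subring_set S" using S by (simp add: sfactorial_def)
  have sp: "subring_set (polys_over S)" using subring_polys_over[OF sr] .
  obtain k where k: "k \<in> polys_over S" "Polynomial.smult c h = f * k" using assms unfolding sdvd_def by blast
  obtain u ps where u: "u \<in> S" "sdvd S u 1" "\<forall>p\<in>set ps. sprime S p" "c = u * prod_list ps"
    using S assms unfolding sfactorial_def by blast
  obtain r' q' a b where r: "r' \<in> polys_over S" "q' \<in> polys_over S" "a \<in> S" "b \<in> S" "a \<noteq> 0" "h = r' * q'" "f = Polynomial.smult a r'"
    using cancel_primes[OF sr u(3,1,2) assms(2) k(1) assms(3)] k u by auto
  obtain v qs where v: "v \<in> S" "sdvd S v 1" "\<forall>p\<in>set qs. sprime S p" "a = v * prod_list qs"
    using S r unfolding sfactorial_def by blast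
  have "qs = []"
  proof (cases qs)
    case (Cons p ps)
    have "f = [:p:] * Polynomial.smult (v * prod_list ps) r'" using r v Cons by (simp add: mult_ac)
    moreover have "Polynomial.smult (v * prod_list ps) r' \<in> polys_over S"
      using v r sr Cons by (intro polys_over_smult subring_setD(5) subring_prod_list) (auto simp: sprime_def)
    ultimately have "sdvd (polys_over S) [:p:] f" unfolding sdvd_def by blast
    then show ?thesis using np v Cons by auto
  qed simp
  then obtain w where w: "w \<in> S" "1 = a * w" using v by (auto simp: sdvd_def)
  have "h = f * Polynomial.smult w q'" using r w by (simp add: mult_ac)
  moreover have "Polynomial.smult w q' \<in> polys_over S" using r w sr polys_over_smult by blast
  ultimately show ?thesis unfolding sdvd_def by blast
qed

text \<open>Division with remainder without fractions: multiplication by the leading coefficient of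
  the divisor allows each step to cancel a leading term.\<close>

lemma pseudo_division:
  fixes f g :: "'a::idom poly"
  assumes S: "subring_set S" and f: "f \<in> polys_over S" and g: "g \<in> polys_over S" "g \<noteq> 0"
  shows "\<exists>k q r. q \<in> polys_over S \<and> r \<in> polys_over S \<and> Polynomial.smult (lead_coeff g ^ k) f = g * q + r \<and> (r = 0 \<or> Polynomial.degree r < Polynomial.degree g)"
  using f
proof (induction "Polynomial.degree f" arbitrary: f rule: less_induct)
  case less
  have sp: "subring_set (polys_over S)" using subring_polys_over[OF S] .
  show ?case
  proof (cases "f = 0 \<or> Polynomial.degree f < Polynomial.degree g")
    case True
    then show ?thesis using less sp by (intro exI[of _ 0] exI[of _ f]) (auto simp: subring_setD)
  next
    case False
    let ?m = "monom (lead_coeff f) (Polynomial.degree f - Polynomial.degree g)"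
    define f' where "f' = Polynomial.smult (lead_coeff g) f - ?m * g"
    have m: "?m \<in> polys_over S" using less S by (auto simp: polys_over_def subring_setD)
    have f'S: "f' \<in> polys_over S" unfolding f'_def using less m g sp S
      by (intro subring_setD polys_over_smult) (auto simp: polys_over_def)
    have dg: "Polynomial.degree (?m * g) = Polynomial.degree f" using False g by (auto simp: degree_mult_eq degree_monom_eq)
    have "coeff (?m * g) (Polynomial.degree f) = lead_coeff f * lead_coeff g"
      by (metis dg lead_coeff_mult lead_coeff_monom)
    then have "coeff f' (Polynomial.degree f) = 0" by (simp add: f'_def)
    moreover have "Polynomial.degree f' \<le> Polynomial.degree f" unfolding f'_def
      by (intro degree_diff_le degree_smult_le) (auto simp: dg)
    ultimately have f': "f' = 0 \<or> Polynomial.degree f' < Polynomial.degree f"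
      by (metis le_neq_implies_less leading_coeff_0_iff)
    have "\<exists>k q r. q \<in> polys_over S \<and> r \<in> polys_over S \<and> Polynomial.smult (lead_coeff g ^ k) f' = g * q + r \<and> (r = 0 \<or> Polynomial.degree r < Polynomial.degree g)"
    proof (cases "f' = 0")
      case True
      then show ?thesis using sp by (intro exI[of _ 0]) (auto simp: subring_setD)
    next
      case False
      then show ?thesis using less.hyps f' f'S by blast
    qed
    then obtain k q r where q: "q \<in> polys_over S" "r \<in> polys_over S" "Polynomial.smult (lead_coeff g ^ k) f' = g * q + r" "r = 0 \<or> Polynomial.degree r < Polynomial.degree g"
      by blast
    have c: "lead_coeff g ^ k \<in> S" using g S by (intro subring_power) (auto simp: polys_over_def)
    have "Polynomial.smult (lead_coeff g ^ Suc k) f = Polynomial.smult (lead_coeff g ^ k) f' + g * Polynomial.smult (lead_coeff g ^ k) ?m"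
      by (simp add: f'_def algebra_simps smult_diff_right)
    also have "\<dots> = g * (q + Polynomial.smult (lead_coeff g ^ k) ?m) + r" using q by (simp add: algebra_simps)
    finally show ?thesis using q c m sp S
      by (intro exI[of _ "Suc k"] exI[of _ "q + Polynomial.smult (lead_coeff g ^ k) ?m"] exI[of _ r])
        (auto intro!: subring_setD polys_over_smult)
  qed
qed

text \<open>This replaces the passage to the fraction field. In the ideal (f, g) an element r of
  least degree divides every element up to a constant. If r is constant, f divides a constant
  multiple of h. Otherwise r agrees with f up to constants by indecomposability, and f divides a
  constant multiple of g. Constants cancel because f is primitive.\<close>

lemma sprime_of_indecomposable:
  fixes f :: "'a::idom poly"
  assumes S: "sfactorial S" and f: "f \<in> polys_over S" "Polynomial.degree f > 0"
    and np: "\<And>p. sprime S p \<Longrightarrow> \<not> sdvd (polys_over S) [:p:] f"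
    and nf: "\<And>a b. a \<in> polys_over S \<Longrightarrow> b \<in> polys_over S \<Longrightarrow> f = a * b \<Longrightarrow> Polynomial.degree a = 0 \<or> Polynomial.degree b = 0"
  shows "sprime (polys_over S) f"
proof -
  let ?P = "polys_over S"
  have sr: "subring_set S" using S by (simp add: sfactorial_def)
  have sp: "subring_set ?P" using subring_polys_over[OF sr] .
  have f0: "f \<noteq> 0" using f by auto
  have nu: "\<not> sdvd ?P f 1"
  proof
    assume "sdvd ?P f 1"
    then obtain c where "1 = f * c" unfolding sdvd_def by blast
    then have "Polynomial.degree f + Polynomial.degree c = 0" "c \<noteq> 0" using f0 by (metis degree_1 degree_mult_eq mult_zero_right one_neq_zero, auto)
    then show False using f by simp
  qed
  have "sdvd ?P f h" if g: "g \<in> ?P" and h: "h \<in> ?P" and d: "sdvd ?P f (g * h)" and ng: "\<not> sdvd ?P f g" for g h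
  proof -
    obtain k where k: "k \<in> ?P" "g * h = f * k" using d unfolding sdvd_def by blast
    define A where "A = {p * f + q * g | p q. p \<in> ?P \<and> q \<in> ?P}"
    have "f = 1 * f + 0 * g" "g = 0 * f + 1 * g" by simp_all
    then have fA: "f \<in> A" and gA: "g \<in> A" unfolding A_def using subring_setD(1,2)[OF sp] by blast+
    have AP: "A \<subseteq> ?P" unfolding A_def using f g sp by (auto simp: subring_setD)
    have Acl: "Polynomial.smult c a - r * q \<in> A" if a: "a \<in> A" "r \<in> A" "q \<in> ?P" "c \<in> S" for a r q c
    proof -
      obtain a1 a2 r1 r2 where x: "a = a1 * f + a2 * g" "r = r1 * f + r2 * g" "a1 \<in> ?P" "a2 \<in> ?P" "r1 \<in> ?P" "r2 \<in> ?P"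
        using a unfolding A_def by auto
      have "Polynomial.smult c a - r * q = (Polynomial.smult c a1 - r1 * q) * f + (Polynomial.smult c a2 - r2 * q) * g"
        using x by (simp add: algebra_simps smult_add_right)
      moreover have "Polynomial.smult c a1 - r1 * q \<in> ?P" "Polynomial.smult c a2 - r2 * q \<in> ?P"
        using x a sp sr by (auto intro!: subring_setD polys_over_smult)
      ultimately show ?thesis unfolding A_def by blast
    qed
    obtain r where r: "r \<in> A" "r \<noteq> 0" "\<And>s. s \<in> A \<Longrightarrow> s \<noteq> 0 \<Longrightarrow> Polynomial.degree r \<le> Polynomial.degree s"
      using ex_has_least_nat[of "\<lambda>r. r \<in> A \<and> r \<noteq> 0" f Polynomial.degree] fA f0 by auto
    have rP: "r \<in> ?P" using r AP by auto
    have div: "\<exists>c q. c \<in> S \<and> c \<noteq> 0 \<and> q \<in> ?P \<and> Polynomial.smult c a = r * q" if a: "a \<in> A" for a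
    proof -
      obtain k q s where q: "q \<in> ?P" "s \<in> ?P" "Polynomial.smult (lead_coeff r ^ k) a = r * q + s" "s = 0 \<or> Polynomial.degree s < Polynomial.degree r"
        using pseudo_division[OF sr, of a r] a r AP rP by blast
      have c: "lead_coeff r ^ k \<in> S" using rP sr by (intro subring_power) (auto simp: polys_over_def)
      have "s = Polynomial.smult (lead_coeff r ^ k) a - r * q" using q by simp
      then have "s \<in> A" using Acl[OF a r(1) q(1) c] by simp
      then have "s = 0" using q(4) r(3)[of s] by (cases "s = 0") auto
      then show ?thesis using q c r by (intro exI[of _ "lead_coeff r ^ k"] exI[of _ q]) auto
    qed
    obtain c q where c: "c \<in> S" "c \<noteq> 0" "q \<in> ?P" "Polynomial.smult c f = r * q" using div[OF fA] by blast
    obtain c' q' where c': "c' \<in> S" "c' \<noteq> 0" "q' \<in> ?P" "Polynomial.smult c' g = r * q'" using div[OF gA] by blast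
    show ?thesis
    proof (cases "Polynomial.degree r = 0")
      case True
      then obtain r0 where r0: "r = [:r0:]" by (meson degree_eq_zeroE)
      obtain p q where pq: "p \<in> ?P" "q \<in> ?P" "r = p * f + q * g" using r unfolding A_def by auto
      have "Polynomial.smult r0 h = p * f * h + q * (g * h)" using pq r0 by (metis distrib_right mult.assoc mult_smult_left smult_one mult_pCons_left add_0_left pCons_0_0 mult_zero_left add.right_neutral)
      also have "\<dots> = f * (p * h + q * k)" using k by (simp add: algebra_simps)
      finally have "sdvd ?P f (Polynomial.smult r0 h)" unfolding sdvd_def using pq h k sp
        by (intro bexI[of _ "p * h + q * k"]) (auto simp: subring_setD)
      then show ?thesis using cancel_const[OF S f(1) h _ _ np, of r0] r0 r rP sr by (auto simp: polys_over_const)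
    next
      case False
      obtain u ps where u: "u \<in> S" "sdvd S u 1" "\<forall>p\<in>set ps. sprime S p" "c = u * prod_list ps"
        using S c unfolding sfactorial_def by blast
      obtain r' q'' a b where x: "r' \<in> ?P" "q'' \<in> ?P" "a \<in> S" "b \<in> S" "a \<noteq> 0" "b \<noteq> 0" "f = r' * q''" "r = Polynomial.smult a r'" "q = Polynomial.smult b q''"
        using cancel_primes[OF sr u(3,1,2) rP c(3) f(1)] c u by auto
      have "Polynomial.degree q'' = 0" using nf[OF x(1,2,7)] x False by simp
      then have "Polynomial.degree q = 0" using x by simp
      then obtain q0 where q0: "q = [:q0:]" by (meson degree_eq_zeroE)
      have q0': "q0 \<noteq> 0" "q0 \<in> S" using c q0 f0 polys_over_const[OF sr] by auto
      have "Polynomial.smult (c' * q0) g = Polynomial.smult q0 (Polynomial.smult c' g)" by (simp add: mult.commute)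
      also have "\<dots> = (Polynomial.smult q0 r) * q'" using c' by simp
      also have "Polynomial.smult q0 r = Polynomial.smult c f" using c(4) q0 by simp
      also have "Polynomial.smult c f * q' = f * Polynomial.smult c q'" by simp
      finally have "sdvd ?P f (Polynomial.smult (c' * q0) g)" unfolding sdvd_def using c c' sp sr
        by (intro bexI[of _ "Polynomial.smult c q'"]) (auto intro!: polys_over_smult)
      then have "sdvd ?P f g" using cancel_const[OF S f(1) g _ _ np, of "c' * q0"] c' q0' sr by (auto simp: subring_setD)
      then show ?thesis using ng by simp
    qed
  qed
  then show ?thesis unfolding sprime_def using f f0 nu by blast
qed

text \<open>Splitting off prime constants terminates: each of them is associated to a prime factor
  of the leading coefficient and so shortens its factorization.\<close>

lemma content_exists:
  fixes f :: "'a::idom poly"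
  assumes S: "sfactorial S" and "f \<in> polys_over S" "lead_coeff f = u * prod_list ps" "sdvd S u 1"
    "u \<in> S" "\<forall>p\<in>set ps. sprime S p" "f \<noteq> 0"
  shows "\<exists>qs g. (\<forall>p\<in>set qs. sprime S p) \<and> g \<in> polys_over S \<and> f = Polynomial.smult (prod_list qs) g \<and>
     (\<forall>p. sprime S p \<longrightarrow> \<not> sdvd (polys_over S) [:p:] g)"
  using assms(2-)
proof (induction "length ps" arbitrary: f u ps rule: less_induct)
  case less
  have sr: "subring_set S" using S by (simp add: sfactorial_def)
  show ?case
  proof (cases "\<exists>p. sprime S p \<and> sdvd (polys_over S) [:p:] f")
    case False
    then show ?thesis using less by (intro exI[of _ "[]"] exI[of _ f]) auto
  next
    case True
    then obtain p f1 where p: "sprime S p" "f1 \<in> polys_over S" "f = [:p:] * f1" unfolding sdvd_def by blast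
    have f1: "f1 \<noteq> 0" using p less by auto
    have lc: "lead_coeff f = p * lead_coeff f1" using p by (simp add: lead_coeff_mult)
    have lS: "lead_coeff f1 \<in> S" using p by (simp add: polys_over_def)
    have ex: "\<exists>q\<in>set ps. sdvd S p q" if "sdvd S p (u * prod_list ps)" "u \<in> S" "sdvd S u 1" "\<forall>p\<in>set ps. sprime S p" for ps u
      using that
    proof (induction ps arbitrary: u)
      case Nil
      then obtain c d where "u = p * c" "1 = u * d" "c \<in> S" "d \<in> S" by (auto simp: sdvd_def)
      then have "sdvd S p 1" unfolding sdvd_def using sr by (intro bexI[of _ "c * d"]) (auto simp: subring_setD mult.assoc)
      then show ?case using p by (simp add: sprime_def)
    next
      case (Cons q ps)
      have "sdvd S p (q * (u * prod_list ps))" using Cons.prems by (simp add: mult_ac)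
      moreover have "u * prod_list ps \<in> S" using Cons.prems sr by (intro subring_setD subring_prod_list) (auto simp: sprime_def)
      ultimately have "sdvd S p q \<or> sdvd S p (u * prod_list ps)" using p(1) Cons.prems unfolding sprime_def by auto
      then show ?case using Cons by auto
    qed
    have "sdvd S p (u * prod_list ps)" using lc less lS by (auto simp: sdvd_def)
    then obtain q where q: "q \<in> set ps" "sdvd S p q" using ex less by blast
    then obtain v where v: "v \<in> S" "q = p * v" unfolding sdvd_def by blast
    have qp: "sprime S q" using q less by blast
    \<comment> \<open>The primes p and q are associated: if q divided the cofactor v in q = p v,
      then p would be a unit.\<close>
    have "sdvd S q (p * v)" using v sr unfolding sdvd_def by (intro bexI[of _ 1]) (auto simp: subring_setD)
    then have "sdvd S q p \<or> sdvd S q v" using qp p v by (auto simp: sprime_def)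
    moreover have "\<not> sdvd S q v"
    proof
      assume "sdvd S q v"
      then obtain w where w: "w \<in> S" "v = q * w" unfolding sdvd_def by blast
      then have "v = v * (p * w)" using v by (simp add: mult_ac)
      then have "p * w = 1" using v qp by (auto simp: sprime_def)
      then show False using p w unfolding sprime_def sdvd_def by metis
    qed
    ultimately obtain w where w: "w \<in> S" "p = q * w" unfolding sdvd_def by blast
    then have "p = p * (v * w)" using v by (simp add: mult_ac)
    then have vw: "1 = v * w" using p by (auto simp: sprime_def)
    obtain ps1 ps2 where ps: "ps = ps1 @ q # ps2" using q by (meson split_list)
    obtain u' where u': "u' \<in> S" "1 = u * u'" using less by (auto simp: sdvd_def)
    have "1 = (u * v) * (u' * w)" using u' vw by (metis mult.assoc mult.commute mult_1_left)
    then have uv: "sdvd S (u * v) 1" using u' w sr unfolding sdvd_def by (intro bexI[of _ "u' * w"]) (auto simp: subring_setD)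
    have "p * lead_coeff f1 = p * ((u * v) * prod_list (ps1 @ ps2))"
      using trans[OF lc[symmetric] less.prems(2)] unfolding ps by (simp add: v mult_ac del: mult_cancel_left)
    then have lc1: "lead_coeff f1 = (u * v) * prod_list (ps1 @ ps2)" using p by (auto simp: sprime_def)
    obtain qs g where g: "\<forall>p\<in>set qs. sprime S p" "g \<in> polys_over S" "f1 = Polynomial.smult (prod_list qs) g"
     "\<forall>p. sprime S p \<longrightarrow> \<not> sdvd (polys_over S) [:p:] g"
      using less.hyps[OF _ p(2) lc1 uv _ _ f1] ps less v sr by (auto simp: subring_setD)
    then show ?thesis using p by (intro exI[of _ "p # qs"] exI[of _ g]) (auto simp: mult.commute)
  qed
qed

text \<open>Induction on the degree. Once the content is split off, the primitive part is a product
  of two factors of smaller positive degree, or it is prime.\<close>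

theorem sfactorial_polys_over:
  fixes S :: "'a::idom set"
  assumes S: "sfactorial S" shows "sfactorial (polys_over S)"
proof -
  have sr: "subring_set S" using S by (simp add: sfactorial_def)
  have sp: "subring_set (polys_over S)" using subring_polys_over[OF sr] .
  have const: "prod_list (map (\<lambda>c. [:c:]) ps) = [:prod_list ps:]" for ps :: "'a list"
    by (induction ps) (auto simp: one_pCons)
  have "\<exists>u ps. u \<in> polys_over S \<and> sdvd (polys_over S) u 1 \<and> (\<forall>p\<in>set ps. sprime (polys_over S) p) \<and> f = u * prod_list ps"
    if "f \<in> polys_over S" "f \<noteq> 0" for f using that
  proof (induction "Polynomial.degree f" arbitrary: f rule: less_induct)
    case less
    have lS: "lead_coeff f \<in> S" "lead_coeff f \<noteq> 0" using less by (auto simp: polys_over_def)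
    then obtain u ps where u: "u \<in> S" "sdvd S u 1" "\<forall>p\<in>set ps. sprime S p" "lead_coeff f = u * prod_list ps"
      using S unfolding sfactorial_def by blast
    show ?case
    proof (cases "Polynomial.degree f = 0")
      case True
      then have f: "f = [:lead_coeff f:]" by (metis degree_eq_zeroE lead_coeff_pCons(2))
      have "f = [:u:] * prod_list (map (\<lambda>c. [:c:]) ps)" by (subst f, subst const) (simp add: u)
      moreover have "sdvd (polys_over S) [:u:] 1"
      proof -
        obtain v where "v \<in> S" "1 = u * v" using u by (auto simp: sdvd_def)
        then show ?thesis unfolding sdvd_def using sr by (intro bexI[of _ "[:v:]"]) (auto simp: polys_over_const one_pCons mult.commute)
      qed
      moreover have "[:u:] \<in> polys_over S" using u sr by (simp add: polys_over_const)
      moreover have "\<forall>p\<in>set (map (\<lambda>c. [:c:]) ps). sprime (polys_over S) p" using u sprime_const_poly[OF sr] by auto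
      ultimately show ?thesis by blast
    next
      case False
      obtain qs g where g: "\<forall>p\<in>set qs. sprime S p" "g \<in> polys_over S" "f = Polynomial.smult (prod_list qs) g"
        and ng: "\<And>p. sprime S p \<Longrightarrow> \<not> sdvd (polys_over S) [:p:] g"
        using content_exists[OF S less(2) u(4,2,1,3) less(3)] by blast
      have g0: "g \<noteq> 0" "Polynomial.degree g = Polynomial.degree f" using g less by auto
      have "\<exists>u ps. u \<in> polys_over S \<and> sdvd (polys_over S) u 1 \<and> (\<forall>p\<in>set ps. sprime (polys_over S) p) \<and> g = u * prod_list ps"
      proof (cases "\<exists>a b. a \<in> polys_over S \<and> b \<in> polys_over S \<and> g = a * b \<and> Polynomial.degree a > 0 \<and> Polynomial.degree b > 0")
        case True
        then obtain a b where ab: "a \<in> polys_over S" "b \<in> polys_over S" "g = a * b" "Polynomial.degree a > 0" "Polynomial.degree b > 0" by blast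
        have n: "a \<noteq> 0" "b \<noteq> 0" using ab by auto
        then have "Polynomial.degree g = Polynomial.degree a + Polynomial.degree b" using ab by (simp add: degree_mult_eq)
        then have "Polynomial.degree a < Polynomial.degree f" "Polynomial.degree b < Polynomial.degree f" using ab g0 by auto
        then obtain u ps v qs where u: "u \<in> polys_over S" "sdvd (polys_over S) u 1" "\<forall>p\<in>set ps. sprime (polys_over S) p" "a = u * prod_list ps"
          and v: "v \<in> polys_over S" "sdvd (polys_over S) v 1" "\<forall>p\<in>set qs. sprime (polys_over S) p" "b = v * prod_list qs"
          using less.hyps[of a] less.hyps[of b] ab n by blast
        obtain u' v' where "1 = u * u'" "u' \<in> polys_over S" "1 = v * v'" "v' \<in> polys_over S" using u v by (auto simp: sdvd_def)
        moreover from this have "1 = (u * v) * (u' * v')" by (metis mult.assoc mult.commute mult_1_left)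
        ultimately have "sdvd (polys_over S) (u * v) 1" unfolding sdvd_def using sp by (intro bexI[of _ "u' * v'"]) (auto simp: subring_setD)
        then show ?thesis using u v ab sp
          by (intro exI[of _ "u * v"] exI[of _ "ps @ qs"]) (auto simp: mult_ac subring_setD)
      next
        case False
        then have "sprime (polys_over S) g" using ng g0 \<open>Polynomial.degree f \<noteq> 0\<close> by (intro sprime_of_indecomposable[OF S g(2)]) auto
        then show ?thesis using sp by (intro exI[of _ 1] exI[of _ "[g]"]) (auto simp: sdvd_def subring_setD)
      qed
      then obtain u ps where u: "u \<in> polys_over S" "sdvd (polys_over S) u 1" "\<forall>p\<in>set ps. sprime (polys_over S) p" "g = u * prod_list ps" by blast
      then show ?thesis using g sprime_const_poly[OF sr]
        by (intro exI[of _ u] exI[of _ "map (\<lambda>c. [:c:]) qs @ ps"]) (auto simp: const mult_ac)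
    qed
  qed
  then show ?thesis using sp unfolding sfactorial_def by blast
qed

text \<open>Factoriality is a property of the multiplicative structure, so a multiplicative
  bijection transports it.\<close>

lemma sfactorial_transfer:
  fixes \<Psi> :: "'b::comm_ring_1 \<Rightarrow> 'a::comm_ring_1"
  assumes S: "sfactorial S" and T: "subring_set T" and bij: "bij_betw \<Psi> T S"
    and hom: "\<And>a b. \<Psi> (a * b) = \<Psi> a * \<Psi> b" "\<Psi> 1 = 1" "\<Psi> 0 = 0"
  shows "sfactorial T"
proof -
  have inj: "\<Psi> a = \<Psi> b \<Longrightarrow> a \<in> T \<Longrightarrow> b \<in> T \<Longrightarrow> a = b" for a b
    using bij by (auto simp: bij_betw_def inj_on_def)
  have im: "\<Psi> ` T = S" using bij by (simp add: bij_betw_def)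
  have dv: "sdvd T a b \<longleftrightarrow> sdvd S (\<Psi> a) (\<Psi> b)" if "a \<in> T" "b \<in> T" for a b
  proof
    assume "sdvd T a b" then show "sdvd S (\<Psi> a) (\<Psi> b)" using im hom unfolding sdvd_def by auto
  next
    assume "sdvd S (\<Psi> a) (\<Psi> b)"
    then obtain c where "c \<in> T" "\<Psi> b = \<Psi> (a * c)" using im hom unfolding sdvd_def by auto
    then show "sdvd T a b" using inj[of b "a * c"] that T unfolding sdvd_def by (auto simp: subring_setD)
  qed
  have pr: "sprime T p" if p: "p \<in> T" "sprime S (\<Psi> p)" for p
    unfolding sprime_def
  proof (intro conjI ballI impI)
    show "p \<noteq> 0" using p hom by (auto simp: sprime_def)
    show "\<not> sdvd T p 1" using p dv[of p 1] hom T by (auto simp: sprime_def subring_setD)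
    fix a b assume ab: "a \<in> T" "b \<in> T" "sdvd T p (a * b)"
    then have "sdvd S (\<Psi> p) (\<Psi> a * \<Psi> b)" using dv[of p "a * b"] hom T p by (auto simp: subring_setD)
    then show "sdvd T p a \<or> sdvd T p b" using p(2) dv[of p a] dv[of p b] p(1) ab im unfolding sprime_def by (metis imageI)
  qed (use p in simp)
  have hp: "\<Psi> (prod_list ps) = prod_list (map \<Psi> ps)" for ps by (induction ps) (auto simp: hom)
  have "\<exists>u ps. u \<in> T \<and> sdvd T u 1 \<and> (\<forall>p\<in>set ps. sprime T p) \<and> a = u * prod_list ps" if a: "a \<in> T" "a \<noteq> 0" for a
  proof -
    have "\<Psi> a \<noteq> 0" "\<Psi> a \<in> S" using a hom inj[of a 0] T im by (auto simp: subring_setD)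
    then obtain u ps where u: "u \<in> S" "sdvd S u 1" "\<forall>p\<in>set ps. sprime S p" "\<Psi> a = u * prod_list ps"
      using S unfolding sfactorial_def by blast
    obtain u' where u': "u' \<in> T" "u = \<Psi> u'" using u im by auto
    have "\<forall>p\<in>set ps. \<exists>p'\<in>T. p = \<Psi> p'" using u im by (auto simp: sprime_def)
    then obtain \<rho> where \<rho>: "\<And>p. p \<in> set ps \<Longrightarrow> \<rho> p \<in> T \<and> p = \<Psi> (\<rho> p)" by metis
    define ps' where "ps' = map \<rho> ps"
    have ps': "set ps' \<subseteq> T" "map \<Psi> ps' = ps" using \<rho> by (auto simp: ps'_def intro!: map_idI)
    have "\<Psi> a = \<Psi> (u' * prod_list ps')" using u u' ps' by (simp add: hom hp)
    then have "a = u' * prod_list ps'" using inj a u' ps' T by (auto simp: subring_setD subring_prod_list)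
    moreover have "\<forall>p\<in>set ps'. sprime T p" using pr ps' u(3) by (metis (no_types, lifting) image_eqI set_map subsetD)
    moreover have "sdvd T u' 1" using dv[of u' 1] u u' hom T by (auto simp: subring_setD)
    ultimately show ?thesis using u' by blast
  qed
  then show ?thesis using T unfolding sfactorial_def by blast
qed

section \<open>Gradings of the polynomial ring\<close>

lemma poly_mapping_expand: "p = (\<Sum>m\<in>Poly_Mapping.keys p. Poly_Mapping.single m (Poly_Mapping.lookup p m))"
proof (rule poly_mapping_eqI)
  fix k
  show "Poly_Mapping.lookup p k = Poly_Mapping.lookup (\<Sum>m\<in>Poly_Mapping.keys p. Poly_Mapping.single m (Poly_Mapping.lookup p m)) k"
    by (simp add: lookup_sum lookup_single when_def in_keys_iff sum.delta)
qed

text \<open>The map that sends a monomial m to \<rho>(m) X^w(m), a ring homomorphism when \<rho> and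
  w are additive. It serves twice: with \<rho> = id and w the degree, X records the grading; with
  \<rho> erasing x and w the exponent of x, it isolates one variable.\<close>

definition grade_map ::
  "('m \<Rightarrow> 'm) \<Rightarrow> ('m \<Rightarrow> nat) \<Rightarrow> ('m \<Rightarrow>\<^sub>0 'k) \<Rightarrow> ('m::comm_monoid_add \<Rightarrow>\<^sub>0 'k::comm_ring_1) poly" where
  "grade_map \<rho> w p = (\<Sum>m\<in>Poly_Mapping.keys p. Polynomial.monom (Poly_Mapping.single (\<rho> m) (Poly_Mapping.lookup p m)) (w m))"

lemma grade_map_superset:
  assumes "finite A" "Poly_Mapping.keys p \<subseteq> A"
  shows "grade_map \<rho> w p = (\<Sum>m\<in>A. Polynomial.monom (Poly_Mapping.single (\<rho> m) (Poly_Mapping.lookup p m)) (w m))"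
  unfolding grade_map_def using assms
  by (intro sum.mono_neutral_left) (auto simp: in_keys_iff)

lemma grade_map_add: "grade_map \<rho> w (p + q) = grade_map \<rho> w p + grade_map \<rho> w q"
  by (simp add: grade_map_superset[of "Poly_Mapping.keys p \<union> Poly_Mapping.keys q"] Poly_Mapping.keys_add
      lookup_add single_add add_monom[symmetric] sum.distrib)

lemma grade_map_0 [simp]: "grade_map \<rho> w 0 = 0"
  by (simp add: grade_map_def)

lemma grade_map_sum: "grade_map \<rho> w (sum f A) = (\<Sum>i\<in>A. grade_map \<rho> w (f i))"
  by (induction A rule: infinite_finite_induct) (auto simp: grade_map_add)

lemma grade_map_single: "grade_map \<rho> w (Poly_Mapping.single m c) = Polynomial.monom (Poly_Mapping.single (\<rho> m) c) (w m)"
  by (simp add: grade_map_superset[of "{m}"])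

lemma grade_map_mult:
  assumes "\<And>m m'. \<rho> (m + m') = \<rho> m + \<rho> m'" "\<And>m m'. w (m + m') = w m + w m'"
  shows "grade_map \<rho> w (p * q) = grade_map \<rho> w p * grade_map \<rho> w q"
proof -
  have "p * q = (\<Sum>m\<in>Poly_Mapping.keys p. \<Sum>m'\<in>Poly_Mapping.keys q. Poly_Mapping.single m (Poly_Mapping.lookup p m) * Poly_Mapping.single m' (Poly_Mapping.lookup q m'))"
    using arg_cong2[OF poly_mapping_expand[of p] poly_mapping_expand[of q], of times] by (simp only: sum_product)
  then have "grade_map \<rho> w (p * q) = (\<Sum>m\<in>Poly_Mapping.keys p. \<Sum>m'\<in>Poly_Mapping.keys q.
    Polynomial.monom (Poly_Mapping.single (\<rho> m + \<rho> m') (Poly_Mapping.lookup p m * Poly_Mapping.lookup q m')) (w m + w m'))"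
    by (simp add: grade_map_sum mult_single grade_map_single assms)
  also have "\<dots> = grade_map \<rho> w p * grade_map \<rho> w q"
    by (simp add: grade_map_def sum_product mult_monom mult_single)
  finally show ?thesis .
qed

lemma grade_map_1: "\<rho> 0 = 0 \<Longrightarrow> w 0 = 0 \<Longrightarrow> grade_map \<rho> w 1 = 1"
  by (metis grade_map_single single_one monom_0 one_pCons)

lemma monom_degree_add: "monom_degree (m + m') = monom_degree m + monom_degree m'"
  by (simp add: monom_degree_def lookup_add sum.distrib)

lemma monom_degree_0 [simp]: "monom_degree 0 = 0"
  by (simp add: monom_degree_def)

lemma monom_degree_eq_0: "monom_degree m = 0 \<longleftrightarrow> m = 0"
  by (auto simp: monom_degree_def intro: poly_mapping_eqI)

text \<open>Read off a univariate polynomial over R, the degree inherits its additivity on products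
  from \<open>degree_mult_eq\<close>.\<close>

definition total_degree :: "('n::finite, 'k::field) mpoly \<Rightarrow> nat" where
  "total_degree p = Polynomial.degree (grade_map id monom_degree p)"

text \<open>Setting X = 1 forgets the grading, so the graded form of p determines p.\<close>

lemma poly_grade_map_total: "poly (grade_map id monom_degree p) 1 = p"
proof -
  have "poly (grade_map id monom_degree p) 1 = (\<Sum>m\<in>Poly_Mapping.keys p. Poly_Mapping.single m (Poly_Mapping.lookup p m))"
    by (simp add: grade_map_def poly_sum poly_monom)
  then show ?thesis using poly_mapping_expand[of p, symmetric] by simp
qed

lemma grade_map_total_eq_0: "grade_map id monom_degree p = 0 \<longleftrightarrow> p = 0"
  by (metis poly_grade_map_total grade_map_0 poly_0)

lemma total_degree_mult:
  fixes p q :: "('n::{finite,linorder}, 'k::field) mpoly"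
  shows "p \<noteq> 0 \<Longrightarrow> q \<noteq> 0 \<Longrightarrow> total_degree (p * q) = total_degree p + total_degree q"
  unfolding total_degree_def
  by (subst grade_map_mult) (auto simp: monom_degree_add degree_mult_eq grade_map_total_eq_0)

lemma lookup_coeff_grade_map_total:
  "Poly_Mapping.lookup (coeff (grade_map id monom_degree p) k) m = (if monom_degree m = k then Poly_Mapping.lookup p m else 0)"
proof -
  have "Poly_Mapping.lookup (coeff (grade_map id monom_degree p) k) m =
    (\<Sum>m'\<in>Poly_Mapping.keys p. if m' = m then (if monom_degree m = k then Poly_Mapping.lookup p m else 0) else 0)"
    unfolding grade_map_def coeff_sum lookup_sum
    by (intro sum.cong) (auto simp: lookup_single when_def)
  then show ?thesis by (simp add: in_keys_iff)
qed

lemma monom_degree_le_total_degree: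
  assumes "m \<in> Poly_Mapping.keys p" shows "monom_degree m \<le> total_degree p"
proof -
  have "Poly_Mapping.lookup (coeff (grade_map id monom_degree p) (monom_degree m)) m \<noteq> 0"
    using assms by (simp add: lookup_coeff_grade_map_total in_keys_iff)
  then have "coeff (grade_map id monom_degree p) (monom_degree m) \<noteq> 0" by auto
  then show ?thesis unfolding total_degree_def by (rule le_degree)
qed

lemma total_degree_homogeneous:
  assumes "homogeneous (int t) p" "p \<noteq> 0" shows "total_degree p = t"
proof -
  have "grade_map id monom_degree p = Polynomial.monom p t"
    using assms by (intro poly_eqI poly_mapping_eqI)
      (auto simp: lookup_coeff_grade_map_total homogeneous_def in_keys_iff)
  then show ?thesis using assms by (simp add: total_degree_def degree_monom_eq)
qed

lemma homogeneous_0 [simp]: "homogeneous t 0"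
  by (simp add: homogeneous_def)

lemma homogeneous_add: "homogeneous t p \<Longrightarrow> homogeneous t q \<Longrightarrow> homogeneous t (p + q)"
  unfolding homogeneous_def using Poly_Mapping.keys_add[of p q] by auto

lemma homogeneous_uminus: "homogeneous t p \<Longrightarrow> homogeneous t (- p)"
  unfolding homogeneous_def by (auto simp: in_keys_iff)

lemma homogeneous_diff: "homogeneous t p \<Longrightarrow> homogeneous t q \<Longrightarrow> homogeneous t (p - q)"
  using homogeneous_add[of t p "- q"] homogeneous_uminus[of t q] by simp

lemma homogeneous_sum: "(\<And>i. i \<in> A \<Longrightarrow> homogeneous t (f i)) \<Longrightarrow> homogeneous t (sum f A)"
  by (induction A rule: infinite_finite_induct) (auto intro: homogeneous_add)

lemma homogeneous_mult: "homogeneous s p \<Longrightarrow> homogeneous t q \<Longrightarrow> homogeneous (s + t) (p * q)"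
  unfolding homogeneous_def using keys_mult[of p q] by (auto simp: monom_degree_add)

lemma homogeneous_single: "homogeneous (int (monom_degree m)) (Poly_Mapping.single m c)"
  by (auto simp: homogeneous_def split: if_splits)

lemma homogeneous_const: "homogeneous 0 (Poly_Mapping.single 0 c)"
  by (auto simp: homogeneous_def split: if_splits)

lemma homogeneous_neg: "t < 0 \<Longrightarrow> homogeneous t p \<Longrightarrow> p = 0"
  unfolding homogeneous_def by (metis equals0I keys_eq_empty of_nat_less_0_iff)

lemma homogeneous_0_const: "homogeneous 0 p \<Longrightarrow> p = Poly_Mapping.single 0 (Poly_Mapping.lookup p 0)"
  by (rule poly_mapping_eqI) (auto simp: lookup_single when_def homogeneous_def in_keys_iff monom_degree_eq_0)

lemma homogeneous_pos_lookup_0: "homogeneous t p \<Longrightarrow> t \<noteq> 0 \<Longrightarrow> Poly_Mapping.lookup p 0 = 0"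
  by (force simp: homogeneous_def in_keys_iff)

text \<open>Integer degrees let components be shifted without case distinctions; those of negative
  degree are zero.\<close>

definition hcomp :: "int \<Rightarrow> ('n::finite, 'k::field) mpoly \<Rightarrow> ('n, 'k) mpoly" where
  "hcomp t p = Poly_Mapping.mapp (\<lambda>m c. if int (monom_degree m) = t then c else 0) p"

lemma lookup_hcomp: "Poly_Mapping.lookup (hcomp t p) m = (if int (monom_degree m) = t then Poly_Mapping.lookup p m else 0)"
  by (auto simp: hcomp_def lookup_mapp when_def in_keys_iff)

lemma keys_hcomp: "Poly_Mapping.keys (hcomp t p) = {m \<in> Poly_Mapping.keys p. int (monom_degree m) = t}"
  by (auto simp: in_keys_iff lookup_hcomp split: if_splits)

lemma homogeneous_hcomp [simp]: "homogeneous t (hcomp t p)"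
  by (simp add: homogeneous_def keys_hcomp)

lemma hcomp_0 [simp]: "hcomp t 0 = 0"
  by (rule poly_mapping_eqI) (simp add: lookup_hcomp)

lemma hcomp_add: "hcomp t (p + q) = hcomp t p + hcomp t q"
  by (rule poly_mapping_eqI) (simp add: lookup_hcomp lookup_add)

lemma hcomp_sum: "hcomp t (sum f A) = (\<Sum>i\<in>A. hcomp t (f i))"
  by (induction A rule: infinite_finite_induct) (auto simp: hcomp_add)

lemma hcomp_homogeneous: "homogeneous t p \<Longrightarrow> hcomp s p = (if s = t then p else 0)"
  by (rule poly_mapping_eqI) (auto simp: lookup_hcomp homogeneous_def in_keys_iff)

lemma hcomp_expand: "p = (\<Sum>t\<in>{0..int (total_degree p)}. hcomp t p)"
proof (rule poly_mapping_eqI)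
  fix m
  have "Poly_Mapping.lookup (\<Sum>t\<in>{0..int (total_degree p)}. hcomp t p) m =
    (if int (monom_degree m) \<in> {0..int (total_degree p)} then Poly_Mapping.lookup p m else 0)"
    by (simp add: lookup_sum lookup_hcomp)
  then show "Poly_Mapping.lookup p m = Poly_Mapping.lookup (\<Sum>t\<in>{0..int (total_degree p)}. hcomp t p) m"
    using monom_degree_le_total_degree[of m p] by (auto simp: in_keys_iff)
qed

text \<open>Once the component of degree s - t is removed from p, no monomial of degree s remains in
  the product with q.\<close>

lemma hcomp_mult_homogeneous:
  assumes "homogeneous t q" shows "hcomp s (p * q) = hcomp (s - t) p * q"
proof -
  define r where "r = p - hcomp (s - t) p"
  have p: "p = hcomp (s - t) p + r" by (simp add: r_def)
  have "m \<notin> Poly_Mapping.keys r" if "int (monom_degree m) = s - t" for m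
    using that by (simp add: r_def in_keys_iff lookup_minus lookup_hcomp)
  then have "\<forall>m\<in>Poly_Mapping.keys (r * q). int (monom_degree m) \<noteq> s"
    using keys_mult[of r q] assms unfolding homogeneous_def by (force simp: monom_degree_add)
  then have 0: "hcomp s (r * q) = 0"
    by (intro poly_mapping_eqI) (auto simp: lookup_hcomp in_keys_iff)
  have "homogeneous s (hcomp (s - t) p * q)" using homogeneous_mult[OF homogeneous_hcomp assms, of "s - t" p] by simp
  then show ?thesis by (subst p) (simp add: distrib_right hcomp_add 0 hcomp_homogeneous)
qed

lemma is_unit_iff_const:
  fixes p :: "('n::{finite,linorder}, 'k::field) mpoly"
  shows "p dvd 1 \<longleftrightarrow> p \<noteq> 0 \<and> total_degree p = 0"
proof
  assume "p dvd 1"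
  then obtain q where q: "1 = p * q" by (auto simp: dvd_def)
  then have n: "p \<noteq> 0" "q \<noteq> 0" by auto
  have "total_degree (1 :: ('n, 'k) mpoly) = 0"
    using total_degree_homogeneous[of 0 "1::('n, 'k) mpoly"] homogeneous_const[of 1] by simp
  then show "p \<noteq> 0 \<and> total_degree p = 0" using total_degree_mult[OF n] q n by simp
next
  assume a: "p \<noteq> 0 \<and> total_degree p = 0"
  then have "p = hcomp 0 p" using hcomp_expand[of p] by simp
  then have "homogeneous 0 p" by (metis homogeneous_hcomp)
  then have p: "p = Poly_Mapping.single 0 (Poly_Mapping.lookup p 0)" by (rule homogeneous_0_const)
  then have "Poly_Mapping.lookup p 0 \<noteq> 0" using a by (metis single_zero)
  then have "1 = p * Poly_Mapping.single 0 (inverse (Poly_Mapping.lookup p 0))"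
    by (subst p) (simp add: mult_single)
  then show "p dvd 1" by (rule dvdI)
qed

section \<open>Polynomials in a subset of the variables\<close>

definition poly_in :: "'n set \<Rightarrow> (('n \<Rightarrow>\<^sub>0 nat) \<Rightarrow>\<^sub>0 'k::zero) set" where
  "poly_in V = {p. \<forall>m\<in>Poly_Mapping.keys p. Poly_Mapping.keys m \<subseteq> V}"

lemma keys_add_nat: "Poly_Mapping.keys (a + b :: 'n \<Rightarrow>\<^sub>0 nat) = Poly_Mapping.keys a \<union> Poly_Mapping.keys b"
  by (auto simp: in_keys_iff lookup_add)

lemma subring_poly_in: "subring_set (poly_in V :: (('n \<Rightarrow>\<^sub>0 nat) \<Rightarrow>\<^sub>0 'k::comm_ring_1) set)"
  unfolding subring_set_def
proof (intro conjI ballI)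
  fix a b :: "('n \<Rightarrow>\<^sub>0 nat) \<Rightarrow>\<^sub>0 'k" assume a: "a \<in> poly_in V" and b: "b \<in> poly_in V"
  show "a + b \<in> poly_in V" using a b Poly_Mapping.keys_add[of a b] by (auto simp: poly_in_def)
  show "a * b \<in> poly_in V" using a b keys_mult[of a b] by (force simp: poly_in_def keys_add_nat)
qed (auto simp: poly_in_def in_keys_iff lookup_one when_def)

lemma poly_in_mono: "V \<subseteq> W \<Longrightarrow> poly_in V \<subseteq> poly_in W"
  by (auto simp: poly_in_def)

lemma poly_in_UNIV [simp]: "poly_in UNIV = UNIV"
  by (simp add: poly_in_def)

lemma single_in_poly_in: "Poly_Mapping.keys m \<subseteq> V \<Longrightarrow> Poly_Mapping.single m c \<in> poly_in V"
  by (auto simp: poly_in_def split: if_splits)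

definition var_poly :: "'n \<Rightarrow> (('n \<Rightarrow>\<^sub>0 nat) \<Rightarrow>\<^sub>0 'k) \<Rightarrow> (('n \<Rightarrow>\<^sub>0 nat) \<Rightarrow>\<^sub>0 'k::comm_ring_1) poly" where
  "var_poly x = grade_map (Poly_Mapping.update x 0) (\<lambda>m. Poly_Mapping.lookup m x)"

definition var :: "'n \<Rightarrow> (('n \<Rightarrow>\<^sub>0 nat) \<Rightarrow>\<^sub>0 'k::comm_ring_1)" where
  "var x = Poly_Mapping.single (Poly_Mapping.single x 1) 1"

lemma update_add: "Poly_Mapping.update x 0 (m + m') = Poly_Mapping.update x 0 m + Poly_Mapping.update x 0 (m' :: 'n \<Rightarrow>\<^sub>0 nat)"
  by (rule poly_mapping_eqI) (simp add: lookup_update lookup_add)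

lemma var_poly_mult: "var_poly x (p * q) = var_poly x p * var_poly x q"
  unfolding var_poly_def by (intro grade_map_mult update_add) (simp add: lookup_add)

lemma var_poly_add: "var_poly x (p + q) = var_poly x p + var_poly x q"
  unfolding var_poly_def by (rule grade_map_add)

lemma var_poly_0 [simp]: "var_poly x 0 = 0"
  by (simp add: var_poly_def)

lemma var_poly_1 [simp]: "var_poly x 1 = 1"
  unfolding var_poly_def by (rule grade_map_1) (auto intro: poly_mapping_eqI simp: lookup_update)

lemma var_poly_sum: "var_poly x (sum f A) = (\<Sum>i\<in>A. var_poly x (f i))"
  unfolding var_poly_def by (rule grade_map_sum)

lemma var_poly_power: "var_poly x (p ^ n) = var_poly x p ^ n"
  by (induction n) (auto simp: var_poly_mult)

lemma var_poly_var: "var_poly x (var x) = [:0, 1:]"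
proof -
  have "Poly_Mapping.update x 0 (Poly_Mapping.single x 1) = (0 :: 'a \<Rightarrow>\<^sub>0 nat)"
    by (rule poly_mapping_eqI) (simp add: lookup_update lookup_single when_def)
  then show ?thesis by (simp add: var_poly_def var_def grade_map_single monom_altdef)
qed

lemma var_power: "var x ^ k = Poly_Mapping.single (Poly_Mapping.single x k) 1"
  by (induction k) (auto simp: var_def mult_single single_add[symmetric])

lemma poly_var_poly: "poly (var_poly x p) (var x) = p"
proof -
  have "Poly_Mapping.update x 0 m + Poly_Mapping.single x (Poly_Mapping.lookup m x) = m" for m :: "'a \<Rightarrow>\<^sub>0 nat"
    by (rule poly_mapping_eqI) (simp add: lookup_update lookup_add lookup_single when_def)
  then have "poly (var_poly x p) (var x) = (\<Sum>m\<in>Poly_Mapping.keys p. Poly_Mapping.single m (Poly_Mapping.lookup p m))"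
    by (simp add: var_poly_def grade_map_def poly_sum poly_monom var_power mult_single)
  then show ?thesis using poly_mapping_expand[of p, symmetric] by simp
qed

lemma var_poly_inj: "var_poly x p = var_poly x q \<Longrightarrow> p = q"
  by (metis poly_var_poly)

lemma var_poly_eq_0_iff [simp]: "var_poly x p = 0 \<longleftrightarrow> p = 0"
  by (metis var_poly_inj var_poly_0)

lemma sum_const_poly: "(\<Sum>i\<in>A. [:f i:]) = [:sum f A:]"
  by (induction A rule: infinite_finite_induct) auto

lemma var_poly_const:
  assumes "p \<in> poly_in V" "x \<notin> V" shows "var_poly x p = [:p:]"
proof -
  have "Poly_Mapping.update x 0 m = m \<and> Poly_Mapping.lookup m x = 0" if "m \<in> Poly_Mapping.keys p" for m
  proof -
    have "x \<notin> Poly_Mapping.keys m" using assms that by (auto simp: poly_in_def)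
    then show ?thesis by (auto intro!: poly_mapping_eqI simp: lookup_update in_keys_iff)
  qed
  then have "var_poly x p = (\<Sum>m\<in>Poly_Mapping.keys p. [:Poly_Mapping.single m (Poly_Mapping.lookup p m):])"
    unfolding var_poly_def grade_map_def by (intro sum.cong) (auto simp: monom_0)
  also have "\<dots> = [:(\<Sum>m\<in>Poly_Mapping.keys p. Poly_Mapping.single m (Poly_Mapping.lookup p m)):]"
    by (rule sum_const_poly)
  finally show ?thesis using poly_mapping_expand[of p, symmetric] by simp
qed

lemma coeff_var_poly_in:
  assumes "p \<in> poly_in (insert x V)" "x \<notin> V" shows "coeff (var_poly x p) k \<in> poly_in V"
proof -
  have "coeff (var_poly x p) k = (\<Sum>m\<in>Poly_Mapping.keys p. if Poly_Mapping.lookup m x = k then Poly_Mapping.single (Poly_Mapping.update x 0 m) (Poly_Mapping.lookup p m) else 0)"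
    by (simp add: var_poly_def grade_map_def coeff_sum)
  also have "\<dots> \<in> poly_in V"
    using assms by (intro subring_sum[OF subring_poly_in])
      (auto simp: subring_setD[OF subring_poly_in] poly_in_def keys_update split: if_splits)
  finally show ?thesis .
qed

lemma coeff_var_poly_in': "coeff (var_poly x p) k \<in> poly_in (- {x})"
  by (rule coeff_var_poly_in) (auto simp: insert_Diff_if poly_in_def)

lemma poly_in_of_var_poly_const:
  assumes "p \<in> poly_in (insert x V)" "x \<notin> V" "Polynomial.degree (var_poly x p) = 0" shows "p \<in> poly_in V"
proof -
  obtain c where c: "var_poly x p = [:c:]" using assms(3) by (meson degree_eq_zeroE)
  then have "p = c" using poly_var_poly[of x p] by simp
  then show ?thesis using coeff_var_poly_in[OF assms(1,2), of 0] c by simp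
qed

text \<open>The isomorphism of k[V, x] with k[V][x], whose inverse is evaluation at x. It carries
  factoriality from V to one more variable.\<close>

lemma bij_betw_var_poly:
  assumes "x \<notin> V" shows "bij_betw (var_poly x) (poly_in (insert x V)) (polys_over (poly_in V))"
proof (rule bij_betwI[where g = "\<lambda>q. poly q (var x)"])
  show "var_poly x \<in> poly_in (insert x V) \<rightarrow> polys_over (poly_in V)"
    using coeff_var_poly_in assms by (auto simp: polys_over_def)
  have v: "var x \<in> poly_in (insert x V)" by (auto simp: var_def intro!: single_in_poly_in split: if_splits)
  show "(\<lambda>q. poly q (var x)) \<in> polys_over (poly_in V) \<rightarrow> poly_in (insert x V)"
    using poly_in_mono[of V "insert x V"] v
    by (auto simp: polys_over_def poly_altdef
      intro!: subring_sum[OF subring_poly_in] subring_setD[OF subring_poly_in] subring_power[OF subring_poly_in])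
  show "poly (var_poly x p) (var x) = p" for p by (rule poly_var_poly)
  show "var_poly x (poly q (var x)) = q" if "q \<in> polys_over (poly_in V)" for q :: "(('a \<Rightarrow>\<^sub>0 nat) \<Rightarrow>\<^sub>0 'b) poly"
  proof -
    have "var_poly x (poly q (var x)) = (\<Sum>i\<le>Polynomial.degree q. [:coeff q i:] * [:0, 1:] ^ i)"
      using var_poly_const[of "coeff q _" V x] that assms
      by (simp add: poly_altdef var_poly_sum var_poly_mult var_poly_power var_poly_var polys_over_def)
    also have "\<dots> = (\<Sum>i\<le>Polynomial.degree q. Polynomial.monom (coeff q i) i)" by (simp add: monom_altdef)
    also have "\<dots> = q" by (rule poly_as_sum_of_monoms)
    finally show ?thesis .
  qed
qed

section \<open>Unique factorization of multivariate polynomials\<close>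

text \<open>One variable is adjoined at a time; the start is the field k, where every nonzero
  element is a unit.\<close>

lemma sfactorial_poly_in:
  "finite V \<Longrightarrow> sfactorial (poly_in V :: ('n::{finite,linorder}, 'k::field) mpoly set)"
proof (induction V rule: finite_induct)
  case empty
  have "\<exists>u ps. u \<in> poly_in {} \<and> sdvd (poly_in {}) u 1 \<and> (\<forall>p\<in>set ps. sprime (poly_in {}) p) \<and> a = u * prod_list ps"
    if a: "a \<in> poly_in {}" "a \<noteq> 0" for a :: "('n, 'k) mpoly"
  proof -
    have "homogeneous 0 a" using a by (auto simp: poly_in_def homogeneous_def)
    then have e: "a = Poly_Mapping.single 0 (Poly_Mapping.lookup a 0)" by (rule homogeneous_0_const)
    then have "Poly_Mapping.lookup a 0 \<noteq> 0" using a by (metis single_zero)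
    then have "1 = a * Poly_Mapping.single 0 (inverse (Poly_Mapping.lookup a 0))"
      by (subst e) (simp add: mult_single)
    then have "sdvd (poly_in {}) a 1" unfolding sdvd_def
      by (intro bexI[of _ "Poly_Mapping.single 0 (inverse (Poly_Mapping.lookup a 0))"]) (auto intro: single_in_poly_in)
    then show ?thesis using a by (intro exI[of _ a] exI[of _ "[]"]) auto
  qed
  then show ?case using subring_poly_in unfolding sfactorial_def by blast
next
  case (insert x V)
  show ?case
    by (rule sfactorial_transfer[OF sfactorial_polys_over[OF insert.IH] subring_poly_in bij_betw_var_poly[OF insert.hyps(2)]])
      (simp_all add: var_poly_mult)
qed

lemma sdvd_UNIV: "sdvd UNIV a b \<longleftrightarrow> a dvd b"
  by (auto simp: sdvd_def dvd_def)

lemma sprime_UNIV: "sprime UNIV p \<longleftrightarrow> prime_elem p"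
  by (auto simp: sprime_def prime_elem_def sdvd_UNIV)

lemma prime_factorization_mpoly:
  fixes p :: "('n::{finite,linorder}, 'k::field) mpoly"
  assumes "p \<noteq> 0"
  obtains u ps where "u dvd 1" "\<forall>q\<in>set ps. prime_elem q" "p = u * prod_list ps"
  using sfactorial_poly_in[of "UNIV::'n set"] assms that
  unfolding sfactorial_def by (auto simp: sdvd_UNIV sprime_UNIV)

text \<open>Coprimality in a factorial ring, expressed through primes so that no gcd has to be
  chosen.\<close>

definition no_common_prime :: "'a::comm_semiring_1 \<Rightarrow> 'a \<Rightarrow> bool" where
  "no_common_prime a b \<longleftrightarrow> (\<forall>p. prime_elem p \<longrightarrow> p dvd a \<longrightarrow> \<not> p dvd b)"

text \<open>Euclid's lemma. Every prime factor of p divides q b but not q, so the prime factors move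
  into b one after the other.\<close>

lemma no_common_prime_dvd:
  fixes p :: "('n::{finite,linorder}, 'k::field) mpoly"
  assumes "p \<noteq> 0" "no_common_prime p q" "p dvd q * b"
  shows "p dvd b"
proof -
  obtain u ps where u: "u dvd 1" "\<forall>q\<in>set ps. prime_elem q" "p = u * prod_list ps"
    using prime_factorization_mpoly[OF assms(1)] .
  have main: "u * prod_list ps dvd b" if "u * prod_list ps dvd q * b" "\<forall>q\<in>set ps. prime_elem q \<and> q dvd p" for b
    using that
  proof (induction ps arbitrary: b)
    case Nil
    then show ?case using u(1) by (simp add: dvd_trans[of u 1 b])
  next
    case (Cons r ps)
    have "r dvd u * prod_list (r # ps)" by simp
    then have "r dvd q * b" using Cons.prems(1) by (rule dvd_trans)
    moreover have r: "prime_elem r" "\<not> r dvd q" using Cons.prems assms(2) by (auto simp: no_common_prime_def)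
    ultimately have "r dvd b" using prime_elem_dvd_multD[of r q b] by auto
    then obtain b1 where b1: "b = r * b1" by (rule dvdE)
    have "r * (u * prod_list ps) dvd r * (q * b1)" using Cons.prems(1) b1 by (simp only: prod_list.Cons ac_simps)
    moreover have "r \<noteq> 0" using r by (simp add: prime_elem_def)
    ultimately have "u * prod_list ps dvd q * b1" by simp
    then have "u * prod_list ps dvd b1" by (rule Cons.IH) (use Cons.prems(2) in simp)
    then have "r * (u * prod_list ps) dvd r * b1" by (rule mult_dvd_mono[OF dvd_refl])
    then show ?case using b1 by (simp only: prod_list.Cons ac_simps)
  qed
  have "r dvd p" if "r \<in> set ps" for r
    using u(3) split_list[OF that] by auto
  then show ?thesis using main[of b] u assms(3) by simp
qed

text \<open>Each common prime that is divided out lowers the total degree of p.\<close>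

lemma reduce_common_primes:
  fixes p :: "('n::{finite,linorder}, 'k::field) mpoly"
  assumes "p \<noteq> 0"
  obtains g p' q' where "p = g * p'" "q = g * q'" "no_common_prime p' q'"
proof -
  have "\<exists>g p' q'. p = g * p' \<and> q = g * q' \<and> no_common_prime p' q'" using assms
  proof (induction "total_degree p" arbitrary: p q rule: less_induct)
    case less
    show ?case
    proof (cases "no_common_prime p q")
      case True
      then show ?thesis by (intro exI[of _ 1] exI[of _ p] exI[of _ q]) auto
    next
      case False
      then obtain r p1 q1 where r: "prime_elem r" "p = r * p1" "q = r * q1"
        by (auto simp: no_common_prime_def dvd_def)
      then have n: "p1 \<noteq> 0" "r \<noteq> 0" using less by auto
      have "total_degree r \<noteq> 0" using r n is_unit_iff_const[of r] by (auto simp: prime_elem_def)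
      then have "total_degree p1 < total_degree p" using r n by (simp add: total_degree_mult)
      then obtain g p' q' where "p1 = g * p'" "q1 = g * q'" "no_common_prime p' q'" using less.hyps n by blast
      then show ?thesis using r by (intro exI[of _ "r * g"] exI[of _ p'] exI[of _ q']) (auto simp: mult_ac)
    qed
  qed
  then show ?thesis using that by blast
qed

lemma prime_dvd_exists:
  fixes p :: "('n::{finite,linorder}, 'k::field) mpoly"
  assumes "p \<noteq> 0" "\<not> p dvd 1"
  obtains r where "prime_elem r" "r dvd p"
proof -
  obtain u ps where u: "u dvd 1" "\<forall>q\<in>set ps. prime_elem q" "p = u * prod_list ps"
    using prime_factorization_mpoly[OF assms(1)] .
  then obtain r qs where "ps = r # qs" using assms(2) by (cases ps) auto
  then show ?thesis using that[of r] u by auto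
qed

section \<open>Ideals and heights\<close>

lemma module_mult: "Modules.module ((*) :: 'a::comm_ring_1 \<Rightarrow> 'a \<Rightarrow> 'a)"
  unfolding Modules.module_def by (simp add: distrib_left distrib_right mult.assoc)

lemma is_ideal_iff:
  "is_ideal I \<longleftrightarrow> 0 \<in> I \<and> (\<forall>a\<in>I. \<forall>b\<in>I. a + b \<in> I) \<and> (\<forall>c. \<forall>a\<in>I. c * a \<in> I)"
  by (rule Modules.module.subspace_def[OF module_mult])

lemma is_idealD:
  assumes "is_ideal I"
  shows "0 \<in> I" "a \<in> I \<Longrightarrow> b \<in> I \<Longrightarrow> a + b \<in> I" "a \<in> I \<Longrightarrow> c * a \<in> I" "a \<in> I \<Longrightarrow> a * c \<in> I"
    "a \<in> I \<Longrightarrow> b \<in> I \<Longrightarrow> a - b \<in> I" "a \<in> I \<Longrightarrow> - a \<in> I"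
proof -
  show "0 \<in> I" "a \<in> I \<Longrightarrow> b \<in> I \<Longrightarrow> a + b \<in> I" "a \<in> I \<Longrightarrow> c * a \<in> I" "a \<in> I \<Longrightarrow> a * c \<in> I"
    using assms unfolding is_ideal_iff by (auto simp: mult.commute[of a c])
  show u: "a \<in> I \<Longrightarrow> - a \<in> I" for a using assms unfolding is_ideal_iff by (metis mult_minus1)
  show "a \<in> I \<Longrightarrow> b \<in> I \<Longrightarrow> a - b \<in> I"
    using assms u[of b] unfolding is_ideal_iff by (metis add_uminus_conv_diff)
qed

lemma is_ideal_sum: "is_ideal I \<Longrightarrow> (\<And>i. i \<in> A \<Longrightarrow> f i \<in> I) \<Longrightarrow> sum f A \<in> I"
  by (induction A rule: infinite_finite_induct) (auto simp: is_idealD)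

lemma is_ideal_span: "is_ideal (ideal_span G)"
  by (rule Modules.module.subspace_span[OF module_mult])

lemma ideal_span_superset: "G \<subseteq> ideal_span G"
  by (rule Modules.module.span_superset[OF module_mult])

lemma ideal_span_least: "G \<subseteq> I \<Longrightarrow> is_ideal I \<Longrightarrow> ideal_span G \<subseteq> I"
  by (rule Modules.module.span_minimal[OF module_mult])

lemma ideal_span_empty: "ideal_span {} = {0}"
  by (rule Modules.module.span_empty[OF module_mult])

lemma ideal_span_insert: "ideal_span (insert a G) = {r * a + x | r x. x \<in> ideal_span G}"
proof -
  have "x \<in> ideal_span (insert a G) \<longleftrightarrow> (\<exists>k. x - k * a \<in> ideal_span G)" for x
    by (rule Modules.module.span_breakdown_eq[OF module_mult])
  moreover have "x = k * a + (x - k * a)" "(k * a + y) - k * a = y" for x k y by simp_all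
  ultimately show ?thesis by (smt (verit, del_insts) Collect_cong Collect_mem_eq)
qed

lemma ideal_span_1: "ideal_span {a} = {r * a | r. True}"
  by (auto simp: ideal_span_insert ideal_span_empty)

lemma ideal_span_2: "ideal_span {a, b} = {r * a + s * b | r s. True}"
  by (auto simp: ideal_span_insert[of a] ideal_span_1)

lemma ideal_span_3: "ideal_span {a, b, c} = {r * a + s * b + t * c | r s t. True}"
  by (auto simp: ideal_span_insert[of a] ideal_span_2 add.assoc)

lemma in_ideal_span_1: "x \<in> ideal_span {a} \<longleftrightarrow> a dvd x"
  by (auto simp: ideal_span_1 dvd_def mult.commute)

lemma prime_ideal_zero: "prime_ideal {0 :: 'a::idom}"
  by (auto simp: prime_ideal_def is_ideal_iff)

lemma prime_ideal_principal: "prime_elem p \<Longrightarrow> prime_ideal (ideal_span {p})"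
  by (auto simp: prime_ideal_def is_ideal_span in_ideal_span_1 prime_elem_def)

text \<open>Krull's lemma: an ideal that is maximal among those disjoint from a multiplicative set
  is prime, and Zorn's lemma provides one.\<close>

lemma prime_ideal_avoiding:
  fixes I W :: "'a::comm_ring_1 set"
  assumes I: "is_ideal I" and W: "1 \<in> W" "\<And>a b. a \<in> W \<Longrightarrow> b \<in> W \<Longrightarrow> a * b \<in> W" and d: "I \<inter> W = {}"
  obtains Q where "prime_ideal Q" "I \<subseteq> Q" "Q \<inter> W = {}"
proof -
  let ?A = "{K. is_ideal K \<and> I \<subseteq> K \<and> K \<inter> W = {}}"
  have "\<exists>M\<in>?A. \<forall>X\<in>?A. M \<subseteq> X \<longrightarrow> X = M"
  proof (rule subset_Zorn_nonempty)
    show "?A \<noteq> {}" using I d by blast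
    fix \<C> assume c: "\<C> \<noteq> {}" "subset.chain ?A \<C>"
    then have m: "\<And>K. K \<in> \<C> \<Longrightarrow> is_ideal K \<and> I \<subseteq> K \<and> K \<inter> W = {}"
      by (auto simp: subset_chain_def)
    have "is_ideal (\<Union>\<C>)" unfolding is_ideal_iff
    proof (intro conjI ballI allI)
      show "0 \<in> \<Union>\<C>" using c m is_idealD(1) by blast
      fix a assume a: "a \<in> \<Union>\<C>"
      then show "b * a \<in> \<Union>\<C>" for b using m is_idealD(3) by blast
      fix b assume b: "b \<in> \<Union>\<C>"
      obtain K L where K: "K \<in> \<C>" "a \<in> K" "L \<in> \<C>" "b \<in> L" using a b by blast
      then have "K \<subseteq> L \<or> L \<subseteq> K" using c(2) unfolding subset_chain_def by blast
      then have "a + b \<in> K \<or> a + b \<in> L" using K m[of K] m[of L] is_idealD(2)[of K a b] is_idealD(2)[of L a b] by auto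
      then show "a + b \<in> \<Union>\<C>" using K by auto
    qed
    moreover obtain K where "K \<in> \<C>" using c(1) by auto
    then have "I \<subseteq> \<Union>\<C>" using m[of K] by auto
    moreover have "\<Union>\<C> \<inter> W = {}" using m by (simp add: Int_Union2)
    ultimately show "\<Union>\<C> \<in> ?A" by simp
  qed
  then obtain Q where QA: "Q \<in> ?A" and mx: "\<forall>X\<in>?A. Q \<subseteq> X \<longrightarrow> X = Q" by (elim bexE)
  have Q: "is_ideal Q" "I \<subseteq> Q" "Q \<inter> W = {}" using QA by simp_all
  have max: "X = Q" if "is_ideal X" "I \<subseteq> X" "X \<inter> W = {}" "Q \<subseteq> X" for X
    using mx that by simp
  have meet: "\<exists>w r. w \<in> W \<and> w - r * a \<in> Q" if "a \<notin> Q" for a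
  proof -
    \<comment> \<open>X is the ideal Q + (a); by the maximality of Q it must meet W.\<close>
    define X where "X = {x. \<exists>r. x - r * a \<in> Q}"
    have "is_ideal X" unfolding is_ideal_iff X_def
    proof (intro conjI ballI allI; clarify?)
      show "\<exists>r. 0 - r * a \<in> Q" using Q by (intro exI[of _ 0]) (auto simp: is_idealD)
      fix x r assume x: "x - r * a \<in> Q"
      show "\<exists>r. c * x - r * a \<in> Q" for c
        using is_idealD(3)[OF Q(1) x, of c] by (intro exI[of _ "c * r"]) (simp add: algebra_simps)
      fix y s assume y: "y - s * a \<in> Q"
      show "\<exists>r. x + y - r * a \<in> Q"
        using is_idealD(2)[OF Q(1) x y] by (intro exI[of _ "r + s"]) (simp add: algebra_simps)
    qed
    moreover have "Q \<subseteq> X" unfolding X_def by (auto intro!: exI[of _ 0])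
    moreover have "a \<in> X" unfolding X_def using Q by (auto intro!: exI[of _ 1] simp: is_idealD)
    ultimately have "X \<inter> W \<noteq> {}" using max[of X] Q that by blast
    then show ?thesis unfolding X_def by blast
  qed
  have "prime_ideal Q" unfolding prime_ideal_def
  proof (intro conjI allI impI)
    show "1 \<notin> Q" using Q W by blast
    fix a b assume ab: "a * b \<in> Q"
    show "a \<in> Q \<or> b \<in> Q"
    proof (rule ccontr)
      assume n: "\<not> ?thesis"
      obtain w r where w: "w \<in> W" "w - r * a \<in> Q" using meet[of a] n by blast
      obtain v s where v: "v \<in> W" "v - s * b \<in> Q" using meet[of b] n by blast
      have "w * v = v * (w - r * a) + r * a * (v - s * b) + r * s * (a * b)" by (simp add: algebra_simps)
      also have "\<dots> \<in> Q" using is_idealD(3)[OF Q(1) w(2), of v]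
        is_idealD(3)[OF Q(1) v(2), of "r * a"] is_idealD(3)[OF Q(1) ab, of "r * s"]
        by (simp add: is_idealD(2)[OF Q(1)])
      finally show False using W(2)[OF w(1) v(1)] Q(3) by auto
    qed
  qed (use Q in simp)
  then show ?thesis using that Q by blast
qed

section \<open>Heights of primes and grade in the polynomial ring\<close>

lemma prime_height_ge:
  assumes "\<forall>i\<le>k. prime_ideal (C i)" "\<forall>i<k. C i \<subset> C (Suc i)" "C k = P"
  shows "enat k \<le> prime_height P"
  unfolding prime_height_def by (rule SUP_upper) (use assms in blast)

text \<open>It suffices to exclude chains of length m + 1, because the upper end of a longer chain
  is such a chain.\<close>

lemma prime_height_le:
  assumes "\<And>C. \<forall>i\<le>Suc m. prime_ideal (C i) \<Longrightarrow> \<forall>i<Suc m. C i \<subset> C (Suc i) \<Longrightarrow> C (Suc m) = P \<Longrightarrow> False"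
  shows "prime_height P \<le> enat m"
  unfolding prime_height_def
proof (rule SUP_least, clarify)
  fix k C assume C: "\<forall>i\<le>k. prime_ideal (C i)" "\<forall>i<k. C i \<subset> C (Suc i)" "P = C k"
  show "enat k \<le> enat m"
  proof (rule ccontr)
    assume "\<not> ?thesis"
    then have k: "Suc m \<le> k" by simp
    then show False using assms[of "\<lambda>i. C (i + (k - Suc m))"] C by auto
  qed
qed

text \<open>In a nonzero prime strictly inside (p), take a nonzero element of least degree. It is a
  multiple of p, and its quotient by p lies in the same prime but has smaller degree.\<close>

lemma prime_height_principal_le:
  fixes p :: "('n::{finite,linorder}, 'k::field) mpoly"
  assumes p: "prime_elem p" shows "prime_height (ideal_span {p}) \<le> 1"
proof -
  have "prime_height (ideal_span {p}) \<le> enat 1"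
  proof (rule prime_height_le)
    fix C assume C: "\<forall>i\<le>Suc 1. prime_ideal (C i)" "\<forall>i<Suc 1. C i \<subset> C (Suc i)" "C (Suc 1) = ideal_span {p}"
    have s: "C 0 \<subset> C 1" "C 1 \<subset> C (Suc 1)" "prime_ideal (C 1)" "prime_ideal (C 0)" using C by auto
    then have "0 \<in> C 0" by (simp add: prime_ideal_def is_idealD)
    then obtain a where "a \<in> C 1 \<and> a \<noteq> 0" using s by blast
    then obtain a where a: "a \<in> C 1 \<and> a \<noteq> 0" "\<And>b. b \<in> C 1 \<and> b \<noteq> 0 \<Longrightarrow> total_degree a \<le> total_degree b"
      using ex_has_least_nat[of "\<lambda>a. a \<in> C 1 \<and> a \<noteq> 0" _ total_degree] by blast
    have "a \<in> ideal_span {p}" using a s C by blast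
    then obtain b where b: "a = p * b" by (auto simp: in_ideal_span_1)
    have "p \<in> C 1 \<or> b \<in> C 1" using a b s by (auto simp: prime_ideal_def)
    then show False
    proof
      assume "p \<in> C 1"
      then have "ideal_span {p} \<subseteq> C 1" using s by (intro ideal_span_least) (auto simp: prime_ideal_def)
      then show False using s C by blast
    next
      assume b1: "b \<in> C 1"
      have n: "p \<noteq> 0" "b \<noteq> 0" using a b by auto
      moreover have "total_degree p \<noteq> 0" using p is_unit_iff_const[of p] n by (auto simp: prime_elem_def)
      ultimately show False using a(2)[of b] b1 b by (simp add: total_degree_mult)
    qed
  qed
  then show ?thesis by (simp add: one_enat_def)
qed

text \<open>A divisor that is not a unit is 0 or has a prime factor r, and then I would lie in the
  prime 0 or (r), of height at most one.\<close>

lemma ideal_height_2_common_divisor: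
  fixes I :: "('n::{finite,linorder}, 'k::field) mpoly set"
  assumes "ideal_height I = 2" "\<And>x. x \<in> I \<Longrightarrow> q dvd x"
  shows "q dvd 1"
proof (rule ccontr)
  assume n: "\<not> q dvd 1"
  have h: "2 \<le> prime_height P" if "prime_ideal P" "I \<subseteq> P" for P
    using that assms(1) unfolding ideal_height_def by (metis (mono_tags, lifting) INF_lower mem_Collect_eq)
  show False
  proof (cases "q = 0")
    case True
    have "prime_height {0::('n, 'k) mpoly} \<le> enat 1"
    proof (rule prime_height_le)
      fix C assume C: "\<forall>i\<le>Suc 1. prime_ideal (C i)" "\<forall>i<Suc 1. C i \<subset> C (Suc i)" "C (Suc 1) = {0::('n, 'k) mpoly}"
      then have "C 1 \<subset> {0}" "C 0 \<subset> C 1" by auto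
      then show False by blast
    qed
    moreover have "2 \<le> prime_height {0::('n, 'k) mpoly}"
      by (rule h[OF prime_ideal_zero]) (use assms True in auto)
    ultimately have "(2::enat) \<le> enat 1" by (rule order_trans[rotated])
    then show False by (simp add: numeral_eq_enat)
  next
    case False
    then obtain r where r: "prime_elem r" "r dvd q" using prime_dvd_exists n by metis
    then have "I \<subseteq> ideal_span {r}" using assms dvd_trans by (fastforce simp: in_ideal_span_1)
    then have "2 \<le> prime_height (ideal_span {r})" using h prime_ideal_principal r by blast
    then have "(2::enat) \<le> 1" using prime_height_principal_le[OF r(1)] by (rule order_trans)
    then show False by (simp add: numeral_eq_enat one_enat_def)
  qed
qed

lemma prime_ideal_contains_prime_divisor:
  fixes P :: "('n::{finite,linorder}, 'k::field) mpoly set"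
  assumes P: "prime_ideal P" and a: "a \<in> P" "a \<noteq> 0"
  obtains p where "prime_elem p" "p dvd a" "p \<in> P"
proof -
  obtain u ps where u: "u dvd 1" "\<forall>q\<in>set ps. prime_elem q" "a = u * prod_list ps"
    using prime_factorization_mpoly[OF a(2)] .
  have "u \<notin> P"
  proof
    assume "u \<in> P"
    moreover obtain v where "1 = u * v" using u(1) by (auto simp: dvd_def)
    ultimately show False using P is_idealD(4)[of P u v] by (simp add: prime_ideal_def)
  qed
  then have "prod_list ps \<in> P" using P a u by (auto simp: prime_ideal_def)
  then have "\<exists>p\<in>set ps. p \<in> P" using P by (induction ps) (auto simp: prime_ideal_def)
  then obtain p where p: "p \<in> set ps" "p \<in> P" by blast
  then have "p dvd a" using u(3) split_list[OF p(1)] by auto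
  then show ?thesis using that u p by blast
qed

text \<open>The chain is 0, (p), P with a prime factor p of a that lies in P; coprimality keeps b
  outside (p).\<close>

lemma prime_height_ge_2:
  fixes P :: "('n::{finite,linorder}, 'k::field) mpoly set"
  assumes P: "prime_ideal P" and ab: "a \<in> P" "a \<noteq> 0" "b \<in> P" "no_common_prime a b"
  shows "2 \<le> prime_height P"
proof -
  obtain p where p: "prime_elem p" "p dvd a" "p \<in> P" using prime_ideal_contains_prime_divisor[OF P ab(1,2)] .
  define C where "C = (\<lambda>i::nat. if i = 0 then {0} else if i = 1 then ideal_span {p} else P)"
  have "p \<in> ideal_span {p}" using ideal_span_superset[of "{p}"] by simp
  then have "{0} \<subset> ideal_span {p}" using p is_idealD(1)[OF is_ideal_span, of "{p}"] by (auto simp: prime_elem_def)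
  moreover have "ideal_span {p} \<subseteq> P" using p P by (intro ideal_span_least) (auto simp: prime_ideal_def)
  moreover have "b \<notin> ideal_span {p}" using ab p by (auto simp: in_ideal_span_1 no_common_prime_def)
  ultimately have "enat 2 \<le> prime_height P" using ab P prime_ideal_zero prime_ideal_principal[OF p(1)]
    by (intro prime_height_ge[of 2 C]) (auto simp: C_def less_2_cases_iff)
  then show ?thesis by (simp add: numeral_eq_enat)
qed

text \<open>The inequality grade \<le> height in the case at hand. Some prime P over I has height
  less than three, while a regular sequence a, b, c in I yields a chain 0, (p), Q, P: here p is a
  prime factor of a, and Q contains a and b but not c.\<close>

lemma grade_le_2:
  fixes I :: "('n::{finite,linorder}, 'k::field) mpoly set"
  assumes I: "ideal_height I = 2"
  shows "grade I \<le> 2"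
  unfolding grade_def
proof (rule SUP_least, clarify)
  fix xs assume xs: "set xs \<subseteq> I" "regular_sequence xs"
  show "enat (length xs) \<le> 2"
  proof (rule ccontr)
    assume "\<not> ?thesis"
    then have l: "3 \<le> length xs" by (simp add: numeral_eq_enat)
    then obtain a b c ys where xse: "xs = a # b # c # ys" by (metis Suc_le_length_iff numeral_3_eq_3)
    have reg: "xs ! i * r \<in> ideal_span (set (take i xs)) \<Longrightarrow> r \<in> ideal_span (set (take i xs))" if "i < 3" for i r
      using xs l that unfolding regular_sequence_def by auto
    have a0: "a \<noteq> 0" using reg[of 0 1] by (auto simp: xse ideal_span_empty)
    have r1: "a dvd b * r \<Longrightarrow> a dvd r" for r using reg[of 1 r] by (simp add: xse in_ideal_span_1)
    have r2: "c * r \<in> ideal_span {a, b} \<Longrightarrow> r \<in> ideal_span {a, b}" for r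
      using reg[of 2 r] by (simp add: xse numeral_2_eq_2)
    have abc: "a \<in> I" "b \<in> I" "c \<in> I" using xs by (auto simp: xse)
    have "\<exists>P. prime_ideal P \<and> I \<subseteq> P \<and> prime_height P < 3"
    proof -
      have "ideal_height I < 3" using I by (simp add: numeral_eq_enat)
      then show ?thesis unfolding ideal_height_def by (auto simp: INF_less_iff)
    qed
    then obtain P where P: "prime_ideal P" "I \<subseteq> P" "prime_height P < 3" by blast
    have Pi: "is_ideal P" using P by (simp add: prime_ideal_def)
    \<comment> \<open>A prime that avoids W lies inside P and does not contain c. The ideal (a, b)
      misses W because it lies in P and c is a nonzerodivisor modulo it.\<close>
    define W where "W = {y * c ^ m | y m. y \<notin> P}"
    have r3: "y * c ^ m \<in> ideal_span {a, b} \<Longrightarrow> y \<in> ideal_span {a, b}" for y m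
      by (induction m) (use r2 in \<open>auto simp: mult_ac\<close>)
    have abP: "ideal_span {a, b} \<subseteq> P" using abc P Pi by (intro ideal_span_least) auto
    obtain Q where Q: "prime_ideal Q" "ideal_span {a, b} \<subseteq> Q" "Q \<inter> W = {}"
    proof (rule prime_ideal_avoiding[of "ideal_span {a, b}" W])
      show "is_ideal (ideal_span {a, b})" by (rule is_ideal_span)
      show "1 \<in> W" using P unfolding W_def prime_ideal_def by (intro CollectI exI[of _ 1] exI[of _ 0]) auto
      show "x * y \<in> W" if xy: "x \<in> W" "y \<in> W" for x y
      proof -
        obtain x' m y' k where e: "x = x' * c ^ m" "y = y' * c ^ k" "x' \<notin> P" "y' \<notin> P" using xy unfolding W_def by blast
        then have "x * y = (x' * y') * c ^ (m + k)" "x' * y' \<notin> P" using P(1) by (auto simp: power_add mult_ac prime_ideal_def)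
        then show ?thesis unfolding W_def by blast
      qed
      show "ideal_span {a, b} \<inter> W = {}" using r3 abP unfolding W_def by blast
    qed
    have Qi: "is_ideal Q" using Q by (simp add: prime_ideal_def)
    have "y \<in> W" if "y \<notin> P" for y using that unfolding W_def by (intro CollectI exI[of _ y] exI[of _ 0]) auto
    then have QP: "Q \<subseteq> P" using Q by blast
    have "c \<in> W" using P unfolding W_def prime_ideal_def by (intro CollectI exI[of _ 1]) (auto intro: exI[of _ 1])
    then have "c \<notin> Q" using Q by blast
    then have QP': "Q \<subset> P" using QP abc P by blast
    have abQ: "a \<in> Q" "b \<in> Q" using Q ideal_span_superset[of "{a, b}"] by auto
    obtain p where p: "prime_elem p" "p dvd a" "p \<in> Q" using prime_ideal_contains_prime_divisor[OF Q(1) abQ(1) a0] .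
    \<comment> \<open>From a = p a' and b = p b' follows b a' = a b', so a divides a' by regularity,
      and p would be a unit.\<close>
    have "b \<notin> ideal_span {p}"
    proof
      assume "b \<in> ideal_span {p}"
      then obtain b' where b': "b = p * b'" by (auto simp: in_ideal_span_1)
      obtain a' where a': "a = p * a'" using p by (auto simp: dvd_def)
      have "b * a' = a * b'" using a' b' by simp
      then have "a dvd a'" using r1[of a'] by simp
      then obtain s where s: "a' = a * s" by (auto simp: dvd_def)
      have "a = p * (a * s)" unfolding s[symmetric] by (rule a')
      then have "a * 1 = a * (p * s)" by (metis mult.left_commute mult_1_right)
      then have "1 = p * s" using a0 mult_left_cancel by blast
      then have "p dvd 1" by (rule dvdI)
      then show False using p(1) by (simp add: prime_elem_def)
    qed
    moreover have "ideal_span {p} \<subseteq> Q" using p Qi by (intro ideal_span_least) auto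
    moreover have "p \<in> ideal_span {p}" using ideal_span_superset[of "{p}"] by simp
    moreover then have "{0} \<subset> ideal_span {p}" using p is_idealD(1)[OF is_ideal_span, of "{p}"] by (auto simp: prime_elem_def)
    moreover define C where "C = (\<lambda>i::nat. if i = 0 then {0} else if i = 1 then ideal_span {p} else if i = 2 then Q else P)"
    ultimately have "enat 3 \<le> prime_height P" using abQ QP' P(1) Q(1) prime_ideal_zero prime_ideal_principal[OF p(1)]
      by (intro prime_height_ge[of 3 C]) (auto simp: C_def less_Suc_eq numeral_3_eq_3)
    then show False using P by (simp add: numeral_eq_enat)
  qed
qed

text \<open>By Euclid's lemma a coprime pair is a regular sequence.\<close>

lemma grade_ge_2:
  fixes I :: "('n::{finite,linorder}, 'k::field) mpoly set"
  assumes I: "is_ideal I" "1 \<notin> I" "a \<in> I" "b \<in> I" "a \<noteq> 0" "no_common_prime a b"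
  shows "2 \<le> grade I"
proof -
  have "regular_sequence [a, b]" unfolding regular_sequence_def
  proof (intro conjI allI impI)
    have "ideal_span (set [a, b]) \<subseteq> I" using I by (intro ideal_span_least) auto
    then show "1 \<notin> ideal_span (set [a, b])" using I(2) by auto
    fix i r assume i: "i < length [a, b]" "[a, b] ! i * r \<in> ideal_span (set (take i [a, b]))"
    then consider "i = 0" | "i = 1" by (auto simp: less_Suc_eq)
    then show "r \<in> ideal_span (set (take i [a, b]))"
    proof cases
      case 1 then show ?thesis using i I by (auto simp: ideal_span_empty)
    next
      case 2
      then have "a dvd b * r" using i by (simp add: in_ideal_span_1)
      then have "a dvd r" by (rule no_common_prime_dvd[OF I(5,6)])
      then show ?thesis using 2 by (simp add: in_ideal_span_1)
    qed
  qed
  then have "enat (length [a, b]) \<le> grade I" unfolding grade_def using I by (intro SUP_upper) auto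
  then show ?thesis by (simp add: numeral_eq_enat numeral_2_eq_2)
qed

section \<open>Primitive vectors\<close>

text \<open>A prime factor of v1 that divides two of these combinations would divide v2 and v3 as
  well, so it rules out at most one constant. Up to associates v1 has finitely many prime factors,
  while the field is infinite.\<close>

lemma primitive_combination:
  fixes v1 v2 v3 :: "('n::{finite,linorder}, 'k::field_char_0) mpoly"
  assumes "v1 \<noteq> 0" "\<And>p. prime_elem p \<Longrightarrow> p dvd v1 \<Longrightarrow> p dvd v2 \<Longrightarrow> \<not> p dvd v3"
  obtains c where "no_common_prime v1 (v2 + Poly_Mapping.single 0 c * v3)"
proof -
  define bad where "bad = (\<lambda>v. {c. \<exists>p. prime_elem p \<and> p dvd v \<and> p dvd v2 + Poly_Mapping.single 0 c * v3})"
  have one: "c = c'" if p: "prime_elem p" "p dvd v1" "p dvd v2 + Poly_Mapping.single 0 c * v3" "p dvd v2 + Poly_Mapping.single 0 c' * v3" for p c c'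
  proof (rule ccontr)
    assume n: "c \<noteq> c'"
    have "p dvd (v2 + Poly_Mapping.single 0 c * v3) - (v2 + Poly_Mapping.single 0 c' * v3)" using p by (intro dvd_diff)
    then have "p dvd Poly_Mapping.single 0 (c - c') * v3" by (simp add: single_diff algebra_simps)
    then have "p dvd Poly_Mapping.single 0 (inverse (c - c')) * (Poly_Mapping.single 0 (c - c') * v3)" by (rule dvd_mult)
    then have 3: "p dvd v3" using n by (simp add: mult.assoc[symmetric] mult_single)
    then have "p dvd (v2 + Poly_Mapping.single 0 c * v3) - Poly_Mapping.single 0 c * v3" using p by (intro dvd_diff dvd_mult)
    then have "p dvd v2" by simp
    then show False using assms(2) p 3 by blast
  qed
  \<comment> \<open>The excluded constants are counted rather than the primes, which occur with all
    their associates: each prime split off from v adds at most one constant.\<close>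
  have fin: "finite (bad v)" if "v \<noteq> 0" "v dvd v1" for v using that
  proof (induction "total_degree v" arbitrary: v rule: less_induct)
    case less
    show ?case
    proof (cases "v dvd 1")
      case True
      then have "bad v = {}" unfolding bad_def using dvd_trans[of _ v 1] by (auto simp: prime_elem_def)
      then show ?thesis by simp
    next
      case False
      then obtain r v' where r: "prime_elem r" "v = r * v'" using prime_dvd_exists[OF less(2)] by (metis dvdE)
      have n: "v' \<noteq> 0" "r \<noteq> 0" using less r by auto
      have "total_degree r \<noteq> 0" using r n is_unit_iff_const[of r] by (auto simp: prime_elem_def)
      then have "total_degree v' < total_degree v" using r n by (simp add: total_degree_mult)
      moreover have "v' dvd v1" "r dvd v1" using less r by (auto dest: dvd_mult_left dvd_mult_right)
      ultimately have f: "finite (bad v')" using less.hyps n by blast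
      define B where "B = {c. r dvd v2 + Poly_Mapping.single 0 c * v3}"
      have "finite B"
      proof (cases "B = {}")
        case False
        then obtain c where "c \<in> B" by blast
        then have "B \<subseteq> {c}" using one[OF r(1) \<open>r dvd v1\<close>] unfolding B_def by auto
        then show ?thesis by (rule finite_subset) simp
      qed simp
      moreover have "bad v \<subseteq> bad v' \<union> B"
      proof
        fix c assume "c \<in> bad v"
        then obtain p where p: "prime_elem p" "p dvd v" "p dvd v2 + Poly_Mapping.single 0 c * v3" unfolding bad_def by blast
        then have "p dvd r \<or> p dvd v'" using r prime_elem_dvd_multD by blast
        then show "c \<in> bad v' \<union> B"
        proof
          assume "p dvd r"
          then obtain s where s: "r = p * s" by (auto simp: dvd_def)
          then have "r dvd p \<or> r dvd s" using r prime_elem_dvd_multD[of r p s] by auto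
          moreover have "\<not> r dvd s"
          proof
            assume "r dvd s"
            then obtain t where "s = r * t" by (auto simp: dvd_def)
            then have "r = p * (r * t)" using s by simp
            then have "r * 1 = r * (p * t)" by (metis mult.left_commute mult_1_right)
            then have "1 = p * t" using n(2) mult_left_cancel by blast
            then have "p dvd 1" by (rule dvdI)
            then show False using p(1) by (simp add: prime_elem_def)
          qed
          ultimately show ?thesis using p unfolding B_def by (auto dest: dvd_trans)
        next
          assume "p dvd v'" then show ?thesis using p unfolding bad_def by blast
        qed
      qed
      moreover have "finite (bad v' \<union> B)" using f \<open>finite B\<close> by simp
      ultimately show ?thesis by (metis finite_subset)
    qed
  qed
  have "finite (bad v1)" by (rule fin[OF assms(1) dvd_refl])
  then obtain c where "c \<notin> bad v1" using ex_new_if_finite[OF infinite_UNIV_char_0] by auto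
  then have "no_common_prime v1 (v2 + Poly_Mapping.single 0 c * v3)" by (auto simp: bad_def no_common_prime_def)
  then show ?thesis by (rule that)
qed

text \<open>After the common primes of \<open>f k\<close> and \<open>v k\<close> are cancelled, the
  remaining factor p of \<open>f k\<close> divides every \<open>f i\<close>, so it is a
  unit.\<close>

lemma parallel_to_primitive:
  fixes f v :: "nat \<Rightarrow> ('n::{finite,linorder}, 'k::field) mpoly"
  assumes par: "\<And>i j. i < N \<Longrightarrow> j < N \<Longrightarrow> f i * v j = f j * v i"
    and prim: "\<And>p. prime_elem p \<Longrightarrow> \<exists>i<N. \<not> p dvd f i" and k: "k < N" "f k \<noteq> 0"
  shows "\<exists>h. \<forall>i<N. v i = h * f i"
proof -
  obtain g p q where g: "f k = g * p" "v k = g * q" "no_common_prime p q" using reduce_common_primes[OF k(2)] .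
  have n: "g \<noteq> 0" "p \<noteq> 0" using g k by auto
  have e: "p * v i = q * f i" if "i < N" for i
  proof -
    have "g * (p * v i) = g * (q * f i)" using par[OF k(1) that] g by (simp add: mult_ac)
    then show ?thesis using n by (simp only: mult_cancel_left) simp
  qed
  have "p dvd f i" if "i < N" for i
    using no_common_prime_dvd[OF n(2) g(3), of "f i"] e[OF that] by (metis dvd_triv_left)
  then have np: "\<not> prime_elem r" if "r dvd p" for r using prim[of r] dvd_trans[OF that] by auto
  have "p dvd 1"
  proof (rule ccontr)
    assume "\<not> p dvd 1"
    then obtain r where "prime_elem r" "r dvd p" using prime_dvd_exists[OF n(2)] by auto
    then show False using np by simp
  qed
  then obtain s where s: "1 = p * s" by (auto simp: dvd_def)
  have "v i = (s * q) * f i" if "i < N" for i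
  proof -
    have "v i = (p * s) * v i" using s by simp
    also have "\<dots> = s * (p * v i)" by (simp only: ac_simps)
    also have "\<dots> = (s * q) * f i" by (simp only: e[OF that] mult.assoc)
    finally show ?thesis .
  qed
  then show ?thesis by blast
qed

section \<open>Colon ideals of modules with a rank one relation module\<close>

lemma common_denominator:
  fixes a :: "'a::comm_ring_1"
  assumes D: "1 \<in> D" "\<And>x y. x \<in> D \<Longrightarrow> y \<in> D \<Longrightarrow> x * y \<in> D" and "\<And>i. i < N \<Longrightarrow> \<exists>d\<in>D. a dvd d * w i"
  shows "\<exists>d\<in>D. \<forall>i<N. a dvd d * w (i::nat)"
  using assms(3)
proof (induction N)
  case 0 then show ?case using D by auto
next
  case (Suc N)
  then obtain d where d: "d \<in> D" "\<forall>i<N. a dvd d * w i" by (meson less_Suc_eq)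
  obtain d' where d': "d' \<in> D" "a dvd d' * w N" using Suc.prems by blast
  have "a dvd (d * d') * w i" if "i < Suc N" for i
  proof (cases "i = N")
    case True
    have "a dvd d * (d' * w N)" using d'(2) by (rule dvd_mult)
    then show ?thesis using True by (simp add: mult.assoc)
  next
    case False
    then have "a dvd d * w i" using d that by simp
    then have "a dvd d' * (d * w i)" by (rule dvd_mult)
    then show ?thesis by (simp add: mult_ac)
  qed
  then show ?case using d d' D by blast
qed

text \<open>If \<open>a, b, c\<close> is a regular sequence after inverting \<open>D\<close>, an element of the free target module that is
  multiplied by \<open>a, b, c\<close> into the image of \<open>A\<close> lies in this image after inverting \<open>D\<close>: this is the
  vanishing of the relevant Ext module, checked by hand on the Koszul relations.\<close>

lemma regular_triple_multiplier:
  fixes A :: "nat \<Rightarrow> nat \<Rightarrow> 'a::idom" and g y :: "nat \<Rightarrow> 'a"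
  assumes D: "1 \<in> D" "0 \<notin> D" "\<And>x y. x \<in> D \<Longrightarrow> y \<in> D \<Longrightarrow> x * y \<in> D"
    and ker: "\<And>u. (\<And>j. (\<Sum>i<N. A i j * u i) = 0) \<Longrightarrow> \<exists>h. \<forall>i<N. u i = h * g i"
    and g: "\<And>j. (\<Sum>i<N. A i j * g i) = 0" "k < N" "g k \<noteq> 0"
    and reg1: "\<And>w. a dvd b * w \<Longrightarrow> \<exists>d\<in>D. a dvd d * w"
    and reg2: "\<And>h \<alpha> \<beta>. c * h = \<alpha> * a + \<beta> * b \<Longrightarrow> \<exists>d\<in>D. \<exists>\<alpha> \<beta>. d * h = \<alpha> * a + \<beta> * b"
    and a0: "a \<noteq> 0"
    and u: "\<And>j. a * y j = (\<Sum>i<N. A i j * u1 i)" "\<And>j. b * y j = (\<Sum>i<N. A i j * u2 i)" "\<And>j. c * y j = (\<Sum>i<N. A i j * u3 i)"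
  shows "\<exists>d\<in>D. \<exists>w. \<forall>j. d * y j = (\<Sum>i<N. A i j * w i)"
proof -
  have lin: "(\<Sum>i<N. A i j * (x * u i - z * v i)) = x * (\<Sum>i<N. A i j * u i) - z * (\<Sum>i<N. A i j * v i)" for j x z u v
    by (simp add: sum_subtractf sum_distrib_left algebra_simps)
  have "\<exists>h. \<forall>i<N. b * u1 i - a * u2 i = h * g i"
    by (rule ker) (simp add: lin u[symmetric])
  then obtain h12 where h12: "\<And>i. i < N \<Longrightarrow> b * u1 i - a * u2 i = h12 * g i" by blast
  have "\<exists>h. \<forall>i<N. c * u1 i - a * u3 i = h * g i"
    by (rule ker) (simp add: lin u[symmetric])
  then obtain h13 where h13: "\<And>i. i < N \<Longrightarrow> c * u1 i - a * u3 i = h13 * g i" by blast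
  have "\<exists>h. \<forall>i<N. c * u2 i - b * u3 i = h * g i"
    by (rule ker) (simp add: lin u[symmetric])
  then obtain h23 where h23: "\<And>i. i < N \<Longrightarrow> c * u2 i - b * u3 i = h23 * g i" by blast
  \<comment> \<open>The three Koszul relations cancel once they are multiplied by c, b and a. As
    \<open>g k\<close> is nonzero, c h12 lies in (a, b).\<close>
  have "(c * h12 - b * h13 + a * h23) * g k = c * (h12 * g k) - b * (h13 * g k) + a * (h23 * g k)" by (simp add: algebra_simps)
  also have "\<dots> = 0" using h12[OF g(2)] h13[OF g(2)] h23[OF g(2)] by (simp flip: h12[OF g(2)] h13[OF g(2)] h23[OF g(2)] add: algebra_simps)
  finally have "c * h12 - b * h13 + a * h23 = 0" using g by simp
  then have "c * h12 = (- h23) * a + h13 * b" by (simp add: algebra_simps add_eq_0_iff)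
  then obtain d \<alpha> \<beta> where d: "d \<in> D" "d * h12 = \<alpha> * a + \<beta> * b" using reg2 by blast
  \<comment> \<open>Subtracting the kernel element \<beta> g makes u1 divisible by a after inverting
    D; the quotient is the required preimage.\<close>
  have "\<exists>d'\<in>D. a dvd d' * (d * u1 i - \<beta> * g i)" if i: "i < N" for i
  proof -
    have "d * (b * u1 i - a * u2 i) = (\<alpha> * a + \<beta> * b) * g i" using h12[OF i] d by (metis mult.assoc)
    then have "b * (d * u1 i - \<beta> * g i) = a * (d * u2 i + \<alpha> * g i)" by (simp add: algebra_simps)
    then show ?thesis using reg1 by (metis dvd_triv_left)
  qed
  then obtain d' where d': "d' \<in> D" "\<And>i. i < N \<Longrightarrow> a dvd d' * (d * u1 i - \<beta> * g i)"
    using common_denominator[of D N a "\<lambda>i. d * u1 i - \<beta> * g i"] D by auto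
  have "\<forall>i. \<exists>z. i < N \<longrightarrow> d' * (d * u1 i - \<beta> * g i) = a * z" using d'(2) by (auto simp: dvd_def)
  from choice[OF this] obtain w where w: "\<forall>i<N. d' * (d * u1 i - \<beta> * g i) = a * w i" by auto
  have "(d' * d) * y j = (\<Sum>i<N. A i j * w i)" for j
  proof -
    have "a * (\<Sum>i<N. A i j * w i) = (\<Sum>i<N. A i j * (a * w i))" by (simp add: sum_distrib_left mult_ac)
    also have "\<dots> = (\<Sum>i<N. A i j * ((d' * d) * u1 i - (d' * \<beta>) * g i))"
    proof (intro sum.cong refl)
      fix i assume "i \<in> {..<N}"
      then have "a * w i = (d' * d) * u1 i - (d' * \<beta>) * g i" using w by (simp add: algebra_simps)
      then show "A i j * (a * w i) = A i j * ((d' * d) * u1 i - (d' * \<beta>) * g i)" by simp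
    qed
    also have "\<dots> = a * ((d' * d) * y j)" by (simp only: lin g(1) u(1)[symmetric]) (simp add: mult_ac)
    finally show ?thesis using a0 by simp
  qed
  then show ?thesis by (intro bexI[of _ "d' * d"] exI[of _ w] allI) (auto intro: D(3)[OF d'(1) d(1)])
qed

section \<open>Pseudo-division with respect to one variable\<close>

lemma var_poly_poly:
  fixes q :: "(('n \<Rightarrow>\<^sub>0 nat) \<Rightarrow>\<^sub>0 'k::comm_ring_1) poly"
  assumes "q \<in> polys_over (poly_in (- {x}))" shows "var_poly x (poly q (var x)) = q"
proof -
  have "bij_betw (var_poly x :: (('n \<Rightarrow>\<^sub>0 nat) \<Rightarrow>\<^sub>0 'k) \<Rightarrow> _) (poly_in (insert x (- {x}))) (polys_over (poly_in (- {x})))"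
    by (rule bij_betw_var_poly) simp
  then obtain p where "q = var_poly x p" using bij_betw_imp_surj_on assms by blast
  then show ?thesis by (simp add: poly_var_poly)
qed

lemma pseudo_division_var:
  fixes c h :: "('n::{finite,linorder}, 'k::field) mpoly"
  assumes "c \<noteq> 0"
  obtains k q s where "lead_coeff (var_poly x c) ^ k * h = c * q + s"
    "s = 0 \<or> Polynomial.degree (var_poly x s) < Polynomial.degree (var_poly x c)"
proof -
  let ?S = "poly_in (- {x}) :: ('n, 'k) mpoly set"
  have mem: "var_poly x p \<in> polys_over ?S" for p by (simp add: polys_over_def coeff_var_poly_in')
  obtain k q r where q: "q \<in> polys_over ?S" "r \<in> polys_over ?S"
    "Polynomial.smult (lead_coeff (var_poly x c) ^ k) (var_poly x h) = var_poly x c * q + r"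
    "r = 0 \<or> Polynomial.degree r < Polynomial.degree (var_poly x c)"
    using pseudo_division[OF subring_poly_in mem[of h] mem[of c]] assms by auto
  have "lead_coeff (var_poly x c) ^ k * h = c * poly q (var x) + poly r (var x)"
    using arg_cong[OF q(3), of "\<lambda>p. poly p (var x)"] by (simp add: poly_var_poly)
  moreover have "poly r (var x) = 0 \<or> Polynomial.degree (var_poly x (poly r (var x))) < Polynomial.degree (var_poly x c)"
    using q by (auto simp: var_poly_poly)
  ultimately show ?thesis using that by blast
qed

lemma degree_var_poly_mult_free:
  fixes c p :: "('n::{finite,linorder}, 'k::field) mpoly"
  assumes "c \<in> poly_in (- {x})" shows "Polynomial.degree (var_poly x (c * p)) \<le> Polynomial.degree (var_poly x p)"
  using var_poly_const[OF assms, of x] by (simp add: var_poly_mult degree_smult_le)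

lemma dvd_small_degree:
  fixes c p :: "('n::{finite,linorder}, 'k::field) mpoly"
  assumes "c dvd p" "p = 0 \<or> Polynomial.degree (var_poly x p) < Polynomial.degree (var_poly x c)"
  shows "p = 0"
proof (rule ccontr)
  assume n: "p \<noteq> 0"
  obtain q where q: "p = c * q" using assms by (auto simp: dvd_def)
  then have "Polynomial.degree (var_poly x p) = Polynomial.degree (var_poly x c) + Polynomial.degree (var_poly x q)"
    using n by (simp add: var_poly_mult degree_mult_eq)
  then show False using assms n by simp
qed

text \<open>Let s be the pseudo-remainder of w modulo c in the variable x. Then c divides b s, whose
  degree in x is too small for a nonzero multiple of c.\<close>

lemma dvd_up_to_leading_coeff:
  fixes c b w :: "('n::{finite,linorder}, 'k::field) mpoly"
  assumes c: "c \<noteq> 0" and b: "b \<noteq> 0" "b \<in> poly_in (- {x})" and pos: "Polynomial.degree (var_poly x c) > 0"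
    and d: "c dvd b * w"
  shows "\<exists>k. c dvd lead_coeff (var_poly x c) ^ k * w"
proof -
  obtain k q s where q: "lead_coeff (var_poly x c) ^ k * w = c * q + s"
    "s = 0 \<or> Polynomial.degree (var_poly x s) < Polynomial.degree (var_poly x c)"
    using pseudo_division_var[OF c] .
  have "b * s = lead_coeff (var_poly x c) ^ k * (b * w) - c * (b * q)"
    using arg_cong[OF q(1), of "\<lambda>z. b * z"] by (simp add: algebra_simps)
  then have "c dvd b * s" using d by (metis dvd_diff dvd_mult dvd_triv_left)
  moreover have "b * s = 0 \<or> Polynomial.degree (var_poly x (b * s)) < Polynomial.degree (var_poly x c)"
    using q(2) degree_var_poly_mult_free[OF b(2), of s] by auto
  ultimately have "b * s = 0" by (rule dvd_small_degree)
  then have "s = 0" using b(1) by simp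
  then have "c dvd lead_coeff (var_poly x c) ^ k * w" using q(1) by simp
  then show ?thesis ..
qed

text \<open>The variables in V are algebraically independent modulo A; for an ideal A their number
  is a lower bound for the dimension of R/A.\<close>

definition indep_vars :: "'n set \<Rightarrow> (('n \<Rightarrow>\<^sub>0 nat) \<Rightarrow>\<^sub>0 'k::zero) set \<Rightarrow> bool" where
  "indep_vars V A \<longleftrightarrow> A \<inter> poly_in V \<subseteq> {0}"

lemma indep_vars_mono: "indep_vars V A \<Longrightarrow> W \<subseteq> V \<Longrightarrow> indep_vars W A"
  unfolding indep_vars_def using poly_in_mono[of W V] by blast

lemma maximal_indep_vars:
  fixes A :: "('n::{finite,linorder}, 'k::field) mpoly set"
  assumes A: "is_ideal A" "1 \<notin> A"
  obtains V where "indep_vars V A" "\<forall>x. x \<notin> V \<longrightarrow> \<not> indep_vars (insert x V) A"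
proof -
  have "a = 0" if a: "a \<in> A" "a \<in> poly_in {}" for a
  proof (rule ccontr)
    assume n: "a \<noteq> 0"
    have h: "homogeneous (int 0) a" using a by (auto simp: poly_in_def homogeneous_def)
    then have "a dvd 1" using is_unit_iff_const[of a] total_degree_homogeneous[OF h n] n by simp
    then obtain b where "1 = a * b" by (auto simp: dvd_def)
    then show False using A a is_idealD(4)[OF A(1), of a b] by simp
  qed
  then have "indep_vars {} A" by (auto simp: indep_vars_def)
  then have ne: "{V. indep_vars V A} \<noteq> {}" by blast
  obtain V where V: "indep_vars V A" "\<And>W. indep_vars W A \<Longrightarrow> V \<subseteq> W \<Longrightarrow> V = W"
    using finite_has_maximal[OF _ ne] by (auto simp: finite_code)
  have "\<forall>x. x \<notin> V \<longrightarrow> \<not> indep_vars (insert x V) A" using V(2)[of "insert _ V"] by auto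
  then show ?thesis by (rule that[OF V(1)])
qed

text \<open>If three variables x1, x2, x3 lie outside a maximal independent V, maximality gives
  nonzero elements c1, c2, c3 of the colon ideal, each involving only V and one of these variables.
  Over the fraction field of k[V] they form a regular sequence, so
  \<open>regular_triple_multiplier\<close> puts a nonzero element of k[V] into the colon ideal,
  against independence.\<close>

lemma indep_vars_colon:
  fixes A :: "nat \<Rightarrow> nat \<Rightarrow> ('n::{finite,linorder}, 'k::field) mpoly" and g y :: "nat \<Rightarrow> ('n, 'k) mpoly"
  assumes ker: "\<And>u. (\<And>j. (\<Sum>i<N. A i j * u i) = 0) \<Longrightarrow> \<exists>h. \<forall>i<N. u i = h * g i"
    and g: "\<And>j. (\<Sum>i<N. A i j * g i) = 0" "k < N" "g k \<noteq> 0"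
    and y: "\<nexists>w. \<forall>j. y j = (\<Sum>i<N. A i j * w i)"
  obtains V where "card V = CARD('n) - 2" "indep_vars V {r. \<exists>w. \<forall>j. r * y j = (\<Sum>i<N. A i j * w i)}"
proof -
  let ?K = "{r. \<exists>w. \<forall>j. r * y j = (\<Sum>i<N. A i j * w i)}"
  have Ki: "is_ideal ?K" unfolding is_ideal_iff
  proof (intro conjI ballI allI; clarify?)
    show "\<exists>w. \<forall>j. 0 * y j = (\<Sum>i<N. A i j * w i)" by (intro exI[of _ "\<lambda>_. 0"]) simp
    fix a w assume a: "\<forall>j. a * y j = (\<Sum>i<N. A i j * w i)"
    show "\<exists>w. \<forall>j. c * a * y j = (\<Sum>i<N. A i j * w i)" for c
      using a by (intro exI[of _ "\<lambda>i. c * w i"]) (simp add: mult.assoc sum_distrib_left mult.left_commute)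
    fix b v assume b: "\<forall>j. b * y j = (\<Sum>i<N. A i j * v i)"
    show "\<exists>w. \<forall>j. (a + b) * y j = (\<Sum>i<N. A i j * w i)"
      using a b by (intro exI[of _ "\<lambda>i. w i + v i"]) (simp add: algebra_simps sum.distrib)
  qed
  have K1: "1 \<notin> ?K" using y by simp
  obtain V where V: "indep_vars V ?K" "\<forall>x. x \<notin> V \<longrightarrow> \<not> indep_vars (insert x V) ?K"
    using maximal_indep_vars[OF Ki K1] .
  have "card (- V) \<le> 2"
  proof (rule ccontr)
    assume "\<not> ?thesis"
    then have "3 \<le> card (- V)" by simp
    then obtain T where T: "T \<subseteq> - V" "card T = 3" by (metis obtain_subset_with_card_n)
    then obtain x1 x2 x3 where x: "T = {x1, x2, x3}" "x1 \<noteq> x2" "x1 \<noteq> x3" "x2 \<noteq> x3" by (auto simp: card_3_iff)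
    have ex: "\<exists>c\<in>?K. c \<in> poly_in (insert x V) \<and> c \<noteq> 0" if "x \<notin> V" for x
      using V(2)[rule_format, OF that] unfolding indep_vars_def by auto
    have xV: "x1 \<notin> V" "x2 \<notin> V" "x3 \<notin> V" using x T by auto
    obtain c1 where c1: "c1 \<in> ?K" "c1 \<in> poly_in (insert x1 V)" "c1 \<noteq> 0" using ex[OF xV(1)] by blast
    obtain c2 where c2: "c2 \<in> ?K" "c2 \<in> poly_in (insert x2 V)" "c2 \<noteq> 0" using ex[OF xV(2)] by blast
    obtain c3 where c3: "c3 \<in> ?K" "c3 \<in> poly_in (insert x3 V)" "c3 \<noteq> 0" using ex[OF xV(3)] by blast
    have nV: "c \<notin> poly_in V" if "c \<in> ?K" "c \<noteq> 0" for c
    proof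
      assume "c \<in> poly_in V"
      then have "c \<in> ?K \<inter> poly_in V" using that(1) by (rule IntI[rotated])
      then have "c \<in> {0}" using V(1) unfolding indep_vars_def by (rule set_mp[rotated])
      then show False using that(2) by simp
    qed
    have deg: "Polynomial.degree (var_poly x c) > 0" if "c \<in> ?K" "c \<noteq> 0" "c \<in> poly_in (insert x V)" "x \<notin> V" for c x
      using nV[OF that(1,2)] poly_in_of_var_poly_const[OF that(3,4)] by auto
    \<comment> \<open>Inverting D amounts to working over the field k(V).\<close>
    define D where "D = poly_in V - {0 :: ('n, 'k) mpoly}"
    have D: "1 \<in> D" "0 \<notin> D" "\<And>x y. x \<in> D \<Longrightarrow> y \<in> D \<Longrightarrow> x * y \<in> D"
      unfolding D_def using subring_setD[OF subring_poly_in] by auto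
    have Dp: "d ^ k \<in> D" if "d \<in> D" for d k using that D by (induction k) auto
    have lead: "lead_coeff (var_poly x c) \<in> D" if "c \<noteq> 0" "c \<in> poly_in (insert x V)" "x \<notin> V" for c x
      using that coeff_var_poly_in[OF that(2,3)] unfolding D_def by simp
    have fr: "c2 \<in> poly_in (- {x1})" "c3 \<in> poly_in (- {x1})" "c3 \<in> poly_in (- {x2})"
      using c2 c3 x xV poly_in_mono[of "insert x2 V" "- {x1}"] poly_in_mono[of "insert x3 V" "- {x1}"]
        poly_in_mono[of "insert x3 V" "- {x2}"] by auto
    obtain u1 where u1: "\<And>j. c1 * y j = (\<Sum>i<N. A i j * u1 i)" using c1 by blast
    obtain u2 where u2: "\<And>j. c2 * y j = (\<Sum>i<N. A i j * u2 i)" using c2 by blast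
    obtain u3 where u3: "\<And>j. c3 * y j = (\<Sum>i<N. A i j * u3 i)" using c3 by blast
    have reg1: "\<exists>d\<in>D. c1 dvd d * w" if "c1 dvd c2 * w" for w
      using dvd_up_to_leading_coeff[OF c1(3) c2(3) fr(1) deg[OF c1(1,3,2) xV(1)] that] Dp lead[OF c1(3,2) xV(1)] by blast
    \<comment> \<open>Modulo c1, replace h and \<beta> by pseudo-remainders s and s' in x1. Up to
      factors from D, c3 s - c2 s' is divisible by c1 and of small degree in x1, so it vanishes.
      Thus c2 divides c3 s, where c3 is free of x2, and c2 divides s up to D.\<close>
    have reg2: "\<exists>d\<in>D. \<exists>\<alpha> \<beta>. d * h = \<alpha> * c1 + \<beta> * c2" if e: "c3 * h = \<alpha> * c1 + \<beta> * c2" for h \<alpha> \<beta>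
    proof -
      define l where "l = lead_coeff (var_poly x1 c1)"
      have lD: "l \<in> D" using lead[OF c1(3,2) xV(1)] by (simp add: l_def)
      then have lfr: "l ^ m \<in> poly_in (- {x1})" for m
        using Dp[of l m] poly_in_mono[of V "- {x1}"] xV unfolding D_def by auto
      obtain k q s where q: "l ^ k * h = c1 * q + s" "s = 0 \<or> Polynomial.degree (var_poly x1 s) < Polynomial.degree (var_poly x1 c1)"
        using pseudo_division_var[OF c1(3), of x1 h] unfolding l_def by blast
      obtain k' q' s' where q': "l ^ k' * \<beta> = c1 * q' + s'" "s' = 0 \<or> Polynomial.degree (var_poly x1 s') < Polynomial.degree (var_poly x1 c1)"
        using pseudo_division_var[OF c1(3), of x1 \<beta>] unfolding l_def by blast
      define z where "z = c3 * (l ^ k' * s) - c2 * (l ^ k * s')"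
      have "c3 * (l ^ k' * s) = l ^ k' * (c3 * (l ^ k * h)) - c1 * (l ^ k' * c3 * q)"
        using q(1) by (simp add: algebra_simps)
      also have "\<dots> = l ^ k * l ^ k' * (c3 * h) - c1 * (l ^ k' * c3 * q)" by (simp add: mult_ac)
      also have "\<dots> = l ^ k * l ^ k' * \<alpha> * c1 + l ^ k * c2 * (l ^ k' * \<beta>) - c1 * (l ^ k' * c3 * q)"
        unfolding e by (simp add: algebra_simps)
      also have "\<dots> = c1 * (l ^ k * l ^ k' * \<alpha> + l ^ k * c2 * q' - l ^ k' * c3 * q) + c2 * (l ^ k * s')"
        unfolding q'(1) by (simp add: algebra_simps)
      finally have zd: "c1 dvd z" by (simp add: z_def)
      have bd: "Polynomial.degree (var_poly x1 (c * (l ^ m * t))) < Polynomial.degree (var_poly x1 c1)"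
        if "t = 0 \<or> Polynomial.degree (var_poly x1 t) < Polynomial.degree (var_poly x1 c1)" "c \<in> poly_in (- {x1})" for c m t
        using degree_var_poly_mult_free[OF that(2), of "l ^ m * t"] degree_var_poly_mult_free[OF lfr, of m t] that(1)
          deg[OF c1(1,3,2) xV(1)] by auto
      have "Polynomial.degree (var_poly x1 z) < Polynomial.degree (var_poly x1 c1)"
      proof -
        have "var_poly x1 z = var_poly x1 (c3 * (l ^ k' * s)) - var_poly x1 (c2 * (l ^ k * s'))"
          using var_poly_add[of x1 z "c2 * (l ^ k * s')"] by (simp add: z_def)
        then show ?thesis using bd[OF q(2) fr(2), of k'] bd[OF q'(2) fr(1), of k] by (simp add: degree_diff_less)
      qed
      then have "z = 0" using dvd_small_degree[OF zd] by blast
      then have "c2 dvd c3 * (l ^ k' * s)" by (simp add: z_def)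
      then obtain m where m: "c2 dvd lead_coeff (var_poly x2 c2) ^ m * (l ^ k' * s)"
        using dvd_up_to_leading_coeff[OF c2(3) c3(3) fr(3) deg[OF c2(1,3,2) xV(2)]] by blast
      define d where "d = lead_coeff (var_poly x2 c2) ^ m"
      obtain t where t: "d * (l ^ k' * s) = c2 * t" using m unfolding d_def by (auto simp: dvd_def)
      have "(d * (l ^ k' * l ^ k)) * h = d * l ^ k' * (l ^ k * h)" by (simp add: mult_ac)
      also have "\<dots> = (d * l ^ k' * q) * c1 + d * (l ^ k' * s)" unfolding q(1) by (simp add: algebra_simps)
      also have "\<dots> = (d * l ^ k' * q) * c1 + t * c2" unfolding t by (simp add: mult_ac)
      finally have "(d * (l ^ k' * l ^ k)) * h = (d * l ^ k' * q) * c1 + t * c2" .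
      moreover have "d * (l ^ k' * l ^ k) \<in> D" unfolding d_def using D Dp lD lead[OF c2(3,2) xV(2)] by blast
      ultimately show ?thesis by blast
    qed
    have "\<exists>d\<in>D. \<exists>w. \<forall>j. d * y j = (\<Sum>i<N. A i j * w i)"
      by (rule regular_triple_multiplier[where a = c1 and b = c2 and c = c3 and k = k and g = g])
        (fact D ker g reg1 reg2 c1(3) u1 u2 u3)+
    then obtain d w where "d \<in> D" "\<forall>j. d * y j = (\<Sum>i<N. A i j * w i)" by blast
    then have "d \<in> ?K" "d \<noteq> 0" "d \<in> poly_in V" unfolding D_def by blast+
    then show False using nV[of d] by simp
  qed
  then have "CARD('n) - 2 \<le> card V" by (simp add: Compl_eq_Diff_UNIV card_Diff_subset)
  then obtain W where "W \<subseteq> V" "card W = CARD('n) - 2" by (rule obtain_subset_with_card_n)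
  then show ?thesis using that[of W] indep_vars_mono[OF V(1), of W] by simp
qed

section \<open>Dimensions of finite-dimensional subspaces\<close>

text \<open>The ambient spaces are infinite-dimensional and \<open>dim\<close> is meaningful only on
  finite-dimensional subspaces, so finiteness is carried along. The span is a parameter in order to
  serve polynomials and tuples alike.\<close>

definition fin_dim_wrt :: "('b set \<Rightarrow> 'b set) \<Rightarrow> 'b set \<Rightarrow> bool" where
  "fin_dim_wrt sp W \<longleftrightarrow> (\<exists>B. finite B \<and> W \<subseteq> sp B)"

context vector_space
begin

lemma fin_dim_subset: "fin_dim_wrt span W \<Longrightarrow> V \<subseteq> W \<Longrightarrow> fin_dim_wrt span V"
  unfolding fin_dim_wrt_def by (meson subset_trans)

lemma fin_dim_finite_independent: "fin_dim_wrt span W \<Longrightarrow> independent B \<Longrightarrow> B \<subseteq> W \<Longrightarrow> finite B"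
  unfolding fin_dim_wrt_def by (meson independent_span_bound subset_trans)

lemma fin_dim_basis:
  assumes "fin_dim_wrt span W"
  obtains B where "B \<subseteq> W" "independent B" "W \<subseteq> span B" "card B = dim W" "finite B"
proof -
  obtain B where B: "B \<subseteq> W" "independent B" "W \<subseteq> span B" "card B = dim W" using basis_exists by blast
  then show ?thesis using that fin_dim_finite_independent[OF assms] by simp
qed

lemma dim_mono_fin_dim: "fin_dim_wrt span W \<Longrightarrow> V \<subseteq> W \<Longrightarrow> dim V \<le> dim W"
proof -
  assume W: "fin_dim_wrt span W" and V: "V \<subseteq> W"
  obtain B where B: "B \<subseteq> W" "independent B" "W \<subseteq> span B" "card B = dim W" "finite B" using fin_dim_basis[OF W] .
  then show "dim V \<le> dim W" using dim_le_card[of V B] V by simp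
qed

end

context vector_space_pair
begin

lemma fin_dim_image:
  assumes f: "Vector_Spaces.linear s1 s2 f" and W: "fin_dim_wrt vs1.span W" shows "fin_dim_wrt vs2.span (f ` W)"
proof -
  interpret f: Vector_Spaces.linear s1 s2 f by (rule f)
  obtain B where B: "finite B" "W \<subseteq> vs1.span B" using W unfolding fin_dim_wrt_def by blast
  then have "f ` W \<subseteq> vs2.span (f ` B)" by (simp add: linear_span_image[OF f] image_mono)
  then show ?thesis unfolding fin_dim_wrt_def using B(1) by (intro exI[of _ "f ` B"]) simp
qed

text \<open>A basis of the kernel is extended to one of W; f is injective on the span of the added
  vectors and maps them to a basis of the image.\<close>

lemma rank_nullity:
  assumes f: "Vector_Spaces.linear s1 s2 f" and W: "vs1.subspace W" "fin_dim_wrt vs1.span W"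
  shows "vs1.dim W = vs2.dim (f ` W) + vs1.dim {x \<in> W. f x = 0}"
proof -
  interpret f: Vector_Spaces.linear s1 s2 f by (rule f)
  let ?K = "{x \<in> W. f x = 0}"
  have K: "fin_dim_wrt vs1.span ?K" by (rule vs1.fin_dim_subset[OF W(2)]) auto
  obtain BK where BK: "BK \<subseteq> ?K" "vs1.independent BK" "?K \<subseteq> vs1.span BK" "card BK = vs1.dim ?K" "finite BK"
    using vs1.fin_dim_basis[OF K] .
  have "BK \<subseteq> W" using BK by blast
  then obtain B where B: "BK \<subseteq> B" "B \<subseteq> W" "vs1.independent B" "W \<subseteq> vs1.span B"
    using vs1.maximal_independent_subset_extend[of BK W] BK(2) by blast
  have fB: "finite B" using vs1.fin_dim_finite_independent[OF W(2) B(3,2)] .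
  let ?B = "B - BK"
  have iB: "vs1.independent ?B" using vs1.independent_mono[OF B(3)] by blast
  have sW: "vs1.span ?B \<subseteq> W" using B W(1) by (intro vs1.span_minimal) auto
  \<comment> \<open>Such an x has representations over two disjoint parts of the basis B, so all its
    coordinates vanish.\<close>
  have 0: "x = 0" if x: "x \<in> vs1.span ?B" "f x = 0" for x
  proof -
    have xK: "x \<in> vs1.span BK" using x sW BK by blast
    have r: "vs1.representation B x = vs1.representation BK x" "vs1.representation B x = vs1.representation ?B x"
      using vs1.representation_extend[OF B(3) xK B(1)] vs1.representation_extend[OF B(3) x(1)] by auto
    have z: "vs1.representation B x b = 0" for b
      using vs1.representation_ne_zero[of BK x b] vs1.representation_ne_zero[of ?B x b] r by auto
    have "x \<in> vs1.span B" using x vs1.span_mono[of ?B B] by blast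
    then have "(\<Sum>b | vs1.representation B x b \<noteq> 0. s1 (vs1.representation B x b) b) = x"
      by (rule vs1.sum_nonzero_representation_eq[OF B(3)])
    then show ?thesis using z by simp
  qed
  have "inj_on f (vs1.span ?B)"
  proof (rule inj_onI)
    fix x y assume xy: "x \<in> vs1.span ?B" "y \<in> vs1.span ?B" "f x = f y"
    then have "f (x - y) = 0" by (simp add: f.diff)
    then show "x = y" using 0[of "x - y"] xy vs1.span_diff by simp
  qed
  then have ind: "vs2.independent (f ` ?B)" and inj: "inj_on f ?B"
    using linear_independent_injective_image[OF f iB] inj_on_subset[OF _ vs1.span_superset] by auto
  have "f ` W \<subseteq> vs2.span (f ` ?B)"
  proof
    fix y assume "y \<in> f ` W"
    then obtain x where x: "x \<in> W" "y = f x" by blast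
    have "f ` W \<subseteq> vs2.span (f ` B)" using B(4) by (simp add: linear_span_image[OF f] image_mono)
    then have y: "y \<in> vs2.span (f ` B)" using x by blast
    have "f ` B \<subseteq> insert 0 (f ` ?B)" using BK by auto
    then have "vs2.span (f ` B) \<subseteq> vs2.span (insert 0 (f ` ?B))" by (rule vs2.span_mono)
    then show "y \<in> vs2.span (f ` ?B)" using y by (simp add: vs2.span_insert_0 subset_iff)
  qed
  moreover have "f ` ?B \<subseteq> f ` W" using B by blast
  ultimately have "vs2.dim (f ` W) = card (f ` ?B)" using ind by (metis vs2.basis_card_eq_dim)
  also have "\<dots> = card B - card BK" using card_image[OF inj] card_Diff_subset[OF BK(5) B(1)] by simp
  finally have "vs2.dim (f ` W) = card B - card BK" .
  moreover have "vs1.dim W = card B" using B by (metis vs1.basis_card_eq_dim)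
  moreover have "card BK \<le> card B" using fB B by (intro card_mono) auto
  ultimately show ?thesis using BK by simp
qed

lemma dim_image_inj:
  assumes f: "Vector_Spaces.linear s1 s2 f" and W: "vs1.subspace W" "fin_dim_wrt vs1.span W" and inj: "\<And>x. x \<in> W \<Longrightarrow> f x = 0 \<Longrightarrow> x = 0"
  shows "vs2.dim (f ` W) = vs1.dim W"
proof -
  interpret f: Vector_Spaces.linear s1 s2 f by (rule f)
  have "{x \<in> W. f x = 0} = {0}" using inj vs1.subspace_0[OF W(1)] by (auto simp: f.zero)
  moreover have "vs1.dim {0} = 0" using vs1.dim_span[of "{}"] vs1.dim_eq_card_independent[OF vs1.independent_empty]
    by (simp add: vs1.span_empty)
  ultimately show ?thesis using rank_nullity[OF f W] by simp
qed

end

section \<open>Polynomials and tuples of polynomials as vector spaces over the field\<close>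

abbreviation scale_poly :: "'k::field \<Rightarrow> ('n, 'k) mpoly \<Rightarrow> ('n, 'k) mpoly" where
  "scale_poly \<equiv> (\<lambda>c p. Poly_Mapping.single 0 c * p)"

abbreviation scale_vec :: "'k::field \<Rightarrow> (nat \<Rightarrow> ('n, 'k) mpoly) \<Rightarrow> nat \<Rightarrow> ('n, 'k) mpoly" where
  "scale_vec \<equiv> (\<lambda>c v i. Poly_Mapping.single 0 c * v i)"

lemma vector_space_scale_poly: "vector_space (scale_poly :: 'k::field \<Rightarrow> ('n, 'k) mpoly \<Rightarrow> ('n, 'k) mpoly)"
  by unfold_locales (simp_all add: distrib_left distrib_right single_add mult.assoc[symmetric] mult_single)

lemma vector_space_scale_vec: "vector_space (scale_vec :: 'k::field \<Rightarrow> (nat \<Rightarrow> ('n, 'k) mpoly) \<Rightarrow> _)"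
  by unfold_locales (simp_all add: fun_eq_iff distrib_left distrib_right single_add mult.assoc[symmetric] mult_single)

global_interpretation P: vector_space "scale_poly :: 'k::field \<Rightarrow> ('n, 'k) mpoly \<Rightarrow> ('n, 'k) mpoly"
  by (rule vector_space_scale_poly)

global_interpretation F: vector_space "scale_vec :: 'k::field \<Rightarrow> (nat \<Rightarrow> ('n, 'k) mpoly) \<Rightarrow> _"
  by (rule vector_space_scale_vec)

global_interpretation FP: vector_space_pair "scale_vec :: 'k::field \<Rightarrow> (nat \<Rightarrow> ('n, 'k) mpoly) \<Rightarrow> _"
    "scale_poly :: 'k::field \<Rightarrow> ('n, 'k) mpoly \<Rightarrow> ('n, 'k) mpoly" ..

global_interpretation PP: vector_space_pair "scale_poly :: 'k::field \<Rightarrow> ('n, 'k) mpoly \<Rightarrow> ('n, 'k) mpoly"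
    "scale_poly :: 'k::field \<Rightarrow> ('n, 'k) mpoly \<Rightarrow> ('n, 'k) mpoly" ..

global_interpretation FF: vector_space_pair "scale_vec :: 'k::field \<Rightarrow> (nat \<Rightarrow> ('n, 'k) mpoly) \<Rightarrow> _"
    "scale_vec :: 'k::field \<Rightarrow> (nat \<Rightarrow> ('n, 'k) mpoly) \<Rightarrow> _" ..

lemma linear_FP_I:
  assumes "\<And>u v. f (\<lambda>i. u i + v i) = f u + f v" "\<And>c u. f (\<lambda>i. Poly_Mapping.single 0 c * u i) = Poly_Mapping.single 0 c * f u"
  shows "Vector_Spaces.linear (scale_vec :: 'k::field \<Rightarrow> (nat \<Rightarrow> ('n, 'k) mpoly) \<Rightarrow> _) scale_poly f"
  by unfold_locales (simp_all add: assms plus_fun_def)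

lemma linear_PP_I:
  assumes "\<And>u v. f (u + v) = f u + f v" "\<And>c u. f (Poly_Mapping.single 0 c * u) = Poly_Mapping.single 0 c * f u"
  shows "Vector_Spaces.linear (scale_poly :: 'k::field \<Rightarrow> ('n, 'k) mpoly \<Rightarrow> ('n, 'k) mpoly) scale_poly f"
  by unfold_locales (simp_all add: assms)

lemma linear_FF_I:
  assumes "\<And>u v. f (\<lambda>i. u i + v i) = (\<lambda>i. f u i + f v i)" "\<And>c u. f (\<lambda>i. Poly_Mapping.single 0 c * u i) = (\<lambda>i. Poly_Mapping.single 0 c * f u i)"
  shows "Vector_Spaces.linear (scale_vec :: 'k::field \<Rightarrow> (nat \<Rightarrow> ('n, 'k) mpoly) \<Rightarrow> _) scale_vec f"
  by unfold_locales (simp_all add: assms plus_fun_def)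

lemma subspace_P_iff: "P.subspace U \<longleftrightarrow> 0 \<in> U \<and> (\<forall>x\<in>U. \<forall>y\<in>U. x + y \<in> U) \<and> (\<forall>c. \<forall>x\<in>U. Poly_Mapping.single 0 c * x \<in> U)"
  by (rule P.subspace_def)

lemma subspace_F_iff: "F.subspace U \<longleftrightarrow> (\<lambda>_. 0) \<in> U \<and> (\<forall>x\<in>U. \<forall>y\<in>U. (\<lambda>i. x i + y i) \<in> U) \<and> (\<forall>c. \<forall>x\<in>U. (\<lambda>i. Poly_Mapping.single 0 c * x i) \<in> U)"
  unfolding F.subspace_def zero_fun_def plus_fun_def by (rule refl)

lemma is_ideal_subspace: "is_ideal I \<Longrightarrow> P.subspace I"
  by (auto simp: subspace_P_iff is_ideal_iff)

text \<open>Finite direct sums, with tuples encoded as functions that vanish from N on. Tuples of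
  all lengths then share one type, in which they form subspaces.\<close>

definition tuples :: "nat \<Rightarrow> (nat \<Rightarrow> 'a set) \<Rightarrow> (nat \<Rightarrow> 'a::zero) set" where
  "tuples N U = {w. (\<forall>i<N. w i \<in> U i) \<and> (\<forall>i\<ge>N. w i = 0)}"

lemma P_dim_0: "P.dim {0 :: ('n, 'k::field) mpoly} = 0"
  using P.dim_span[of "{} :: ('n, 'k) mpoly set"] P.dim_eq_card_independent[of "{} :: ('n, 'k) mpoly set"]
  by (simp add: P.span_empty P.independent_empty)

lemma F_dim_0: "F.dim {\<lambda>_. 0 :: ('n, 'k::field) mpoly} = 0"
  using F.dim_span[of "{} :: (nat \<Rightarrow> ('n, 'k) mpoly) set"] F.dim_eq_card_independent[of "{} :: (nat \<Rightarrow> ('n, 'k) mpoly) set"]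
  by (simp add: F.span_empty F.independent_empty zero_fun_def)

lemma subspace_tuples:
  assumes "\<And>i. i < N \<Longrightarrow> P.subspace (U i)" shows "F.subspace (tuples N U)"
  using assms by (simp add: subspace_F_iff subspace_P_iff tuples_def)

lemma fin_dim_tuples:
  assumes "\<And>i. i < N \<Longrightarrow> P.subspace (U i :: ('n, 'k::field) mpoly set)" "\<And>i. i < N \<Longrightarrow> fin_dim_wrt P.span (U i)"
  shows "fin_dim_wrt F.span (tuples N U)"
  using assms
proof (induction N)
  case 0
  have "tuples 0 U = {\<lambda>_. 0}" by (auto simp: tuples_def)
  then show ?case unfolding fin_dim_wrt_def by (intro exI[of _ "{}"]) (simp add: F.span_empty zero_fun_def)
next
  case (Suc N)
  interpret V: vector_space_pair "scale_poly :: 'k \<Rightarrow> ('n, 'k) mpoly \<Rightarrow> ('n, 'k) mpoly" scale_vec ..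
  define f where "f = (\<lambda>p::('n, 'k) mpoly. \<lambda>i. if i = N then p else 0)"
  have "Vector_Spaces.linear scale_poly scale_vec f"
    by unfold_locales (auto simp: f_def fun_eq_iff)
  then have "fin_dim_wrt F.span (f ` U N)" using V.fin_dim_image Suc.prems(2)[of N] by blast
  then obtain B1 where B1: "finite B1" "f ` U N \<subseteq> F.span B1" unfolding fin_dim_wrt_def by blast
  obtain B2 where B2: "finite B2" "tuples N U \<subseteq> F.span B2" using Suc.IH Suc.prems unfolding fin_dim_wrt_def by auto
  have "tuples (Suc N) U \<subseteq> F.span (B1 \<union> B2)"
  proof
    fix v assume "v \<in> tuples (Suc N) U"
    then have v: "v N \<in> U N" "(\<lambda>i. if i = N then 0 else v i) \<in> tuples N U" by (auto simp: tuples_def)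
    have "(\<lambda>i. if i = N then 0 else v i) \<in> F.span (B1 \<union> B2)"
      using v(2) B2(2) F.span_mono[of B2 "B1 \<union> B2"] by auto
    moreover have "f (v N) \<in> F.span (B1 \<union> B2)"
      using v(1) B1(2) F.span_mono[of B1 "B1 \<union> B2"] by auto
    ultimately have "(\<lambda>i. if i = N then 0 else v i) + f (v N) \<in> F.span (B1 \<union> B2)" by (rule F.span_add)
    moreover have "(\<lambda>i. if i = N then 0 else v i) + f (v N) = v" by (simp add: f_def fun_eq_iff)
    ultimately show "v \<in> F.span (B1 \<union> B2)" by simp
  qed
  then show ?case unfolding fin_dim_wrt_def using B1 B2 by (intro exI[of _ "B1 \<union> B2"]) auto
qed

text \<open>Rank-nullity for the projection to the last coordinate.\<close>

lemma dim_tuples: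
  assumes "\<And>i. i < N \<Longrightarrow> P.subspace (U i :: ('n, 'k::field) mpoly set)" "\<And>i. i < N \<Longrightarrow> fin_dim_wrt P.span (U i)"
  shows "F.dim (tuples N U) = (\<Sum>i<N. P.dim (U i))"
  using assms
proof (induction N)
  case 0
  have "tuples 0 U = {\<lambda>_. 0}" by (auto simp: tuples_def)
  then show ?case by (simp add: F_dim_0)
next
  case (Suc N)
  have s: "F.subspace (tuples (Suc N) U)" using Suc.prems by (intro subspace_tuples) auto
  have fd: "fin_dim_wrt F.span (tuples (Suc N) U)" using Suc.prems by (intro fin_dim_tuples) auto
  have l: "Vector_Spaces.linear scale_vec scale_poly (\<lambda>w::nat \<Rightarrow> ('n, 'k) mpoly. w N)"
    by (rule linear_FP_I) auto
  have 0: "0 \<in> U i" if "i < Suc N" for i using P.subspace_0[OF Suc.prems(1)[OF that]] .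
  have "(\<lambda>w. w N) ` tuples (Suc N) U = U N"
  proof (intro equalityI subsetI)
    fix p assume p: "p \<in> U N"
    then have "(\<lambda>i. if i = N then p else 0) \<in> tuples (Suc N) U" using 0 by (auto simp: tuples_def)
    then show "p \<in> (\<lambda>w. w N) ` tuples (Suc N) U" by (rule image_eqI[rotated]) simp
  qed (auto simp: tuples_def)
  moreover have "{w \<in> tuples (Suc N) U. w N = 0} = tuples N U"
    using 0 by (auto simp: tuples_def less_Suc_eq le_Suc_eq) (metis le_antisym not_less_eq_eq)
  ultimately show ?case using FP.rank_nullity[OF l s fd] Suc by simp
qed

definition supported :: "'m set \<Rightarrow> ('m \<Rightarrow>\<^sub>0 'k::zero) set" where
  "supported B = {p. Poly_Mapping.keys p \<subseteq> B}"

lemma subspace_supported: "P.subspace (supported B :: ('n, 'k::field) mpoly set)"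
  unfolding subspace_P_iff
proof (intro conjI ballI allI)
  fix x y :: "('n, 'k) mpoly" and c assume x: "x \<in> supported B"
  show "y \<in> supported B \<Longrightarrow> x + y \<in> supported B" using x Poly_Mapping.keys_add[of x y] by (auto simp: supported_def)
  show "Poly_Mapping.single 0 c * x \<in> supported B"
    using x keys_mult[of "Poly_Mapping.single 0 c" x] by (auto simp: supported_def split: if_splits)
qed (simp add: supported_def)

lemma lookup_const_mult: "Poly_Mapping.lookup (Poly_Mapping.single 0 c * p :: ('n, 'k::field) mpoly) m = c * Poly_Mapping.lookup p m"
  by (simp add: mult_map_scale_conv_mult[symmetric] Poly_Mapping.map.rep_eq when_def)

text \<open>Rank-nullity for the coefficient of one monomial after the other. The coefficient is
  taken as a constant polynomial, so that the target is the line spanned by 1 in the same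
  space.\<close>

lemma dim_supported:
  assumes "finite B"
  shows "fin_dim_wrt P.span (supported B :: ('n, 'k::field) mpoly set) \<and> P.dim (supported B :: ('n, 'k) mpoly set) = card B"
  using assms
proof (induction B rule: finite_induct)
  case empty
  have "supported {} = {0 :: ('n, 'k) mpoly}" by (auto simp: supported_def)
  then show ?case unfolding fin_dim_wrt_def by (auto simp: P_dim_0 P.span_empty intro!: exI[of _ "{}"])
next
  case (insert m B)
  let ?S = "supported (insert m B) :: ('n, 'k) mpoly set"
  have split: "p = Poly_Mapping.single 0 (Poly_Mapping.lookup p m) * Poly_Mapping.single m 1 + (p - Poly_Mapping.single m (Poly_Mapping.lookup p m))" for p :: "('n, 'k) mpoly"
    by (simp add: mult_single)
  have mem: "p - Poly_Mapping.single m (Poly_Mapping.lookup p m) \<in> supported B" if "p \<in> ?S" for p :: "('n, 'k) mpoly"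
    using that unfolding supported_def by (auto simp: in_keys_iff lookup_minus lookup_single when_def split: if_splits)
  obtain B' :: "('n, 'k) mpoly set" where B': "finite B'" "supported B \<subseteq> P.span B'" using insert.IH unfolding fin_dim_wrt_def by blast
  have "?S \<subseteq> P.span (insert (Poly_Mapping.single m 1) B')"
  proof
    fix p assume p: "p \<in> ?S"
    have 1: "Poly_Mapping.single 0 (Poly_Mapping.lookup p m) * Poly_Mapping.single m 1 \<in> P.span (insert (Poly_Mapping.single m 1) B')"
      by (rule P.span_scale) (simp add: P.span_base)
    have 2: "p - Poly_Mapping.single m (Poly_Mapping.lookup p m) \<in> P.span (insert (Poly_Mapping.single m 1) B')"
      using mem[OF p] B' P.span_mono[of B' "insert (Poly_Mapping.single m 1) B'"] by blast
    show "p \<in> P.span (insert (Poly_Mapping.single m 1) B')" using P.span_add[OF 1 2] split[of p] by simp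
  qed
  then have fd: "fin_dim_wrt P.span ?S" unfolding fin_dim_wrt_def using B' by blast
  have l: "Vector_Spaces.linear scale_poly scale_poly (\<lambda>p::('n, 'k) mpoly. Poly_Mapping.single 0 (Poly_Mapping.lookup p m) :: ('n, 'k) mpoly)"
    by (rule linear_PP_I) (simp_all add: lookup_add single_add lookup_const_mult mult_single)
  have "(\<lambda>p::('n, 'k) mpoly. Poly_Mapping.single 0 (Poly_Mapping.lookup p m) :: ('n, 'k) mpoly) ` ?S = P.span {1}"
  proof (intro equalityI subsetI)
    fix q assume "q \<in> (\<lambda>p::('n, 'k) mpoly. Poly_Mapping.single 0 (Poly_Mapping.lookup p m) :: ('n, 'k) mpoly) ` ?S"
    then obtain c :: 'k where "q = Poly_Mapping.single 0 c * 1" by auto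
    then show "q \<in> P.span {1}" using P.span_scale[OF P.span_base[of 1 "{1}"], of c] by simp
  next
    fix q :: "('n, 'k) mpoly" assume "q \<in> P.span {1}"
    then obtain c :: 'k where "q = Poly_Mapping.single 0 c * 1" by (auto simp: P.span_singleton)
    then have "q = Poly_Mapping.single 0 (Poly_Mapping.lookup (Poly_Mapping.single m c) m)" by simp
    moreover have "Poly_Mapping.single m c \<in> ?S" by (auto simp: supported_def)
    ultimately show "q \<in> (\<lambda>p::('n, 'k) mpoly. Poly_Mapping.single 0 (Poly_Mapping.lookup p m) :: ('n, 'k) mpoly) ` ?S" by blast
  qed
  moreover have "P.dim (P.span {1 :: ('n, 'k) mpoly}) = 1"
    using P.dim_eq_card_independent[of "{1 :: ('n, 'k) mpoly}"] by (simp add: P.dependent_single)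
  moreover have "{p \<in> ?S. (Poly_Mapping.single 0 (Poly_Mapping.lookup p m) :: ('n, 'k) mpoly) = 0} = supported B"
  proof -
    have "(Poly_Mapping.single 0 c :: ('n, 'k) mpoly) = 0 \<longleftrightarrow> c = 0" for c :: 'k
      by (metis lookup_single_eq lookup_zero single_zero)
    then show ?thesis using insert.hyps unfolding supported_def by (auto simp: in_keys_iff)
  qed
  ultimately show ?case using PP.rank_nullity[OF l subspace_supported fd] insert fd by simp
qed

section \<open>Primes of small height\<close>

text \<open>Bounding each exponent, instead of the degree, makes the number of monomials an exact
  power of t.\<close>

definition box :: "'n::finite set \<Rightarrow> nat \<Rightarrow> ('n \<Rightarrow>\<^sub>0 nat) set" where
  "box V t = {m. Poly_Mapping.keys m \<subseteq> V \<and> (\<forall>i. Poly_Mapping.lookup m i < t)}"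

lemma card_box:
  assumes "t > 0" shows "finite (box V t) \<and> card (box V t) = t ^ card V"
proof -
  have lk: "Poly_Mapping.lookup (Abs_poly_mapping g) = g" for g :: "'a \<Rightarrow> nat"
    by (simp add: Abs_poly_mapping_inverse)
  have "bij_betw (\<lambda>m. restrict (Poly_Mapping.lookup m) V) (box V t) (PiE V (\<lambda>_. {..<t}))"
  proof (rule bij_betwI[where g = "\<lambda>f. Abs_poly_mapping (\<lambda>i. if i \<in> V then f i else 0)"])
    show "(\<lambda>m. restrict (Poly_Mapping.lookup m) V) \<in> box V t \<rightarrow> PiE V (\<lambda>_. {..<t})" by (auto simp: box_def)
    show "(\<lambda>f. Abs_poly_mapping (\<lambda>i. if i \<in> V then f i else 0)) \<in> PiE V (\<lambda>_. {..<t}) \<rightarrow> box V t"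
      using assms by (auto simp: box_def lk in_keys_iff split: if_splits)
    show "Abs_poly_mapping (\<lambda>i. if i \<in> V then restrict (Poly_Mapping.lookup m) V i else 0) = m" if "m \<in> box V t" for m
      using that by (intro poly_mapping_eqI) (auto simp: lk box_def in_keys_iff)
    show "restrict (Poly_Mapping.lookup (Abs_poly_mapping (\<lambda>i. if i \<in> V then f i else 0))) V = f" if "f \<in> PiE V (\<lambda>_. {..<t})" for f
      using that by (auto simp: lk fun_eq_iff PiE_def extensional_def)
  qed
  then show ?thesis using bij_betw_finite bij_betw_same_card by (fastforce simp: card_PiE finite_PiE)
qed

lemma prime_ideal_multD: "prime_ideal P \<Longrightarrow> a * b \<in> P \<Longrightarrow> a \<in> P \<or> b \<in> P"
  unfolding prime_ideal_def by blast

text \<open>If \<open>U\<close> meets \<open>P\<close> only in 0 and \<open>p \<in> P\<close> is not in the smaller prime \<open>Q\<close>, the powers of \<open>p\<close> are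
  linearly independent over \<open>U\<close> modulo \<open>Q\<close>.\<close>

lemma powers_independent:
  fixes U P Q :: "('n::{finite,linorder}, 'k::field) mpoly set"
  assumes U: "U \<inter> P \<subseteq> {0}" and P: "prime_ideal P" and Q: "prime_ideal Q" "Q \<subseteq> P" and p: "p \<in> P" "p \<notin> Q"
    and s: "\<forall>l<t. s l \<in> U" "(\<Sum>l<t. p ^ l * s l) \<in> Q"
  shows "\<forall>l<t. s l = 0"
  using s
proof (induction t arbitrary: s)
  case (Suc t)
  have Pi: "is_ideal P" using P by (simp add: prime_ideal_def)
  have e: "(\<Sum>l<Suc t. p ^ l * s l) = s 0 + p * (\<Sum>l<t. p ^ l * s (Suc l))"
    by (simp add: sum.lessThan_Suc_shift sum_distrib_left mult.assoc del: sum.lessThan_Suc)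
  then have "s 0 + p * (\<Sum>l<t. p ^ l * s (Suc l)) \<in> Q" using Suc.prems(2) by (simp only: e)
  then have "s 0 + p * (\<Sum>l<t. p ^ l * s (Suc l)) - p * (\<Sum>l<t. p ^ l * s (Suc l)) \<in> P"
    using Q(2) is_idealD(4)[OF Pi p(1)] by (intro is_idealD(5)[OF Pi]) auto
  then have "s 0 \<in> P" by simp
  then have s0: "s 0 = 0" using U Suc.prems(1) by auto
  then have "p * (\<Sum>l<t. p ^ l * s (Suc l)) \<in> Q" using e Suc.prems(2) by (simp del: sum.lessThan_Suc)
  then have "p \<in> Q \<or> (\<Sum>l<t. p ^ l * s (Suc l)) \<in> Q" by (rule prime_ideal_multD[OF Q(1)])
  then have "(\<Sum>l<t. p ^ l * s (Suc l)) \<in> Q" using p(2) by simp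
  then have "\<forall>l<t. s (Suc l) = 0" using Suc.prems(1) by (intro Suc.IH) simp_all
  then show ?case using s0 by (simp add: All_less_Suc2)
qed simp

definition exp_bounded :: "nat \<Rightarrow> ('n, 'k::zero) mpoly set" where
  "exp_bounded a = {p. \<forall>m\<in>Poly_Mapping.keys p. \<forall>i. Poly_Mapping.lookup m i \<le> a}"

lemma exp_bounded_mono: "a \<le> b \<Longrightarrow> exp_bounded a \<subseteq> exp_bounded b"
  by (auto simp: exp_bounded_def intro: order_trans)

lemma exp_bounded_add: "p \<in> exp_bounded a \<Longrightarrow> q \<in> exp_bounded a \<Longrightarrow> p + q \<in> exp_bounded (a::nat)"
  for p q :: "('n, 'k::field) mpoly"
  using Poly_Mapping.keys_add[of p q] by (auto simp: exp_bounded_def)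

lemma exp_bounded_sum: "(\<And>i. i \<in> A \<Longrightarrow> g i \<in> exp_bounded a) \<Longrightarrow> sum g A \<in> exp_bounded a"
  for g :: "'i \<Rightarrow> ('n, 'k::field) mpoly"
proof (induction A rule: infinite_finite_induct)
  case (insert x F)
  then show ?case by (simp add: exp_bounded_add)
qed (simp_all add: exp_bounded_def)

lemma exp_bounded_mult:
  fixes p q :: "('n, 'k::field) mpoly"
  assumes "p \<in> exp_bounded a" "q \<in> exp_bounded b" shows "p * q \<in> exp_bounded (a + b)"
  unfolding exp_bounded_def
proof (intro CollectI ballI allI)
  fix m i assume "m \<in> Poly_Mapping.keys (p * q)"
  then obtain x y where "m = x + y" "x \<in> Poly_Mapping.keys p" "y \<in> Poly_Mapping.keys q" using keys_mult[of p q] by blast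
  then show "Poly_Mapping.lookup m i \<le> a + b" using assms by (simp add: exp_bounded_def lookup_add add_mono)
qed

lemma exp_bounded_power: "p \<in> exp_bounded a \<Longrightarrow> p ^ l \<in> exp_bounded (l * a)" for p :: "('n, 'k::field) mpoly"
proof (induction l)
  case 0 then show ?case by (simp add: exp_bounded_def)
next
  case (Suc l) then show ?case using exp_bounded_mult[of p a "p ^ l" "l * a"] by simp
qed

lemma exp_bounded_exists: "\<exists>a. (p :: ('n::finite, 'k::field) mpoly) \<in> exp_bounded a"
proof -
  let ?A = "(\<lambda>(m, i). Poly_Mapping.lookup m i) ` (Poly_Mapping.keys p \<times> UNIV)"
  have "p \<in> exp_bounded (Max ?A)" unfolding exp_bounded_def
    by (intro CollectI ballI allI Max_ge) auto
  then show ?thesis ..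
qed

lemma exp_bounded_powers:
  fixes p :: "('n, 'k::field) mpoly"
  assumes "p \<in> exp_bounded a" "U \<subseteq> exp_bounded b"
  shows "(\<lambda>s. \<Sum>l<t. p ^ l * s l) ` tuples t (\<lambda>_. U) \<subseteq> exp_bounded (t * a + b)"
proof clarify
  fix s assume s: "s \<in> tuples t (\<lambda>_. U)"
  have "p ^ l * s l \<in> exp_bounded (t * a + b)" if "l < t" for l
  proof -
    have "p ^ l * s l \<in> exp_bounded (l * a + b)"
      using s that assms by (intro exp_bounded_mult exp_bounded_power) (auto simp: tuples_def)
    then show ?thesis using exp_bounded_mono[of "l * a + b" "t * a + b"] that by auto
  qed
  then show "(\<Sum>l<t. p ^ l * s l) \<in> exp_bounded (t * a + b)" by (intro exp_bounded_sum) simp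
qed

text \<open>W is the sum of the p^l U with l < t. One step down a chain of primes thus multiplies
  the dimension by t, while the exponents grow only linearly in t.\<close>

lemma subspace_powers:
  fixes U P Q :: "('n::{finite,linorder}, 'k::field) mpoly set"
  assumes U: "U \<inter> P \<subseteq> {0}" "P.subspace U" "fin_dim_wrt P.span U" "U \<subseteq> exp_bounded b"
    and P: "prime_ideal P" and Q: "prime_ideal Q" "Q \<subseteq> P" and p: "p \<in> P" "p \<notin> Q" "p \<in> exp_bounded a"
  obtains W where "W \<inter> Q \<subseteq> {0}" "P.subspace W" "fin_dim_wrt P.span W" "W \<subseteq> exp_bounded (t * a + b)" "P.dim W = t * P.dim U"
proof -
  have Qi: "is_ideal Q" using Q by (simp add: prime_ideal_def)
  let ?f = "\<lambda>s. \<Sum>l<t. p ^ l * s l"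
  have l: "Vector_Spaces.linear scale_vec scale_poly ?f"
    by (rule linear_FP_I) (simp_all add: distrib_left sum.distrib sum_distrib_left mult_ac)
  have s: "F.subspace (tuples t (\<lambda>_. U))" by (rule subspace_tuples) (rule U)
  have f: "fin_dim_wrt F.span (tuples t (\<lambda>_. U))" by (rule fin_dim_tuples) (rule U)+
  have z: "\<forall>i<t. v i = 0" if "v \<in> tuples t (\<lambda>_. U)" "?f v \<in> Q" for v
  proof (rule powers_independent[OF U(1) P Q p(1,2)])
    show "\<forall>l<t. v l \<in> U" using that(1) by (simp add: tuples_def)
  qed (rule that(2))
  have z0: "v = 0" if "v \<in> tuples t (\<lambda>_. U)" "?f v = 0" for v
  proof
    fix i
    have "?f v \<in> Q" using that(2) is_idealD(1)[OF Qi] by simp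
    then have "\<forall>i<t. v i = 0" by (rule z[OF that(1)])
    then show "v i = 0 i" using that(1) by (cases "i < t") (simp_all add: tuples_def)
  qed
  have zQ: "?f ` tuples t (\<lambda>_. U) \<inter> Q \<subseteq> {0}"
  proof clarify
    fix v assume v: "v \<in> tuples t (\<lambda>_. U)" "?f v \<in> Q" "?f v \<notin> {}"
    show "?f v = 0" using z[OF v(1,2)] by (intro sum.neutral) simp
  qed
  show ?thesis
  proof (rule that[of "?f ` tuples t (\<lambda>_. U)"])
    show "P.subspace (?f ` tuples t (\<lambda>_. U))" by (rule FP.linear_subspace_image[OF l s])
    show "fin_dim_wrt P.span (?f ` tuples t (\<lambda>_. U))" by (rule FP.fin_dim_image[OF l f])
    have "P.dim (?f ` tuples t (\<lambda>_. U)) = F.dim (tuples t (\<lambda>_. U))"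
      by (rule FP.dim_image_inj[OF l s f]) (rule z0)
    then show "P.dim (?f ` tuples t (\<lambda>_. U)) = t * P.dim U"
      using dim_tuples[of t "\<lambda>_. U"] U by simp
    show "?f ` tuples t (\<lambda>_. U) \<inter> Q \<subseteq> {0}" by (rule zQ)
    show "?f ` tuples t (\<lambda>_. U) \<subseteq> exp_bounded (t * a + b)" by (rule exp_bounded_powers[OF p(3) U(4)])
  qed
qed

text \<open>A growth argument instead of transcendence degrees. Modulo P the polynomials in V stay
  independent, and each of three strict inclusions below P contributes the powers of one more
  element. This yields dimension t ^ (card V + 3), with card V + 3 > n, among polynomials whose
  exponents are of order t, a space of dimension of order t ^ n.\<close>

lemma prime_height_le_2:
  fixes P :: "('n::{finite,linorder}, 'k::field) mpoly set"
  assumes P: "prime_ideal P" and V: "indep_vars V P" "CARD('n) \<le> card V + 2"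
  shows "prime_height P \<le> 2"
proof -
  have "prime_height P \<le> enat 2"
  proof (rule prime_height_le)
    fix C assume C: "\<forall>i\<le>Suc 2. prime_ideal (C i)" "\<forall>i<Suc 2. C i \<subset> C (Suc i)" "C (Suc 2) = P"
    define C0 C1 C2 where Cd: "C0 = C 0" "C1 = C 1" "C2 = C 2"
    have pr: "prime_ideal C0" "prime_ideal C1" "prime_ideal C2" using C unfolding Cd by auto
    have ch: "C0 \<subset> C1" "C1 \<subset> C2" "C2 \<subset> P" using C unfolding Cd by (auto simp: numeral_2_eq_2)
    obtain p1 where p1: "p1 \<in> C1" "p1 \<notin> C0" using ch(1) by auto
    obtain p2 where p2: "p2 \<in> C2" "p2 \<notin> C1" using ch(2) by auto
    obtain p3 where p3: "p3 \<in> P" "p3 \<notin> C2" using ch(3) by auto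
    obtain a1 a2 a3 where a: "p1 \<in> exp_bounded a1" "p2 \<in> exp_bounded a2" "p3 \<in> exp_bounded a3"
      using exp_bounded_exists[of p1] exp_bounded_exists[of p2] exp_bounded_exists[of p3] by auto
    \<comment> \<open>The exponents below are at most t * (a1 + a2 + a3 + 1). The strict bound of a
      box adds 1, which is at most t, so T \<le> c * t.\<close>
    define c where "c = a1 + a2 + a3 + 2"
    have ineq: "t ^ (card V + 3) \<le> (c * t) ^ CARD('n)" if t: "t > 0" for t
    proof -
      define U :: "('n, 'k) mpoly set" where "U = supported (box V t)"
      have "U \<subseteq> poly_in V" by (auto simp: U_def supported_def box_def poly_in_def)
      then have U1: "U \<inter> P \<subseteq> {0}" using V(1) unfolding indep_vars_def by auto
      have U2: "P.subspace U" unfolding U_def by (rule subspace_supported)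
      have U3: "fin_dim_wrt P.span U" "P.dim U = t ^ card V"
        using dim_supported[of "box V t"] card_box[OF t, of V] unfolding U_def by auto
      have U4: "U \<subseteq> exp_bounded t" by (auto simp: U_def supported_def box_def exp_bounded_def intro: less_imp_le)
      obtain W3 where W3: "W3 \<inter> C2 \<subseteq> {0}" "P.subspace W3" "fin_dim_wrt P.span W3" "W3 \<subseteq> exp_bounded (t * a3 + t)" "P.dim W3 = t * P.dim U"
        using subspace_powers[OF U1 U2 U3(1) U4 P pr(3) psubset_imp_subset[OF ch(3)] p3 a(3)] .
      obtain W2 where W2: "W2 \<inter> C1 \<subseteq> {0}" "P.subspace W2" "fin_dim_wrt P.span W2" "W2 \<subseteq> exp_bounded (t * a2 + (t * a3 + t))" "P.dim W2 = t * P.dim W3"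
        using subspace_powers[OF W3(1-4) pr(3) pr(2) psubset_imp_subset[OF ch(2)] p2 a(2)] .
      obtain W1 where W1: "W1 \<inter> C0 \<subseteq> {0}" "P.subspace W1" "fin_dim_wrt P.span W1" "W1 \<subseteq> exp_bounded (t * a1 + (t * a2 + (t * a3 + t)))" "P.dim W1 = t * P.dim W2"
        using subspace_powers[OF W2(1-4) pr(2) pr(1) psubset_imp_subset[OF ch(1)] p1 a(1)] .
      define T where "T = t * a1 + (t * a2 + (t * a3 + t)) + 1"
      have cT: "finite (box (UNIV :: 'n set) T)" "card (box (UNIV :: 'n set) T) = T ^ CARD('n)"
        using card_box[of T "UNIV::'n set"] by (simp_all add: T_def)
      have dT: "fin_dim_wrt P.span (supported (box UNIV T) :: ('n, 'k) mpoly set)"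
        "P.dim (supported (box UNIV T) :: ('n, 'k) mpoly set) = T ^ CARD('n)"
        by (simp_all add: dim_supported[OF cT(1)] cT(2))
      have "W1 \<subseteq> supported (box UNIV T)"
        using W1(4) unfolding T_def supported_def box_def exp_bounded_def by (auto simp: less_Suc_eq_le)
      then have "P.dim W1 \<le> P.dim (supported (box UNIV T) :: ('n, 'k) mpoly set)"
        by (rule P.dim_mono_fin_dim[OF dT(1)])
      also have "\<dots> = T ^ CARD('n)" by (rule dT(2))
      also have "\<dots> \<le> (c * t) ^ CARD('n)" using t unfolding T_def c_def by (intro power_mono) (auto simp: algebra_simps)
      finally have "t * (t * (t * t ^ card V)) \<le> (c * t) ^ CARD('n)" by (simp only: W1(5) W2(5) W3(5) U3(2))
      moreover have "t ^ (card V + 3) = t * (t * (t * t ^ card V))" by (simp add: power_add numeral_3_eq_3)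
      ultimately show ?thesis by simp
    qed
    \<comment> \<open>Just large enough for t ^ (n + 1) to exceed (c * t) ^ n.\<close>
    define t where "t = c ^ CARD('n) + 1"
    have t: "t > 0" by (simp add: t_def)
    have "t ^ (CARD('n) + 1) \<le> t ^ (card V + 3)" using V(2) t by (intro power_increasing) auto
    also have "\<dots> \<le> c ^ CARD('n) * t ^ CARD('n)" using ineq[OF t] by (simp add: power_mult_distrib)
    finally have "t * t ^ CARD('n) \<le> c ^ CARD('n) * t ^ CARD('n)" by simp
    then have "t \<le> c ^ CARD('n)" using t by simp
    then show False by (simp add: t_def)
  qed
  then show ?thesis by (simp add: numeral_eq_enat)
qed

section \<open>Syzygies of three forms\<close>

definition cross :: "(nat \<Rightarrow> 'a::comm_ring_1) \<Rightarrow> (nat \<Rightarrow> 'a) \<Rightarrow> nat \<Rightarrow> 'a" where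
  "cross u v = (\<lambda>j. if j = 0 then u 1 * v 2 - u 2 * v 1 else if j = 1 then u 2 * v 0 - u 0 * v 2
     else if j = 2 then u 0 * v 1 - u 1 * v 0 else 0)"

definition dot :: "(nat \<Rightarrow> 'a::comm_ring_1) \<Rightarrow> (nat \<Rightarrow> 'a) \<Rightarrow> 'a" where
  "dot u v = u 0 * v 0 + u 1 * v 1 + u 2 * v 2"

text \<open>The matrix of u \<times> -, in the shape in which \<open>indep_vars_colon\<close> takes
  its linear maps.\<close>

definition cross_matrix :: "(nat \<Rightarrow> 'a::comm_ring_1) \<Rightarrow> nat \<Rightarrow> nat \<Rightarrow> 'a" where
  "cross_matrix u i j = cross u (\<lambda>l. if l = i then 1 else 0) j"

lemma dot_add: "dot (\<lambda>i. u i + v i) f = dot u f + dot v f"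
  by (simp add: dot_def algebra_simps)

lemma dot_scale: "dot (\<lambda>i. c * u i) f = c * dot u f"
  by (simp add: dot_def algebra_simps)

lemma less_3_iff: "i < (3::nat) \<longleftrightarrow> i = 0 \<or> i = 1 \<or> i = 2"
  by auto

lemma sum_3: "(\<Sum>i<(3::nat). g i) = g 0 + g 1 + (g 2 :: 'a::comm_monoid_add)"
  by (simp add: numeral_3_eq_3 numeral_2_eq_2 add.assoc)

lemma sum_cross_matrix: "(\<Sum>i<3. cross_matrix u i j * v i) = cross u v j"
  by (simp add: sum_3 cross_matrix_def cross_def)

text \<open>Two vectors orthogonal to f have a cross product parallel to f: the minors of f and u
  \<times> v are combinations of \<open>dot u f\<close> and \<open>dot v f\<close>.\<close>

lemma cross_eq_multiple:
  assumes "dot u f = 0" "dot v f = (0::'a::comm_ring_1)" "i < 3" "j < 3"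
  shows "f i * cross u v j = f j * cross u v i"
proof -
  have e: "f 0 * cross u v 1 = f 1 * cross u v 0" "f 0 * cross u v 2 = f 2 * cross u v 0" "f 1 * cross u v 2 = f 2 * cross u v 1"
  proof -
    have "f 0 * cross u v 1 - f 1 * cross u v 0 = u 2 * dot v f - v 2 * dot u f" by (simp add: cross_def dot_def algebra_simps)
    then show "f 0 * cross u v 1 = f 1 * cross u v 0" using assms by simp
    have "f 0 * cross u v 2 - f 2 * cross u v 0 = v 1 * dot u f - u 1 * dot v f" by (simp add: cross_def dot_def algebra_simps)
    then show "f 0 * cross u v 2 = f 2 * cross u v 0" using assms by simp
    have "f 1 * cross u v 2 - f 2 * cross u v 1 = u 0 * dot v f - v 0 * dot u f" by (simp add: cross_def dot_def algebra_simps)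
    then show "f 1 * cross u v 2 = f 2 * cross u v 1" using assms by simp
  qed
  show ?thesis using assms(3,4) e by (auto simp: less_3_iff)
qed

lemma dot_cross_right: "dot (cross u v) v = 0" for u :: "nat \<Rightarrow> 'a::comm_ring_1"
  by (simp add: cross_def dot_def algebra_simps)

lemma cross_cross: "dot \<nu> f = 0 \<Longrightarrow> j < 3 \<Longrightarrow> cross \<nu> (cross f w) j = dot \<nu> w * f j" for f :: "nat \<Rightarrow> 'a::comm_ring_1"
proof -
  assume a: "dot \<nu> f = 0" "j < 3"
  have "cross \<nu> (cross f w) j = dot \<nu> w * f j - dot \<nu> f * w j"
    using a(2) by (auto simp: less_3_iff cross_def dot_def algebra_simps)
  then show ?thesis using a by simp
qed

lemma dot_cross_left: "dot (cross f w) f = 0" for f :: "nat \<Rightarrow> 'a::comm_ring_1"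
  by (simp add: cross_def dot_def algebra_simps)

text \<open>One combination is a nonzero coordinate, the other mixes the remaining two by
  \<open>primitive_combination\<close>. Constant weights keep combinations of forms of one degree
  homogeneous.\<close>

lemma coprime_combinations:
  fixes v :: "nat \<Rightarrow> ('n::{finite,linorder}, 'k::field_char_0) mpoly"
  assumes nz: "\<exists>i<3. v i \<noteq> 0" and prim: "\<And>p. prime_elem p \<Longrightarrow> \<exists>i<3. \<not> p dvd v i"
  obtains w1 w2 where "\<forall>i. homogeneous 0 (w1 i)" "\<forall>i. homogeneous 0 (w2 i)"
    "dot v w1 \<noteq> 0" "no_common_prime (dot v w1) (dot v w2)"
proof -
  obtain i j l where ijl: "{i, j, l} = {0, 1, 2}" "i < 3" "j < 3" "l < (3::nat)" "i \<noteq> j" "i \<noteq> l" "j \<noteq> l" "v i \<noteq> 0"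
  proof -
    obtain i where i: "i < 3" "v i \<noteq> 0" using nz by blast
    then consider "i = 0" | "i = 1" | "i = 2" by (auto simp: less_3_iff)
    then show ?thesis
    proof cases
      case 1 then show ?thesis using that[of 0 1 2] i by auto
    next
      case 2 then show ?thesis using that[of 1 0 2] i by auto
    next
      case 3 then show ?thesis using that[of 2 0 1] i by auto
    qed
  qed
  have np: "\<not> p dvd v l" if p: "prime_elem p" "p dvd v i" "p dvd v j" for p
  proof -
    obtain k where k: "k < 3" "\<not> p dvd v k" using prim[OF p(1)] by blast
    then have "k \<in> {i, j, l}" unfolding ijl(1) by (auto simp: less_3_iff)
    then show ?thesis using k p by auto
  qed
  obtain c where c: "no_common_prime (v i) (v j + Poly_Mapping.single 0 c * v l)"
    by (rule primitive_combination[OF ijl(8) np])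
  define w1 :: "nat \<Rightarrow> ('n, 'k) mpoly" where "w1 = (\<lambda>k. if k = i then 1 else 0)"
  define w2 :: "nat \<Rightarrow> ('n, 'k) mpoly" where "w2 = (\<lambda>k. if k = j then 1 else if k = l then Poly_Mapping.single 0 c else 0)"
  have h1: "homogeneous 0 (1 :: ('n, 'k) mpoly)" using homogeneous_const[of 1] by simp
  have w: "homogeneous 0 (w1 k)" "homogeneous 0 (w2 k)" for k
    using h1 homogeneous_const[of c] by (auto simp: w1_def w2_def)
  have a: "dot v w1 = v i" using ijl by (auto simp: dot_def w1_def less_3_iff)
  have b: "dot v w2 = v j + Poly_Mapping.single 0 c * v l" using ijl by (auto simp: dot_def w2_def less_3_iff mult.commute)
  show ?thesis by (rule that[of w1 w2]) (simp_all add: w a b c ijl(8))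
qed

text \<open>\<open>prim_f\<close> is what height two provides at this stage. The syzygy \<nu> is a
  parameter because the Bourbaki degree ranges over all minimal generators of degree e, each of
  which gives an instance.\<close>

locale three_forms =
  fixes f :: "nat \<Rightarrow> ('n::{finite,linorder}, 'k::field_char_0) mpoly" and d e :: nat and \<nu> :: "nat \<Rightarrow> ('n, 'k) mpoly"
  assumes hom_f: "\<And>i. i < 3 \<Longrightarrow> homogeneous (int d) (f i)"
    and prim_f: "\<And>p. prime_elem p \<Longrightarrow> \<exists>i<3. \<not> p dvd f i"
    and f_nz: "\<exists>i<3. f i \<noteq> 0"
    and hom_nu: "\<And>i. i < 3 \<Longrightarrow> homogeneous (int e) (\<nu> i)"
    and nu_nz: "\<exists>i<3. \<nu> i \<noteq> 0"
    and nu_syz: "dot \<nu> f = 0"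
    and min_deg: "\<And>t v. dot v f = 0 \<Longrightarrow> (\<And>i. i < 3 \<Longrightarrow> homogeneous t (v i)) \<Longrightarrow> t < int e \<Longrightarrow> \<forall>i<3. v i = 0"
    and n3: "CARD('n) \<ge> 3"
begin

text \<open>A common prime factor could be divided out, which would leave a nonzero syzygy of
  smaller degree.\<close>

lemma prim_nu:
  assumes p: "prime_elem p" shows "\<exists>i<3. \<not> p dvd \<nu> i"
proof (rule ccontr)
  assume "\<not> ?thesis"
  then have "\<forall>i. \<exists>w. i < 3 \<longrightarrow> \<nu> i = p * w" by (auto simp: dvd_def)
  from choice[OF this] obtain w where w: "\<And>i. i < 3 \<Longrightarrow> \<nu> i = p * w i" by auto
  have p0: "p \<noteq> 0" and pd: "total_degree p \<noteq> 0" using p is_unit_iff_const[of p] by (auto simp: prime_elem_def)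
  have "p * dot w f = dot \<nu> f" using w[of 0] w[of 1] w[of 2] by (simp add: dot_def algebra_simps)
  then have wf: "dot w f = 0" using nu_syz p0 by simp
  \<comment> \<open>The quotient w is not known to be homogeneous, but its components are syzygies,
    and those of degree below e vanish by minimality.\<close>
  have hc: "hcomp t (dot w f) = dot (\<lambda>i. hcomp (t - int d) (w i)) f" for t
    by (simp add: dot_def hcomp_add hcomp_mult_homogeneous[OF hom_f])
  have z: "\<forall>i<3. hcomp t (w i) = 0" if "t < int e" for t
  proof (rule min_deg[OF _ _ that])
    show "dot (\<lambda>i. hcomp t (w i)) f = 0" using hc[of "t + int d"] wf by simp
  qed simp
  obtain i where i: "i < 3" "\<nu> i \<noteq> 0" using nu_nz by blast
  then have wi: "w i \<noteq> 0" using w[OF i(1)] by auto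
  have "e = total_degree (\<nu> i)" using total_degree_homogeneous[OF hom_nu[OF i(1)] i(2)] by simp
  also have "\<dots> = total_degree p + total_degree (w i)" unfolding w[OF i(1)] by (rule total_degree_mult[OF p0 wi])
  finally have "total_degree (w i) < e" using pd by simp
  then have "(\<Sum>t\<in>{0..int (total_degree (w i))}. hcomp t (w i)) = 0" using z i(1) by (intro sum.neutral) auto
  then show False using wi hcomp_expand[of "w i"] by simp
qed

section \<open>The Bourbaki map and its image\<close>

lemma f_nonzero: obtains k where "k < 3" "f k \<noteq> 0" using f_nz by blast

lemma multiple_f_unique: "(\<And>j. j < 3 \<Longrightarrow> h * f j = h' * f j) \<Longrightarrow> h = h'"
  using f_nz mult_right_cancel by blast

text \<open>The multiplier is unique where it exists, since f is nonzero, but it is guaranteed to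
  exist only for syzygies u. Hence the assumption \<open>dot u f = 0\<close> in the rules
  below.\<close>

definition bour :: "(nat \<Rightarrow> ('n, 'k) mpoly) \<Rightarrow> ('n, 'k) mpoly" where
  "bour u = (SOME h. \<forall>j<3. cross \<nu> u j = h * f j)"

lemma bour:
  assumes "dot u f = 0" "j < 3" shows "cross \<nu> u j = bour u * f j"
proof -
  obtain k where k: "k < 3" "f k \<noteq> 0" by (rule f_nonzero)
  have "\<exists>h. \<forall>i<3. cross \<nu> u i = h * f i"
    by (rule parallel_to_primitive[OF cross_eq_multiple[OF nu_syz assms(1)] prim_f k])
  from someI_ex[OF this] show ?thesis using assms(2) unfolding bour_def by blast
qed

lemma bour_eqI: "dot u f = 0 \<Longrightarrow> (\<And>j. j < 3 \<Longrightarrow> cross \<nu> u j = h * f j) \<Longrightarrow> bour u = h"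
  by (rule multiple_f_unique) (simp add: bour[symmetric])

lemma bour_add: "dot u f = 0 \<Longrightarrow> dot v f = 0 \<Longrightarrow> bour (\<lambda>i. u i + v i) = bour u + bour v"
proof (rule bour_eqI)
  assume a: "dot u f = 0" "dot v f = 0"
  show "dot (\<lambda>i. u i + v i) f = 0" using a by (simp add: dot_add)
  fix j :: nat assume j: "j < 3"
  have "cross \<nu> (\<lambda>i. u i + v i) j = cross \<nu> u j + cross \<nu> v j" by (simp add: cross_def algebra_simps)
  then show "cross \<nu> (\<lambda>i. u i + v i) j = (bour u + bour v) * f j" using bour[OF a(1) j] bour[OF a(2) j] by (simp add: distrib_right)
qed

lemma bour_scale: "dot u f = 0 \<Longrightarrow> bour (\<lambda>i. p * u i) = p * bour u"
proof (rule bour_eqI)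
  assume a: "dot u f = 0"
  have "dot (\<lambda>i. p * u i) f = p * dot u f" by (simp add: dot_def algebra_simps)
  then show "dot (\<lambda>i. p * u i) f = 0" using a by simp
  fix j :: nat assume j: "j < 3"
  have "cross \<nu> (\<lambda>i. p * u i) j = p * cross \<nu> u j" by (simp add: cross_def algebra_simps)
  then show "cross \<nu> (\<lambda>i. p * u i) j = (p * bour u) * f j" using bour[OF a j] by (simp add: mult.assoc)
qed

text \<open>The double cross product formula for the Koszul syzygies f \<times> w; for this reason
  the ideal contains the coordinates of \<nu>.\<close>

lemma bour_cross: "bour (cross f w) = dot \<nu> w"
  by (rule bour_eqI) (auto simp: dot_cross_left cross_cross nu_syz)

lemma cross_nu_zero:
  assumes "\<And>j. j < 3 \<Longrightarrow> cross \<nu> u j = 0" shows "\<exists>h. \<forall>i<3. u i = h * \<nu> i"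
proof -
  obtain k where k: "k < 3" "\<nu> k \<noteq> 0" using nu_nz by blast
  have e: "\<nu> 1 * u 2 = \<nu> 2 * u 1" "\<nu> 2 * u 0 = \<nu> 0 * u 2" "\<nu> 0 * u 1 = \<nu> 1 * u 0"
    using assms[of 0] assms[of 1] assms[of 2] by (auto simp: cross_def)
  have "\<nu> i * u j = \<nu> j * u i" if "i < 3" "j < 3" for i j using that e by (auto simp: less_3_iff)
  then show ?thesis by (rule parallel_to_primitive[OF _ prim_nu k])
qed

lemma bour_eq_0_iff:
  assumes "dot u f = 0" shows "bour u = 0 \<longleftrightarrow> (\<exists>h. \<forall>i<3. u i = h * \<nu> i)"
proof
  assume "bour u = 0"
  then have "cross \<nu> u j = 0" if "j < 3" for j using bour[OF assms that] by simp
  then show "\<exists>h. \<forall>i<3. u i = h * \<nu> i" by (rule cross_nu_zero)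
next
  assume "\<exists>h. \<forall>i<3. u i = h * \<nu> i"
  then obtain h where h: "\<And>i. i < 3 \<Longrightarrow> u i = h * \<nu> i" by blast
  show "bour u = 0"
  proof (rule bour_eqI[OF assms])
    fix j :: nat assume "j < 3"
    show "cross \<nu> u j = 0 * f j" using h[of 0] h[of 1] h[of 2] by (simp add: cross_def algebra_simps)
  qed
qed

definition bour_ideal :: "('n, 'k) mpoly set" where
  "bour_ideal = bour ` {u. dot u f = 0}"

text \<open>Membership becomes a linear system in which u need not be assumed a syzygy: \<nu>
  \<times> u = h f implies h (u . f) = (\<nu> \<times> u) . u = 0, so u is a syzygy as soon as h
  \<noteq> 0.\<close>

lemma bour_ideal_iff: "h \<in> bour_ideal \<longleftrightarrow> (\<exists>u. \<forall>j<3. h * f j = cross \<nu> u j)"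
proof
  assume "h \<in> bour_ideal"
  then obtain u where "dot u f = 0" "h = bour u" unfolding bour_ideal_def by blast
  then show "\<exists>u. \<forall>j<3. h * f j = cross \<nu> u j" by (intro exI[of _ u]) (simp add: bour)
next
  assume "\<exists>u. \<forall>j<3. h * f j = cross \<nu> u j"
  then obtain u where u: "\<And>j. j < 3 \<Longrightarrow> h * f j = cross \<nu> u j" by blast
  show "h \<in> bour_ideal"
  proof (cases "h = 0")
    case True
    have "bour (\<lambda>_. 0) = 0" by (rule bour_eqI) (simp_all add: dot_def cross_def)
    moreover have "dot (\<lambda>_. 0) f = 0" by (simp add: dot_def)
    ultimately have "0 \<in> bour_ideal" unfolding bour_ideal_def by (intro image_eqI[of 0 bour "\<lambda>_. 0"]) simp_all
    then show ?thesis using True by simp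
  next
    case False
    have u': "cross \<nu> u 0 = h * f 0" "cross \<nu> u 1 = h * f 1" "cross \<nu> u 2 = h * f 2"
      using u[of 0] u[of 1] u[of 2] by simp_all
    have "h * dot u f = dot (cross \<nu> u) u" unfolding dot_def u' by (simp add: algebra_simps)
    then have uf: "dot u f = 0" using False by (simp add: dot_cross_right)
    have "bour u = h" by (rule bour_eqI[OF uf]) (simp add: u)
    then show ?thesis unfolding bour_ideal_def using uf by (intro image_eqI[of h bour u]) simp_all
  qed
qed

lemma bour_ideal_iff_matrix: "h \<in> bour_ideal \<longleftrightarrow> (\<exists>u. \<forall>j. h * (if j < 3 then f j else 0) = (\<Sum>i<3. cross_matrix \<nu> i j * u i))"
proof -
  have c0: "cross \<nu> u j = 0" if "\<not> j < 3" for u j using that by (simp add: cross_def)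
  have "(\<forall>j<3. h * f j = cross \<nu> u j) = (\<forall>j. h * (if j < 3 then f j else 0) = cross \<nu> u j)" for u
  proof (intro iffI allI impI)
    fix j assume a: "\<forall>j<3. h * f j = cross \<nu> u j"
    show "h * (if j < 3 then f j else 0) = cross \<nu> u j" by (cases "j < 3") (simp_all add: a c0)
  next
    fix j :: nat assume a: "\<forall>j. h * (if j < 3 then f j else 0) = cross \<nu> u j" and "j < 3"
    then show "h * f j = cross \<nu> u j" using a[rule_format, of j] by simp
  qed
  then show ?thesis unfolding bour_ideal_iff sum_cross_matrix by simp
qed

lemma bour_in_bour_ideal: "dot u f = 0 \<Longrightarrow> bour u \<in> bour_ideal"
  by (simp add: bour_ideal_def)

lemma bour_zero: "bour (\<lambda>_. 0) = 0"
  by (rule bour_eqI) (simp_all add: dot_def cross_def)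

lemma bour_idealE:
  assumes "h \<in> bour_ideal" obtains u where "dot u f = 0" "h = bour u"
  using assms unfolding bour_ideal_def by blast

lemma is_ideal_bour_ideal: "is_ideal bour_ideal"
  unfolding is_ideal_iff
proof (intro conjI ballI allI)
  have "dot (\<lambda>_. 0) f = 0" by (simp add: dot_def)
  then show "0 \<in> bour_ideal" using bour_in_bour_ideal[of "\<lambda>_. 0"] by (simp add: bour_zero)
  fix a assume "a \<in> bour_ideal"
  then obtain u where u: "dot u f = 0" "a = bour u" by (rule bour_idealE)
  show "c * a \<in> bour_ideal" for c
    using bour_in_bour_ideal[of "\<lambda>i. c * u i"] u by (simp add: dot_scale bour_scale)
  fix b assume "b \<in> bour_ideal"
  then obtain v where v: "dot v f = 0" "b = bour v" by (rule bour_idealE)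
  show "a + b \<in> bour_ideal"
    using bour_in_bour_ideal[of "\<lambda>i. u i + v i"] u v by (simp add: dot_add bour_add)
qed

section \<open>Homogeneity of the Bourbaki map\<close>

lemma homogeneous_cancel:
  fixes h g :: "('n, 'k) mpoly"
  assumes "homogeneous (s + t) (h * g)" "homogeneous t g" "g \<noteq> 0"
  shows "homogeneous s h"
proof -
  have "hcomp r h = 0" if "r \<noteq> s" for r
  proof -
    have "hcomp r h * g = hcomp (r + t) (h * g)" using hcomp_mult_homogeneous[OF assms(2), of "r + t" h] by simp
    also have "\<dots> = 0" using hcomp_homogeneous[OF assms(1), of "r + t"] that by simp
    finally show ?thesis using assms by simp
  qed
  then have "Poly_Mapping.lookup (hcomp (int (monom_degree m)) h) m = 0" if "int (monom_degree m) \<noteq> s" for m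
    using that by simp
  then show ?thesis by (auto simp: homogeneous_def lookup_hcomp in_keys_iff)
qed

lemma homogeneous_cross:
  assumes "\<And>i. i < 3 \<Longrightarrow> homogeneous s (u i)" "\<And>i. i < 3 \<Longrightarrow> homogeneous t (v i)"
  shows "homogeneous (s + t) (cross u v j)"
  unfolding cross_def using assms by (auto intro!: homogeneous_diff homogeneous_mult)

lemma homogeneous_bour:
  assumes u: "dot u f = 0" "\<And>i. i < 3 \<Longrightarrow> homogeneous t (u i)"
  shows "homogeneous (t + (int e - int d)) (bour u)"
proof -
  obtain k where k: "k < 3" "f k \<noteq> 0" by (rule f_nonzero)
  have "homogeneous (int e + t) (bour u * f k)"
    using homogeneous_cross[of "int e" \<nu> t u k] hom_nu u bour[OF u(1) k(1)] by auto
  then have "homogeneous ((t + (int e - int d)) + int d) (bour u * f k)" by (simp add: algebra_simps)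
  then show ?thesis using homogeneous_cancel hom_f[OF k(1)] k(2) by blast
qed

lemma dot_hcomp: "hcomp (t + int d) (dot u f) = dot (\<lambda>i. hcomp t (u i)) f"
  by (simp add: dot_def hcomp_add hcomp_mult_homogeneous[OF hom_f])

lemma hcomp_cross_nu: "hcomp (t + int e) (cross \<nu> u j) = cross \<nu> (\<lambda>i. hcomp t (u i)) j"
proof -
  have "hcomp (t + int e) (- p) = - hcomp (t + int e) p" for p :: "('n, 'k) mpoly"
    using hcomp_add[of "t + int e" p "- p"] by (simp add: eq_neg_iff_add_eq_0 add.commute)
  then have m: "hcomp (t + int e) (p - q) = hcomp (t + int e) p - hcomp (t + int e) q" for p q :: "('n, 'k) mpoly"
    using hcomp_add[of "t + int e" p "- q"] by simp
  have h: "hcomp (t + int e) (\<nu> i * p) = \<nu> i * hcomp t p" if "i < 3" for i p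
    using hcomp_mult_homogeneous[OF hom_nu[OF that], of "t + int e" p] by (simp add: mult.commute)
  show ?thesis by (simp add: cross_def m h)
qed

lemma hcomp_bour:
  assumes "dot u f = 0"
  shows "dot (\<lambda>i. hcomp t (u i)) f = 0" "hcomp (t + (int e - int d)) (bour u) = bour (\<lambda>i. hcomp t (u i))"
proof -
  show 0: "dot (\<lambda>i. hcomp t (u i)) f = 0" using dot_hcomp[of t u] assms by simp
  show "hcomp (t + (int e - int d)) (bour u) = bour (\<lambda>i. hcomp t (u i))"
  proof (rule sym, rule bour_eqI[OF 0])
    fix j :: nat assume j: "j < 3"
    have "cross \<nu> (\<lambda>i. hcomp t (u i)) j = hcomp (t + int e) (bour u * f j)"
      using hcomp_cross_nu[of t u j] bour[OF assms j] by simp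
    then show "cross \<nu> (\<lambda>i. hcomp t (u i)) j = hcomp (t + (int e - int d)) (bour u) * f j"
      using hcomp_mult_homogeneous[OF hom_f[OF j], of "t + int e" "bour u"] by (simp add: algebra_simps)
  qed
qed

lemma hcomp_bour_ideal: "h \<in> bour_ideal \<Longrightarrow> hcomp t h \<in> bour_ideal"
proof -
  assume "h \<in> bour_ideal"
  then obtain u where u: "dot u f = 0" "h = bour u" by (rule bour_idealE)
  show ?thesis using hcomp_bour[OF u(1), of "t - (int e - int d)"] bour_in_bour_ideal u(2) by simp
qed

lemma dot_nu_in_bour_ideal: "dot \<nu> w \<in> bour_ideal"
  using bour_in_bour_ideal[OF dot_cross_left, of w] by (simp add: bour_cross)

lemma homogeneous_dot_nu:
  assumes "\<And>i. homogeneous 0 (w i)" shows "homogeneous (int e) (dot \<nu> w)"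
  unfolding dot_def using homogeneous_mult[OF hom_nu assms] by (simp add: homogeneous_add)

section \<open>Height and unmixedness of the Bourbaki ideal\<close>

lemma coprime_in_nu:
  obtains w1 w2 where "\<forall>i. homogeneous 0 (w1 i)" "\<forall>i. homogeneous 0 (w2 i)"
    "dot \<nu> w1 \<noteq> 0" "no_common_prime (dot \<nu> w1) (dot \<nu> w2)"
  by (rule coprime_combinations[OF nu_nz prim_nu])

text \<open>\<open>indep_vars_colon\<close> applies to the matrix of \<nu> \<times> - and the vector
  x f; the kernel of the matrix is R\<nu> because \<nu> is primitive.\<close>

lemma colon_indep_vars:
  assumes x: "x \<notin> bour_ideal"
  obtains V where "card V = CARD('n) - 2" "indep_vars V {r. r * x \<in> bour_ideal}"
proof -
  obtain k where k: "k < 3" "\<nu> k \<noteq> 0" using nu_nz by blast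
  define y where "y = (\<lambda>j. x * (if j < 3 then f j else 0))"
  have ker: "\<exists>h. \<forall>i<3. u i = h * \<nu> i" if "\<And>j. (\<Sum>i<3. cross_matrix \<nu> i j * u i) = 0" for u
    by (rule cross_nu_zero) (use that in \<open>simp add: sum_cross_matrix\<close>)
  have g: "(\<Sum>i<3. cross_matrix \<nu> i j * \<nu> i) = 0" for j
    unfolding sum_cross_matrix by (simp add: cross_def)
  have ny: "\<nexists>w. \<forall>j. y j = (\<Sum>i<3. cross_matrix \<nu> i j * w i)"
    using x unfolding bour_ideal_iff_matrix y_def by simp
  have "{r. \<exists>w. \<forall>j. r * y j = (\<Sum>i<3. cross_matrix \<nu> i j * w i)} = {r. r * x \<in> bour_ideal}"
    unfolding bour_ideal_iff_matrix y_def by (simp add: mult.assoc)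
  then show ?thesis using indep_vars_colon[OF ker g k ny] that by auto
qed

lemma prime_containing_bour_ideal:
  assumes "prime_ideal P" "bour_ideal \<subseteq> P" shows "2 \<le> prime_height P"
proof -
  obtain w1 w2 where w: "\<forall>i. homogeneous 0 (w1 i)" "\<forall>i. homogeneous 0 (w2 i)"
    "dot \<nu> w1 \<noteq> 0" "no_common_prime (dot \<nu> w1) (dot \<nu> w2)" by (rule coprime_in_nu)
  show ?thesis using prime_height_ge_2[OF assms(1) _ w(3) _ w(4)] dot_nu_in_bour_ideal assms(2) by auto
qed

text \<open>The lower bound comes from two coprime combinations of the coordinates of \<nu>. For the
  upper bound, the colon ideal of x = 1 leaves n - 2 variables V independent, so some prime over the
  ideal avoids k[V] - {0}, and this bounds its height.\<close>

lemma ideal_height_bour_ideal: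
  assumes "1 \<notin> bour_ideal" shows "ideal_height bour_ideal = 2"
proof (rule antisym)
  obtain V where V: "card V = CARD('n) - 2" "indep_vars V {r. r * 1 \<in> bour_ideal}"
    by (rule colon_indep_vars[OF assms])
  define W where "W = poly_in V - {0 :: ('n, 'k) mpoly}"
  have W: "1 \<in> W" "\<And>a b. a \<in> W \<Longrightarrow> b \<in> W \<Longrightarrow> a * b \<in> W"
    unfolding W_def using subring_setD[OF subring_poly_in] by auto
  have "bour_ideal \<inter> W = {}" using V(2) unfolding W_def indep_vars_def by auto
  then obtain Q where Q: "prime_ideal Q" "bour_ideal \<subseteq> Q" "Q \<inter> W = {}"
    using prime_ideal_avoiding[OF is_ideal_bour_ideal W] by metis
  have "indep_vars V Q" using Q(3) unfolding W_def indep_vars_def by auto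
  then have "prime_height Q \<le> 2" using prime_height_le_2[OF Q(1)] V(1) by simp
  moreover have "ideal_height bour_ideal \<le> prime_height Q" unfolding ideal_height_def using Q by (intro INF_lower) auto
  ultimately show "ideal_height bour_ideal \<le> 2" by simp
  show "2 \<le> ideal_height bour_ideal" unfolding ideal_height_def
    by (rule INF_greatest) (use prime_containing_bour_ideal in auto)
qed

text \<open>An associated prime is itself a colon ideal, so it leaves n - 2 variables independent
  and has height at most two.\<close>

lemma unmixed_bour_ideal:
  assumes "1 \<notin> bour_ideal" shows "unmixed bour_ideal"
  unfolding unmixed_def
proof (intro allI impI)
  fix P assume P: "associated_prime bour_ideal P"
  then obtain x where x: "prime_ideal P" "P = {r. r * x \<in> bour_ideal}" unfolding associated_prime_def by blast
  have "x \<notin> bour_ideal"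
  proof
    assume "x \<in> bour_ideal"
    then have "1 \<in> P" using x(2) by simp
    then show False using x(1) by (simp add: prime_ideal_def)
  qed
  then obtain V where V: "card V = CARD('n) - 2" "indep_vars V {r. r * x \<in> bour_ideal}" by (rule colon_indep_vars)
  then have "prime_height P \<le> 2" using prime_height_le_2[OF x(1)] x(2) by simp
  moreover have "bour_ideal \<subseteq> P" using x(2) is_idealD(4)[OF is_ideal_bour_ideal] by auto
  then have "2 \<le> prime_height P" using prime_containing_bour_ideal[OF x(1)] by simp
  ultimately show "prime_height P = ideal_height bour_ideal" using ideal_height_bour_ideal[OF assms] by simp
qed

lemma homogeneous_ideal_bour_ideal: "homogeneous_ideal bour_ideal"
  unfolding homogeneous_ideal_def
proof (rule antisym)
  show "ideal_span {p \<in> bour_ideal. \<exists>t. homogeneous t p} \<subseteq> bour_ideal"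
    by (rule ideal_span_least[OF _ is_ideal_bour_ideal]) blast
  show "bour_ideal \<subseteq> ideal_span {p \<in> bour_ideal. \<exists>t. homogeneous t p}"
  proof
    fix p assume p: "p \<in> bour_ideal"
    have "hcomp t p \<in> ideal_span {p \<in> bour_ideal. \<exists>t. homogeneous t p}" for t
    proof (rule set_mp[OF ideal_span_superset])
      show "hcomp t p \<in> {p \<in> bour_ideal. \<exists>t. homogeneous t p}" using hcomp_bour_ideal[OF p] homogeneous_hcomp[of t p] by blast
    qed
    then have "(\<Sum>t\<in>{0..int (total_degree p)}. hcomp t p) \<in> ideal_span {p \<in> bour_ideal. \<exists>t. homogeneous t p}"
      by (intro is_ideal_sum[OF is_ideal_span]) auto
    then show "p \<in> ideal_span {p \<in> bour_ideal. \<exists>t. homogeneous t p}" using hcomp_expand[of p] by simp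
  qed
qed

end

section \<open>Eventually polynomial functions\<close>

definition ev_poly :: "(nat \<Rightarrow> nat) \<Rightarrow> bool" where
  "ev_poly f \<longleftrightarrow> (\<exists>P :: rat poly. \<forall>\<^sub>F t in sequentially. poly P (of_nat t) = of_nat (f t))"

lemma ev_poly_cong: "ev_poly f \<Longrightarrow> (\<And>t. t \<ge> T \<Longrightarrow> g t = f t) \<Longrightarrow> ev_poly g"
  unfolding ev_poly_def eventually_sequentially by (metis le_trans nat_le_linear)

lemma ev_poly_0: "ev_poly (\<lambda>_. 0)"
  unfolding ev_poly_def by (intro exI[of _ 0]) simp

lemma ev_poly_add: "ev_poly f \<Longrightarrow> ev_poly g \<Longrightarrow> ev_poly (\<lambda>t. f t + g t)"
  unfolding ev_poly_def
proof (elim exE)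
  fix P Q :: "rat poly"
  assume "\<forall>\<^sub>F t in sequentially. poly P (of_nat t) = of_nat (f t)" "\<forall>\<^sub>F t in sequentially. poly Q (of_nat t) = of_nat (g t)"
  then have "\<forall>\<^sub>F t in sequentially. poly (P + Q) (of_nat t) = of_nat (f t + g t)" by eventually_elim simp
  then show "\<exists>P :: rat poly. \<forall>\<^sub>F t in sequentially. poly P (of_nat t) = of_nat (f t + g t)" ..
qed

lemma ev_poly_sum: "(\<And>i. i \<in> A \<Longrightarrow> ev_poly (f i)) \<Longrightarrow> ev_poly (\<lambda>t. \<Sum>i\<in>A. f i t)"
  by (induction A rule: infinite_finite_induct) (auto simp: ev_poly_0 ev_poly_add)

lemma ev_poly_diff: "ev_poly f \<Longrightarrow> ev_poly g \<Longrightarrow> (\<And>t. g t \<le> f t) \<Longrightarrow> ev_poly (\<lambda>t. f t - g t)"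
  unfolding ev_poly_def
proof (elim exE)
  fix P Q :: "rat poly" assume le: "\<And>t. g t \<le> f t"
  assume "\<forall>\<^sub>F t in sequentially. poly P (of_nat t) = of_nat (f t)" "\<forall>\<^sub>F t in sequentially. poly Q (of_nat t) = of_nat (g t)"
  then have "\<forall>\<^sub>F t in sequentially. poly (P - Q) (of_nat t) = of_nat (f t - g t)"
    by eventually_elim (simp add: of_nat_diff le)
  then show "\<exists>P :: rat poly. \<forall>\<^sub>F t in sequentially. poly P (of_nat t) = of_nat (f t - g t)" ..
qed

lemma ev_poly_shift: "ev_poly f \<Longrightarrow> ev_poly (\<lambda>t. f (t - j))"
  unfolding ev_poly_def eventually_sequentially
proof (elim exE)
  fix P :: "rat poly" and T assume P: "\<forall>t\<ge>T. poly P (of_nat t) = of_nat (f t)"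
  show "\<exists>P :: rat poly. \<exists>T. \<forall>t\<ge>T. poly P (of_nat t) = of_nat (f (t - j))"
  proof (intro exI allI impI)
    fix t assume t: "T + j \<le> t"
    have "poly P (of_nat (t - j)) = of_nat (f (t - j))" by (rule P[rule_format]) (use t in simp)
    moreover have "of_nat (t - j) = (of_nat t - of_nat j :: rat)" using t by (simp add: of_nat_diff)
    ultimately show "poly (P \<circ>\<^sub>p [:- of_nat j, 1:]) (of_nat t) = of_nat (f (t - j))" by (simp add: poly_pcompose)
  qed
qed

text \<open>The falling factorials \<open>b k\<close> are monic of degree k, and the difference of
  \<open>b (Suc k)\<close> is k + 1 times \<open>b k\<close>; so the leading term of P is removed
  repeatedly.\<close>

lemma antidifference:
  fixes P :: "rat poly" shows "\<exists>Q. \<forall>x. poly Q (x + 1) - poly Q x = poly P x"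
proof -
  define b :: "nat \<Rightarrow> rat poly" where "b = (\<lambda>k. \<Prod>i<k. [:- of_nat i, 1:])"
  have bS: "b (Suc k) = b k * [:- of_nat k, 1:]" for k by (simp add: b_def mult.commute)
  have bn: "b k \<noteq> 0" and bd: "Polynomial.degree (b k) = k" and bl: "lead_coeff (b k) = 1" for k
  proof -
    have "b k \<noteq> 0 \<and> Polynomial.degree (b k) = k \<and> lead_coeff (b k) = 1"
    proof (induction k)
      case (Suc k)
      have "lead_coeff (b (Suc k)) = lead_coeff (b k) * lead_coeff [:- of_nat k, 1:]" unfolding bS by (rule lead_coeff_mult)
      moreover have "lead_coeff (b k) = 1" using Suc by blast
      ultimately have l: "lead_coeff (b (Suc k)) = 1" by simp
      have "Polynomial.degree (b (Suc k)) = Polynomial.degree (b k) + Polynomial.degree [:- of_nat k, 1 :: rat:]"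
        unfolding bS using Suc by (intro degree_mult_eq) auto
      then show ?case using l Suc by auto
    qed (simp add: b_def)
    then show "b k \<noteq> 0" "Polynomial.degree (b k) = k" "lead_coeff (b k) = 1" by auto
  qed
  have b1: "poly (b (Suc k)) (x + 1) = (x + 1) * poly (b k) x" for k x
  proof (induction k)
    case (Suc k)
    have "poly (b (Suc (Suc k))) (x + 1) = poly (b (Suc k)) (x + 1) * (x - of_nat k)"
      by (subst bS) (simp add: algebra_simps)
    also have "\<dots> = (x + 1) * (poly (b k) x * (x - of_nat k))" by (simp only: Suc.IH mult.assoc)
    also have "poly (b k) x * (x - of_nat k) = poly (b (Suc k)) x" by (simp add: bS algebra_simps)
    finally show ?case .
  qed (simp add: b_def)
  have db: "poly (b (Suc k)) (x + 1) - poly (b (Suc k)) x = of_nat (Suc k) * poly (b k) x" for k x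
    unfolding b1 by (simp add: bS algebra_simps)
  show ?thesis
  proof (induction "Polynomial.degree P" arbitrary: P rule: less_induct)
    case less
    let ?n = "Polynomial.degree P"
    define R where "R = P - Polynomial.smult (lead_coeff P) (b ?n)"
    have ex: "\<exists>Q. \<forall>x. poly Q (x + 1) - poly Q x = poly R x"
    proof (cases "R = 0")
      case True then show ?thesis by (intro exI[of _ 0]) simp
    next
      case False
      have "coeff R ?n = 0" using bl[of ?n] by (simp add: R_def bd)
      moreover have "Polynomial.degree R \<le> ?n" unfolding R_def
        by (rule degree_diff_le) (auto simp: bd intro: order_trans[OF degree_smult_le])
      ultimately have "Polynomial.degree R < ?n" using False by (metis le_neq_implies_less leading_coeff_0_iff)
      then show ?thesis by (rule less)
    qed
    then obtain Q where Q: "\<And>x. poly Q (x + 1) - poly Q x = poly R x" by blast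
    define Q' where "Q' = Q + Polynomial.smult (lead_coeff P / of_nat (Suc ?n)) (b (Suc ?n))"
    have "poly Q' (x + 1) - poly Q' x = poly P x" for x
    proof -
      have "poly Q' (x + 1) - poly Q' x = (poly Q (x + 1) - poly Q x) + lead_coeff P / of_nat (Suc ?n) * (poly (b (Suc ?n)) (x + 1) - poly (b (Suc ?n)) x)"
        by (simp add: Q'_def algebra_simps)
      also have "\<dots> = poly R x + lead_coeff P * poly (b ?n) x" unfolding Q db by (simp del: of_nat_Suc)
      also have "\<dots> = poly P x" by (simp add: R_def)
      finally show ?thesis .
    qed
    then show ?case by blast
  qed
qed

lemma ev_poly_partial_sum:
  assumes "ev_poly f" shows "ev_poly (\<lambda>t. \<Sum>i\<le>t. f i)"
proof -
  obtain P :: "rat poly" and T where P: "\<And>t. t \<ge> T \<Longrightarrow> poly P (of_nat t) = of_nat (f t)"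
    using assms unfolding ev_poly_def eventually_sequentially by blast
  obtain Q where Q: "\<And>x. poly Q (x + 1) - poly Q x = poly P x" using antidifference[of P] by blast
  \<comment> \<open>The argument is shifted by one because the sum includes the index t; the
    constant accounts for the indices below T, where P may differ from f.\<close>
  define R where "R = Q \<circ>\<^sub>p [:1, 1:] + [: of_nat (\<Sum>i<T. f i) - poly Q (of_nat T) :]"
  have "poly R (of_nat t) = of_nat (\<Sum>i\<le>t. f i)" if "T \<le> t" for t
    using that
  proof (induction t rule: dec_induct)
    case base
    have "poly Q (of_nat T + 1) = poly Q (of_nat T) + of_nat (f T)" using Q[of "of_nat T"] P[of T] by simp
    then show ?case by (simp add: R_def poly_pcompose add.commute lessThan_Suc_atMost[symmetric])
  next
    case (step t)
    have "poly Q (of_nat (Suc t) + 1) = poly Q (of_nat (Suc t)) + of_nat (f (Suc t))" using Q[of "of_nat (Suc t)"] P[of "Suc t"] step by simp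
    then show ?case using step by (simp add: R_def poly_pcompose add.commute algebra_simps)
  qed
  then show ?thesis unfolding ev_poly_def eventually_sequentially by blast
qed

section \<open>Dickson's lemma and counting monomials\<close>

text \<open>A decreasing sequence of natural numbers is eventually constant, so a monotone
  subsequence always yields an increasing one.\<close>

lemma nat_seq_incseq_subseq:
  fixes f :: "nat \<Rightarrow> nat"
  obtains r :: "nat \<Rightarrow> nat" where "strict_mono r" "incseq (\<lambda>n. f (r n))"
proof -
  obtain r :: "nat \<Rightarrow> nat" where r: "strict_mono r" "monoseq (\<lambda>n. f (r n))" using seq_monosub[of f] by blast
  show ?thesis
  proof (cases "incseq (\<lambda>n. f (r n))")
    case True then show ?thesis using that r by blast
  next
    case False
    then have dec: "decseq (\<lambda>n. f (r n))" using r(2) by (simp add: monoseq_iff)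
    obtain N where N: "\<And>m. f (r N) \<le> f (r m)"
      using ex_has_least_nat[of "\<lambda>_. True" 0 "\<lambda>n. f (r n)"] by blast
    have c: "f (r (n + N)) = f (r N)" for n using N[of "n + N"] decseqD[OF dec, of N "n + N"] by simp
    have "incseq (\<lambda>n. f (r (n + N)))" unfolding c by (simp add: incseq_def)
    moreover have "strict_mono (\<lambda>n. r (n + N))" using r(1) by (simp add: strict_mono_def)
    ultimately show ?thesis using that[of "\<lambda>n. r (n + N)"] by blast
  qed
qed

text \<open>Dickson's lemma: a subsequence is extracted for one variable after the other.\<close>

lemma dickson_subseq:
  fixes f :: "nat \<Rightarrow> ('n \<Rightarrow>\<^sub>0 nat)"
  assumes "finite V"
  shows "\<exists>r :: nat \<Rightarrow> nat. strict_mono r \<and> (\<forall>x\<in>V. incseq (\<lambda>n. Poly_Mapping.lookup (f (r n)) x))"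
  using assms
proof (induction V rule: finite_induct)
  case empty
  then show ?case by (intro exI[of _ id]) (simp add: strict_mono_def)
next
  case (insert x V)
  then obtain r :: "nat \<Rightarrow> nat" where r: "strict_mono r" "\<And>y. y \<in> V \<Longrightarrow> incseq (\<lambda>n. Poly_Mapping.lookup (f (r n)) y)" by blast
  obtain s :: "nat \<Rightarrow> nat" where s: "strict_mono s" "incseq (\<lambda>n. Poly_Mapping.lookup (f (r (s n))) x)"
    by (rule nat_seq_incseq_subseq[of "\<lambda>n. Poly_Mapping.lookup (f (r n)) x"])
  have "strict_mono (\<lambda>n. r (s n))" using r(1) s(1) by (simp add: strict_mono_def)
  moreover have "incseq (\<lambda>n. Poly_Mapping.lookup (f (r (s n))) y)" if "y \<in> V" for y
    using r(2)[OF that] s(1) by (simp add: incseq_def strict_mono_less_eq)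
  ultimately show ?case using s(2) by blast
qed

lemma dickson_pair:
  fixes f :: "nat \<Rightarrow> ('n::finite \<Rightarrow>\<^sub>0 nat)"
  obtains i j c where "i < j" "f j = f i + c"
proof -
  obtain r :: "nat \<Rightarrow> nat" where r: "strict_mono r" "\<And>x. incseq (\<lambda>n. Poly_Mapping.lookup (f (r n)) x)"
    using dickson_subseq[of "UNIV :: 'n set" f] by auto
  have "Poly_Mapping.lookup (f (r 0)) x \<le> Poly_Mapping.lookup (f (r 1)) x" for x using incseqD[OF r(2)[of x], of 0 1] by simp
  then have "f (r 1) = f (r 0) + (f (r 1) - f (r 0))"
    by (intro poly_mapping_eqI) (simp add: lookup_add lookup_minus)
  then show ?thesis using that[of "r 0" "r 1"] strict_monoD[OF r(1), of 0 1] by simp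
qed

text \<open>The sets of monomials of the monomial ideals of k[V].\<close>

definition upset :: "'n set \<Rightarrow> ('n \<Rightarrow>\<^sub>0 nat) set \<Rightarrow> bool" where
  "upset V U \<longleftrightarrow> (\<forall>m\<in>U. Poly_Mapping.keys m \<subseteq> V \<and> (\<forall>c. Poly_Mapping.keys c \<subseteq> V \<longrightarrow> m + c \<in> U))"

definition graded_count :: "('n::finite \<Rightarrow>\<^sub>0 nat) set \<Rightarrow> nat \<Rightarrow> nat" where
  "graded_count U t = card {m \<in> U. monom_degree m = t}"

lemma lookup_le_monom_degree: "Poly_Mapping.lookup m i \<le> monom_degree m"
  unfolding monom_degree_def by (rule member_le_sum) auto

lemma finite_monom_degree: "finite {m :: 'n::finite \<Rightarrow>\<^sub>0 nat. monom_degree m = t}"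
proof (rule finite_subset)
  show "{m :: 'n \<Rightarrow>\<^sub>0 nat. monom_degree m = t} \<subseteq> box UNIV (Suc t)"
    using lookup_le_monom_degree by (auto simp: box_def less_Suc_eq_le)
  show "finite (box (UNIV :: 'n set) (Suc t))" using card_box[of "Suc t" "UNIV :: 'n set"] by simp
qed

text \<open>The coefficients of x^j in a monomial ideal of k[V, x]; they form monomial ideals of
  k[V] that increase with j.\<close>

definition slice :: "'n \<Rightarrow> 'n set \<Rightarrow> ('n \<Rightarrow>\<^sub>0 nat) set \<Rightarrow> nat \<Rightarrow> ('n \<Rightarrow>\<^sub>0 nat) set" where
  "slice x V U j = {m. Poly_Mapping.keys m \<subseteq> V \<and> m + Poly_Mapping.single x j \<in> U}"

lemma monom_degree_single: "monom_degree (Poly_Mapping.single x j) = j"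
  by (simp add: monom_degree_def lookup_single when_def)

lemma graded_count_slices:
  assumes x: "x \<notin> V" and U: "\<And>m. m \<in> U \<Longrightarrow> Poly_Mapping.keys m \<subseteq> insert x V"
  shows "graded_count U t = (\<Sum>j\<le>t. graded_count (slice x V U j) (t - j))"
proof -
  let ?A = "\<lambda>j. {m \<in> slice x V U j. monom_degree m = t - j}"
  have kx: "Poly_Mapping.lookup m x = 0" if "Poly_Mapping.keys m \<subseteq> V" for m :: "'a \<Rightarrow>\<^sub>0 nat"
    using that x by (auto simp: in_keys_iff)
  have "{m \<in> U. monom_degree m = t} = (\<Union>j\<le>t. (\<lambda>m. m + Poly_Mapping.single x j) ` ?A j)"
  proof (intro equalityI subsetI)
    fix m assume m: "m \<in> {m \<in> U. monom_degree m = t}"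
    define m' where "m' = Poly_Mapping.update x 0 m"
    let ?j = "Poly_Mapping.lookup m x"
    have e: "m = m' + Poly_Mapping.single x ?j"
      by (rule poly_mapping_eqI) (simp add: m'_def lookup_update lookup_add lookup_single when_def)
    have "Poly_Mapping.keys m' \<subseteq> V" using U[of m] m by (auto simp: m'_def keys_update)
    then have "m' \<in> slice x V U ?j" using m e by (simp add: slice_def)
    moreover have "monom_degree m = monom_degree m' + ?j" by (subst e) (simp add: monom_degree_add monom_degree_single)
    ultimately have "m' \<in> ?A ?j" "?j \<le> t" using m by auto
    then show "m \<in> (\<Union>j\<le>t. (\<lambda>m. m + Poly_Mapping.single x j) ` ?A j)" using e by auto
  next
    fix m assume "m \<in> (\<Union>j\<le>t. (\<lambda>m. m + Poly_Mapping.single x j) ` ?A j)"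
    then show "m \<in> {m \<in> U. monom_degree m = t}" by (auto simp: slice_def monom_degree_add monom_degree_single)
  qed
  then have "graded_count U t = card (\<Union>j\<le>t. (\<lambda>m. m + Poly_Mapping.single x j) ` ?A j)" by (simp add: graded_count_def)
  also have "\<dots> = (\<Sum>j\<le>t. card ((\<lambda>m. m + Poly_Mapping.single x j) ` ?A j))"
  proof (rule card_UN_disjoint)
    show "\<forall>j\<in>{..t}. finite ((\<lambda>m. m + Poly_Mapping.single x j) ` ?A j)"
      by (auto intro!: finite_imageI finite_subset[OF _ finite_monom_degree[of "t - _"]])
    show "\<forall>i\<in>{..t}. \<forall>j\<in>{..t}. i \<noteq> j \<longrightarrow> (\<lambda>m. m + Poly_Mapping.single x i) ` ?A i \<inter> (\<lambda>m. m + Poly_Mapping.single x j) ` ?A j = {}"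
    proof (intro ballI impI equals0I)
      fix i j m assume ij: "i \<noteq> j" and m: "m \<in> (\<lambda>m. m + Poly_Mapping.single x i) ` ?A i \<inter> (\<lambda>m. m + Poly_Mapping.single x j) ` ?A j"
      then obtain a b where ab: "a + Poly_Mapping.single x i = b + Poly_Mapping.single x j" "Poly_Mapping.keys a \<subseteq> V" "Poly_Mapping.keys b \<subseteq> V"
        by (auto simp: slice_def)
      have "Poly_Mapping.lookup (a + Poly_Mapping.single x i) x = Poly_Mapping.lookup (b + Poly_Mapping.single x j) x" using ab(1) by simp
      then show False using kx[OF ab(2)] kx[OF ab(3)] ij by (simp add: lookup_add)
    qed
  qed simp
  also have "\<dots> = (\<Sum>j\<le>t. graded_count (slice x V U j) (t - j))"
    by (intro sum.cong refl) (simp add: graded_count_def card_image inj_on_def)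
  finally show ?thesis .
qed

lemma upset_slice:
  fixes V :: "'n set"
  assumes U: "upset (insert x V) U"
  shows "upset V (slice x V U j)" "j \<le> k \<Longrightarrow> slice x V U j \<subseteq> slice x V U k"
proof -
  have up: "m + c \<in> U" if "m \<in> U" "Poly_Mapping.keys c \<subseteq> insert x V" for m c using U that by (auto simp: upset_def)
  show "upset V (slice x V U j)" unfolding upset_def
  proof (intro ballI conjI allI impI)
    fix m assume m: "m \<in> slice x V U j"
    then show "Poly_Mapping.keys m \<subseteq> V" by (simp add: slice_def)
    fix c :: "'n \<Rightarrow>\<^sub>0 nat" assume c: "Poly_Mapping.keys c \<subseteq> V"
    have "(m + Poly_Mapping.single x j) + c \<in> U" by (rule up) (use m c in \<open>auto simp: slice_def\<close>)
    then show "m + c \<in> slice x V U j" using m c by (simp add: slice_def keys_add_nat add_ac)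
  qed
  assume jk: "j \<le> k"
  show "slice x V U j \<subseteq> slice x V U k"
  proof
    fix m assume m: "m \<in> slice x V U j"
    have "(m + Poly_Mapping.single x j) + Poly_Mapping.single x (k - j) \<in> U" by (rule up) (use m in \<open>auto simp: slice_def\<close>)
    then show "m \<in> slice x V U k" using m jk by (simp add: slice_def add.assoc single_add[symmetric])
  qed
qed

text \<open>Ascending chain condition. Otherwise new monomials appear infinitely often; by Dickson's
  lemma one of them divides a later one, which was then not new.\<close>

lemma increasing_upsets_stabilize:
  fixes S :: "nat \<Rightarrow> ('n::finite \<Rightarrow>\<^sub>0 nat) set"
  assumes "\<And>j. upset V (S j)" "\<And>j k. j \<le> k \<Longrightarrow> S j \<subseteq> S k"
  obtains J where "\<forall>j\<ge>J. S j = S J"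
proof (rule ccontr)
  assume "\<not> thesis"
  then have n: "\<And>J. \<exists>j\<ge>J. S j \<noteq> S J" using that by blast
  have ex: "\<forall>J. \<exists>p. J < fst p \<and> snd p \<in> S (fst p) \<and> snd p \<notin> S J"
  proof
    fix J
    obtain j where j: "j \<ge> J" "S j \<noteq> S J" using n by blast
    then have "\<not> S j \<subseteq> S J" using assms(2)[OF j(1)] by blast
    then obtain m where "m \<in> S j" "m \<notin> S J" by blast
    moreover have "j \<noteq> J" using j by blast
    ultimately show "\<exists>p. J < fst p \<and> snd p \<in> S (fst p) \<and> snd p \<notin> S J"
      using j(1) by (intro exI[of _ "(j, m)"]) auto
  qed
  from choice[OF ex] obtain h where h: "\<forall>J. J < fst (h J) \<and> snd (h J) \<in> S (fst (h J)) \<and> snd (h J) \<notin> S J" ..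
  define nx where "nx = (\<lambda>J. fst (h J))"
  define g where "g = (\<lambda>J. snd (h J))"
  have ng: "\<And>J. J < nx J" "\<And>J. g J \<in> S (nx J)" "\<And>J. g J \<notin> S J" using h by (simp_all add: nx_def g_def)
  \<comment> \<open>Stages at which something new has appeared: \<open>g (s i)\<close> is missing at
    stage \<open>s i\<close> and present at stage \<open>s (Suc i)\<close>.\<close>
  define s where "s = (\<lambda>i. (nx ^^ i) 0)"
  have sS: "s (Suc i) = nx (s i)" for i by (simp add: s_def)
  have "strict_mono s" using ng(1) by (simp add: strict_mono_Suc_iff sS)
  obtain i j c where ij: "i < j" "g (s j) = g (s i) + c" by (rule dickson_pair[of "\<lambda>i. g (s i)"])
  have "Suc i \<le> j" using ij(1) by simp
  then have "s (Suc i) \<le> s j" using \<open>strict_mono s\<close> by (simp add: strict_mono_less_eq)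
  moreover have "g (s i) \<in> S (s (Suc i))" unfolding sS by (rule ng(2))
  ultimately have "g (s i) \<in> S (s j)" using assms(2)[of "s (Suc i)" "s j"] by auto
  moreover have "Poly_Mapping.keys c \<subseteq> V"
  proof -
    have "Poly_Mapping.keys (g (s j)) \<subseteq> V" using ng(2)[of "s j"] assms(1) by (auto simp: upset_def)
    then show ?thesis unfolding ij(2) keys_add_nat by blast
  qed
  ultimately have "g (s j) \<in> S (s j)" unfolding ij(2) using assms(1) by (auto simp: upset_def)
  then show False using ng(3) by blast
qed

text \<open>From some J on the slices by the exponent of x coincide. The count is thus a finite sum
  of shifted functions and the partial sums of a single one, all eventually polynomial by
  induction.\<close>

lemma ev_poly_graded_count:
  assumes "finite V" "upset V U" shows "ev_poly (graded_count U)"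
  using assms
proof (induction V arbitrary: U rule: finite_induct)
  case empty
  have "graded_count U t = 0" if "t \<ge> 1" for t
  proof -
    have "{m \<in> U. monom_degree m = t} = {}" using empty that by (auto simp: upset_def)
    then show ?thesis by (simp only: graded_count_def card.empty)
  qed
  then show ?case by (rule ev_poly_cong[OF ev_poly_0])
next
  case (insert x V)
  let ?S = "slice x V U"
  obtain J where J: "\<forall>j\<ge>J. ?S j = ?S J"
    by (rule increasing_upsets_stabilize[of V ?S, OF upset_slice[OF insert.prems]])
  have evS: "ev_poly (graded_count (?S j))" for j by (rule insert.IH[OF upset_slice(1)[OF insert.prems]])
  have ex: "graded_count U t = (\<Sum>j<J. graded_count (?S j) (t - j)) + (\<Sum>i\<le>t - J. graded_count (?S J) i)" if t: "t \<ge> J" for t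
  proof -
    have "graded_count U t = (\<Sum>j\<le>t. graded_count (?S j) (t - j))"
      using insert by (intro graded_count_slices) (auto simp: upset_def)
    also have "{..t} = {..<J} \<union> {J..t}" using t by auto
    also have "(\<Sum>j\<in>{..<J} \<union> {J..t}. graded_count (?S j) (t - j)) = (\<Sum>j<J. graded_count (?S j) (t - j)) + (\<Sum>j\<in>{J..t}. graded_count (?S j) (t - j))"
      by (rule sum.union_disjoint) auto
    also have "(\<Sum>j\<in>{J..t}. graded_count (?S j) (t - j)) = (\<Sum>j\<in>{J..t}. graded_count (?S J) (t - j))"
    proof (rule sum.cong[OF refl])
      fix j assume "j \<in> {J..t}"
      then have "?S j = ?S J" by (intro J[rule_format]) simp
      then show "graded_count (?S j) (t - j) = graded_count (?S J) (t - j)" by (rule arg_cong)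
    qed
    also have "\<dots> = (\<Sum>i\<le>t - J. graded_count (?S J) i)"
      by (rule sum.reindex_bij_witness[of _ "\<lambda>i. t - i" "\<lambda>j. t - j"]) (use t in auto)
    finally show ?thesis .
  qed
  have "ev_poly (\<lambda>t. (\<Sum>j<J. graded_count (?S j) (t - j)) + (\<Sum>i\<le>t - J. graded_count (?S J) i))"
    by (intro ev_poly_add ev_poly_sum ev_poly_shift evS ev_poly_shift[OF ev_poly_partial_sum[OF evS]])
  then show ?case by (rule ev_poly_cong) (rule ex)
qed

text \<open>The hockey-stick identity, applied with each added variable. No variables form a case of
  their own: there the count is 1 in degree 0 only.\<close>

lemma graded_count_all:
  assumes "finite V"
  shows "graded_count {m :: 'n::finite \<Rightarrow>\<^sub>0 nat. Poly_Mapping.keys m \<subseteq> V} t =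
    (if V = {} then (if t = 0 then 1 else 0) else (t + card V - 1) choose t)"
  using assms
proof (induction V arbitrary: t rule: finite_induct)
  case empty
  have "{m :: 'n \<Rightarrow>\<^sub>0 nat. Poly_Mapping.keys m \<subseteq> {} \<and> monom_degree m = t} = (if t = 0 then {0} else {})" by auto
  then show ?case by (simp add: graded_count_def)
next
  case (insert x V)
  have s: "slice x V {m. Poly_Mapping.keys m \<subseteq> insert x V} j = {m. Poly_Mapping.keys m \<subseteq> V}" for j
    by (auto simp: slice_def keys_add_nat)
  have "graded_count {m :: 'n \<Rightarrow>\<^sub>0 nat. Poly_Mapping.keys m \<subseteq> insert x V} t = (\<Sum>j\<le>t. graded_count {m :: 'n \<Rightarrow>\<^sub>0 nat. Poly_Mapping.keys m \<subseteq> V} (t - j))"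
    using graded_count_slices[OF insert.hyps(2), of "{m. Poly_Mapping.keys m \<subseteq> insert x V}" t] s by simp
  also have "\<dots> = (\<Sum>i\<le>t. graded_count {m :: 'n \<Rightarrow>\<^sub>0 nat. Poly_Mapping.keys m \<subseteq> V} i)"
    by (rule sum.reindex_bij_witness[of _ "\<lambda>i. t - i" "\<lambda>j. t - j"]) auto
  also have "\<dots> = (t + card (insert x V) - 1) choose t"
  proof (cases "V = {}")
    case True
    have "(\<Sum>i\<le>t. graded_count {m :: 'n \<Rightarrow>\<^sub>0 nat. Poly_Mapping.keys m \<subseteq> V} i) = (\<Sum>i\<le>t. if i = 0 then 1 else 0)"
      by (intro sum.cong refl, subst insert.IH) (simp add: True)
    then show ?thesis by (simp add: True)
  next
    case False
    then have c: "card V > 0" using insert by (simp add: card_gt_0_iff)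
    have "(\<Sum>i\<le>t. graded_count {m :: 'n \<Rightarrow>\<^sub>0 nat. Poly_Mapping.keys m \<subseteq> V} i) = (\<Sum>i\<le>t. (card V - 1 + i) choose i)"
      using c False by (intro sum.cong) (simp_all add: insert.IH add.commute)
    also have "\<dots> = Suc (card V - 1 + t) choose t" by (rule sum_choose_lower)
    also have "Suc (card V - 1 + t) = t + card (insert x V) - 1" using c insert by simp
    finally show ?thesis .
  qed
  finally show ?case by simp
qed

section \<open>Leading monomials and Hilbert functions\<close>

text \<open>The monomial order is the linear order on exponent vectors. It is compatible with
  addition, which makes the leading monomials of an ideal an upset.\<close>

definition lead_monom :: "('n::{finite,linorder}, 'k::zero) mpoly \<Rightarrow> 'n \<Rightarrow>\<^sub>0 nat" where
  "lead_monom p = Max (Poly_Mapping.keys p)"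

lemma lead_monom_in_keys: "p \<noteq> 0 \<Longrightarrow> lead_monom p \<in> Poly_Mapping.keys p"
  unfolding lead_monom_def by (rule Max_in) auto

lemma lead_monom_max: "m \<in> Poly_Mapping.keys p \<Longrightarrow> m \<le> lead_monom p"
  unfolding lead_monom_def by (rule Max_ge) auto

lemma lead_monom_eqI: "m \<in> Poly_Mapping.keys p \<Longrightarrow> (\<And>m'. m' \<in> Poly_Mapping.keys p \<Longrightarrow> m' \<le> m) \<Longrightarrow> lead_monom p = m"
  unfolding lead_monom_def by (rule Max_eqI) auto

lemma keys_single_mult:
  fixes p :: "('n::{finite,linorder}, 'k::field) mpoly"
  shows "Poly_Mapping.keys (Poly_Mapping.single m 1 * p) = (\<lambda>k. m + k) ` Poly_Mapping.keys p"
proof -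
  have "Poly_Mapping.lookup (Poly_Mapping.single m 1 * p) (m + k) = Poly_Mapping.lookup p k" for k
  proof -
    have "Poly_Mapping.single m 1 * p = (\<Sum>l\<in>Poly_Mapping.keys p. Poly_Mapping.single (m + l) (Poly_Mapping.lookup p l))"
      using arg_cong[OF poly_mapping_expand[of p], of "\<lambda>q. Poly_Mapping.single m 1 * q"]
      by (simp only: sum_distrib_left mult_single mult_1_left)
    then have "Poly_Mapping.lookup (Poly_Mapping.single m 1 * p) (m + k) =
      (\<Sum>l\<in>Poly_Mapping.keys p. if l = k then Poly_Mapping.lookup p l else 0)"
      by (simp add: lookup_sum lookup_single when_def)
    then show ?thesis by (simp add: in_keys_iff)
  qed
  then have "(\<lambda>k. m + k) ` Poly_Mapping.keys p \<subseteq> Poly_Mapping.keys (Poly_Mapping.single m 1 * p)"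
    by (auto simp: in_keys_iff)
  moreover have "Poly_Mapping.keys (Poly_Mapping.single m 1 * p) \<subseteq> (\<lambda>k. m + k) ` Poly_Mapping.keys p"
    using keys_mult[of "Poly_Mapping.single m 1" p] by auto
  ultimately show ?thesis by blast
qed

lemma lead_monom_single_mult:
  fixes p :: "('n::{finite,linorder}, 'k::field) mpoly"
  assumes "p \<noteq> 0" shows "lead_monom (Poly_Mapping.single m 1 * p) = m + lead_monom p"
  by (rule lead_monom_eqI) (use assms lead_monom_in_keys[OF assms] lead_monom_max[of _ p] in \<open>auto simp: keys_single_mult add_left_mono\<close>)

text \<open>Elimination at the largest monomial b: rank-nullity for the coefficient of b splits off
  the elements supported below b, and b is a leading monomial iff this coefficient is not
  identically zero on W.\<close>

lemma dim_eq_card_lead_monoms: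
  fixes W :: "('n::{finite,linorder}, 'k::field) mpoly set"
  assumes "finite B" "P.subspace W" "W \<subseteq> supported B"
  shows "P.dim W = card (lead_monom ` (W - {0}))"
  using assms
proof (induction B arbitrary: W rule: finite_linorder_max_induct)
  case empty
  then have "W = {0}" using P.subspace_0[OF empty(1)] by (auto simp: supported_def)
  then show ?case by (simp add: P_dim_0)
next
  case (insert b B)
  let ?W' = "{p \<in> W. Poly_Mapping.lookup p b = 0}"
  have fd: "fin_dim_wrt P.span W" using P.fin_dim_subset[OF conjunct1[OF dim_supported[of "insert b B"]] insert.prems(2)] insert.hyps by simp
  let ?f = "\<lambda>p::('n, 'k) mpoly. Poly_Mapping.single 0 (Poly_Mapping.lookup p b) :: ('n, 'k) mpoly"
  have l: "Vector_Spaces.linear scale_poly scale_poly ?f"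
    by (rule linear_PP_I) (simp_all add: lookup_add single_add lookup_const_mult mult_single)
  have k: "{p \<in> W. ?f p = 0} = ?W'"
  proof -
    have "(Poly_Mapping.single 0 c :: ('n, 'k) mpoly) = 0 \<longleftrightarrow> c = 0" for c :: 'k
      by (metis lookup_single_eq lookup_zero single_zero)
    then show ?thesis by simp
  qed
  have sW': "P.subspace ?W'" using insert.prems(1) by (simp add: subspace_P_iff lookup_add lookup_const_mult)
  have "?W' \<subseteq> supported B" using insert.prems(2) by (auto simp: supported_def in_keys_iff)
  then have IH: "P.dim ?W' = card (lead_monom ` (?W' - {0}))" by (rule insert.IH[OF sW'])
  have lmB: "lead_monom ` (?W' - {0}) \<subseteq> B"
  proof
    fix m assume "m \<in> lead_monom ` (?W' - {0})"
    then obtain p where p: "p \<in> W" "Poly_Mapping.lookup p b = 0" "m = lead_monom p" "p \<noteq> 0" by auto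
    then have "p \<in> supported B" using \<open>?W' \<subseteq> supported B\<close> by auto
    then show "m \<in> B" using lead_monom_in_keys[OF p(4)] p(3) by (auto simp: supported_def)
  qed
  have fin: "finite (lead_monom ` (?W' - {0}))" using finite_subset[OF lmB] insert.hyps by simp
  have rn: "P.dim W = P.dim (?f ` W) + P.dim ?W'" using PP.rank_nullity[OF l insert.prems(1) fd] k by simp
  show ?case
  proof (cases "W = ?W'")
    case True
    then have "Poly_Mapping.lookup p b = 0" if "p \<in> W" for p using that by blast
    then have "?f p = 0" if "p \<in> W" for p using that by simp
    then have "?f ` W = {0}" using P.subspace_0[OF insert.prems(1)] by (auto simp: image_iff)
    then show ?thesis using rn IH True P_dim_0 by simp
  next
    case False
    then obtain q where q: "q \<in> W" "Poly_Mapping.lookup q b \<noteq> 0" by blast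
    have "?f ` W = P.span {1}"
    proof (intro equalityI subsetI)
      fix r assume "r \<in> ?f ` W"
      then obtain c :: 'k where "r = Poly_Mapping.single 0 c * 1" by auto
      then show "r \<in> P.span {1}" using P.span_scale[OF P.span_base[of 1 "{1}"], of c] by simp
    next
      fix r :: "('n, 'k) mpoly" assume "r \<in> P.span {1}"
      then obtain c :: 'k where r: "r = Poly_Mapping.single 0 c * 1" by (auto simp: P.span_singleton)
      have "Poly_Mapping.single 0 (c / Poly_Mapping.lookup q b) * q \<in> W" using insert.prems(1) q(1) by (simp add: subspace_P_iff)
      moreover have "?f (Poly_Mapping.single 0 (c / Poly_Mapping.lookup q b) * q) = r" using q(2) r by (simp add: lookup_const_mult)
      ultimately show "r \<in> ?f ` W" by blast
    qed
    moreover have "P.dim (P.span {1 :: ('n, 'k) mpoly}) = 1"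
      using P.dim_eq_card_independent[of "{1 :: ('n, 'k) mpoly}"] by (simp add: P.dependent_single)
    moreover have "lead_monom ` (W - {0}) = insert b (lead_monom ` (?W' - {0}))"
    proof -
      have lb: "lead_monom p = b" if "p \<in> W" "Poly_Mapping.lookup p b \<noteq> 0" for p
      proof (rule lead_monom_eqI)
        show "b \<in> Poly_Mapping.keys p" using that by (simp add: in_keys_iff)
        fix m assume "m \<in> Poly_Mapping.keys p"
        then have "m \<in> insert b B" using that insert.prems(2) by (auto simp: supported_def)
        then show "m \<le> b" using insert.hyps by (auto intro: less_imp_le)
      qed
      have "lead_monom p \<in> insert b (lead_monom ` (?W' - {0}))" if "p \<in> W - {0}" for p
        using that lb[of p] by (cases "Poly_Mapping.lookup p b = 0") auto
      moreover have "b \<in> lead_monom ` (W - {0})" using lb[OF q] q by (intro image_eqI[of _ _ q]) auto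
      ultimately show ?thesis by blast
    qed
    moreover have "b \<notin> lead_monom ` (?W' - {0})" using lmB insert.hyps by auto
    ultimately show ?thesis using rn IH fin by simp
  qed
qed

abbreviation homog :: "int \<Rightarrow> ('n::{finite,linorder}, 'k::field) mpoly set" where
  "homog t \<equiv> {p. homogeneous t p}"

lemma homog_supported: "homog t = supported {m. int (monom_degree m) = t}"
  by (auto simp: homogeneous_def supported_def)

lemma finite_int_monom_degree: "finite {m :: 'n::finite \<Rightarrow>\<^sub>0 nat. int (monom_degree m) = t}"
  by (rule finite_subset[OF _ finite_monom_degree[of "nat t"]]) auto

lemma subspace_homog: "P.subspace (homog t)"
  unfolding homog_supported by (rule subspace_supported)

lemma fin_dim_homog: "fin_dim_wrt P.span (homog t)"
  unfolding homog_supported using dim_supported[OF finite_int_monom_degree] by blast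

lemma subspace_ideal_part:
  fixes I :: "('n::{finite,linorder}, 'k::field) mpoly set"
  shows "is_ideal I \<Longrightarrow> P.subspace {p \<in> I. homogeneous t p}"
  using P.subspace_inter[OF is_ideal_subspace subspace_homog, of I t] by (simp add: Int_def)

lemma fin_dim_ideal_part:
  fixes I :: "('n::{finite,linorder}, 'k::field) mpoly set"
  shows "fin_dim_wrt P.span {p \<in> I. homogeneous t p}"
  by (rule P.fin_dim_subset[OF fin_dim_homog]) auto

definition lead_set :: "('n::{finite,linorder}, 'k::field) mpoly set \<Rightarrow> ('n \<Rightarrow>\<^sub>0 nat) set" where
  "lead_set I = {lead_monom p | p. p \<in> I \<and> p \<noteq> 0 \<and> (\<exists>t. homogeneous t p)}"

lemma dim_ideal_part:
  assumes "is_ideal I"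
  shows "P.dim {p \<in> I. homogeneous (int t) p} = graded_count (lead_set I) t"
proof -
  let ?W = "{p \<in> I. homogeneous (int t) p}"
  have "P.dim ?W = card (lead_monom ` (?W - {0}))"
    by (rule dim_eq_card_lead_monoms[OF finite_int_monom_degree[of "int t"] subspace_ideal_part[OF assms]])
      (auto simp: supported_def homogeneous_def)
  also have "lead_monom ` (?W - {0}) = {m \<in> lead_set I. monom_degree m = t}"
  proof (intro equalityI subsetI)
    fix m assume "m \<in> lead_monom ` (?W - {0})"
    then obtain p where p: "p \<in> I" "homogeneous (int t) p" "p \<noteq> 0" "m = lead_monom p" by blast
    then have "monom_degree m = t" using lead_monom_in_keys[OF p(3)] by (auto simp: homogeneous_def)
    then show "m \<in> {m \<in> lead_set I. monom_degree m = t}" using p unfolding lead_set_def by blast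
  next
    fix m assume m: "m \<in> {m \<in> lead_set I. monom_degree m = t}"
    then obtain p s where p: "p \<in> I" "homogeneous s p" "p \<noteq> 0" "m = lead_monom p" unfolding lead_set_def by blast
    then have "s = int t" using lead_monom_in_keys[OF p(3)] m by (auto simp: homogeneous_def)
    then show "m \<in> lead_monom ` (?W - {0})" using p by blast
  qed
  finally show ?thesis by (simp add: graded_count_def)
qed

lemma dim_homog:
  "P.dim (homog (int t) :: ('n::{finite,linorder}, 'k::field) mpoly set) = graded_count {m :: 'n \<Rightarrow>\<^sub>0 nat. Poly_Mapping.keys m \<subseteq> UNIV} t"
  unfolding homog_supported conjunct2[OF dim_supported[OF finite_int_monom_degree]] by (simp add: graded_count_def)

lemma upset_lead_set:
  assumes "is_ideal I" shows "upset UNIV (lead_set I)"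
  unfolding upset_def
proof (intro ballI conjI allI impI subset_UNIV)
  fix m c assume "m \<in> lead_set I"
  then obtain p s where p: "p \<in> I" "homogeneous s p" "p \<noteq> 0" "m = lead_monom p" unfolding lead_set_def by blast
  let ?q = "Poly_Mapping.single c 1 * p"
  have "?q \<in> I" using is_idealD(3)[OF assms p(1)] .
  moreover have "homogeneous (int (monom_degree c) + s) ?q" by (rule homogeneous_mult[OF homogeneous_single p(2)])
  moreover have "?q \<noteq> 0" using p(3) by (metis keys_eq_empty keys_single_mult image_is_empty keys_zero)
  moreover have "lead_monom ?q = m + c" using lead_monom_single_mult[OF p(3)] p(4) by (simp add: add.commute)
  ultimately show "m + c \<in> lead_set I" unfolding lead_set_def by (metis (mono_tags, lifting) mem_Collect_eq)
qed

text \<open>Macaulay's theorem: an ideal and its leading monomials have the same dimension in each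
  degree, which reduces the claim to counting an upset.\<close>

lemma hilbert_polynomial_exists:
  fixes I :: "('n::{finite,linorder}, 'k::field) mpoly set"
  assumes "is_ideal I" shows "ev_poly (hilbert_function I)"
proof -
  define N where "N = graded_count {m :: 'n \<Rightarrow>\<^sub>0 nat. Poly_Mapping.keys m \<subseteq> UNIV}"
  define L where "L = graded_count (lead_set I)"
  have h: "hilbert_function I = (\<lambda>t. N t - L t)"
    unfolding hilbert_function_def N_def L_def by (simp only: dim_homog dim_ideal_part[OF assms])
  have le: "L t \<le> N t" for t
    unfolding N_def L_def graded_count_def by (rule card_mono) (auto simp: finite_monom_degree)
  have "ev_poly N" unfolding N_def by (rule ev_poly_graded_count[of UNIV]) (auto simp: upset_def)
  moreover have "ev_poly L" unfolding L_def
    by (rule ev_poly_graded_count[OF finite_class.finite_UNIV upset_lead_set[OF assms]])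
  ultimately show ?thesis unfolding h using le by (rule ev_poly_diff)
qed

text \<open>B consists of the minimal monomials for divisibility; by Dickson's lemma they cannot be
  infinitely many.\<close>

lemma upset_finitely_generated:
  fixes U :: "('n::finite \<Rightarrow>\<^sub>0 nat) set"
  assumes "upset UNIV U"
  obtains B where "finite B" "B \<subseteq> U" "\<And>m. m \<in> U \<Longrightarrow> \<exists>b\<in>B. \<exists>c. m = b + c"
proof -
  define B where "B = {m \<in> U. \<forall>b\<in>U. \<forall>c. m = b + c \<longrightarrow> c = 0}"
  have "finite B"
  proof (rule ccontr)
    assume "infinite B"
    then obtain g :: "nat \<Rightarrow> 'n \<Rightarrow>\<^sub>0 nat" where g: "inj g" "range g \<subseteq> B" using infinite_countable_subset by blast
    obtain i j c where ij: "i < j" "g j = g i + c" by (rule dickson_pair[of g])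
    have "g i \<in> U" "g j \<in> B" using g unfolding B_def by auto
    then have "c = 0" using ij unfolding B_def by blast
    then have "g j = g i" using ij by simp
    then show False using g(1) ij(1) by (simp add: inj_eq)
  qed
  moreover have "\<exists>b\<in>B. \<exists>c. m = b + c" if "m \<in> U" for m using that
  proof (induction "monom_degree m" arbitrary: m rule: less_induct)
    case less
    show ?case
    proof (cases "m \<in> B")
      case True then show ?thesis by (intro bexI[of _ m] exI[of _ 0]) auto
    next
      case False
      then obtain b c where b: "b \<in> U" "m = b + c" "c \<noteq> 0" using less unfolding B_def by blast
      then have "monom_degree b < monom_degree m" using monom_degree_eq_0[of c] by (simp add: monom_degree_add)
      then obtain b' c' where "b' \<in> B" "b = b' + c'" using less.hyps b(1) by blast
      then show ?thesis using b by (intro bexI[of _ b'] exI[of _ "c' + c"]) (auto simp: add.assoc)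
    qed
  qed
  ultimately show ?thesis using that[of B] unfolding B_def by blast
qed

text \<open>Hilbert's basis theorem. Elements whose leading monomials generate all leading monomials
  span an ideal with the same leading monomials, which then has the same dimension in every degree
  as I.\<close>

lemma homogeneous_ideal_finitely_generated:
  fixes I :: "('n::{finite,linorder}, 'k::field) mpoly set"
  assumes I: "is_ideal I" and hI: "\<And>p t. p \<in> I \<Longrightarrow> hcomp t p \<in> I"
  obtains G where "finite G" "G \<subseteq> I" "\<And>g. g \<in> G \<Longrightarrow> \<exists>t. homogeneous t g" "I = ideal_span G"
proof -
  obtain B where B: "finite B" "B \<subseteq> lead_set I" "\<And>m. m \<in> lead_set I \<Longrightarrow> \<exists>b\<in>B. \<exists>c. m = b + c"
    using upset_finitely_generated[OF upset_lead_set[OF I]] by metis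
  have "\<forall>b\<in>B. \<exists>p. p \<in> I \<and> p \<noteq> 0 \<and> (\<exists>t. homogeneous t p) \<and> b = lead_monom p" using B(2) unfolding lead_set_def by blast
  then obtain g where g: "\<And>b. b \<in> B \<Longrightarrow> g b \<in> I \<and> g b \<noteq> 0 \<and> (\<exists>t. homogeneous t (g b)) \<and> b = lead_monom (g b)" by metis
  let ?J = "ideal_span (g ` B)"
  have J: "is_ideal ?J" by (rule is_ideal_span)
  have JI: "?J \<subseteq> I" using g by (intro ideal_span_least[OF _ I]) auto
  have gJ: "g b \<in> ?J" if "b \<in> B" for b using ideal_span_superset that by blast
  have "B \<subseteq> lead_set ?J" using g gJ unfolding lead_set_def by blast
  then have "lead_set I \<subseteq> lead_set ?J" using B(3) upset_lead_set[OF J] unfolding upset_def by blast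
  then have "graded_count (lead_set I) t \<le> graded_count (lead_set ?J) t" for t
    unfolding graded_count_def by (intro card_mono) (auto intro: finite_subset[OF _ finite_monom_degree[of t]])
  then have le: "P.dim {p \<in> I. homogeneous (int t) p} \<le> P.dim {p \<in> ?J. homogeneous (int t) p}" for t
    by (simp add: dim_ideal_part I J)
  have part: "{p \<in> I. homogeneous (int t) p} \<subseteq> ?J" for t
  proof (rule ccontr)
    let ?W = "{p \<in> I. homogeneous (int t) p}" and ?V = "{p \<in> ?J. homogeneous (int t) p}"
    assume "\<not> ?W \<subseteq> ?J"
    then obtain x where x: "x \<in> ?W" "x \<notin> ?V" by blast
    obtain A where A: "A \<subseteq> ?V" "P.independent A" "?V \<subseteq> P.span A" "card A = P.dim ?V" "finite A"
      by (rule P.fin_dim_basis[OF fin_dim_ideal_part])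
    have "P.span A \<subseteq> ?V" using A(1) by (rule P.span_minimal[OF _ subspace_ideal_part[OF J]])
    then have "x \<notin> P.span A" using x by blast
    then have ind: "P.independent (insert x A)" and "x \<notin> A" using A(2) P.span_base by (auto simp: P.independent_insert)
    have "insert x A \<subseteq> ?W" using x A(1) JI by blast
    then have "P.dim (insert x A) \<le> P.dim ?W" by (rule P.dim_mono_fin_dim[OF fin_dim_ideal_part])
    moreover have "P.dim (insert x A) = Suc (P.dim ?V)" using P.dim_eq_card_independent[OF ind] A \<open>x \<notin> A\<close> by simp
    ultimately show False using le[of t] by simp
  qed
  have "I \<subseteq> ?J"
  proof
    fix p assume p: "p \<in> I"
    have "hcomp t p \<in> ?J" if "t \<in> {0..int (total_degree p)}" for t
      using part[of "nat t"] hI[OF p, of t] homogeneous_hcomp[of t p] that by (auto simp del: homogeneous_hcomp)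
    then have "(\<Sum>t\<in>{0..int (total_degree p)}. hcomp t p) \<in> ?J" by (intro is_ideal_sum[OF J])
    then show "p \<in> ?J" using hcomp_expand[of p] by simp
  qed
  then have "I = ?J" using JI by blast
  then show ?thesis using that[of "g ` B"] B g by blast
qed

section \<open>Multiplicities of complete intersections\<close>

lemma poly_eventually_ge_lead_coeff:
  fixes p :: "rat poly"
  assumes "lead_coeff p > 0" shows "\<exists>N. \<forall>x\<ge>N. lead_coeff p \<le> poly p x"
  using assms
proof (induction p)
  case (pCons a q)
  show ?case
  proof (cases "q = 0")
    case True
    then show ?thesis by simp
  next
    case False
    then have l: "lead_coeff q > 0" and e: "lead_coeff (pCons a q) = lead_coeff q" using pCons.prems by simp_all
    obtain N where N: "\<And>x. x \<ge> N \<Longrightarrow> lead_coeff q \<le> poly q x" using pCons.IH[OF l] by blast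
    define l' where "l' = lead_coeff q"
    have l': "l' > 0" using l by (simp add: l'_def)
    \<comment> \<open>Beyond B, x times the value of q is at least l' + |a|, which absorbs the
      constant term a.\<close>
    define B where "B = max N (1 + \<bar>a\<bar> / l')"
    have "l' \<le> poly (pCons a q) x" if x: "x \<ge> B" for x
    proof -
      have x1: "x \<ge> N" "x \<ge> 1 + \<bar>a\<bar> / l'" using x by (simp_all add: B_def)
      have xp: "x \<ge> 0" using x1(2) l' by (meson abs_ge_zero add_nonneg_nonneg divide_nonneg_pos order_trans zero_le_one)
      have "(1 + \<bar>a\<bar> / l') * l' \<le> x * l'" using x1(2) l' by (intro mult_right_mono) simp_all
      moreover have "(1 + \<bar>a\<bar> / l') * l' = l' + \<bar>a\<bar>" using l' by (simp add: distrib_right)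
      ultimately have "l' + \<bar>a\<bar> \<le> x * l'" by simp
      also have "\<dots> \<le> x * poly q x" using N[OF x1(1)] xp by (intro mult_left_mono) (simp_all add: l'_def)
      finally show ?thesis by simp
    qed
    then show ?thesis unfolding e l'_def by (intro exI[of _ B]) simp
  qed
qed simp

lemma lead_coeff_nonneg_of_eventually:
  fixes r :: "rat poly"
  assumes "\<forall>\<^sub>F t in sequentially. poly r (of_nat t) \<ge> 0"
  shows "lead_coeff r \<ge> 0"
proof (rule ccontr)
  assume "\<not> ?thesis"
  then have "lead_coeff (- r) > 0" by simp
  then obtain N where N: "\<And>x. x \<ge> N \<Longrightarrow> lead_coeff (- r) \<le> poly (- r) x" using poly_eventually_ge_lead_coeff by blast
  obtain T where T: "\<And>t. t \<ge> T \<Longrightarrow> poly r (of_nat t) \<ge> 0" using assms unfolding eventually_sequentially by blast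
  obtain m :: nat where m: "N \<le> of_nat m" using reals_Archimedean2[of N] by (meson less_imp_le)
  define t where "t = max T m"
  have "N \<le> of_nat t" using order_trans[OF m, of "of_nat t"] by (simp add: t_def)
  then have "lead_coeff (- r) \<le> - poly r (of_nat t)" using N[of "of_nat t"] by simp
  moreover have "poly r (of_nat t) \<ge> 0" by (rule T) (simp add: t_def)
  ultimately show False using \<open>lead_coeff (- r) > 0\<close> by linarith
qed

lemma coeff_nonneg_of_eventually:
  fixes r :: "rat poly"
  assumes "\<forall>\<^sub>F t in sequentially. poly r (of_nat t) \<ge> 0" "Polynomial.degree r \<le> k"
  shows "coeff r k \<ge> 0"
proof (cases "Polynomial.degree r = k")
  case True then show ?thesis using lead_coeff_nonneg_of_eventually[OF assms(1)] by simp
next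
  case False then show ?thesis using assms(2) by (simp add: coeff_eq_0)
qed

text \<open>The Hilbert polynomial of a polynomial ring in \<open>k + 1\<close> variables.\<close>

definition binom_poly :: "nat \<Rightarrow> rat poly" where
  "binom_poly k = Polynomial.smult (1 / fact k) (\<Prod>i<k. [:of_nat k - of_nat i, 1:])"

lemma poly_binom_poly: "poly (binom_poly k) x = (x + of_nat k) gchoose k"
  by (simp add: binom_poly_def gbinomial_prod_rev poly_prod atLeast0LessThan algebra_simps)

lemma degree_binom_poly: "Polynomial.degree (binom_poly k) = k" "lead_coeff (binom_poly k) = 1 / fact k"
proof -
  let ?p = "\<Prod>i<k. [:of_nat k - of_nat i, 1 :: rat:]"
  have "Polynomial.degree ?p = (\<Sum>i<k. Polynomial.degree [:of_nat k - of_nat i, 1 :: rat:])"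
    by (rule degree_prod_sum_eq) simp
  then have d: "Polynomial.degree ?p = k" by simp
  have l: "lead_coeff ?p = 1" by (simp add: lead_coeff_prod)
  show "Polynomial.degree (binom_poly k) = k" by (simp add: binom_poly_def d)
  then show "lead_coeff (binom_poly k) = 1 / fact k" using l d by (simp add: binom_poly_def)
qed

lemma binom_poly_diff:
  "poly (binom_poly (Suc k)) x - poly (binom_poly (Suc k)) (x - 1) = poly (binom_poly k) x"
proof -
  have "(x + of_nat k + 1) gchoose Suc k = ((x + of_nat k) gchoose k) + ((x + of_nat k) gchoose Suc k)"
    by (rule gbinomial_Suc_Suc)
  moreover have "x + of_nat (Suc k) = x + of_nat k + 1" "x - 1 + of_nat (Suc k) = x + of_nat k" by simp_all
  ultimately show ?thesis unfolding poly_binom_poly by (simp only: add_diff_cancel_right')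
qed

lemma binom_poly_diff_n:
  "poly (binom_poly (Suc k)) x - poly (binom_poly (Suc k)) (x - of_nat e) = (\<Sum>i<e. poly (binom_poly k) (x - of_nat i))"
proof (induction e)
  case (Suc e)
  have "poly (binom_poly (Suc k)) (x - of_nat e) - poly (binom_poly (Suc k)) (x - of_nat e - 1) = poly (binom_poly k) (x - of_nat e)"
    by (rule binom_poly_diff)
  then show ?case using Suc by (simp add: algebra_simps)
qed simp

text \<open>The Hilbert polynomial of a complete intersection of two forms of degree e in k + 3
  variables, i.e. the second difference with step e of \<open>binom_poly (k + 2)\<close>. The double
  sum makes the bound k for the degree and the coefficient e^2/k! visible.\<close>

definition ci_poly :: "nat \<Rightarrow> nat \<Rightarrow> rat poly" where
  "ci_poly k e = (\<Sum>i<e. \<Sum>j<e. binom_poly k \<circ>\<^sub>p [:- of_nat (i + j), 1:])"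

lemma poly_ci_poly:
  "poly (ci_poly k e) x = poly (binom_poly (k + 2)) x - 2 * poly (binom_poly (k + 2)) (x - of_nat e) + poly (binom_poly (k + 2)) (x - of_nat (2 * e))"
proof -
  have "poly (ci_poly k e) x = (\<Sum>i<e. \<Sum>j<e. poly (binom_poly k) (x - of_nat i - of_nat j))"
    by (simp add: ci_poly_def poly_sum poly_pcompose algebra_simps)
  also have "\<dots> = (\<Sum>i<e. poly (binom_poly (Suc k)) (x - of_nat i) - poly (binom_poly (Suc k)) ((x - of_nat e) - of_nat i))"
  proof (intro sum.cong refl)
    fix i
    have "(\<Sum>j<e. poly (binom_poly k) (x - of_nat i - of_nat j)) = poly (binom_poly (Suc k)) (x - of_nat i) - poly (binom_poly (Suc k)) (x - of_nat i - of_nat e)"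
      by (rule binom_poly_diff_n[symmetric])
    moreover have "x - of_nat i - of_nat e = x - of_nat e - of_nat i" by simp
    ultimately show "(\<Sum>j<e. poly (binom_poly k) (x - of_nat i - of_nat j)) = poly (binom_poly (Suc k)) (x - of_nat i) - poly (binom_poly (Suc k)) (x - of_nat e - of_nat i)" by simp
  qed
  also have "\<dots> = (\<Sum>i<e. poly (binom_poly (Suc k)) (x - of_nat i)) - (\<Sum>i<e. poly (binom_poly (Suc k)) ((x - of_nat e) - of_nat i))"
    by (rule sum_subtractf)
  also have "\<dots> = (poly (binom_poly (Suc (Suc k))) x - poly (binom_poly (Suc (Suc k))) (x - of_nat e)) -
      (poly (binom_poly (Suc (Suc k))) (x - of_nat e) - poly (binom_poly (Suc (Suc k))) ((x - of_nat e) - of_nat e))"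
    by (simp only: binom_poly_diff_n)
  finally show ?thesis by (simp add: algebra_simps)
qed

lemma degree_shift_binom_poly:
  "Polynomial.degree (binom_poly k \<circ>\<^sub>p [:- of_nat j, 1:]) \<le> k" "coeff (binom_poly k \<circ>\<^sub>p [:- of_nat j, 1:]) k = 1 / fact k"
proof -
  have d: "Polynomial.degree (binom_poly k \<circ>\<^sub>p [:- of_nat j, 1:]) = k"
    by (simp add: degree_pcompose degree_binom_poly)
  then show "Polynomial.degree (binom_poly k \<circ>\<^sub>p [:- of_nat j, 1:]) \<le> k" by simp
  have "lead_coeff (binom_poly k \<circ>\<^sub>p [:- of_nat j, 1:]) = lead_coeff (binom_poly k) * lead_coeff [:- of_nat j, 1:] ^ Polynomial.degree (binom_poly k)"
    by (rule lead_coeff_comp) simp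
  then show "coeff (binom_poly k \<circ>\<^sub>p [:- of_nat j, 1:]) k = 1 / fact k" unfolding d degree_binom_poly by (simp add: degree_binom_poly[unfolded degree_binom_poly(1)])
qed

lemma degree_ci_poly: "Polynomial.degree (ci_poly k e) \<le> k" "coeff (ci_poly k e) k = of_nat (e ^ 2) / fact k"
proof -
  show "Polynomial.degree (ci_poly k e) \<le> k" unfolding ci_poly_def
    by (intro degree_sum_le degree_shift_binom_poly) simp_all
  have "coeff (ci_poly k e) k = (\<Sum>i<e. \<Sum>j<e. 1 / fact k)"
    unfolding ci_poly_def coeff_sum degree_shift_binom_poly(2) by (rule refl)
  then show "coeff (ci_poly k e) k = of_nat (e ^ 2) / fact k" by (simp add: power2_eq_square)
qed

section \<open>Hilbert polynomials and multiplicities\<close>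

lemma hilbert_polynomial_eqI:
  assumes "\<forall>\<^sub>F t in sequentially. poly P (of_nat t) = of_nat (hilbert_function I t)"
  shows "hilbert_polynomial I = P"
  unfolding hilbert_polynomial_def
proof (rule the_equality[where a = P])
  show "\<forall>\<^sub>F t in sequentially. poly P (of_nat t) = of_nat (hilbert_function I t)" by (rule assms)
next
  fix Q :: "rat poly" assume "\<forall>\<^sub>F t in sequentially. poly Q (of_nat t) = of_nat (hilbert_function I t)"
  then have "\<forall>\<^sub>F t in sequentially. poly Q (of_nat t) = poly P (of_nat t)" using assms by eventually_elim simp
  then obtain T where T: "\<And>t. t \<ge> T \<Longrightarrow> poly (Q - P) (of_nat t) = 0" unfolding eventually_sequentially by auto
  have "infinite (of_nat ` {T..} :: rat set)" by (subst finite_image_iff) (simp_all add: inj_on_def infinite_Ici)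
  moreover have "of_nat ` {T..} \<subseteq> {x. poly (Q - P) x = 0}" using T by auto
  ultimately have "infinite {x. poly (Q - P) x = 0}" using finite_subset by blast
  then have "Q - P = 0" using poly_roots_finite by blast
  then show "Q = P" by simp
qed

lemma dim_homog_choose:
  "P.dim (homog (int t) :: ('n::{finite,linorder}, 'k::field) mpoly set) = (t + CARD('n) - 1) choose t"
  unfolding dim_homog using graded_count_all[of "UNIV :: 'n set" t] by simp

lemma choose_binom_poly:
  assumes "v \<ge> 1" shows "of_nat ((t + v - 1) choose t) = poly (binom_poly (v - 1)) (of_nat t)"
proof -
  have "(t + v - 1) choose t = (t + (v - 1)) choose (v - 1)"
    using assms binomial_symmetric[of t "t + v - 1"] by simp
  then show ?thesis by (simp add: poly_binom_poly binomial_gbinomial)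
qed

lemma dim_homog_poly:
  assumes "t \<ge> 0" "CARD('n) \<ge> 3"
  shows "of_nat (P.dim (homog t :: ('n::{finite,linorder}, 'k::field) mpoly set)) = poly (binom_poly ((CARD('n) - 3) + 2)) (of_int t)"
proof -
  obtain m where m: "t = int m" using assms(1) nonneg_int_cases by blast
  have "CARD('n) - 1 = (CARD('n) - 3) + 2" using assms by simp
  then show ?thesis unfolding m dim_homog_choose using choose_binom_poly[of "CARD('n)" m] assms by simp
qed

text \<open>For t \<ge> 2 e all the twists have nonnegative degree, where \<open>binom_poly\<close>
  gives the dimensions. As e > 0, the coefficient e^2/k! at k = n - 3 is the leading one, and k!
  times it is the multiplicity.\<close>

lemma multiplicity_of_ci_hilbert_function:
  fixes I :: "('n::{finite,linorder}, 'k::field) mpoly set"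
  assumes n: "CARD('n) \<ge> 3" and e: "e > 0"
    and h: "\<And>t. t \<ge> 2 * e \<Longrightarrow> P.dim {p \<in> I. homogeneous (int t) p} + P.dim (homog (int t - 2 * int e) :: ('n, 'k) mpoly set) = 2 * P.dim (homog (int t - int e) :: ('n, 'k) mpoly set)"
  shows "\<forall>\<^sub>F t in sequentially. poly (ci_poly (CARD('n) - 3) e) (of_nat t) = of_nat (hilbert_function I t)"
    "ideal_multiplicity I = of_nat (e ^ 2)"
proof -
  let ?k = "CARD('n) - 3"
  let ?N = "\<lambda>t. P.dim (homog t :: ('n, 'k) mpoly set)"
  have "poly (ci_poly ?k e) (of_nat t) = of_nat (hilbert_function I t)" if t: "t \<ge> 2 * e" for t
  proof -
    have N: "poly (binom_poly (?k + 2)) (of_nat t) = of_nat (?N (int t))"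
      "poly (binom_poly (?k + 2)) (of_nat t - of_nat e) = of_nat (?N (int t - int e))"
      "poly (binom_poly (?k + 2)) (of_nat t - of_nat (2 * e)) = of_nat (?N (int t - 2 * int e))"
      using dim_homog_poly[where 'n = 'n and 'k = 'k, of "int t"] dim_homog_poly[where 'n = 'n and 'k = 'k, of "int t - int e"]
        dim_homog_poly[where 'n = 'n and 'k = 'k, of "int t - 2 * int e"] t n by simp_all
    have le: "P.dim {p \<in> I. homogeneous (int t) p} \<le> ?N (int t)"
      by (rule P.dim_mono_fin_dim[OF fin_dim_homog]) auto
    have "rat_of_nat (P.dim {p \<in> I. homogeneous (int t) p}) + of_nat (?N (int t - 2 * int e)) = 2 * of_nat (?N (int t - int e))"
      using arg_cong[OF h[OF t], of rat_of_nat] by simp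
    then show ?thesis unfolding poly_ci_poly N hilbert_function_def by (simp add: of_nat_diff[OF le])
  qed
  then show ev: "\<forall>\<^sub>F t in sequentially. poly (ci_poly ?k e) (of_nat t) = of_nat (hilbert_function I t)"
    unfolding eventually_sequentially by blast
  have P: "hilbert_polynomial I = ci_poly ?k e" by (rule hilbert_polynomial_eqI[OF ev])
  have c: "coeff (ci_poly ?k e) ?k \<noteq> 0" using e by (simp add: degree_ci_poly)
  then have d: "Polynomial.degree (ci_poly ?k e) = ?k" using degree_ci_poly(1)[of ?k e] le_degree[OF c] by simp
  have "ci_poly ?k e \<noteq> 0" using c by auto
  then show "ideal_multiplicity I = of_nat (e ^ 2)"
    unfolding ideal_multiplicity_def P Let_def d degree_ci_poly(2) by simp
qed

text \<open>The sum map on pairs from A and B is injective because A and B meet only in 0.\<close>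

lemma dim_sum_le:
  fixes A B W :: "('n, 'k::field) mpoly set"
  assumes W: "fin_dim_wrt P.span W" "P.subspace W" and A: "P.subspace A" "A \<subseteq> W" and B: "P.subspace B" "B \<subseteq> W"
    and d: "A \<inter> B \<subseteq> {0}"
  shows "P.dim A + P.dim B \<le> P.dim W"
proof -
  define U where "U = (\<lambda>i::nat. if i = 0 then A else B)"
  let ?f = "\<lambda>w::nat \<Rightarrow> ('n, 'k) mpoly. w 0 + w 1"
  have U: "P.subspace (U i)" "fin_dim_wrt P.span (U i)" for i
    using A B P.fin_dim_subset[OF W(1)] by (simp_all add: U_def)
  have l: "Vector_Spaces.linear scale_vec scale_poly ?f"
    by (rule linear_FP_I) (simp_all add: algebra_simps)
  have s: "F.subspace (tuples 2 U)" by (rule subspace_tuples) (rule U)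
  have f: "fin_dim_wrt F.span (tuples 2 U)" by (rule fin_dim_tuples) (rule U)+
  have inj: "w = 0" if w: "w \<in> tuples 2 U" "?f w = 0" for w
  proof -
    have t: "\<forall>i<2. w i \<in> U i" "\<forall>i\<ge>2. w i = 0" using w(1) by (simp_all add: tuples_def)
    have w01: "w 0 \<in> A" "w 1 \<in> B" "\<And>i. i \<ge> 2 \<Longrightarrow> w i = 0"
      using t(1)[rule_format, of 0] t(1)[rule_format, of 1] t(2) by (simp_all add: U_def)
    have e: "w 0 = - w 1" using w(2) by (simp add: eq_neg_iff_add_eq_0)
    have "w 0 \<in> B" unfolding e by (rule P.subspace_neg[OF B(1) w01(2)])
    then have "w 0 = 0" using d w01(1) by auto
    moreover then have "w 1 = 0" using e by simp
    ultimately show ?thesis using w01(3) by (intro ext) (metis One_nat_def less_2_cases not_less zero_fun_def)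
  qed
  have "P.dim (?f ` tuples 2 U) = F.dim (tuples 2 U)" by (rule FP.dim_image_inj[OF l s f inj])
  also have "\<dots> = (\<Sum>i<2. P.dim (U i))" by (rule dim_tuples) (rule U)+
  also have "\<dots> = P.dim A + P.dim B" by (simp add: U_def numeral_2_eq_2)
  finally have "P.dim A + P.dim B = P.dim (?f ` tuples 2 U)" by simp
  also have "?f ` tuples 2 U \<subseteq> W"
  proof
    fix x assume "x \<in> ?f ` tuples 2 U"
    then obtain w where w: "w \<in> tuples 2 U" "x = w 0 + w 1" by blast
    have t: "\<forall>i<2. w i \<in> U i" using w(1) by (simp add: tuples_def)
    have "w 0 \<in> W" "w 1 \<in> W"
      using t[rule_format, of 0] t[rule_format, of 1] A(2) B(2) by (auto simp: U_def)
    then show "x \<in> W" unfolding w(2) by (rule P.subspace_add[OF W(2)])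
  qed
  then have "P.dim (?f ` tuples 2 U) \<le> P.dim W" by (rule P.dim_mono_fin_dim[OF W(1)])
  finally show ?thesis .
qed

lemma dim_homog_poly_in:
  fixes V :: "'n::{finite,linorder} set"
  assumes "V \<noteq> {}"
  shows "P.dim ({p. homogeneous (int t) p} \<inter> poly_in V :: ('n, 'k::field) mpoly set) = (t + card V - 1) choose t"
proof -
  have e: "({p. homogeneous (int t) p} \<inter> poly_in V :: ('n, 'k) mpoly set) = supported {m \<in> {m. Poly_Mapping.keys m \<subseteq> V}. monom_degree m = t}"
    by (auto simp: supported_def homogeneous_def poly_in_def)
  have "finite {m \<in> {m :: 'n \<Rightarrow>\<^sub>0 nat. Poly_Mapping.keys m \<subseteq> V}. monom_degree m = t}"
    by (rule finite_subset[OF _ finite_monom_degree[of t]]) auto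
  then have "P.dim ({p. homogeneous (int t) p} \<inter> poly_in V :: ('n, 'k) mpoly set) = graded_count {m. Poly_Mapping.keys m \<subseteq> V} t"
    unfolding e graded_count_def by (rule conjunct2[OF dim_supported])
  then show ?thesis using graded_count_all[of V t] assms by simp
qed

lemma subspace_poly_in: "P.subspace (poly_in V :: ('n, 'k::field) mpoly set)"
  unfolding subspace_P_iff
proof (intro conjI ballI allI)
  fix c :: 'k and p :: "('n, 'k) mpoly" assume "p \<in> poly_in V"
  then show "scale_poly c p \<in> poly_in V" by (intro subring_setD(5)[OF subring_poly_in] single_in_poly_in) simp_all
qed (simp_all add: subring_setD[OF subring_poly_in])

text \<open>Multiplication by y embeds the degree t part of k[V] into I, and by independence its
  image meets A only in 0.\<close>

lemma dim_indep_le: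
  fixes A I :: "('n::{finite,linorder}, 'k::field) mpoly set"
  assumes A: "is_ideal A" and I: "is_ideal I" "A \<subseteq> I" and y: "y \<in> I" "homogeneous (int \<delta>) y"
    and V: "indep_vars V {r. r * y \<in> A}" "V \<noteq> {}" "y \<noteq> 0"
  shows "P.dim {p \<in> A. homogeneous (int (t + \<delta>)) p} + ((t + card V - 1) choose t) \<le> P.dim {p \<in> I. homogeneous (int (t + \<delta>)) p}"
proof -
  let ?S = "{p. homogeneous (int t) p} \<inter> poly_in V :: ('n, 'k) mpoly set"
  have l: "Vector_Spaces.linear scale_poly scale_poly (\<lambda>p::('n, 'k) mpoly. p * y)"
    by (rule linear_PP_I) (simp_all add: distrib_right mult.assoc)
  have S: "P.subspace ?S" by (rule P.subspace_inter[OF subspace_homog subspace_poly_in])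
  have fS: "fin_dim_wrt P.span ?S" by (rule P.fin_dim_subset[OF fin_dim_homog]) auto
  have "P.dim ((\<lambda>p. p * y) ` ?S) = P.dim ?S" by (rule PP.dim_image_inj[OF l S fS]) (use V(3) in simp)
  also have "\<dots> = (t + card V - 1) choose t" by (rule dim_homog_poly_in[OF V(2)])
  finally have d: "P.dim ((\<lambda>p. p * y) ` ?S) = (t + card V - 1) choose t" .
  have "P.dim {p \<in> A. homogeneous (int (t + \<delta>)) p} + P.dim ((\<lambda>p. p * y) ` ?S) \<le> P.dim {p \<in> I. homogeneous (int (t + \<delta>)) p}"
  proof (rule dim_sum_le)
    show "fin_dim_wrt P.span {p \<in> I. homogeneous (int (t + \<delta>)) p}" by (rule fin_dim_ideal_part)
    show "P.subspace {p \<in> I. homogeneous (int (t + \<delta>)) p}" by (rule subspace_ideal_part[OF I(1)])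
    show "P.subspace {p \<in> A. homogeneous (int (t + \<delta>)) p}" by (rule subspace_ideal_part[OF A])
    show "{p \<in> A. homogeneous (int (t + \<delta>)) p} \<subseteq> {p \<in> I. homogeneous (int (t + \<delta>)) p}" using I(2) by auto
    show "P.subspace ((\<lambda>p. p * y) ` ?S)" by (rule PP.linear_subspace_image[OF l S])
    show "(\<lambda>p. p * y) ` ?S \<subseteq> {p \<in> I. homogeneous (int (t + \<delta>)) p}"
      using homogeneous_mult[of "int t" _ "int \<delta>" y] y is_idealD(3)[OF I(1) y(1)] by auto
    show "{p \<in> A. homogeneous (int (t + \<delta>)) p} \<inter> (\<lambda>p. p * y) ` ?S \<subseteq> {0}"
    proof
      fix x assume "x \<in> {p \<in> A. homogeneous (int (t + \<delta>)) p} \<inter> (\<lambda>p. p * y) ` ?S"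
      then obtain p where p: "x = p * y" "p * y \<in> A" "p \<in> poly_in V" by blast
      then have "p \<in> {r. r * y \<in> A} \<inter> poly_in V" by simp
      then have "p = 0" using V(1) unfolding indep_vars_def by auto
      then show "x \<in> {0}" using p by simp
    qed
  qed
  then show ?thesis unfolding d .
qed

text \<open>Exactness of the Koszul complex of a coprime pair.\<close>

lemma ci_syzygy:
  fixes a b :: "('n::{finite,linorder}, 'k::field) mpoly"
  assumes "a \<noteq> 0" "no_common_prime a b" "u * a + v * b = 0"
  shows "\<exists>h. u = h * b \<and> v = - (h * a)"
proof -
  have "b * v = a * (- u)" using assms(3) by (simp add: algebra_simps add_eq_0_iff)
  then have "a dvd b * v" by simp
  then have "a dvd v" by (rule no_common_prime_dvd[OF assms(1,2)])
  then obtain h where h: "v = a * h" by (rule dvdE)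
  have "a * (u + h * b) = 0" using assms(3) h by (simp add: algebra_simps)
  then have "u = (- h) * b" using assms(1) by (simp add: add_eq_0_iff)
  then show ?thesis using h by (intro exI[of _ "- h"]) simp
qed

text \<open>Rank-nullity in degree t for the Koszul complex 0 -> R(-2e) -> R(-e)^2 -> (a, b) ->
  0.\<close>

lemma dim_ci:
  fixes a b :: "('n::{finite,linorder}, 'k::field) mpoly"
  assumes ab: "a \<noteq> 0" "no_common_prime a b" and h: "homogeneous (int e) a" "homogeneous (int e) b"
  shows "P.dim {p \<in> ideal_span {a, b}. homogeneous t p} + P.dim (homog (t - 2 * int e) :: ('n, 'k) mpoly set) = 2 * P.dim (homog (t - int e) :: ('n, 'k) mpoly set)"
proof -
  let ?T = "tuples 2 (\<lambda>_. homog (t - int e) :: ('n, 'k) mpoly set)"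
  let ?f = "\<lambda>w::nat \<Rightarrow> ('n, 'k) mpoly. w 0 * a + w 1 * b"
  have l: "Vector_Spaces.linear scale_vec scale_poly ?f"
    by (rule linear_FP_I) (simp_all add: algebra_simps)
  have s: "F.subspace ?T" by (rule subspace_tuples) (rule subspace_homog)
  have f: "fin_dim_wrt F.span ?T" by (rule fin_dim_tuples) (rule subspace_homog fin_dim_homog)+
  have "F.dim ?T = (\<Sum>i<(2::nat). P.dim (homog (t - int e) :: ('n, 'k) mpoly set))"
    by (rule dim_tuples) (rule subspace_homog fin_dim_homog)+
  then have dT: "F.dim ?T = 2 * P.dim (homog (t - int e) :: ('n, 'k) mpoly set)" by simp
  have im: "?f ` ?T = {p \<in> ideal_span {a, b}. homogeneous t p}"
  proof (intro equalityI subsetI)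
    fix p assume "p \<in> ?f ` ?T"
    then obtain w where w: "w \<in> ?T" "p = w 0 * a + w 1 * b" by blast
    have "homogeneous (t - int e) (w 0)" "homogeneous (t - int e) (w 1)" using w(1) by (simp_all add: tuples_def)
    then have "homogeneous t (w 0 * a)" "homogeneous t (w 1 * b)"
      using homogeneous_mult[OF _ h(1), of "t - int e"] homogeneous_mult[OF _ h(2), of "t - int e"] by simp_all
    then have "homogeneous t p" unfolding w(2) by (rule homogeneous_add)
    moreover have "p \<in> ideal_span {a, b}" unfolding w(2) ideal_span_2 by blast
    ultimately show "p \<in> {p \<in> ideal_span {a, b}. homogeneous t p}" by simp
  next
    fix p assume p: "p \<in> {p \<in> ideal_span {a, b}. homogeneous t p}"
    then obtain u v where uv: "p = u * a + v * b" unfolding ideal_span_2 by blast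
    define w where "w = (\<lambda>i::nat. if i = 0 then hcomp (t - int e) u else if i = 1 then hcomp (t - int e) v else 0)"
    have "homogeneous t p" using p by simp
    then have "p = hcomp t p" by (simp add: hcomp_homogeneous)
    also have "\<dots> = ?f w" unfolding uv hcomp_add hcomp_mult_homogeneous[OF h(1)] hcomp_mult_homogeneous[OF h(2)] by (simp add: w_def)
    finally have "p = ?f w" .
    moreover have "w \<in> ?T" by (simp add: tuples_def w_def)
    ultimately show "p \<in> ?f ` ?T" by blast
  qed
  let ?g = "\<lambda>p::('n, 'k) mpoly. \<lambda>i::nat. if i = 0 then p * b else if i = 1 then - (p * a) else 0"
  have k: "{w \<in> ?T. ?f w = 0} = ?g ` homog (t - 2 * int e)"
  proof (intro equalityI subsetI)
    fix w assume "w \<in> {w \<in> ?T. ?f w = 0}"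
    then have w: "w \<in> ?T" "w 0 * a + w 1 * b = 0" by simp_all
    obtain p where p: "w 0 = p * b" "w 1 = - (p * a)" using ci_syzygy[OF ab w(2)] by blast
    define q where "q = hcomp (t - 2 * int e) p"
    have hw: "homogeneous (t - int e) (w 1)" using w(1) by (simp add: tuples_def)
    have ha: "homogeneous (t - int e) (p * a)" using homogeneous_uminus[OF hw] p(2) by simp
    have "p * a = hcomp (t - int e) (p * a)" using ha by (simp add: hcomp_homogeneous)
    also have "\<dots> = q * a" unfolding hcomp_mult_homogeneous[OF h(1)] q_def by (simp add: algebra_simps)
    finally have pq: "p = q" using ab(1) by simp
    have "w = ?g q"
    proof
      fix i :: nat
      consider "i = 0" | "i = 1" | "i \<ge> 2" by linarith
      then show "w i = ?g q i" using w(1) p pq by cases (simp_all add: tuples_def)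
    qed
    moreover have "q \<in> homog (t - 2 * int e)" by (simp add: q_def)
    ultimately show "w \<in> ?g ` homog (t - 2 * int e)" by blast
  next
    fix w assume "w \<in> ?g ` homog (t - 2 * int e)"
    then obtain q where q: "homogeneous (t - 2 * int e) q" "w = ?g q" by blast
    have "homogeneous (t - 2 * int e + int e) (q * b)" "homogeneous (t - 2 * int e + int e) (q * a)"
      using homogeneous_mult[OF q(1) h(1)] homogeneous_mult[OF q(1) h(2)] by simp_all
    moreover have "t - 2 * int e + int e = t - int e" by simp
    ultimately have "homogeneous (t - int e) (q * b)" "homogeneous (t - int e) (- (q * a))" by (simp_all add: homogeneous_uminus)
    then show "w \<in> {w \<in> ?T. ?f w = 0}" unfolding q(2) by (simp add: tuples_def algebra_simps)
  qed
  interpret PF: vector_space_pair "scale_poly :: 'k \<Rightarrow> ('n, 'k) mpoly \<Rightarrow> ('n, 'k) mpoly" scale_vec ..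
  have lg: "Vector_Spaces.linear scale_poly scale_vec ?g"
    by unfold_locales (auto simp: fun_eq_iff algebra_simps)
  have "F.dim (?g ` homog (t - 2 * int e)) = P.dim (homog (t - 2 * int e) :: ('n, 'k) mpoly set)"
  proof (rule PF.dim_image_inj[OF lg subspace_homog fin_dim_homog])
    fix x assume "?g x = 0"
    from fun_cong[OF this, of 1] have "x * a = 0" by simp
    then show "x = 0" using ab(1) by simp
  qed
  then show ?thesis using FP.rank_nullity[OF l s f] dT im k by simp
qed

text \<open>\<open>indep_vars_colon\<close> for the map (u, v) to u a + v b, whose kernel is
  generated by (b, -a). The target is padded by zero coordinates, so only coordinate 0 carries
  information.\<close>

lemma ci_colon_indep_vars:
  fixes a b y :: "('n::{finite,linorder}, 'k::field) mpoly"
  assumes ab: "a \<noteq> 0" "no_common_prime a b" and y: "y \<notin> ideal_span {a, b}"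
  obtains V where "card V = CARD('n) - 2" "indep_vars V {r. r * y \<in> ideal_span {a, b}}"
proof -
  define A :: "nat \<Rightarrow> nat \<Rightarrow> ('n, 'k) mpoly" where "A = (\<lambda>i j. if j = 0 then if i = 0 then a else b else 0)"
  define g where "g = (\<lambda>i::nat. if i = 0 then b else - a)"
  have S: "(\<Sum>i<2. A i j * u i) = (if j = 0 then u 0 * a + u 1 * b else 0)" for j u
    by (simp add: A_def numeral_2_eq_2 mult.commute)
  have ker: "\<exists>h. \<forall>i<2. u i = h * g i" if "\<And>j. (\<Sum>i<2. A i j * u i) = 0" for u
  proof -
    have "u 0 * a + u 1 * b = 0" using that[of 0] by (simp add: S)
    then obtain h where "u 0 = h * b" "u 1 = - (h * a)" using ci_syzygy[OF ab] by blast
    then show ?thesis by (intro exI[of _ h]) (auto simp: g_def less_2_cases_iff)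
  qed
  have g0: "(\<Sum>i<2. A i j * g i) = 0" for j by (simp add: S g_def algebra_simps)
  have one_lt_2: "(1::nat) < 2" by simp
  have g1: "g 1 \<noteq> 0" using ab(1) by (simp add: g_def)
  define z where "z = (\<lambda>j::nat. if j = 0 then y else 0)"
  have mem: "(\<exists>w. \<forall>j. r * z j = (\<Sum>i<2. A i j * w i)) \<longleftrightarrow> r * y \<in> ideal_span {a, b}" for r
  proof
    assume "\<exists>w. \<forall>j. r * z j = (\<Sum>i<2. A i j * w i)"
    then obtain w where "\<forall>j. r * z j = (\<Sum>i<2. A i j * w i)" by blast
    then have "r * y = w 0 * a + w 1 * b" by (auto simp: S z_def dest: spec[of _ 0])
    then show "r * y \<in> ideal_span {a, b}" unfolding ideal_span_2 by blast
  next
    assume "r * y \<in> ideal_span {a, b}"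
    then obtain u v where "r * y = u * a + v * b" unfolding ideal_span_2 by blast
    then show "\<exists>w. \<forall>j. r * z j = (\<Sum>i<2. A i j * w i)"
      by (intro exI[of _ "\<lambda>i. if i = 0 then u else v"]) (simp add: S z_def)
  qed
  have nz: "\<nexists>w. \<forall>j. z j = (\<Sum>i<2. A i j * w i)" using mem[of 1] y by simp
  obtain V where "card V = CARD('n) - 2" "indep_vars V {r. \<exists>w. \<forall>j. r * z j = (\<Sum>i<2. A i j * w i)}"
    by (rule indep_vars_colon[OF ker g0 one_lt_2 g1 nz])
  then show ?thesis using that unfolding mem by blast
qed

text \<open>An ideal between a complete intersection and itself: a form \<open>y\<close> of \<open>I\<close> outside \<open>C = (a, b)\<close>
  generates a copy of a polynomial ring in \<open>n - 2\<close> variables inside \<open>I/C\<close>, which lowers the leading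
  coefficient of the Hilbert polynomial.\<close>

lemma ideal_eq_ci_of_multiplicity:
  fixes I :: "('n::{finite,linorder}, 'k::field) mpoly set"
  assumes n: "CARD('n) \<ge> 3" and e: "e > 0" and I: "is_ideal I" "\<And>p t. p \<in> I \<Longrightarrow> hcomp t p \<in> I"
    and V: "indep_vars V I" "card V = CARD('n) - 2"
    and ab: "a \<noteq> 0" "no_common_prime a b" "homogeneous (int e) a" "homogeneous (int e) b" "a \<in> I" "b \<in> I"
    and m: "ideal_multiplicity I = of_nat (e ^ 2)"
  shows "I = ideal_span {a, b}"
proof (rule ccontr)
  let ?C = "ideal_span {a, b}"
  let ?k = "CARD('n) - 3"
  assume neq: "I \<noteq> ?C"
  have CI: "?C \<subseteq> I" using ab I(1) by (intro ideal_span_least) auto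
  obtain y \<delta> where y: "y \<in> I" "y \<notin> ?C" "homogeneous (int \<delta>) y"
  proof -
    obtain p where p: "p \<in> I" "p \<notin> ?C" using neq CI by blast
    have "\<exists>t\<in>{0..int (total_degree p)}. hcomp t p \<notin> ?C"
    proof (rule ccontr)
      assume "\<not> ?thesis"
      then have "(\<Sum>t\<in>{0..int (total_degree p)}. hcomp t p) \<in> ?C" by (intro is_ideal_sum[OF is_ideal_span]) auto
      then show False using p(2) hcomp_expand[of p] by simp
    qed
    then obtain t where t: "0 \<le> t" "hcomp t p \<notin> ?C" by auto
    then show ?thesis using that[of "hcomp t p" "nat t"] I(2)[OF p(1)] homogeneous_hcomp[of t p] by (simp del: homogeneous_hcomp)
  qed
  have y0: "y \<noteq> 0" using y(2) is_idealD(1)[OF is_ideal_span] by auto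
  obtain W where W: "card W = CARD('n) - 2" "indep_vars W {r. r * y \<in> ?C}" by (rule ci_colon_indep_vars[OF ab(1,2) y(2)])
  have Wne: "W \<noteq> {}" "V \<noteq> {}" using W(1) V(2) n by auto
  have cW: "of_nat ((t + card W - 1) choose t) = poly (binom_poly ?k) (of_nat t)" for t
  proof -
    have "card W - 1 = ?k" "card W \<ge> 1" using W(1) n by simp_all
    then show ?thesis using choose_binom_poly[of "card W" t] by simp
  qed
  have cV: "card V = card W" using W(1) V(2) by simp
  have dC: "P.dim {p \<in> ?C. homogeneous (int t) p} + P.dim (homog (int t - 2 * int e) :: ('n, 'k) mpoly set) = 2 * P.dim (homog (int t - int e) :: ('n, 'k) mpoly set)" for t
    by (rule dim_ci[OF ab(1-4)])
  have hC: "\<forall>\<^sub>F t in sequentially. poly (ci_poly ?k e) (of_nat t) = of_nat (hilbert_function ?C t)"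
    by (rule multiplicity_of_ci_hilbert_function(1)[OF n e dC])
  obtain R :: "rat poly" where R: "\<forall>\<^sub>F t in sequentially. poly R (of_nat t) = of_nat (hilbert_function I t)"
    using hilbert_polynomial_exists[OF I(1)] unfolding ev_poly_def by blast
  have hR: "hilbert_polynomial I = R" by (rule hilbert_polynomial_eqI[OF R])
  let ?N = "\<lambda>t. P.dim (homog (int t) :: ('n, 'k) mpoly set)"
  let ?dI = "\<lambda>t. P.dim {p \<in> I. homogeneous (int t) p}" and ?dC = "\<lambda>t. P.dim {p \<in> ?C. homogeneous (int t) p}"
  have leN: "?dI t \<le> ?N t" "?dC t \<le> ?N t" for t
    by (rule P.dim_mono_fin_dim[OF fin_dim_homog], auto)+
  have hI: "hilbert_function I t = ?N t - ?dI t" and hC': "hilbert_function ?C t = ?N t - ?dC t" for t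
    unfolding hilbert_function_def by (rule refl)+
  \<comment> \<open>The n - 2 variables that are independent modulo I bound its Hilbert function
    from below; this prevents the degree of R from dropping below k, where the multiplicity is read
    off.\<close>
  have low: "poly (binom_poly ?k) (of_nat t) \<le> of_nat (hilbert_function I t)" for t
  proof -
    have 1: "homogeneous (int 0) (1 :: ('n, 'k) mpoly)" using homogeneous_const[of 1] by simp
    have "is_ideal (UNIV :: ('n, 'k) mpoly set)" by (simp add: is_ideal_iff)
    then have "?dI (t + 0) + ((t + card V - 1) choose t) \<le> P.dim {p \<in> (UNIV :: ('n, 'k) mpoly set). homogeneous (int (t + 0)) p}"
      by (intro dim_indep_le[OF I(1) _ _ _ 1]) (use V Wne in simp_all)
    then have "(t + card V - 1) choose t \<le> hilbert_function I t" unfolding hI by simp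
    then have "rat_of_nat ((t + card W - 1) choose t) \<le> of_nat (hilbert_function I t)" unfolding cV by (simp only: of_nat_le_iff)
    then show ?thesis unfolding cW .
  qed
  have up: "of_nat (hilbert_function I (t + \<delta>)) + poly (binom_poly ?k) (of_nat t) \<le> rat_of_nat (hilbert_function ?C (t + \<delta>))" for t
  proof -
    have "?dC (t + \<delta>) + ((t + card W - 1) choose t) \<le> ?dI (t + \<delta>)"
      by (rule dim_indep_le[OF is_ideal_span I(1) CI y(1,3) W(2) Wne(1) y0])
    then have "hilbert_function I (t + \<delta>) + ((t + card W - 1) choose t) \<le> hilbert_function ?C (t + \<delta>)"
      unfolding hI hC' using leN[of "t + \<delta>"] by linarith
    then have "rat_of_nat (hilbert_function I (t + \<delta>) + ((t + card W - 1) choose t)) \<le> of_nat (hilbert_function ?C (t + \<delta>))"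
      by (simp only: of_nat_le_iff)
    then show ?thesis unfolding of_nat_add cW .
  qed
  \<comment> \<open>Both r1 and r2 are eventually nonnegative: R lies above a polynomial ring in n -
    2 variables, and below the complete intersection minus a copy of that ring shifted by the degree
    of y.\<close>
  define r1 where "r1 = ci_poly ?k e - R - binom_poly ?k \<circ>\<^sub>p [:- of_nat \<delta>, 1:]"
  define r2 where "r2 = R - binom_poly ?k"
  have e2: "\<forall>\<^sub>F t in sequentially. poly r2 (of_nat t) \<ge> 0"
    using R by eventually_elim (use low in \<open>simp add: r2_def\<close>)
  have e1: "\<forall>\<^sub>F t in sequentially. poly r1 (of_nat t) \<ge> 0"
    using R hC eventually_ge_at_top[of \<delta>]
  proof eventually_elim
    case (elim t)
    then have "poly (binom_poly ?k \<circ>\<^sub>p [:- of_nat \<delta>, 1:]) (of_nat t) = poly (binom_poly ?k) (of_nat (t - \<delta>))"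
      by (simp add: poly_pcompose of_nat_diff)
    then show ?case using up[of "t - \<delta>"] elim unfolding r1_def by simp
  qed
  \<comment> \<open>If R had larger degree, its leading coefficient would occur with opposite signs
    as a coefficient of r1 and of r2, and both coefficients are nonnegative.\<close>
  have dR: "Polynomial.degree R \<le> ?k"
  proof (rule ccontr)
    assume "\<not> ?thesis"
    then have g: "?k < Polynomial.degree R" by simp
    have z: "coeff q (Polynomial.degree R) = 0" if "Polynomial.degree q \<le> ?k" for q :: "rat poly"
      using g that by (intro coeff_eq_0) simp
    have c2: "coeff r2 (Polynomial.degree R) = lead_coeff R" unfolding r2_def by (simp add: z degree_binom_poly)
    have c1: "coeff r1 (Polynomial.degree R) = - lead_coeff R" unfolding r1_def by (simp add: z degree_ci_poly degree_shift_binom_poly)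
    have "Polynomial.degree r2 \<le> Polynomial.degree R" unfolding r2_def using g by (intro degree_diff_le) (simp_all add: degree_binom_poly)
    then have "lead_coeff R \<ge> 0" using coeff_nonneg_of_eventually[OF e2, of "Polynomial.degree R"] c2 by simp
    moreover have "Polynomial.degree r1 \<le> Polynomial.degree R" unfolding r1_def
      using g degree_ci_poly(1)[of ?k e] degree_shift_binom_poly(1)[of ?k \<delta>] by (intro degree_diff_le) simp_all
    then have "lead_coeff R \<le> 0" using coeff_nonneg_of_eventually[OF e1, of "Polynomial.degree R"] c1 by simp
    ultimately have "R = 0" by simp
    then show False using g by simp
  qed
  have "Polynomial.degree r2 \<le> ?k" unfolding r2_def using dR by (intro degree_diff_le) (simp_all add: degree_binom_poly)
  then have "0 \<le> coeff R ?k - coeff (binom_poly ?k) ?k" using coeff_nonneg_of_eventually[OF e2] by (simp add: r2_def)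
  then have R1: "1 / fact ?k \<le> coeff R ?k" using degree_binom_poly[of ?k] by simp
  moreover have "0 < 1 / (fact ?k :: rat)" by simp
  ultimately have cR: "coeff R ?k \<noteq> 0" by linarith
  then have dR': "Polynomial.degree R = ?k" using dR le_degree by (metis le_antisym)
  have R0: "R \<noteq> 0" using cR by auto
  have "Polynomial.degree r1 \<le> ?k" unfolding r1_def
    using dR degree_ci_poly(1)[of ?k e] degree_shift_binom_poly(1)[of ?k \<delta>] by (intro degree_diff_le) simp_all
  then have "0 \<le> of_nat (e ^ 2) / fact ?k - coeff R ?k - 1 / fact ?k"
    using coeff_nonneg_of_eventually[OF e1, of ?k] by (simp add: r1_def degree_ci_poly degree_shift_binom_poly)
  then have "fact ?k * (coeff R ?k + 1 / fact ?k) \<le> fact ?k * (of_nat (e ^ 2) / fact ?k)" by (intro mult_left_mono) simp_all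
  then have "fact ?k * coeff R ?k + 1 \<le> of_nat (e ^ 2)" by (simp add: distrib_left)
  moreover have "ideal_multiplicity I = fact ?k * coeff R ?k" unfolding ideal_multiplicity_def hR Let_def using R0 dR' by simp
  ultimately show False using m by simp
qed

section \<open>The Bourbaki ideal and the Bourbaki degree\<close>

context three_forms
begin

section \<open>Dimensions of the graded parts of the Bourbaki ideal\<close>

lemma cross_nu_add: "cross \<nu> (\<lambda>i. u i + v i) = (\<lambda>j. cross \<nu> u j + cross \<nu> v j)"
  by (rule ext) (simp add: cross_def algebra_simps)

lemma cross_nu_scale: "cross \<nu> (\<lambda>i. c * u i) = (\<lambda>j. c * cross \<nu> u j)"
  by (rule ext) (simp add: cross_def algebra_simps)

text \<open>Two rank-nullity counts: for the map from R^3 onto J, whose kernel are the syzygies, and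
  for \<nu> \<times> - on the syzygies, with image I f and kernel R\<nu>. The cross product stands
  in for \<open>bour\<close>, whose additivity is known only on syzygies. As \<nu> enters the
  formula only through e, the Hilbert function of I is the same for every choice of \<nu>.\<close>

lemma dim_relation:
  "P.dim {p \<in> bour_ideal. homogeneous (t + (int e - int d)) p} + P.dim (homog (t - int e) :: ('n, 'k) mpoly set)
    + P.dim {p \<in> ideal_span {f 0, f 1, f 2}. homogeneous (t + int d) p} = 3 * P.dim (homog t :: ('n, 'k) mpoly set)"
proof -
  let ?T = "tuples 3 (\<lambda>_. homog t :: ('n, 'k) mpoly set)"
  let ?K = "{u \<in> ?T. dot u f = 0}"
  let ?J = "ideal_span {f 0, f 1, f 2}"
  interpret PF: vector_space_pair "scale_poly :: 'k \<Rightarrow> ('n, 'k) mpoly \<Rightarrow> ('n, 'k) mpoly" scale_vec ..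
  have s: "F.subspace ?T" by (rule subspace_tuples) (rule subspace_homog)
  have fT: "fin_dim_wrt F.span ?T" by (rule fin_dim_tuples) (rule subspace_homog fin_dim_homog)+
  have "F.dim ?T = (\<Sum>i<(3::nat). P.dim (homog t :: ('n, 'k) mpoly set))"
    by (rule dim_tuples) (rule subspace_homog fin_dim_homog)+
  then have dT: "F.dim ?T = 3 * P.dim (homog t :: ('n, 'k) mpoly set)" by simp
  have ldot: "Vector_Spaces.linear scale_vec scale_poly (\<lambda>u::nat \<Rightarrow> ('n, 'k) mpoly. dot u f)"
    by (rule linear_FP_I) (simp_all add: dot_add dot_scale)
  have hT: "homogeneous t (u i)" if "u \<in> ?T" "i < 3" for u i using that by (simp add: tuples_def)
  have im1: "(\<lambda>u. dot u f) ` ?T = {p \<in> ?J. homogeneous (t + int d) p}"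
  proof (intro equalityI subsetI)
    fix p assume "p \<in> (\<lambda>u. dot u f) ` ?T"
    then obtain u where u: "u \<in> ?T" "p = dot u f" by blast
    have "homogeneous (t + int d) (u i * f i)" if "i < 3" for i
      by (rule homogeneous_mult[OF hT[OF u(1) that] hom_f[OF that]])
    then have "homogeneous (t + int d) p" unfolding u(2) dot_def by (simp add: homogeneous_add)
    moreover have "p \<in> ?J" unfolding u(2) dot_def ideal_span_3 by blast
    ultimately show "p \<in> {p \<in> ?J. homogeneous (t + int d) p}" by simp
  next
    fix p assume p: "p \<in> {p \<in> ?J. homogeneous (t + int d) p}"
    then obtain r s q where rs: "p = r * f 0 + s * f 1 + q * f 2" unfolding ideal_span_3 by blast
    define u where "u = (\<lambda>i::nat. if i = 0 then r else if i = 1 then s else if i = 2 then q else 0)"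
    have pu: "p = dot u f" by (simp add: rs dot_def u_def)
    have "homogeneous (t + int d) p" using p by simp
    then have "p = hcomp (t + int d) p" by (simp add: hcomp_homogeneous)
    also have "\<dots> = dot (\<lambda>i. hcomp t (u i)) f" unfolding pu by (rule dot_hcomp)
    finally have "p = dot (\<lambda>i. hcomp t (u i)) f" .
    moreover have "(\<lambda>i. hcomp t (u i)) \<in> ?T" by (simp add: tuples_def u_def)
    ultimately show "p \<in> (\<lambda>u. dot u f) ` ?T" by blast
  qed
  have rn1: "F.dim ?T = P.dim {p \<in> ?J. homogeneous (t + int d) p} + F.dim ?K"
    using FP.rank_nullity[OF ldot s fT] im1 by simp
  have sK: "F.subspace ?K" using s by (simp add: subspace_F_iff dot_add dot_scale) (simp add: dot_def)
  have fK: "fin_dim_wrt F.span ?K" by (rule F.fin_dim_subset[OF fT]) auto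
  have lc: "Vector_Spaces.linear scale_vec scale_vec (cross \<nu>)"
    by (rule linear_FF_I) (simp_all only: cross_nu_add cross_nu_scale)
  let ?G = "\<lambda>h::('n, 'k) mpoly. \<lambda>j::nat. if j < 3 then h * f j else 0"
  let ?H = "\<lambda>h::('n, 'k) mpoly. \<lambda>j::nat. if j < 3 then h * \<nu> j else 0"
  let ?I = "{p \<in> bour_ideal. homogeneous (t + (int e - int d)) p}"
  have lG: "Vector_Spaces.linear scale_poly scale_vec ?G"
    by unfold_locales (auto simp: fun_eq_iff algebra_simps)
  have lH: "Vector_Spaces.linear scale_poly scale_vec ?H"
    by unfold_locales (auto simp: fun_eq_iff algebra_simps)
  have cb: "cross \<nu> u = ?G (bour u)" if "dot u f = 0" for u
  proof
    fix j show "cross \<nu> u j = ?G (bour u) j"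
      by (cases "j < 3") (simp_all add: bour[OF that], simp add: cross_def)
  qed
  have im2: "cross \<nu> ` ?K = ?G ` ?I"
  proof (intro equalityI subsetI)
    fix v assume "v \<in> cross \<nu> ` ?K"
    then obtain u where u: "u \<in> ?T" "dot u f = 0" "v = cross \<nu> u" by blast
    have "homogeneous (t + (int e - int d)) (bour u)" by (rule homogeneous_bour[OF u(2) hT[OF u(1)]])
    then have "bour u \<in> ?I" using bour_in_bour_ideal[OF u(2)] by simp
    then show "v \<in> ?G ` ?I" using cb[OF u(2)] u(3) by blast
  next
    fix v assume "v \<in> ?G ` ?I"
    then obtain h where h: "h \<in> bour_ideal" "homogeneous (t + (int e - int d)) h" "v = ?G h" by blast
    obtain u where u: "dot u f = 0" "h = bour u" using bour_idealE[OF h(1)] .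
    define w where "w = (\<lambda>i::nat. if i < 3 then hcomp t (u i) else 0)"
    have "dot w f = dot (\<lambda>i. hcomp t (u i)) f" "cross \<nu> w = cross \<nu> (\<lambda>i. hcomp t (u i))"
      by (simp_all add: w_def dot_def cross_def)
    moreover have "h = bour (\<lambda>i. hcomp t (u i))"
      using hcomp_bour(2)[OF u(1), of t] hcomp_homogeneous[OF h(2), of "t + (int e - int d)"] u(2) by simp
    ultimately have w: "dot w f = 0" "cross \<nu> w = ?G h"
      using hcomp_bour(1)[OF u(1), of t] cb[OF hcomp_bour(1)[OF u(1), of t]] by (simp, simp only:)
    have "w \<in> ?T" by (simp add: tuples_def w_def)
    then show "v \<in> cross \<nu> ` ?K" using w h(3) by (intro image_eqI[of _ _ w]) simp_all
  qed
  have k2: "{u \<in> ?K. cross \<nu> u = 0} = ?H ` homog (t - int e)"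
  proof (intro equalityI subsetI)
    fix u assume "u \<in> {u \<in> ?K. cross \<nu> u = 0}"
    then have u: "u \<in> ?T" "cross \<nu> u = 0" by simp_all
    obtain h where h: "\<forall>i<3. u i = h * \<nu> i" using cross_nu_zero[of u] u(2) by auto
    obtain k where k: "k < 3" "\<nu> k \<noteq> 0" using nu_nz by blast
    have "homogeneous ((t - int e) + int e) (h * \<nu> k)" using hT[OF u(1) k(1)] h k(1) by simp
    then have "homogeneous (t - int e) h" by (rule homogeneous_cancel[OF _ hom_nu[OF k(1)] k(2)])
    moreover have "u = ?H h"
    proof
      fix i show "u i = ?H h i" using h u(1) by (cases "i < 3") (simp_all add: tuples_def)
    qed
    ultimately show "u \<in> ?H ` homog (t - int e)" by blast
  next
    fix u assume "u \<in> ?H ` homog (t - int e)"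
    then obtain h where h: "homogeneous (t - int e) h" "u = ?H h" by blast
    have "homogeneous (t - int e + int e) (h * \<nu> i)" if "i < 3" for i
      by (rule homogeneous_mult[OF h(1) hom_nu[OF that]])
    then have "u \<in> ?T" unfolding h(2) by (simp add: tuples_def)
    moreover have "dot u f = h * dot \<nu> f" unfolding h(2) by (simp add: dot_def algebra_simps)
    moreover have "cross \<nu> u = 0" unfolding h(2) by (rule ext) (simp add: cross_def algebra_simps)
    ultimately show "u \<in> {u \<in> ?K. cross \<nu> u = 0}" using nu_syz by simp
  qed
  have dG: "F.dim (?G ` ?I) = P.dim ?I"
  proof (rule PF.dim_image_inj[OF lG subspace_ideal_part[OF is_ideal_bour_ideal] fin_dim_ideal_part])
    fix x assume x: "?G x = 0"
    obtain k where k: "k < 3" "f k \<noteq> 0" by (rule f_nonzero)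
    have "?G x k = 0" using fun_cong[OF x, of k] by simp
    then show "x = 0" using k by simp
  qed
  have dH: "F.dim (?H ` homog (t - int e)) = P.dim (homog (t - int e) :: ('n, 'k) mpoly set)"
  proof (rule PF.dim_image_inj[OF lH subspace_homog fin_dim_homog])
    fix x assume x: "?H x = 0"
    obtain k where k: "k < 3" "\<nu> k \<noteq> 0" using nu_nz by blast
    have "?H x k = 0" using fun_cong[OF x, of k] by simp
    then show "x = 0" using k by simp
  qed
  have "F.dim ?K = P.dim ?I + P.dim (homog (t - int e) :: ('n, 'k) mpoly set)"
    using FF.rank_nullity[OF lc sK fK] im2 k2 dG dH by simp
  then show ?thesis using rn1 dT by simp
qed

section \<open>The syzygy module as a set of vectors\<close>

definition syz :: "('n, 'k) mpoly vec set" where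
  "syz = {v \<in> carrier_vec 3. dot (($) v) f = 0}"

lemma syz_eq: "syzygies (f 0) (f 1) (f 2) = syz"
  by (simp add: syz_def syzygies_def dot_def)

text \<open>A vector read as a function has unspecified values from index 3 on; the products only
  see the first three.\<close>

lemma dot_cong: "u 0 = v 0 \<Longrightarrow> u 1 = v 1 \<Longrightarrow> u 2 = v 2 \<Longrightarrow> dot u g = dot v (g :: nat \<Rightarrow> ('n, 'k) mpoly)"
  by (simp add: dot_def)

lemma bour_cong: "u 0 = v 0 \<Longrightarrow> u 1 = v 1 \<Longrightarrow> u 2 = v 2 \<Longrightarrow> bour u = bour v"
proof -
  assume "u 0 = v 0" "u 1 = v 1" "u 2 = v 2"
  then have "cross \<nu> u = cross \<nu> v" unfolding cross_def by (intro ext) simp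
  then show "bour u = bour v" by (simp add: bour_def)
qed

lemma vec_syz: "dot u f = 0 \<Longrightarrow> vec 3 u \<in> syz"
  using dot_cong[of "($) (vec 3 u)" u f] by (simp add: syz_def)

lemma bour_vec: "bour (($) (vec 3 u)) = bour u"
  by (rule bour_cong) simp_all

lemma syz_add: "u \<in> syz \<Longrightarrow> v \<in> syz \<Longrightarrow> u + v \<in> syz \<and> bour (($) (u + v)) = bour (($) u) + bour (($) v)"
proof -
  assume u: "u \<in> syz" and v: "v \<in> syz"
  have c: "u \<in> carrier_vec 3" "v \<in> carrier_vec 3" "dot (($) u) f = 0" "dot (($) v) f = 0" using u v by (simp_all add: syz_def)
  have e: "(u + v) $ 0 = u $ 0 + v $ 0" "(u + v) $ 1 = u $ 1 + v $ 1" "(u + v) $ 2 = u $ 2 + v $ 2"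
    using c by simp_all
  have "dot (($) (u + v)) f = dot (\<lambda>i. u $ i + v $ i) f" by (rule dot_cong) (fact e)+
  then have "u + v \<in> syz" using c by (simp add: syz_def dot_add)
  moreover have "bour (($) (u + v)) = bour (\<lambda>i. u $ i + v $ i)" by (rule bour_cong) (fact e)+
  ultimately show ?thesis using bour_add[OF c(3,4)] by simp
qed

lemma syz_smult: "u \<in> syz \<Longrightarrow> p \<cdot>\<^sub>v u \<in> syz \<and> bour (($) (p \<cdot>\<^sub>v u)) = p * bour (($) u)"
proof -
  assume u: "u \<in> syz"
  have c: "u \<in> carrier_vec 3" "dot (($) u) f = 0" using u by (simp_all add: syz_def)
  have e: "(p \<cdot>\<^sub>v u) $ 0 = p * u $ 0" "(p \<cdot>\<^sub>v u) $ 1 = p * u $ 1" "(p \<cdot>\<^sub>v u) $ 2 = p * u $ 2"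
    using c by simp_all
  have "dot (($) (p \<cdot>\<^sub>v u)) f = dot (\<lambda>i. p * u $ i) f" by (rule dot_cong) (fact e)+
  then have "p \<cdot>\<^sub>v u \<in> syz" using c by (simp add: syz_def dot_scale)
  moreover have "bour (($) (p \<cdot>\<^sub>v u)) = bour (\<lambda>i. p * u $ i)" by (rule bour_cong) (fact e)+
  ultimately show ?thesis using bour_scale[OF c(2)] by simp
qed

lemma bour_syz_zero_iff: "v \<in> syz \<Longrightarrow> bour (($) v) = 0 \<longleftrightarrow> (\<exists>p. v = p \<cdot>\<^sub>v vec 3 \<nu>)"
proof
  assume v: "v \<in> syz" "bour (($) v) = 0"
  then obtain h where h: "\<forall>i<3. v $ i = h * \<nu> i" using bour_eq_0_iff[of "($) v"] by (auto simp: syz_def)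
  have "v = h \<cdot>\<^sub>v vec 3 \<nu>" using v h by (intro eq_vecI) (simp_all add: syz_def)
  then show "\<exists>p. v = p \<cdot>\<^sub>v vec 3 \<nu>" ..
next
  assume v: "v \<in> syz" "\<exists>p. v = p \<cdot>\<^sub>v vec 3 \<nu>"
  then obtain p where p: "v = p \<cdot>\<^sub>v vec 3 \<nu>" by blast
  have "\<forall>i<3. v $ i = p * \<nu> i" unfolding p by simp
  then show "bour (($) v) = 0" using bour_eq_0_iff[of "($) v"] v(1) by (auto simp: syz_def)
qed

lemma bour_image_syz: "(\<lambda>v. bour (($) v)) ` syz = bour_ideal"
proof (intro equalityI subsetI)
  fix h assume "h \<in> bour_ideal"
  then obtain u where u: "dot u f = 0" "h = bour u" by (rule bour_idealE)
  then show "h \<in> (\<lambda>v. bour (($) v)) ` syz" by (intro image_eqI[of _ _ "vec 3 u"]) (simp_all add: bour_vec vec_syz)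
qed (auto simp: syz_def bour_in_bour_ideal)

lemma homogeneous_bour_syz:
  assumes "v \<in> syz" "homogeneous_vec t v" shows "homogeneous (t + (int e - int d)) (bour (($) v))"
  by (rule homogeneous_bour) (use assms in \<open>auto simp: syz_def homogeneous_vec_def\<close>)

lemma nu_vec_syz: "vec 3 \<nu> \<in> syz"
  by (rule vec_syz[OF nu_syz])

lemma bourbaki_ideal_bour_ideal:
  assumes "1 \<notin> bour_ideal" shows "bourbaki_ideal syz (vec 3 \<nu>) bour_ideal"
  unfolding bourbaki_ideal_def
proof (intro conjI exI[of _ "\<lambda>v. bour (($) v)"] exI[of _ "int e - int d"])
  show "is_ideal bour_ideal" by (rule is_ideal_bour_ideal)
  show "homogeneous_ideal bour_ideal" by (rule homogeneous_ideal_bour_ideal)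
  show "ideal_height bour_ideal = 2" by (rule ideal_height_bour_ideal[OF assms])
  show "unmixed bour_ideal" by (rule unmixed_bour_ideal[OF assms])
  show "\<forall>u\<in>syz. \<forall>v\<in>syz. bour (($) (u + v)) = bour (($) u) + bour (($) v)" by (simp add: syz_add)
  show "\<forall>p. \<forall>v\<in>syz. bour (($) (p \<cdot>\<^sub>v v)) = p * bour (($) v)" by (simp add: syz_smult)
  show "\<forall>t. \<forall>v\<in>syz. homogeneous_vec t v \<longrightarrow> homogeneous (t + (int e - int d)) (bour (($) v))"
    by (simp add: homogeneous_bour_syz)
  show "(\<lambda>v. bour (($) v)) ` syz = bour_ideal" by (rule bour_image_syz)
  show "{v \<in> syz. bour (($) v) = 0} = {p \<cdot>\<^sub>v vec 3 \<nu> |p. True}"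
    using bour_syz_zero_iff syz_smult[OF nu_vec_syz] by auto
qed

text \<open>Two Bourbaki maps with the same kernel are proportional over the fraction field, and the
  factor is a unit because both images have height two.\<close>

lemma bourbaki_ideal_unique:
  assumes "bourbaki_ideal syz (vec 3 \<nu>) I" shows "I = bour_ideal"
proof -
  obtain \<phi> where I: "is_ideal I" "ideal_height I = 2"
    and add: "\<forall>u\<in>syz. \<forall>v\<in>syz. \<phi> (u + v) = \<phi> u + \<phi> v" and sm: "\<forall>p. \<forall>v\<in>syz. \<phi> (p \<cdot>\<^sub>v v) = p * \<phi> v"
    and im: "\<phi> ` syz = I" and ker: "{v \<in> syz. \<phi> v = 0} = {p \<cdot>\<^sub>v vec 3 \<nu> | p. True}"
    using assms unfolding bourbaki_ideal_def by blast
  obtain w1 w2 where w: "\<forall>i. homogeneous 0 (w1 i)" "\<forall>i. homogeneous 0 (w2 i)"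
    "dot \<nu> w1 \<noteq> 0" "no_common_prime (dot \<nu> w1) (dot \<nu> w2)" by (rule coprime_in_nu)
  define a where "a = dot \<nu> w1"
  define u0 where "u0 = vec 3 (cross f w1)"
  have u0: "u0 \<in> syz" "bour (($) u0) = a"
    unfolding u0_def a_def by (simp_all add: vec_syz dot_cross_left bour_vec bour_cross)
  define q where "q = \<phi> u0"
  have proportional: "a * \<phi> v = q * bour (($) v)" if v: "v \<in> syz" for v
  proof -
    \<comment> \<open>x lies in the kernel of \<open>bour\<close>, which is R\<nu> and hence also
      the kernel of \<phi>; applying \<phi> to x compares the two maps.\<close>
    define x where "x = bour (($) v) \<cdot>\<^sub>v u0 + (- a) \<cdot>\<^sub>v v"
    have m: "bour (($) v) \<cdot>\<^sub>v u0 \<in> syz" "(- a) \<cdot>\<^sub>v v \<in> syz" using syz_smult[OF u0(1)] syz_smult[OF v] by simp_all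
    have x: "x \<in> syz" "bour (($) x) = 0"
      unfolding x_def using syz_add[OF m] syz_smult[OF u0(1), of "bour (($) v)"] syz_smult[OF v, of "- a"] u0(2) by simp_all
    then obtain p where "x = p \<cdot>\<^sub>v vec 3 \<nu>" using bour_syz_zero_iff by blast
    then have "\<phi> x = 0" using ker x(1) by blast
    moreover have "\<phi> x = bour (($) v) * q + (- a) * \<phi> v"
      unfolding x_def q_def using add m sm u0(1) v by simp
    ultimately show ?thesis by (simp add: algebra_simps)
  qed
  obtain g p' q' where g: "a = g * p'" "q = g * q'" "no_common_prime p' q'"
    by (rule reduce_common_primes[of a q]) (use w(3) in \<open>simp_all add: a_def\<close>)
  have n: "g \<noteq> 0" "p' \<noteq> 0" using g(1) w(3) by (auto simp: a_def)
  have proportional': "p' * \<phi> v = q' * bour (($) v)" if v: "v \<in> syz" for v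
  proof -
    have "g * (p' * \<phi> v) = g * (q' * bour (($) v))" using proportional[OF v] unfolding g(1,2) by (simp only: mult.assoc)
    then show ?thesis using n(1) by (simp only: mult_cancel_left) simp
  qed
  \<comment> \<open>Dividing all of \<open>bour_ideal\<close>, p' divides in particular two coprime
    combinations of the coordinates of \<nu>, so it is a unit.\<close>
  have pd: "p' dvd h" if "h \<in> bour_ideal" for h
  proof -
    obtain v where v: "v \<in> syz" "h = bour (($) v)" using \<open>h \<in> bour_ideal\<close> bour_image_syz by blast
    have "p' dvd q' * h" using proportional'[OF v(1)] v(2) by (metis dvd_triv_left)
    then show ?thesis by (rule no_common_prime_dvd[OF n(2) g(3)])
  qed
  have "p' dvd 1"
  proof (rule ccontr)
    assume "\<not> p' dvd 1"
    then obtain r where r: "prime_elem r" "r dvd p'" using prime_dvd_exists[OF n(2)] by auto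
    then have "r dvd dot \<nu> w1" "r dvd dot \<nu> w2" using pd[OF dot_nu_in_bour_ideal] dvd_trans[OF r(2)] by auto
    then show False using w(4) r(1) unfolding no_common_prime_def by blast
  qed
  then obtain s where s: "1 = p' * s" by (rule dvdE)
  define c where "c = s * q'"
  have phi: "\<phi> v = c * bour (($) v)" if v: "v \<in> syz" for v
  proof -
    have "\<phi> v = (p' * s) * \<phi> v" by (simp flip: s)
    also have "\<dots> = s * (p' * \<phi> v)" by (simp only: ac_simps)
    also have "\<dots> = c * bour (($) v)" by (simp only: proportional'[OF v] c_def mult.assoc)
    finally show ?thesis .
  qed
  have "c dvd 1"
  proof (rule ideal_height_2_common_divisor[OF I(2)])
    fix x assume "x \<in> I"
    then obtain v where "v \<in> syz" "x = \<phi> v" using im by blast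
    then show "c dvd x" by (simp add: phi)
  qed
  then obtain r where r: "1 = c * r" by (rule dvdE)
  show ?thesis
  proof (intro equalityI subsetI)
    fix x assume "x \<in> I"
    then obtain v where v: "v \<in> syz" "x = \<phi> v" using im by blast
    have "bour (($) v) \<in> bour_ideal" using v(1) bour_image_syz by blast
    then show "x \<in> bour_ideal" unfolding v(2) phi[OF v(1)] by (rule is_idealD(3)[OF is_ideal_bour_ideal])
  next
    fix x assume "x \<in> bour_ideal"
    then obtain v where v: "v \<in> syz" "x = bour (($) v)" using bour_image_syz by blast
    have "r * \<phi> v \<in> I" using im v(1) by (intro is_idealD(3)[OF I(1)]) blast
    moreover have "r * \<phi> v = (c * r) * x" unfolding phi[OF v(1)] v(2) by (simp only: ac_simps)
    ultimately show "x \<in> I" by (simp flip: r)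
  qed
qed

section \<open>Homogeneous and minimal generators of the syzygy module\<close>

lemma mat_of_cols_mult_vec:
  fixes us :: "('n, 'k) mpoly vec list"
  assumes "set us \<subseteq> carrier_vec 3" "w \<in> carrier_vec (length us)"
  shows "mat_of_cols 3 us *\<^sub>v w = vec 3 (\<lambda>j. \<Sum>i<length us. w $ i * us ! i $ j)"
  using assms by (intro eq_vecI) (auto simp: scalar_prod_def mat_of_cols_index atLeast0LessThan mult.commute intro!: sum.cong)

lemma mat_image_cols:
  fixes us :: "('n, 'k) mpoly vec list"
  assumes "set us \<subseteq> carrier_vec 3"
  shows "mat_image (mat_of_cols 3 us) = {vec 3 (\<lambda>j. \<Sum>i<length us. c i * us ! i $ j) | c. True}"
  unfolding mat_image_def
proof (intro equalityI subsetI)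
  fix v assume "v \<in> {mat_of_cols 3 us *\<^sub>v w |w. w \<in> carrier_vec (dim_col (mat_of_cols 3 us))}"
  then obtain w where "w \<in> carrier_vec (length us)" "v = mat_of_cols 3 us *\<^sub>v w" by auto
  then show "v \<in> {vec 3 (\<lambda>j. \<Sum>i<length us. c i * us ! i $ j) | c. True}" using mat_of_cols_mult_vec[OF assms] by blast
next
  fix v assume "v \<in> {vec 3 (\<lambda>j. \<Sum>i<length us. c i * us ! i $ j) | c. True}"
  then obtain c where v: "v = vec 3 (\<lambda>j. \<Sum>i<length us. c i * us ! i $ j)" by blast
  have "mat_of_cols 3 us *\<^sub>v vec (length us) c = vec 3 (\<lambda>j. \<Sum>i<length us. vec (length us) c $ i * us ! i $ j)"
    by (rule mat_of_cols_mult_vec[OF assms]) simp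
  also have "\<dots> = v" unfolding v by (intro eq_vecI) (auto intro!: sum.cong)
  finally have "mat_of_cols 3 us *\<^sub>v vec (length us) c = v" .
  moreover have "vec (length us) c \<in> carrier_vec (dim_col (mat_of_cols 3 us))" by simp
  ultimately show "v \<in> {mat_of_cols 3 us *\<^sub>v w |w. w \<in> carrier_vec (dim_col (mat_of_cols 3 us))}" by blast
qed

lemma ideal_span_list: "x \<in> ideal_span (set gs) \<Longrightarrow> \<exists>c. x = (\<Sum>i<length gs. c i * gs ! i)" for x :: "('n, 'k) mpoly"
proof (induction gs arbitrary: x)
  case Nil then show ?case by (simp add: ideal_span_empty)
next
  case (Cons g gs)
  then obtain r y where y: "x = r * g + y" "y \<in> ideal_span (set gs)" by (auto simp: ideal_span_insert)
  obtain c where c: "y = (\<Sum>i<length gs. c i * gs ! i)" using Cons.IH[OF y(2)] ..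
  show ?case
    by (intro exI[of _ "\<lambda>i. case i of 0 \<Rightarrow> r | Suc j \<Rightarrow> c j"])
      (simp add: y(1) c sum.lessThan_Suc_shift del: sum.lessThan_Suc)
qed

definition homogeneous_generators :: "('n, 'k) mpoly vec list \<Rightarrow> bool" where
  "homogeneous_generators us \<longleftrightarrow> set us \<subseteq> carrier_vec 3 \<and> (\<forall>u\<in>set us. \<exists>t. homogeneous_vec t u) \<and> mat_image (mat_of_cols 3 us) = syz"

lemma syz_sum: "finite A \<Longrightarrow> (\<And>i. i \<in> A \<Longrightarrow> dot (U i) f = 0) \<Longrightarrow>
  dot (\<lambda>j. \<Sum>i\<in>A. c i * U i j) f = 0 \<and> bour (\<lambda>j. \<Sum>i\<in>A. c i * U i j) = (\<Sum>i\<in>A. c i * bour (U i))"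
proof (induction A rule: finite_induct)
  case empty then show ?case by (simp add: dot_def bour_zero)
next
  case (insert x A)
  have 1: "dot (\<lambda>j. c x * U x j) f = 0" "bour (\<lambda>j. c x * U x j) = c x * bour (U x)"
    using insert.prems[of x] by (simp_all add: dot_scale bour_scale)
  have 2: "dot (\<lambda>j. \<Sum>i\<in>A. c i * U i j) f = 0" "bour (\<lambda>j. \<Sum>i\<in>A. c i * U i j) = (\<Sum>i\<in>A. c i * bour (U i))"
    using insert by simp_all
  show ?case using bour_add[OF 1(1) 2(1)] 1 2 insert.hyps by (simp add: dot_add)
qed

text \<open>For a syzygy v there is a combination of the \<open>Us\<close> with the same image under
  \<open>bour\<close>; the difference lies in the kernel R\<nu>. Both the existence of homogeneous
  generators and the matrices of the resolutions rest on this.\<close>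

lemma mat_image_syz:
  assumes Us: "\<And>i. i < length Us \<Longrightarrow> dot (Us ! i) f = 0" and span: "bour_ideal \<subseteq> ideal_span (set (map bour Us))"
  shows "mat_image (mat_of_cols 3 (vec 3 \<nu> # map (vec 3) Us)) = syz"
proof -
  define us where "us = vec 3 \<nu> # map (vec 3) Us"
  have us3: "set us \<subseteq> carrier_vec 3" by (auto simp: us_def)
  have sum_us: "vec 3 (\<lambda>j. \<Sum>i<length us. c i * us ! i $ j) = vec 3 (\<lambda>j. c 0 * \<nu> j + (\<Sum>i<length Us. c (Suc i) * (Us ! i) j))" for c
    by (rule eq_vecI) (simp_all add: us_def sum.lessThan_Suc_shift del: sum.lessThan_Suc)
  have S: "dot (\<lambda>j. \<Sum>i<length Us. c i * (Us ! i) j) f = 0 \<and> bour (\<lambda>j. \<Sum>i<length Us. c i * (Us ! i) j) = (\<Sum>i<length Us. c i * bour (Us ! i))" for c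
    using syz_sum[of "{..<length Us}" "\<lambda>i. Us ! i" c] Us by simp
  have "mat_image (mat_of_cols 3 us) = syz"
    unfolding mat_image_cols[OF us3] sum_us
  proof (intro equalityI subsetI)
    fix v assume "v \<in> {vec 3 (\<lambda>j. c 0 * \<nu> j + (\<Sum>i<length Us. c (Suc i) * (Us ! i) j)) | c. True}"
    then obtain c where v: "v = vec 3 (\<lambda>j. c 0 * \<nu> j + (\<Sum>i<length Us. c (Suc i) * (Us ! i) j))" by blast
    have "dot (\<lambda>j. c 0 * \<nu> j + (\<Sum>i<length Us. c (Suc i) * (Us ! i) j)) f = 0"
      using S[of "\<lambda>i. c (Suc i)"] nu_syz by (simp add: dot_add dot_scale)
    then show "v \<in> syz" unfolding v by (rule vec_syz)
  next
    fix v assume v: "v \<in> syz"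
    then have vf: "dot (($) v) f = 0" by (simp add: syz_def)
    have "bour (($) v) \<in> ideal_span (set (map bour Us))" using bour_in_bour_ideal[OF vf] span by blast
    then obtain c where c: "bour (($) v) = (\<Sum>i<length Us. c i * bour (Us ! i))" using ideal_span_list[of _ "map bour Us"] by auto
    define z where "z = (\<lambda>j. \<Sum>i<length Us. c i * (Us ! i) j)"
    have z: "dot z f = 0" "bour z = bour (($) v)" unfolding z_def using S[of c] c by simp_all
    have mz: "dot (\<lambda>j. (- 1) * z j) f = 0" "bour (\<lambda>j. (- 1) * z j) = - bour z"
      by (simp only: dot_scale z mult_zero_right) (simp only: bour_scale[OF z(1)], simp)
    have "dot (\<lambda>j. v $ j + (- 1) * z j) f = 0" "bour (\<lambda>j. v $ j + (- 1) * z j) = 0"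
      by (simp only: dot_add vf mz add_0_left) (simp only: bour_add[OF vf mz(1)] mz(2) z(2) right_minus)
    then obtain h where h: "\<forall>i<3. v $ i + (- 1) * z i = h * \<nu> i" using bour_eq_0_iff by blast
    have "v = vec 3 (\<lambda>j. h * \<nu> j + z j)"
    proof (rule eq_vecI)
      fix i assume "i < dim_vec (vec 3 (\<lambda>j. h * \<nu> j + z j))"
      then have i: "i < 3" by simp
      then have "v $ i = h * \<nu> i + z i" using h by (simp add: algebra_simps)
      then show "v $ i = vec 3 (\<lambda>j. h * \<nu> j + z j) $ i" using i by simp
    qed (use v in \<open>simp add: syz_def\<close>)
    then show "v \<in> {vec 3 (\<lambda>j. c 0 * \<nu> j + (\<Sum>i<length Us. c (Suc i) * (Us ! i) j)) | c. True}"
      unfolding z_def by (intro CollectI exI[of _ "\<lambda>i. case i of 0 \<Rightarrow> h | Suc j \<Rightarrow> c j"]) simp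
  qed
  then show ?thesis by (simp only: us_def)
qed

text \<open>Homogeneous generators of the Bourbaki ideal are lifted to homogeneous syzygies and
  completed by \<nu>.\<close>

lemma homogeneous_generators_exist: "\<exists>us. homogeneous_generators us"
proof -
  obtain G where G: "finite G" "G \<subseteq> bour_ideal" "\<And>g. g \<in> G \<Longrightarrow> \<exists>t. homogeneous t g" "bour_ideal = ideal_span G"
    using homogeneous_ideal_finitely_generated[OF is_ideal_bour_ideal hcomp_bour_ideal] by metis
  obtain gs where gs: "set gs = G" using finite_list[OF G(1)] by blast
  have "\<forall>g\<in>G. \<exists>u. dot u f = 0 \<and> bour u = g \<and> (\<exists>t. \<forall>i. homogeneous t (u i))"
  proof
    fix g assume g: "g \<in> G"
    obtain t where t: "homogeneous t g" using G(3)[OF g] by blast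
    obtain u where u: "dot u f = 0" "g = bour u" using bour_idealE[of g] G(2) g by blast
    define s where "s = t - (int e - int d)"
    have "bour (\<lambda>i. hcomp s (u i)) = g"
      using hcomp_bour(2)[OF u(1), of s] hcomp_homogeneous[OF t, of t] u(2) by (simp add: s_def)
    then show "\<exists>u. dot u f = 0 \<and> bour u = g \<and> (\<exists>t. \<forall>i. homogeneous t (u i))"
      using hcomp_bour(1)[OF u(1), of s] by (intro exI[of _ "\<lambda>i. hcomp s (u i)"] conjI exI[of _ s] allI homogeneous_hcomp)
  qed
  from bchoice[OF this] obtain U where U: "\<forall>g\<in>G. dot (U g) f = 0 \<and> bour (U g) = g \<and> (\<exists>t. \<forall>i. homogeneous t (U g i))" ..
  define us where "us = vec 3 \<nu> # map (\<lambda>g. vec 3 (U g)) gs"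
  have us3: "set us \<subseteq> carrier_vec 3" by (auto simp: us_def)
  have hom: "\<exists>t. homogeneous_vec t u" if "u \<in> set us" for u
  proof -
    have "u = vec 3 \<nu> \<or> (\<exists>g\<in>G. u = vec 3 (U g))" using that gs by (auto simp: us_def)
    then show ?thesis
    proof
      assume "u = vec 3 \<nu>"
      then show ?thesis using hom_nu by (intro exI[of _ "int e"]) (simp add: homogeneous_vec_def)
    next
      assume "\<exists>g\<in>G. u = vec 3 (U g)"
      then obtain g t where "u = vec 3 (U g)" "\<forall>i. homogeneous t (U g i)" using U by blast
      then show ?thesis by (intro exI[of _ t]) (simp add: homogeneous_vec_def)
    qed
  qed
  have Ugs: "dot (map U gs ! i) f = 0" if "i < length (map U gs)" for i
    using U gs nth_mem[of i gs] that by auto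
  have "map bour (map U gs) = gs" using U gs by (intro nth_equalityI) auto
  then have "mat_image (mat_of_cols 3 (vec 3 \<nu> # map (vec 3) (map U gs))) = syz"
    using G(4) gs by (intro mat_image_syz Ugs) simp_all
  then have "mat_image (mat_of_cols 3 us) = syz" unfolding us_def by (simp add: comp_def)
  then show ?thesis using us3 hom unfolding homogeneous_generators_def by blast
qed

text \<open>This makes the definite description in \<open>bourbaki_degree\<close> nonempty. A
  shortest list of homogeneous generators is irredundant, and one of its members has degree e, for
  otherwise \<nu> could not be generated.\<close>

lemma minimal_generator_exists:
  obtains v where "minimal_generator 3 syz v" "homogeneous_vec (int e) v"
proof -
  obtain us where us: "homogeneous_generators us" "\<And>vs. homogeneous_generators vs \<Longrightarrow> length us \<le> length vs"
    using homogeneous_generators_exist ex_has_least_nat[of homogeneous_generators _ length] by metis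
  have us3: "set us \<subseteq> carrier_vec 3" and ush: "\<forall>u\<in>set us. \<exists>t. homogeneous_vec t u" and img: "mat_image (mat_of_cols 3 us) = syz"
    using us(1) unfolding homogeneous_generators_def by simp_all
  have min: "mat_image (mat_of_cols 3 (take i us @ drop (Suc i) us)) \<noteq> syz" if i: "i < length us" for i
  proof
    assume m: "mat_image (mat_of_cols 3 (take i us @ drop (Suc i) us)) = syz"
    have sub: "set (take i us @ drop (Suc i) us) \<subseteq> set us" using set_take_subset[of i us] set_drop_subset[of "Suc i" us] by auto
    then have "homogeneous_generators (take i us @ drop (Suc i) us)"
      using us3 ush m unfolding homogeneous_generators_def by (meson subset_trans subsetD)
    then have "length us \<le> length (take i us @ drop (Suc i) us)" by (rule us(2))
    then show False using i by simp
  qed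
  have in_syz: "us ! i \<in> syz" if i: "i < length us" for i
  proof -
    have "us ! i = vec 3 (\<lambda>j. \<Sum>l<length us. (if l = i then 1 else 0) * us ! l $ j)"
    proof (rule eq_vecI)
      show "dim_vec (us ! i) = dim_vec (vec 3 (\<lambda>j. \<Sum>l<length us. (if l = i then 1 else 0) * us ! l $ j))"
        using us3 nth_mem[OF i] by auto
      fix j assume "j < dim_vec (vec 3 (\<lambda>j. \<Sum>l<length us. (if l = i then 1 else 0) * us ! l $ j))"
      moreover have "(\<Sum>l<length us. (if l = i then 1 else 0) * us ! l $ j) = (\<Sum>l<length us. if l = i then us ! l $ j else 0)"
        by (intro sum.cong refl) simp
      ultimately show "us ! i $ j = vec 3 (\<lambda>j. \<Sum>l<length us. (if l = i then 1 else 0) * us ! l $ j) $ j"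
        using i by simp
    qed
    then have "us ! i \<in> mat_image (mat_of_cols 3 us)" unfolding mat_image_cols[OF us3]
      by (intro CollectI exI[of _ "\<lambda>l. if l = i then 1 else 0"] conjI TrueI)
    then show ?thesis using img by simp
  qed
  have "vec 3 \<nu> \<in> mat_image (mat_of_cols 3 us)" using img nu_vec_syz by simp
  then obtain c where c: "vec 3 \<nu> = vec 3 (\<lambda>j. \<Sum>i<length us. c i * us ! i $ j)" unfolding mat_image_cols[OF us3] by blast
  have "\<exists>i<length us. homogeneous_vec (int e) (us ! i)"
  proof (rule ccontr)
    assume n: "\<not> ?thesis"
    \<comment> \<open>A generator of degree below e vanishes by minimality, and one of degree above
      e would need a coefficient of negative degree.\<close>
    have z: "hcomp (int e) (c i * us ! i $ j) = 0" if i: "i < length us" and j: "j < 3" for i j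
    proof -
      obtain t where t: "homogeneous_vec t (us ! i)" using ush nth_mem[OF i] by blast
      have d3: "dim_vec (us ! i) = 3" using us3 nth_mem[OF i] by auto
      have tj: "homogeneous t (us ! i $ l)" if "l < 3" for l using t d3 that by (simp add: homogeneous_vec_def)
      have te: "t \<noteq> int e" using n i t by blast
      show ?thesis
      proof (cases "t < int e")
        case True
        have "dot (($) (us ! i)) f = 0" using in_syz[OF i] by (simp add: syz_def)
        then have "\<forall>l<3. us ! i $ l = 0" by (rule min_deg[OF _ tj True])
        then show ?thesis using j by simp
      next
        case False
        then have "hcomp (int e - t) (c i) = 0" using te by (intro homogeneous_neg[OF _ homogeneous_hcomp]) simp
        then show ?thesis by (simp add: hcomp_mult_homogeneous[OF tj[OF j]])
      qed
    qed
    obtain k where k: "k < 3" "\<nu> k \<noteq> 0" using nu_nz by blast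
    have "\<nu> k = (\<Sum>i<length us. c i * us ! i $ k)" using arg_cong[OF c, of "\<lambda>v. v $ k"] k(1) by simp
    then have "hcomp (int e) (\<nu> k) = (\<Sum>i<length us. hcomp (int e) (c i * us ! i $ k))" by (simp add: hcomp_sum)
    also have "\<dots> = 0" using z k(1) by (intro sum.neutral) simp
    finally show False using k hcomp_homogeneous[OF hom_nu[OF k(1)], of "int e"] by simp
  qed
  then obtain i where i: "i < length us" "homogeneous_vec (int e) (us ! i)" by blast
  have "minimal_generator 3 syz (us ! i)"
    unfolding minimal_generator_def using i(1) us3 ush img min by (intro exI[of _ us]) auto
  then show ?thesis using i(2) by (rule that)
qed

text \<open>A zero generator could be left out, against irredundancy.\<close>

lemma minimal_generator_nonzero:
  assumes "minimal_generator 3 syz v" shows "v \<in> syz" "v \<noteq> 0\<^sub>v 3"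
proof -
  obtain us where us: "v \<in> set us" "set us \<subseteq> carrier_vec 3" "mat_image (mat_of_cols 3 us) = syz"
    "\<forall>i<length us. mat_image (mat_of_cols 3 (take i us @ drop (Suc i) us)) \<noteq> syz"
    using assms unfolding minimal_generator_def by blast
  obtain i where i: "i < length us" "us ! i = v" using us(1) by (auto simp: in_set_conv_nth)
  have v3: "v \<in> carrier_vec 3" using us by blast
  have "v = vec 3 (\<lambda>j. \<Sum>l<length us. (if l = i then 1 else 0) * us ! l $ j)"
  proof (rule eq_vecI)
    show "dim_vec v = dim_vec (vec 3 (\<lambda>j. \<Sum>l<length us. (if l = i then 1 else 0) * us ! l $ j))" using v3 by simp
    fix j assume "j < dim_vec (vec 3 (\<lambda>j. \<Sum>l<length us. (if l = i then 1 else 0) * us ! l $ j))"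
    moreover have "(\<Sum>l<length us. (if l = i then 1 else 0) * us ! l $ j) = (\<Sum>l<length us. if l = i then us ! l $ j else 0)"
      by (intro sum.cong refl) simp
    ultimately show "v $ j = vec 3 (\<lambda>j. \<Sum>l<length us. (if l = i then 1 else 0) * us ! l $ j) $ j"
      using i by simp
  qed
  then have "v \<in> mat_image (mat_of_cols 3 us)" unfolding mat_image_cols[OF us(2)]
    by (intro CollectI exI[of _ "\<lambda>l. if l = i then 1 else 0"] conjI TrueI)
  then show "v \<in> syz" using us(3) by simp
  show "v \<noteq> 0\<^sub>v 3"
  proof
    assume v0: "v = 0\<^sub>v 3"
    define vs where "vs = take i us @ drop (Suc i) us"
    have use: "us = take i us @ v # drop (Suc i) us" using id_take_nth_drop[OF i(1)] i(2) by simp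
    have vs3: "set vs \<subseteq> carrier_vec 3" using us(2) set_take_subset[of i us] set_drop_subset[of "Suc i" us] by (auto simp: vs_def)
    have lv: "length us = Suc (length vs)" "i \<le> length vs" using i(1) by (simp_all add: vs_def)
    have "mat_image (mat_of_cols 3 vs) = mat_image (mat_of_cols 3 us)"
      unfolding mat_image_cols[OF us(2)] mat_image_cols[OF vs3]
    proof (intro equalityI subsetI)
      have usl: "us ! l = vs ! l" if "l < i" for l using that i(1) by (simp add: vs_def nth_append)
      have usr: "us ! Suc l = vs ! l" if "i \<le> l" "l < length vs" for l
        using that i(1) by (simp add: vs_def nth_append)
      have split: "(\<Sum>l<length us. g l) = (\<Sum>l<i. g l) + g i + (\<Sum>l\<in>{i..<length vs}. g (Suc l))" for g :: "nat \<Rightarrow> ('n, 'k) mpoly"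
      proof -
        have "(\<Sum>l<length us. g l) = (\<Sum>l<i. g l) + (g i + (\<Sum>l\<in>{Suc i..<length us}. g l))"
          using sum.atLeastLessThan_concat[of 0 i "length us" g] sum.atLeast_Suc_lessThan[OF i(1), of g] i(1)
          by (simp add: lessThan_atLeast0)
        also have "(\<Sum>l\<in>{Suc i..<length us}. g l) = (\<Sum>l\<in>{i..<length vs}. g (Suc l))"
          unfolding lv(1) by (rule sum.shift_bounds_Suc_ivl)
        finally show ?thesis by (simp add: add.assoc)
      qed
      have split': "(\<Sum>l<length vs. g l) = (\<Sum>l<i. g l) + (\<Sum>l\<in>{i..<length vs}. g l)" for g :: "nat \<Rightarrow> ('n, 'k) mpoly"
      proof -
        show ?thesis using sum.atLeastLessThan_concat[of 0 i "length vs" g] lv(2) by (simp add: lessThan_atLeast0)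
      qed
      \<comment> \<open>Coefficients for \<open>us\<close> and for \<open>vs\<close> correspond by
        skipping position i, whose summand is zero.\<close>
      have key: "vec 3 (\<lambda>j. \<Sum>l<length us. c l * us ! l $ j) = vec 3 (\<lambda>j. \<Sum>l<length vs. c' l * vs ! l $ j)"
        if "\<And>l. l < i \<Longrightarrow> c l = c' l" "\<And>l. i \<le> l \<Longrightarrow> c (Suc l) = c' l" for c c'
      proof (rule eq_vecI)
        fix j assume "j < dim_vec (vec 3 (\<lambda>j. \<Sum>l<length vs. c' l * vs ! l $ j))"
        then have j: "j < 3" by simp
        have "(\<Sum>l<length us. c l * us ! l $ j) = (\<Sum>l<length vs. c' l * vs ! l $ j)"
        proof -
          have "(\<Sum>l<i. c l * us ! l $ j) = (\<Sum>l<i. c' l * vs ! l $ j)" by (intro sum.cong refl) (simp add: that usl)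
          moreover have "(\<Sum>l\<in>{i..<length vs}. c (Suc l) * us ! Suc l $ j) = (\<Sum>l\<in>{i..<length vs}. c' l * vs ! l $ j)"
            by (intro sum.cong refl) (simp add: that usr)
          moreover have "us ! i $ j = 0" using i(2) v0 j by simp
          ultimately show ?thesis unfolding split split' by simp
        qed
        then show "vec 3 (\<lambda>j. \<Sum>l<length us. c l * us ! l $ j) $ j = vec 3 (\<lambda>j. \<Sum>l<length vs. c' l * vs ! l $ j) $ j"
          using j by simp
      qed simp
      fix x
      {
        assume "x \<in> {vec 3 (\<lambda>j. \<Sum>l<length us. c l * us ! l $ j) | c. True}"
        then obtain c where x: "x = vec 3 (\<lambda>j. \<Sum>l<length us. c l * us ! l $ j)" by blast
        have "x = vec 3 (\<lambda>j. \<Sum>l<length vs. (if l < i then c l else c (Suc l)) * vs ! l $ j)"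
          unfolding x by (rule key) simp_all
        then show "x \<in> {vec 3 (\<lambda>j. \<Sum>l<length vs. c l * vs ! l $ j) | c. True}"
          by (intro CollectI exI[of _ "\<lambda>l. if l < i then c l else c (Suc l)"] conjI TrueI)
      }
      {
        assume "x \<in> {vec 3 (\<lambda>j. \<Sum>l<length vs. c l * vs ! l $ j) | c. True}"
        then obtain c where x: "x = vec 3 (\<lambda>j. \<Sum>l<length vs. c l * vs ! l $ j)" by blast
        have "x = vec 3 (\<lambda>j. \<Sum>l<length us. (if l < i then c l else c (l - 1)) * us ! l $ j)"
          unfolding x by (rule key[symmetric]) simp_all
        then show "x \<in> {vec 3 (\<lambda>j. \<Sum>l<length us. c l * us ! l $ j) | c. True}"
          by (intro CollectI exI[of _ "\<lambda>l. if l < i then c l else c (l - 1)"] conjI TrueI)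
      }
    qed
    then show False using us(3,4) i(1) unfolding vs_def by simp
  qed
qed

lemma three_forms_other:
  assumes "v \<in> syz" "v \<noteq> 0\<^sub>v 3" "homogeneous_vec (int e) v" shows "three_forms f d e (($) v)"
proof
  have v3: "dim_vec v = 3" using assms(1) by (simp add: syz_def)
  show "homogeneous (int e) (v $ i)" if "i < 3" for i using assms(3) that v3 by (simp add: homogeneous_vec_def)
  show "\<exists>i<3. v $ i \<noteq> 0"
  proof (rule ccontr)
    assume "\<not> ?thesis"
    then have "v = 0\<^sub>v 3" using v3 by (intro eq_vecI) simp_all
    then show False using assms(2) by simp
  qed
  show "dot (($) v) f = 0" using assms(1) by (simp add: syz_def)
qed (fact hom_f prim_f f_nz min_deg n3)+

text \<open>Every minimal generator of degree e is an instance of the locale with a Bourbaki ideal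
  of its own. By \<open>dim_relation\<close> all these ideals have the same Hilbert function, so the
  description singles out one number.\<close>

lemma bourbaki_degree_eq:
  assumes np: "\<not> (perfect_ideal (ideal_span {f 0, f 1, f 2}) \<and> ideal_height (ideal_span {f 0, f 1, f 2}) = 2)"
    and e: "indeg syz = e" and unit: "\<And>\<nu>'. three_forms f d e \<nu>' \<Longrightarrow> 1 \<notin> three_forms.bour_ideal f \<nu>'"
  shows "bourbaki_degree (f 0) (f 1) (f 2) = ideal_multiplicity bour_ideal"
proof -
  let ?Q = "\<lambda>b. \<exists>\<nu> I. minimal_generator 3 syz \<nu> \<and> homogeneous_vec (int (indeg syz)) \<nu> \<and> bourbaki_ideal syz \<nu> I \<and> b = ideal_multiplicity I"
  have same: "ideal_multiplicity (three_forms.bour_ideal f \<nu>') = ideal_multiplicity bour_ideal" if t: "three_forms f d e \<nu>'" for \<nu>'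
  proof -
    interpret o: three_forms f d e \<nu>' by (rule t)
    have "P.dim {p \<in> o.bour_ideal. homogeneous (int t) p} = P.dim {p \<in> bour_ideal. homogeneous (int t) p}" for t
      using o.dim_relation[of "int t - (int e - int d)"] dim_relation[of "int t - (int e - int d)"] by simp
    then have "hilbert_function o.bour_ideal = hilbert_function bour_ideal" by (simp add: hilbert_function_def fun_eq_iff)
    then show ?thesis unfolding ideal_multiplicity_def hilbert_polynomial_def by (simp only:)
  qed
  have locale_of: "three_forms f d e (($) v) \<and> vec 3 (($) v) = v" if "minimal_generator 3 syz v" "homogeneous_vec (int e) v" for v
  proof -
    note mg = minimal_generator_nonzero[OF that(1)]
    have "vec 3 (($) v) = v" using mg(1) by (intro eq_vecI) (auto simp: syz_def)
    then show ?thesis using three_forms_other[OF mg that(2)] by simp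
  qed
  have "(THE b. ?Q b) = ideal_multiplicity bour_ideal"
  proof (rule the_equality)
    obtain v where v: "minimal_generator 3 syz v" "homogeneous_vec (int e) v" by (rule minimal_generator_exists)
    interpret o: three_forms f d e "($) v" using locale_of[OF v] by simp
    have "bourbaki_ideal syz v o.bour_ideal"
      using o.bourbaki_ideal_bour_ideal[OF unit[OF o.three_forms_axioms]] locale_of[OF v] by (simp add: syz_def o.syz_def)
    then show "?Q (ideal_multiplicity bour_ideal)"
      using v e same[OF o.three_forms_axioms] by (intro exI[of _ v] exI[of _ o.bour_ideal]) simp
  next
    fix b assume "?Q b"
    then obtain v I where v: "minimal_generator 3 syz v" "homogeneous_vec (int e) v" "bourbaki_ideal syz v I" "b = ideal_multiplicity I"
      using e by auto
    interpret o: three_forms f d e "($) v" using locale_of[OF v(1,2)] by simp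
    have "I = o.bour_ideal"
      using o.bourbaki_ideal_unique[of I] v(3) locale_of[OF v(1,2)] by (simp add: syz_def o.syz_def)
    then show "b = ideal_multiplicity bour_ideal" using v(4) same[OF o.three_forms_axioms] by simp
  qed
  then show ?thesis unfolding bourbaki_degree_def Let_def syz_eq if_not_P[OF np] .
qed

end

section \<open>Graded free resolutions of ideals of height two\<close>

text \<open>The unit ideal lies in no prime, and the infimum of the empty set is
  \<infinity>.\<close>

lemma one_notin_of_ideal_height: "ideal_height J = 2 \<Longrightarrow> 1 \<notin> J"
proof
  assume h: "ideal_height J = 2" and 1: "1 \<in> J"
  have e: "{P. prime_ideal P \<and> J \<subseteq> P} = {}" using 1 by (auto simp: prime_ideal_def)
  have "ideal_height J = \<infinity>" unfolding ideal_height_def e by (simp add: top_enat_def)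
  then show False using h by simp
qed

section \<open>Lifting maps through exact sequences of matrices\<close>

lemma mult_mat_vec_index_sum:
  "A \<in> carrier_mat r c \<Longrightarrow> w \<in> carrier_vec c \<Longrightarrow> i < r \<Longrightarrow> (A *\<^sub>v w) $ i = (\<Sum>j<c. A $$ (i, j) * w $ j)"
  by (auto simp: scalar_prod_def atLeast0LessThan)

lemma mat_kernel_iff: "A \<in> carrier_mat r c \<Longrightarrow> w \<in> mat_kernel A \<longleftrightarrow> w \<in> carrier_vec c \<and> A *\<^sub>v w = 0\<^sub>v r"
  by (auto simp: mat_kernel_def)

lemma mat_imageI: "A \<in> carrier_mat r c \<Longrightarrow> w \<in> carrier_vec c \<Longrightarrow> A *\<^sub>v w \<in> mat_image A"
  unfolding mat_image_def by auto

lemma mat_imageE: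
  assumes "v \<in> mat_image A" "A \<in> carrier_mat r c" obtains w where "w \<in> carrier_vec c" "v = A *\<^sub>v w"
  using assms unfolding mat_image_def by auto

lemma mat_mult_unit_vec: "A \<in> carrier_mat r c \<Longrightarrow> j < c \<Longrightarrow> A *\<^sub>v unit_vec c j = col A (j::nat)"
  for A :: "'a::comm_ring_1 mat"
  by (intro eq_vecI) auto

lemma col_in_mat_image: "A \<in> carrier_mat r c \<Longrightarrow> j < c \<Longrightarrow> col A j \<in> mat_image A"
  for A :: "'a::comm_ring_1 mat"
  using mat_imageI[of A r c "unit_vec c j"] mat_mult_unit_vec[of A r c j] by simp

text \<open>Free modules are projective: a preimage is chosen for each column.\<close>

lemma mat_factor:
  fixes B C :: "'a::comm_ring_1 mat"
  assumes B: "B \<in> carrier_mat r m" and C: "C \<in> carrier_mat r k" and im: "\<And>j. j < k \<Longrightarrow> col C j \<in> mat_image B"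
  obtains H where "H \<in> carrier_mat m k" "C = B * H"
proof -
  have "\<forall>j. \<exists>h. j < k \<longrightarrow> h \<in> carrier_vec m \<and> col C j = B *\<^sub>v h"
    using im mat_imageE[OF _ B] by metis
  from choice[OF this] obtain h where h: "\<And>j. j < k \<Longrightarrow> h j \<in> carrier_vec m" "\<And>j. j < k \<Longrightarrow> col C j = B *\<^sub>v h j" by blast
  define H where "H = mat m k (\<lambda>(i, j). h j $ i)"
  have H: "H \<in> carrier_mat m k" by (simp add: H_def)
  have "C = B * H"
  proof (rule eq_matI)
    fix i j assume "i < dim_row (B * H)" "j < dim_col (B * H)"
    then have ij: "i < r" "j < k" using B by (simp_all add: H_def)
    have "col H j = h j" using h(1)[OF ij(2)] ij(2) by (intro eq_vecI) (auto simp: H_def)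
    then have "(B * H) $$ (i, j) = (B *\<^sub>v h j) $ i" using B H ij by simp
    also have "\<dots> = C $$ (i, j)" unfolding h(2)[OF ij(2), symmetric] using C ij by simp
    finally show "C $$ (i, j) = (B * H) $$ (i, j)" by simp
  qed (use B C H in auto)
  with H show ?thesis by (rule that)
qed

lemma mat_factor_kernel:
  fixes A B C :: "'a::comm_ring_1 mat"
  assumes A: "A \<in> carrier_mat n r" and B: "B \<in> carrier_mat r m" and ker: "mat_kernel A = mat_image B"
    and C: "C \<in> carrier_mat r k" and 0: "A * C = 0\<^sub>m n k"
  obtains H where "H \<in> carrier_mat m k" "C = B * H"
proof (rule mat_factor[OF B C])
  fix j assume j: "j < k"
  have "A *\<^sub>v col C j = col (A * C) j" using A C j by (intro eq_vecI) auto
  also have "\<dots> = 0\<^sub>v n" unfolding 0 using j by (intro eq_vecI) auto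
  finally have "col C j \<in> mat_kernel A" using mat_kernel_iff[OF A] C j by simp
  then show "col C j \<in> mat_image B" using ker by simp
qed

lemma mat_mult_eq_zero:
  fixes A B :: "'a::comm_ring_1 mat"
  assumes A: "A \<in> carrier_mat n r" and B: "B \<in> carrier_mat r m" and ker: "mat_kernel A = mat_image B"
  shows "A * B = 0\<^sub>m n m"
proof (rule eq_matI)
  fix i j assume "i < dim_row (0\<^sub>m n m :: 'a mat)" "j < dim_col (0\<^sub>m n m :: 'a mat)"
  then have ij: "i < n" "j < m" by simp_all
  have "col B j \<in> mat_kernel A" unfolding ker by (rule col_in_mat_image[OF B ij(2)])
  then have "A *\<^sub>v col B j = 0\<^sub>v n" using mat_kernel_iff[OF A] by simp
  moreover have "(A * B) $$ (i, j) = (A *\<^sub>v col B j) $ i" using A B ij by simp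
  ultimately show "(A * B) $$ (i, j) = 0\<^sub>m n m $$ (i, j)" using ij by simp
qed (use A B in auto)

lemma mat_cancel_kernel:
  fixes A C :: "'a::comm_ring_1 mat"
  assumes A: "A \<in> carrier_mat n r" and ker: "mat_kernel A = {0\<^sub>v r}" and C: "C \<in> carrier_mat r k" and 0: "A * C = 0\<^sub>m n k"
  shows "C = 0\<^sub>m r k"
proof (rule eq_matI)
  fix i j assume "i < dim_row (0\<^sub>m r k :: 'a mat)" "j < dim_col (0\<^sub>m r k :: 'a mat)"
  then have ij: "i < r" "j < k" by simp_all
  have "A *\<^sub>v col C j = col (A * C) j" using A C ij by (intro eq_vecI) auto
  also have "\<dots> = 0\<^sub>v n" unfolding 0 using ij by (intro eq_vecI) auto
  finally have "col C j \<in> mat_kernel A" using mat_kernel_iff[OF A] C ij by simp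
  then have "col C j = 0\<^sub>v r" using ker by simp
  moreover have "C $$ (i, j) = col C j $ i" using C ij by simp
  ultimately show "C $$ (i, j) = 0\<^sub>m r k $$ (i, j)" using ij by simp
qed (use C in auto)

text \<open>Comparison of a resolution of length three with one of length two: lifting the identity in
  both directions shows that the last map of the longer one splits.\<close>

lemma last_map_splits:
  fixes A0 A1 A2 B0 B1 :: "'a::idom mat"
  assumes A: "A0 \<in> carrier_mat 1 a" "A1 \<in> carrier_mat a b" "A2 \<in> carrier_mat b c"
    and B: "B0 \<in> carrier_mat 1 p" "B1 \<in> carrier_mat p q"
    and im: "mat_image A0 = mat_image B0"
    and kA: "mat_kernel A0 = mat_image A1" "mat_kernel A1 = mat_image A2" "mat_kernel A2 = {0\<^sub>v c}"
    and kB: "mat_kernel B0 = mat_image B1" "mat_kernel B1 = {0\<^sub>v q}"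
  obtains H where "H \<in> carrier_mat c b" "H * A2 = 1\<^sub>m c"
proof -
  have A01: "A0 * A1 = 0\<^sub>m 1 b" by (rule mat_mult_eq_zero[OF A(1,2) kA(1)])
  have A12: "A1 * A2 = 0\<^sub>m a c" by (rule mat_mult_eq_zero[OF A(2,3) kA(2)])
  have B01: "B0 * B1 = 0\<^sub>m 1 q" by (rule mat_mult_eq_zero[OF B(1,2) kB(1)])
  \<comment> \<open>The maps \<alpha>1, \<alpha>2 lift the identity from the longer complex to the
    shorter one, and \<beta>1, \<beta>2 lift it back; h1 and h2 form a homotopy from \<beta>
    \<alpha> to the identity.\<close>
  obtain \<alpha>1 where \<alpha>1: "\<alpha>1 \<in> carrier_mat p a" "A0 = B0 * \<alpha>1"
    by (rule mat_factor[OF B(1) A(1)]) (simp add: im[symmetric] col_in_mat_image[OF A(1)])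
  obtain \<beta>1 where \<beta>1: "\<beta>1 \<in> carrier_mat a p" "B0 = A0 * \<beta>1"
    by (rule mat_factor[OF A(1) B(1)]) (simp add: im col_in_mat_image[OF B(1)])
  have ba1: "\<beta>1 * \<alpha>1 \<in> carrier_mat a a" using \<alpha>1(1) \<beta>1(1) by simp
  have "A0 * (1\<^sub>m a - \<beta>1 * \<alpha>1) = A0 * 1\<^sub>m a - A0 * (\<beta>1 * \<alpha>1)"
    by (rule mult_minus_distrib_mat[OF A(1) _ ba1]) simp
  also have "A0 * (\<beta>1 * \<alpha>1) = A0"
    using assoc_mult_mat[OF A(1) \<beta>1(1) \<alpha>1(1)] unfolding \<beta>1(2)[symmetric] \<alpha>1(2)[symmetric] by (rule sym)
  also have "A0 * 1\<^sub>m a - A0 = 0\<^sub>m 1 a" using A(1) by simp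
  finally have z: "A0 * (1\<^sub>m a - \<beta>1 * \<alpha>1) = 0\<^sub>m 1 a" .
  have ia: "1\<^sub>m a - \<beta>1 * \<alpha>1 \<in> carrier_mat a a" by (rule minus_carrier_mat[OF ba1])
  obtain h1 where h1: "h1 \<in> carrier_mat b a" "1\<^sub>m a - \<beta>1 * \<alpha>1 = A1 * h1"
    by (rule mat_factor_kernel[OF A(1,2) kA(1) ia z])
  have aA: "\<alpha>1 * A1 \<in> carrier_mat p b" using \<alpha>1(1) A(2) by simp
  have "B0 * (\<alpha>1 * A1) = A0 * A1" using assoc_mult_mat[OF B(1) \<alpha>1(1) A(2)] \<alpha>1(2) by simp
  then have z: "B0 * (\<alpha>1 * A1) = 0\<^sub>m 1 b" using A01 by simp
  obtain \<alpha>2 where \<alpha>2: "\<alpha>2 \<in> carrier_mat q b" "\<alpha>1 * A1 = B1 * \<alpha>2"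
    by (rule mat_factor_kernel[OF B(1,2) kB(1) aA z])
  have "A0 * (\<beta>1 * B1) = B0 * B1" using assoc_mult_mat[OF A(1) \<beta>1(1) B(2)] \<beta>1(2) by simp
  then have z: "A0 * (\<beta>1 * B1) = 0\<^sub>m 1 q" using B01 by simp
  have bB: "\<beta>1 * B1 \<in> carrier_mat a q" using \<beta>1(1) B(2) by simp
  obtain \<beta>2 where \<beta>2: "\<beta>2 \<in> carrier_mat b q" "\<beta>1 * B1 = A1 * \<beta>2"
    by (rule mat_factor_kernel[OF A(1,2) kA(1) bB z])
  have ba2: "\<beta>2 * \<alpha>2 \<in> carrier_mat b b" and hA: "h1 * A1 \<in> carrier_mat b b" using \<alpha>2(1) \<beta>2(1) h1(1) A(2) by simp_all
  define X where "X = \<beta>1 * (\<alpha>1 * A1)"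
  have X: "X \<in> carrier_mat a b" using \<beta>1(1) aA by (simp add: X_def)
  have e1: "A1 * (\<beta>2 * \<alpha>2) = X"
    using assoc_mult_mat[OF A(2) \<beta>2(1) \<alpha>2(1)] assoc_mult_mat[OF \<beta>1(1) B(2) \<alpha>2(1)] \<alpha>2(2) \<beta>2(2) by (simp add: X_def)
  have "A1 * (h1 * A1) = (1\<^sub>m a - \<beta>1 * \<alpha>1) * A1" using assoc_mult_mat[OF A(2) h1(1) A(2)] h1(2) by simp
  also have "\<dots> = 1\<^sub>m a * A1 - (\<beta>1 * \<alpha>1) * A1" by (rule minus_mult_distrib_mat[OF _ ba1 A(2)]) simp
  finally have e2: "A1 * (h1 * A1) = A1 - X"
    using assoc_mult_mat[OF \<beta>1(1) \<alpha>1(1) A(2)] A(2) by (simp add: X_def)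
  define Y where "Y = 1\<^sub>m b - \<beta>2 * \<alpha>2"
  have Y: "Y \<in> carrier_mat b b" unfolding Y_def by (rule minus_carrier_mat[OF ba2])
  have "A1 * Y = A1 * 1\<^sub>m b - A1 * (\<beta>2 * \<alpha>2)" unfolding Y_def by (rule mult_minus_distrib_mat[OF A(2) _ ba2]) simp
  then have e3: "A1 * Y = A1 - X" using e1 A(2) by simp
  have "A1 * (Y - h1 * A1) = A1 * Y - A1 * (h1 * A1)" by (rule mult_minus_distrib_mat[OF A(2) Y hA])
  also have "\<dots> = 0\<^sub>m a b" unfolding e2 e3 by (rule minus_r_inv_mat[OF minus_carrier_mat[OF X]])
  finally have z: "A1 * (Y - h1 * A1) = 0\<^sub>m a b" .
  have Yh: "Y - h1 * A1 \<in> carrier_mat b b" by (rule minus_carrier_mat[OF hA])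
  obtain h2 where h2: "h2 \<in> carrier_mat c b" "Y - h1 * A1 = A2 * h2"
    by (rule mat_factor_kernel[OF A(2,3) kA(2) Yh z])
  have aA2: "\<alpha>2 * A2 \<in> carrier_mat q c" and hA2: "h2 * A2 \<in> carrier_mat c c" using \<alpha>2(1) h2(1) A(3) by simp_all
  \<comment> \<open>The shorter complex has ended here, B1 being injective, so \<alpha>2 kills the
    image of A2.\<close>
  have "B1 * (\<alpha>2 * A2) = \<alpha>1 * (A1 * A2)"
    using assoc_mult_mat[OF B(2) \<alpha>2(1) A(3)] assoc_mult_mat[OF \<alpha>1(1) A(2,3)] \<alpha>2(2) by simp
  also have "\<dots> = 0\<^sub>m p c" unfolding A12 using \<alpha>1(1) by simp
  finally have "\<alpha>2 * A2 = 0\<^sub>m q c" by (rule mat_cancel_kernel[OF B(2) kB(2) aA2])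
  then have e4: "(\<beta>2 * \<alpha>2) * A2 = 0\<^sub>m b c" using assoc_mult_mat[OF \<beta>2(1) \<alpha>2(1) A(3)] \<beta>2(1) by simp
  have e5: "(h1 * A1) * A2 = 0\<^sub>m b c" using assoc_mult_mat[OF h1(1) A(2,3)] A12 h1(1) by simp
  have "Y * A2 = 1\<^sub>m b * A2 - (\<beta>2 * \<alpha>2) * A2" unfolding Y_def by (rule minus_mult_distrib_mat[OF _ ba2 A(3)]) simp
  then have e6: "Y * A2 = A2" unfolding e4 using A(3) by (intro eq_matI) auto
  have "(Y - h1 * A1) * A2 = Y * A2 - (h1 * A1) * A2" by (rule minus_mult_distrib_mat[OF Y hA A(3)])
  then have e7: "(Y - h1 * A1) * A2 = A2" unfolding e5 e6 using A(3) by (intro eq_matI) auto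
  \<comment> \<open>The homotopy gives A2 h2 A2 = A2, and the injective A2 can be cancelled on the
    left.\<close>
  have "A2 * (1\<^sub>m c - h2 * A2) = A2 * 1\<^sub>m c - A2 * (h2 * A2)" by (rule mult_minus_distrib_mat[OF A(3) _ hA2]) simp
  also have "A2 * (h2 * A2) = A2" using assoc_mult_mat[OF A(3) h2(1) A(3)] h2(2) e7 by simp
  also have "A2 * 1\<^sub>m c - A2 = 0\<^sub>m b c" using A(3) by simp
  finally have 0: "1\<^sub>m c - h2 * A2 = 0\<^sub>m c c" by (rule mat_cancel_kernel[OF A(3) kA(3) minus_carrier_mat[OF hA2]])
  have "h2 * A2 = 1\<^sub>m c"
  proof (rule eq_matI)
    fix i j assume ij: "i < dim_row (1\<^sub>m c :: 'a mat)" "j < dim_col (1\<^sub>m c :: 'a mat)"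
    have "(1\<^sub>m c - h2 * A2) $$ (i, j) = 1\<^sub>m c $$ (i, j) - (h2 * A2) $$ (i, j)" using ij hA2 by (intro index_minus_mat) auto
    moreover have "(1\<^sub>m c - h2 * A2) $$ (i, j) = 0" unfolding 0 using ij by simp
    ultimately show "(h2 * A2) $$ (i, j) = 1\<^sub>m c $$ (i, j)" by simp
  qed (use hA2 in auto)
  with h2(1) show ?thesis by (rule that)
qed

section \<open>Lower bounds for the length of a resolution\<close>

definition graded_mat :: "int list \<Rightarrow> int list \<Rightarrow> ('n::{finite,linorder}, 'k::field) mpoly mat \<Rightarrow> bool" where
  "graded_mat ds ds' A \<longleftrightarrow> A \<in> carrier_mat (length ds) (length ds') \<and>
     (\<forall>p<length ds. \<forall>q<length ds'. homogeneous (ds' ! q - ds ! p) (A $$ (p, q)))"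

lemma graded_free_resolution_length_3:
  "graded_free_resolution J [[0], ds1, ds2, ds3] [A0, A1, A2] \<longleftrightarrow>
     graded_mat [0] ds1 A0 \<and> graded_mat ds1 ds2 A1 \<and> graded_mat ds2 ds3 A2 \<and>
     mat_image A0 = {v \<in> carrier_vec 1. v $ 0 \<in> J} \<and> mat_kernel A0 = mat_image A1 \<and>
     mat_kernel A1 = mat_image A2 \<and> mat_kernel A2 = {0\<^sub>v (length ds3)}"
proof -
  have 3: "(\<forall>i<length [A0, A1, A2]. Q i) \<longleftrightarrow> Q 0 \<and> Q 1 \<and> Q 2" for Q :: "nat \<Rightarrow> bool"
    by (auto simp: less_Suc_eq numeral_2_eq_2)
  show ?thesis unfolding graded_free_resolution_def graded_mat_def Let_def 3
    by (simp add: numeral_2_eq_2) blast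
qed

lemma graded_free_resolution_length_2:
  "graded_free_resolution J [[0], ds1, ds2] [A0, A1] \<longleftrightarrow>
     graded_mat [0] ds1 A0 \<and> graded_mat ds1 ds2 A1 \<and>
     mat_image A0 = {v \<in> carrier_vec 1. v $ 0 \<in> J} \<and> mat_kernel A0 = mat_image A1 \<and>
     mat_kernel A1 = {0\<^sub>v (length ds2)}"
proof -
  have 2: "(\<forall>i<length [A0, A1]. Q i) \<longleftrightarrow> Q 0 \<and> Q 1" for Q :: "nat \<Rightarrow> bool"
    by (auto simp: less_Suc_eq)
  show ?thesis unfolding graded_free_resolution_def graded_mat_def Let_def 2
    by simp blast
qed

text \<open>Length zero makes J zero. Length one makes J principal, since an injective matrix with
  one row has at most one column. Neither is possible in height two.\<close>

lemma resolution_length_ge_2: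
  fixes J :: "('n::{finite,linorder}, 'k::field) mpoly set"
  assumes h: "ideal_height J = 2" and r: "graded_free_resolution J D As"
  shows "2 \<le> length As"
proof (rule ccontr)
  assume "\<not> ?thesis"
  then consider "As = []" | A where "As = [A]" by (cases As) (auto simp: not_le less_Suc_eq numeral_2_eq_2)
  then show False
  proof cases
    case 1
    have D0: "D ! 0 = [0]" using r unfolding graded_free_resolution_def by simp
    have im: "{0\<^sub>v 1} = {v \<in> carrier_vec 1. v $ 0 \<in> J}"
      using r unfolding graded_free_resolution_def Let_def D0 1 by simp
    have "0 dvd x" if "x \<in> J" for x
    proof -
      have "vec 1 (\<lambda>_. x) \<in> {v \<in> carrier_vec 1. v $ 0 \<in> J}" using that by simp
      then have "vec 1 (\<lambda>_. x) = 0\<^sub>v 1" unfolding im[symmetric] by simp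
      then have "vec 1 (\<lambda>_. x) $ 0 = (0\<^sub>v 1 :: ('n, 'k) mpoly vec) $ 0" by (rule arg_cong)
      then show ?thesis by simp
    qed
    then have "(0 :: ('n, 'k) mpoly) dvd 1" by (rule ideal_height_2_common_divisor[OF h])
    then show False by simp
  next
    case (2 A)
    define m where "m = length (D ! 1)"
    have D0: "D ! 0 = [0]" using r unfolding graded_free_resolution_def by simp
    have A: "A \<in> carrier_mat 1 m" and im: "mat_image A = {v \<in> carrier_vec 1. v $ 0 \<in> J}" and ker: "mat_kernel A = {0\<^sub>v m}"
      using r D0 2 unfolding graded_free_resolution_def Let_def m_def by simp_all
    have zero: "w = 0\<^sub>v m" if w: "w \<in> carrier_vec m" "(\<Sum>j<m. A $$ (0, j) * w $ j) = 0" for w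
    proof -
      have "A *\<^sub>v w = 0\<^sub>v 1" using mult_mat_vec_index_sum[OF A w(1), of 0] w(2) A by (intro eq_vecI) (auto simp del: index_mult_mat_vec)
      then have "w \<in> mat_kernel A" using mat_kernel_iff[OF A] w(1) by simp
      then show ?thesis using ker by simp
    qed
    have m1: "m \<le> 1"
    proof (rule ccontr)
      assume "\<not> m \<le> 1"
      then have m: "0 < m" "1 < m" by simp_all
      have S: "(\<Sum>j<m. A $$ (0, j) * vec m g $ j) = A $$ (0, 0) * g 0 + A $$ (0, 1) * g 1" if "\<And>j. j \<ge> 2 \<Longrightarrow> g j = 0" for g
      proof -
        have "(\<Sum>j<m. A $$ (0, j) * vec m g $ j) = (\<Sum>j\<in>{0, 1}. A $$ (0, j) * vec m g $ j)"
          using m that by (intro sum.mono_neutral_right) (auto simp: Suc_le_eq)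
        then show ?thesis using m by simp
      qed
      \<comment> \<open>The Koszul relation of the first two entries lies in the kernel and is zero,
        so the second entry vanishes; but then the second unit vector lies in the kernel as
        well.\<close>
      define g where "g = (\<lambda>j::nat. if j = 0 then A $$ (0, 1) else if j = 1 then - A $$ (0, 0) else 0)"
      have "vec m g = 0\<^sub>v m" by (rule zero) (simp, subst S, simp_all add: g_def)
      then have "vec m g $ 0 = (0\<^sub>v m :: ('n, 'k) mpoly vec) $ 0" by (rule arg_cong)
      then have a1: "A $$ (0, 1) = 0" using m by (simp add: g_def)
      define g' where "g' = (\<lambda>j::nat. if j = 1 then 1 else 0 :: ('n, 'k) mpoly)"
      have "vec m g' = 0\<^sub>v m" by (rule zero) (simp, subst S, simp_all add: g'_def a1[unfolded One_nat_def])
      then have "vec m g' $ 1 = (0\<^sub>v m :: ('n, 'k) mpoly vec) $ 1" by (rule arg_cong)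
      then show False using m by (simp add: g'_def)
    qed
    define g where "g = (if m = 1 then A $$ (0, 0) else 0)"
    have g: "g dvd x" if "x \<in> J" for x
    proof -
      have "vec 1 (\<lambda>_. x) \<in> mat_image A" unfolding im using that by simp
      then obtain w where w: "w \<in> carrier_vec m" "vec 1 (\<lambda>_. x) = A *\<^sub>v w" by (rule mat_imageE[OF _ A])
      have "x = vec 1 (\<lambda>_. x) $ 0" by simp
      also have "\<dots> = (\<Sum>j<m. A $$ (0, j) * w $ j)" unfolding w(2) by (rule mult_mat_vec_index_sum[OF A w(1)]) simp
      finally have x: "x = (\<Sum>j<m. A $$ (0, j) * w $ j)" .
      show ?thesis
      proof (cases "m = 1")
        case True then show ?thesis using x by (simp add: g_def)
      next
        case False
        then have "m = 0" using m1 by simp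
        then show ?thesis using x by simp
      qed
    qed
    then have u: "g dvd 1" by (rule ideal_height_2_common_divisor[OF h])
    then obtain s where s: "1 = g * s" by (rule dvdE)
    have "m = 1" using u by (auto simp: g_def split: if_splits)
    have "A *\<^sub>v vec m (\<lambda>_. s) \<in> mat_image A" by (rule mat_imageI[OF A]) simp
    then have "(A *\<^sub>v vec m (\<lambda>_. s)) $ 0 \<in> J" unfolding im by simp
    moreover have "(A *\<^sub>v vec m (\<lambda>_. s)) $ 0 = (\<Sum>j<m. A $$ (0, j) * vec m (\<lambda>_. s) $ j)"
      by (rule mult_mat_vec_index_sum[OF A]) simp_all
    ultimately have "1 \<in> J" using \<open>m = 1\<close> s by (simp add: g_def)
    then show False using one_notin_of_ideal_height[OF h] by simp
  qed
qed

text \<open>Against a resolution of length two, the last map A2 of the given one would split. By the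
  degrees its entries have no constant term, so no product H A2 can have an entry 1.\<close>

lemma resolution_length_ge_3:
  fixes J :: "('n::{finite,linorder}, 'k::field) mpoly set"
  assumes h: "ideal_height J = 2" and r: "graded_free_resolution J [[0], ds1, ds2, ds3] [A0, A1, A2]"
    and ds: "ds3 \<noteq> []" "\<And>x y. x \<in> set ds2 \<Longrightarrow> y \<in> set ds3 \<Longrightarrow> x < y"
    and r': "graded_free_resolution J D As"
  shows "3 \<le> length As"
proof (rule ccontr)
  assume "\<not> ?thesis"
  then have l2: "length As = 2" using resolution_length_ge_2[OF h r'] by simp
  then obtain B0 B1 where As: "As = [B0, B1]" by (auto simp: length_Suc_conv numeral_2_eq_2)
  have lD: "length D = 3" "D ! 0 = [0]" using r' l2 unfolding graded_free_resolution_def by simp_all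
  then obtain es1 es2 where D: "D = [[0], es1, es2]" by (auto simp: length_Suc_conv numeral_3_eq_3)
  note X = r[unfolded graded_free_resolution_length_3] and Y = r'[unfolded D As graded_free_resolution_length_2]
  have c: "A0 \<in> carrier_mat 1 (length ds1)" "A1 \<in> carrier_mat (length ds1) (length ds2)" "A2 \<in> carrier_mat (length ds2) (length ds3)"
    "B0 \<in> carrier_mat 1 (length es1)" "B1 \<in> carrier_mat (length es1) (length es2)"
    using X Y by (simp_all add: graded_mat_def)
  have im: "mat_image A0 = mat_image B0" using X Y by simp
  obtain H where H: "H \<in> carrier_mat (length ds3) (length ds2)" "H * A2 = 1\<^sub>m (length ds3)"
    using last_map_splits[OF c im] X Y by blast
  have 0: "0 < length ds3" using ds(1) by simp
  have "(1 :: ('n, 'k) mpoly) = (H * A2) $$ (0, 0)" unfolding H(2) using 0 by simp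
  also have "\<dots> = (\<Sum>j<length ds2. H $$ (0, j) * A2 $$ (j, 0))"
    using c(3) H(1) 0 by (auto simp: scalar_prod_def atLeast0LessThan)
  finally have "hcomp 0 (1 :: ('n, 'k) mpoly) = hcomp 0 (\<Sum>j<length ds2. H $$ (0, j) * A2 $$ (j, 0))" by (rule arg_cong)
  also have "\<dots> = (\<Sum>j<length ds2. hcomp 0 (H $$ (0, j) * A2 $$ (j, 0)))" by (rule hcomp_sum)
  also have "\<dots> = 0"
  proof (intro sum.neutral ballI)
    fix j assume "j \<in> {..<length ds2}"
    then have j: "j < length ds2" by simp
    have "homogeneous (ds3 ! 0 - ds2 ! j) (A2 $$ (j, 0))" using X j 0 unfolding graded_mat_def by blast
    then have "hcomp 0 (H $$ (0, j) * A2 $$ (j, 0)) = hcomp (0 - (ds3 ! 0 - ds2 ! j)) (H $$ (0, j)) * A2 $$ (j, 0)"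
      by (rule hcomp_mult_homogeneous)
    moreover have "ds2 ! j < ds3 ! 0" using ds(2) j 0 by simp
    then have "hcomp (0 - (ds3 ! 0 - ds2 ! j)) (H $$ (0, j)) = 0" by (intro homogeneous_neg[OF _ homogeneous_hcomp]) simp
    ultimately show "hcomp 0 (H $$ (0, j) * A2 $$ (j, 0)) = 0" by simp
  qed
  finally have "hcomp 0 (1 :: ('n, 'k) mpoly) = 0" .
  moreover have "homogeneous 0 (1 :: ('n, 'k) mpoly)" using homogeneous_const[of 1] by simp
  ultimately show False by (simp add: hcomp_homogeneous)
qed

section \<open>Hilbert functions from resolutions\<close>

text \<open>Matrices act on functions here, because functions form a vector space, whereas vectors
  of varying dimension do not.\<close>

definition mat_act :: "('n, 'k::field) mpoly mat \<Rightarrow> (nat \<Rightarrow> ('n, 'k) mpoly) \<Rightarrow> nat \<Rightarrow> ('n, 'k) mpoly" where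
  "mat_act A w = (\<lambda>i. if i < dim_row A then \<Sum>j<dim_col A. A $$ (i, j) * w j else 0)"

text \<open>The degree t part of the direct sum of the R(-a), with a in \<open>ds\<close>.\<close>

definition graded_free :: "int list \<Rightarrow> int \<Rightarrow> (nat \<Rightarrow> ('n::{finite,linorder}, 'k::field) mpoly) set" where
  "graded_free ds t = tuples (length ds) (\<lambda>i. homog (t - ds ! i))"

lemma linear_mat_act: "Vector_Spaces.linear scale_vec scale_vec (mat_act (A :: ('n, 'k::field) mpoly mat))"
  by (rule linear_FF_I) (auto simp: mat_act_def fun_eq_iff distrib_left sum.distrib sum_distrib_left mult.left_commute)

lemma graded_free_props:
  "F.subspace (graded_free ds t :: (nat \<Rightarrow> ('n::{finite,linorder}, 'k::field) mpoly) set)"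
  "fin_dim_wrt F.span (graded_free ds t :: (nat \<Rightarrow> ('n, 'k) mpoly) set)"
  "F.dim (graded_free ds t :: (nat \<Rightarrow> ('n, 'k) mpoly) set) = (\<Sum>i<length ds. P.dim (homog (t - ds ! i) :: ('n, 'k) mpoly set))"
proof -
  show "F.subspace (graded_free ds t :: (nat \<Rightarrow> ('n, 'k) mpoly) set)"
    unfolding graded_free_def by (rule subspace_tuples) (rule subspace_homog)
  show "fin_dim_wrt F.span (graded_free ds t :: (nat \<Rightarrow> ('n, 'k) mpoly) set)"
    unfolding graded_free_def by (rule fin_dim_tuples) (rule subspace_homog fin_dim_homog)+
  show "F.dim (graded_free ds t :: (nat \<Rightarrow> ('n, 'k) mpoly) set) = (\<Sum>i<length ds. P.dim (homog (t - ds ! i) :: ('n, 'k) mpoly set))"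
    unfolding graded_free_def by (rule dim_tuples) (rule subspace_homog fin_dim_homog)+
qed

lemma mat_act_vec: "A \<in> carrier_mat r c \<Longrightarrow> w \<in> carrier_vec c \<Longrightarrow> A *\<^sub>v w = vec r (mat_act A (($) w))"
  by (intro eq_vecI) (auto simp: mat_act_def scalar_prod_def atLeast0LessThan)

lemma mat_act_cong: "(\<And>j. j < dim_col A \<Longrightarrow> u j = v j) \<Longrightarrow> mat_act A u = mat_act A v"
  unfolding mat_act_def by (intro ext if_cong sum.cong refl) simp

text \<open>A preimage of a homogeneous element may be replaced by its component of the matching
  degree, so exactness can be used degree by degree.\<close>

lemma mat_act_image:
  assumes B: "graded_mat ds ds' B"
  shows "mat_act B ` graded_free ds' t = {w \<in> graded_free ds t. vec (length ds) w \<in> mat_image B}"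
proof (intro equalityI subsetI)
  have c: "B \<in> carrier_mat (length ds) (length ds')" and d: "dim_row B = length ds" "dim_col B = length ds'"
    and h: "\<And>p q. p < length ds \<Longrightarrow> q < length ds' \<Longrightarrow> homogeneous (ds' ! q - ds ! p) (B $$ (p, q))"
    using B by (auto simp: graded_mat_def)
  {
    fix w assume "w \<in> mat_act B ` graded_free ds' t"
    then obtain z where z: "z \<in> graded_free ds' t" "w = mat_act B z" by blast
    have hz: "homogeneous (t - ds' ! j) (z j)" if "j < length ds'" for j using z(1) that by (simp add: graded_free_def tuples_def)
    have "homogeneous (t - ds ! i) (w i)" if i: "i < length ds" for i
    proof -
      have "homogeneous (t - ds ! i) (B $$ (i, j) * z j)" if j: "j < length ds'" for j
        using homogeneous_mult[OF h[OF i j] hz[OF j]] by simp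
      then show ?thesis unfolding z(2) mat_act_def d using i by (auto intro!: homogeneous_sum)
    qed
    moreover have "w i = 0" if "\<not> i < length ds" for i unfolding z(2) mat_act_def d using that by simp
    ultimately have "w \<in> graded_free ds t" by (simp add: graded_free_def tuples_def)
    moreover have "B *\<^sub>v vec (length ds') z = vec (length ds) (mat_act B (($) (vec (length ds') z)))" by (rule mat_act_vec[OF c]) simp
    then have "B *\<^sub>v vec (length ds') z = vec (length ds) w"
      unfolding z(2) using mat_act_cong[of B "($) (vec (length ds') z)" z] d by simp
    then have "vec (length ds) w \<in> mat_image B" using mat_imageI[OF c, of "vec (length ds') z"] by simp
    ultimately show "w \<in> {w \<in> graded_free ds t. vec (length ds) w \<in> mat_image B}" by simp
  next
    fix w assume "w \<in> {w \<in> graded_free ds t. vec (length ds) w \<in> mat_image B}"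
    then have w: "w \<in> graded_free ds t" "vec (length ds) w \<in> mat_image B" by simp_all
    obtain v where v: "v \<in> carrier_vec (length ds')" "vec (length ds) w = B *\<^sub>v v" by (rule mat_imageE[OF w(2) c])
    define z where "z = (\<lambda>j. if j < length ds' then hcomp (t - ds' ! j) (v $ j) else 0)"
    have "z \<in> graded_free ds' t" by (simp add: graded_free_def tuples_def z_def)
    moreover have "w = mat_act B z"
    proof
      fix i
      show "w i = mat_act B z i"
      proof (cases "i < length ds")
        case i: True
        have "w i = vec (length ds) w $ i" using i by simp
        also have "\<dots> = (\<Sum>j<length ds'. B $$ (i, j) * v $ j)" unfolding v(2) by (rule mult_mat_vec_index_sum[OF c v(1) i])
        finally have wi: "w i = (\<Sum>j<length ds'. B $$ (i, j) * v $ j)" .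
        have "homogeneous (t - ds ! i) (w i)" using w(1) i by (simp add: graded_free_def tuples_def)
        then have "w i = hcomp (t - ds ! i) (w i)" by (simp add: hcomp_homogeneous)
        also have "\<dots> = (\<Sum>j<length ds'. hcomp (t - ds ! i) (v $ j * B $$ (i, j)))" unfolding wi hcomp_sum by (simp only: mult.commute)
        also have "\<dots> = (\<Sum>j<length ds'. B $$ (i, j) * z j)"
        proof (intro sum.cong refl)
          fix j assume "j \<in> {..<length ds'}"
          then have j: "j < length ds'" by simp
          have "hcomp (t - ds ! i) (v $ j * B $$ (i, j)) = hcomp (t - ds ! i - (ds' ! j - ds ! i)) (v $ j) * B $$ (i, j)"
            by (rule hcomp_mult_homogeneous[OF h[OF i j]])
          then show "hcomp (t - ds ! i) (v $ j * B $$ (i, j)) = B $$ (i, j) * z j" using j by (simp add: z_def mult.commute)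
        qed
        finally show ?thesis using i d by (simp add: mat_act_def)
      next
        case False then show ?thesis using w(1) d by (simp add: graded_free_def tuples_def mat_act_def)
      qed
    qed
    ultimately show "w \<in> mat_act B ` graded_free ds' t" by blast
  }
qed

lemma mat_act_kernel:
  assumes A: "graded_mat ds ds' A"
  shows "{w \<in> graded_free ds' t. mat_act A w = 0} = {w \<in> graded_free ds' t. vec (length ds') w \<in> mat_kernel A}"
proof -
  have c: "A \<in> carrier_mat (length ds) (length ds')" and d: "dim_row A = length ds" "dim_col A = length ds'"
    using A by (auto simp: graded_mat_def)
  have "mat_act A w = 0 \<longleftrightarrow> vec (length ds') w \<in> mat_kernel A" for w
  proof -
    have "A *\<^sub>v vec (length ds') w = vec (length ds) (mat_act A (($) (vec (length ds') w)))" by (rule mat_act_vec[OF c]) simp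
    then have e: "A *\<^sub>v vec (length ds') w = vec (length ds) (mat_act A w)"
      using mat_act_cong[of A "($) (vec (length ds') w)" w] d by simp
    have "vec (length ds) (mat_act A w) = 0\<^sub>v (length ds) \<longleftrightarrow> (\<forall>i<length ds. mat_act A w i = 0)" by (auto simp: vec_eq_iff)
    also have "\<dots> \<longleftrightarrow> mat_act A w = 0" by (auto simp: fun_eq_iff mat_act_def d)
    finally show ?thesis using mat_kernel_iff[OF c] e by simp
  qed
  then show ?thesis by simp
qed

lemma rank_nullity_mat_act:
  assumes "graded_mat ds ds' A"
  shows "F.dim (graded_free ds' t :: (nat \<Rightarrow> ('n::{finite,linorder}, 'k::field) mpoly) set)
    = F.dim {w \<in> graded_free ds t. vec (length ds) w \<in> mat_image A} + F.dim {w \<in> graded_free ds' t. vec (length ds') w \<in> mat_kernel (A :: ('n, 'k) mpoly mat)}"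
  using FF.rank_nullity[OF linear_mat_act[of A] graded_free_props(1,2)[of ds' t]] unfolding mat_act_image[OF assms] mat_act_kernel[OF assms] .

text \<open>The alternating sum of dimensions along the exact sequence in degree t, arranged without
  subtraction.\<close>

lemma dim_ideal_of_resolution:
  fixes J :: "('n::{finite,linorder}, 'k::field) mpoly set"
  assumes J: "is_ideal J" and r: "graded_free_resolution J [[0], ds1, ds2, ds3] [A0, A1, A2]"
  shows "P.dim {p \<in> J. homogeneous t p} + (\<Sum>i<length ds2. P.dim (homog (t - ds2 ! i) :: ('n, 'k) mpoly set))
    = (\<Sum>i<length ds1. P.dim (homog (t - ds1 ! i) :: ('n, 'k) mpoly set)) + (\<Sum>i<length ds3. P.dim (homog (t - ds3 ! i) :: ('n, 'k) mpoly set))"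
proof -
  note X = r[unfolded graded_free_resolution_length_3]
  interpret PF: vector_space_pair "scale_poly :: 'k \<Rightarrow> ('n, 'k) mpoly \<Rightarrow> ('n, 'k) mpoly" scale_vec ..
  let ?E = "\<lambda>p::('n, 'k) mpoly. \<lambda>i::nat. if i = 0 then p else 0"
  have lE: "Vector_Spaces.linear scale_poly scale_vec ?E" by unfold_locales (auto simp: fun_eq_iff)
  have e0: "{w \<in> graded_free [0] t. vec (length [0 :: int]) w \<in> mat_image A0} = ?E ` {p \<in> J. homogeneous t p}"
  proof (intro equalityI subsetI)
    fix w assume "w \<in> {w \<in> graded_free [0] t. vec (length [0 :: int]) w \<in> mat_image A0}"
    then have w: "homogeneous t (w 0)" "\<forall>i\<ge>1. w i = 0" "w 0 \<in> J" using X by (simp_all add: graded_free_def tuples_def)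
    have "w = ?E (w 0)"
    proof
      fix i show "w i = ?E (w 0) i" using w(2) by (cases "i = 0") simp_all
    qed
    then show "w \<in> ?E ` {p \<in> J. homogeneous t p}" by (rule image_eqI) (use w in simp)
  next
    fix w assume "w \<in> ?E ` {p \<in> J. homogeneous t p}"
    then show "w \<in> {w \<in> graded_free [0] t. vec (length [0 :: int]) w \<in> mat_image A0}"
      using X by (auto simp: graded_free_def tuples_def)
  qed
  have d0: "F.dim (?E ` {p \<in> J. homogeneous t p}) = P.dim {p \<in> J. homogeneous t p}"
  proof (rule PF.dim_image_inj[OF lE subspace_ideal_part[OF J] fin_dim_ideal_part])
    fix p assume p: "?E p = 0"
    show "p = 0" using fun_cong[OF p, of 0] by simp
  qed
  have e3: "{w \<in> graded_free ds3 t. vec (length ds3) w \<in> mat_kernel A2} = {\<lambda>_. 0 :: ('n, 'k) mpoly}"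
  proof (intro equalityI subsetI)
    fix w :: "nat \<Rightarrow> ('n, 'k) mpoly" assume "w \<in> {w \<in> graded_free ds3 t. vec (length ds3) w \<in> mat_kernel A2}"
    then have w: "\<forall>i\<ge>length ds3. w i = 0" "vec (length ds3) w = 0\<^sub>v (length ds3)" using X by (simp_all add: graded_free_def tuples_def)
    have "w i = 0" for i using w by (cases "i < length ds3") (auto simp: vec_eq_iff)
    then show "w \<in> {\<lambda>_. 0}" by auto
  next
    fix w :: "nat \<Rightarrow> ('n, 'k) mpoly" assume "w \<in> {\<lambda>_. 0}"
    then have "w = (\<lambda>_. 0)" by simp
    then show "w \<in> {w \<in> graded_free ds3 t. vec (length ds3) w \<in> mat_kernel A2}"
      using X by (auto simp: graded_free_def tuples_def vec_eq_iff)
  qed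
  have g: "graded_mat [0] ds1 A0" "graded_mat ds1 ds2 A1" "graded_mat ds2 ds3 A2" and k: "mat_kernel A0 = mat_image A1" "mat_kernel A1 = mat_image A2"
    using X by simp_all
  show ?thesis
    using rank_nullity_mat_act[OF g(1), of t] rank_nullity_mat_act[OF g(2), of t] rank_nullity_mat_act[OF g(3), of t]
    unfolding e0 d0 e3 F_dim_0 k graded_free_props(3) by simp
qed

section \<open>Matrices of the resolution\<close>

lemma homogeneous_cross:
  assumes "\<And>i. i < 3 \<Longrightarrow> homogeneous s (u i)" "\<And>i. i < 3 \<Longrightarrow> homogeneous t (v i)"
  shows "homogeneous (s + t) (cross u v j)"
  unfolding cross_def using assms by (auto intro!: homogeneous_diff homogeneous_mult)

lemma homogeneous_dot:
  assumes "\<And>i. i < 3 \<Longrightarrow> homogeneous s (u i)" "\<And>i. i < 3 \<Longrightarrow> homogeneous t (v i)"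
  shows "homogeneous (s + t) (dot u v)"
  unfolding dot_def using assms by (auto intro!: homogeneous_add homogeneous_mult)

text \<open>The Koszul relation between \<open>dot v w1\<close> and \<open>dot v w2\<close> lifts to
  the syzygies f \<times> w1 and f \<times> w2 up to a multiple of v, whose coefficient is the
  determinant of f, w1, w2.\<close>

lemma cross_relation:
  fixes f :: "nat \<Rightarrow> 'a::comm_ring_1"
  assumes "dot v f = 0" "j < 3"
  shows "dot v w2 * cross f w1 j - dot v w1 * cross f w2 j = dot f (cross w1 w2) * v j"
proof -
  have "dot v w2 * cross f w1 j - dot v w1 * cross f w2 j = dot f (cross w1 w2) * v j - cross w1 w2 j * dot v f"
    using assms(2) by (auto simp: less_3_iff cross_def dot_def algebra_simps)
  then show ?thesis using assms(1) by simp
qed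

text \<open>An entry of positive degree has no constant term, so minimality can be read off the
  shifts.\<close>

lemma graded_mat_minimal:
  assumes "graded_mat ds ds' A" "\<And>x y. x \<in> set ds \<Longrightarrow> y \<in> set ds' \<Longrightarrow> x < y" "p < dim_row A" "q < dim_col A"
  shows "Poly_Mapping.lookup (A $$ (p, q)) 0 = 0"
proof -
  have pq: "p < length ds" "q < length ds'" using assms(1,3,4) by (auto simp: graded_mat_def)
  have h: "homogeneous (ds' ! q - ds ! p) (A $$ (p, q))" using assms(1) pq by (simp add: graded_mat_def)
  have "ds ! p < ds' ! q" by (rule assms(2)) (use pq in simp_all)
  then show ?thesis by (intro homogeneous_pos_lookup_0[OF h]) simp
qed

lemma mat_of_cols_3_mult_vec:
  fixes v :: "nat \<Rightarrow> 'a::comm_ring_1"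
  assumes "w \<in> carrier_vec 3"
  shows "mat_of_cols 3 [vec 3 v, vec 3 u1, vec 3 u2] *\<^sub>v w = vec 3 (\<lambda>j. w $ 0 * v j + w $ 1 * u1 j + w $ 2 * u2 j)"
  using assms by (intro eq_vecI) (auto simp: scalar_prod_def mat_of_cols_index numeral_3_eq_3 numeral_2_eq_2 algebra_simps)

lemma mat_of_cols_2_mult_vec:
  fixes v :: "nat \<Rightarrow> 'a::comm_ring_1"
  assumes "w \<in> carrier_vec 2"
  shows "mat_of_cols 3 [vec 3 v, vec 3 u] *\<^sub>v w = vec 3 (\<lambda>j. w $ 0 * v j + w $ 1 * u j)"
  using assms by (intro eq_vecI) (auto simp: scalar_prod_def mat_of_cols_index numeral_2_eq_2 algebra_simps)

lemma vec_eq_0_3: "vec 3 g = 0\<^sub>v 3 \<longleftrightarrow> (\<forall>j<3. g j = 0)"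
  by (auto simp: vec_eq_iff)

lemma nth_replicate_3: "p < 3 \<Longrightarrow> [x, x, x] ! p = x"
  by (auto simp: less_3_iff)

context three_forms
begin

abbreviation forms_ideal :: "('n, 'k) mpoly set" where "forms_ideal \<equiv> ideal_span {f 0, f 1, f 2}"

definition forms_mat :: "('n, 'k) mpoly mat" where "forms_mat = mat 1 3 (\<lambda>(i, j). f j)"

lemma forms_mat_carrier: "forms_mat \<in> carrier_mat 1 3"
  by (simp add: forms_mat_def)

lemma forms_mat_mult_vec: "w \<in> carrier_vec 3 \<Longrightarrow> forms_mat *\<^sub>v w = vec 1 (\<lambda>_. dot (($) w) f)"
proof (rule eq_vecI)
  fix i assume w: "w \<in> carrier_vec 3" and "i < dim_vec (vec 1 (\<lambda>_. dot (($) w) f))"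
  then have i: "i = 0" by simp
  have "(forms_mat *\<^sub>v w) $ 0 = (\<Sum>j<3. forms_mat $$ (0, j) * w $ j)" by (rule mult_mat_vec_index_sum[OF forms_mat_carrier w]) simp
  also have "\<dots> = dot (($) w) f" by (simp add: sum_3 forms_mat_def dot_def mult.commute)
  finally show "(forms_mat *\<^sub>v w) $ i = vec 1 (\<lambda>_. dot (($) w) f) $ i" using i by simp
qed (simp add: forms_mat_def)

lemma graded_forms_mat: "graded_mat [0] [int d, int d, int d] forms_mat"
  unfolding graded_mat_def
proof (intro conjI allI impI)
  fix p q assume "p < length [0 :: int]" "q < length [int d, int d, int d]"
  then have pq: "p = 0" "q < 3" by simp_all
  then show "homogeneous ([int d, int d, int d] ! q - [0] ! p) (forms_mat $$ (p, q))"
    unfolding nth_replicate_3[OF pq(2)] using hom_f[OF pq(2)] by (simp add: forms_mat_def)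
qed (simp add: forms_mat_def numeral_3_eq_3)

lemma mat_image_forms_mat: "mat_image forms_mat = {v \<in> carrier_vec 1. v $ 0 \<in> forms_ideal}"
proof (intro equalityI subsetI)
  fix v assume "v \<in> mat_image forms_mat"
  then obtain w where w: "w \<in> carrier_vec 3" "v = forms_mat *\<^sub>v w" by (rule mat_imageE[OF _ forms_mat_carrier])
  have "dot (($) w) f \<in> forms_ideal" unfolding ideal_span_3 dot_def by blast
  then show "v \<in> {v \<in> carrier_vec 1. v $ 0 \<in> forms_ideal}" unfolding w(2) forms_mat_mult_vec[OF w(1)] by simp
next
  fix v assume "v \<in> {v \<in> carrier_vec 1. v $ 0 \<in> forms_ideal}"
  then have v: "v \<in> carrier_vec 1" "v $ 0 \<in> forms_ideal" by simp_all
  obtain r s q where rs: "v $ 0 = r * f 0 + s * f 1 + q * f 2" using v(2) unfolding ideal_span_3 by blast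
  define w where "w = vec 3 (\<lambda>i::nat. if i = 0 then r else if i = 1 then s else q)"
  have w: "w \<in> carrier_vec 3" by (simp add: w_def)
  have "dot (($) w) f = v $ 0" unfolding rs by (simp add: w_def dot_def)
  then have "forms_mat *\<^sub>v w = v" unfolding forms_mat_mult_vec[OF w] using v(1) by (intro eq_vecI) auto
  then show "v \<in> mat_image forms_mat" using mat_imageI[OF forms_mat_carrier w] by simp
qed

lemma mat_kernel_forms_mat: "mat_kernel forms_mat = syz"
proof -
  have "w \<in> mat_kernel forms_mat \<longleftrightarrow> w \<in> syz" for w
  proof (cases "w \<in> carrier_vec 3")
    case True
    have "forms_mat *\<^sub>v w = 0\<^sub>v 1 \<longleftrightarrow> dot (($) w) f = 0"
      unfolding forms_mat_mult_vec[OF True] by (auto simp: vec_eq_iff)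
    then show ?thesis using True mat_kernel_iff[OF forms_mat_carrier] by (simp add: syz_def)
  next
    case False then show ?thesis using mat_kernel_iff[OF forms_mat_carrier] by (simp add: syz_def)
  qed
  then show ?thesis by blast
qed

text \<open>\<open>bour\<close> kills \<nu>, so a relation among \<nu>, u and v becomes one between
  the images of u and v.\<close>

lemma nu_relation:
  assumes "dot u f = 0" "dot v f = 0" "\<forall>j<3. p * \<nu> j + q * u j + r * v j = 0"
  shows "q * bour u + r * bour v = 0"
proof -
  have n: "bour \<nu> = 0" using bour_eq_0_iff[OF nu_syz] by (auto intro!: exI[of _ 1])
  have 1: "dot (\<lambda>j. p * \<nu> j) f = 0" "dot (\<lambda>j. q * u j) f = 0" "dot (\<lambda>j. r * v j) f = 0"
    by (simp_all only: dot_scale assms nu_syz mult_zero_right)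
  have 2: "dot (\<lambda>j. p * \<nu> j + q * u j) f = 0" by (simp only: dot_add 1 add_0_left)
  have "bour (\<lambda>j. p * \<nu> j + q * u j + r * v j) = p * bour \<nu> + q * bour u + r * bour v"
    by (simp only: bour_add[OF 2 1(3)] bour_add[OF 1(1,2)] bour_scale[OF nu_syz] bour_scale[OF assms(1)] bour_scale[OF assms(2)])
  moreover have "bour (\<lambda>j. p * \<nu> j + q * u j + r * v j) = bour (\<lambda>_. 0)"
    by (rule bour_cong) (use assms(3) in auto)
  ultimately show ?thesis using n bour_zero by simp
qed

text \<open>The lower bound comes from two coprime combinations of the forms.\<close>

lemma grade_J:
  assumes "ideal_height forms_ideal = 2" shows "grade forms_ideal = 2"
proof -
  obtain w1 w2 where "\<forall>i. homogeneous 0 (w1 i)" "\<forall>i. homogeneous 0 (w2 i)"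
    and w: "dot f w1 \<noteq> 0" "no_common_prime (dot f w1) (dot f w2)"
    by (rule coprime_combinations[OF f_nz prim_f])
  have m: "dot f w \<in> forms_ideal" for w
  proof -
    have "dot f w = w 0 * f 0 + w 1 * f 1 + w 2 * f 2" by (simp add: dot_def mult.commute)
    then show ?thesis unfolding ideal_span_3 by blast
  qed
  have "2 \<le> grade forms_ideal" by (rule grade_ge_2[OF is_ideal_span one_notin_of_ideal_height[OF assms] m m w])
  then show ?thesis using grade_le_2[OF assms] by simp
qed

text \<open>The value 1 is taken at a homogeneous syzygy v of degree d - e. Then \<nu> and v form a
  basis of the syzygies, with shifts d + e and 2 d - e.\<close>

lemma resolution_of_unit:
  assumes "1 \<in> bour_ideal"
  obtains D As where "graded_free_resolution forms_ideal D As" "length As = 2"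
proof -
  obtain u where u: "dot u f = 0" "1 = bour u" by (rule bour_idealE[OF assms])
  define s where "s = int d - int e"
  define v where "v = (\<lambda>i. hcomp s (u i))"
  have vf: "dot v f = 0" unfolding v_def by (rule hcomp_bour(1)[OF u(1)])
  have h1: "homogeneous 0 (1 :: ('n, 'k) mpoly)" using homogeneous_const[of 1] by simp
  have "bour v = hcomp (s + (int e - int d)) (bour u)" unfolding v_def by (rule hcomp_bour(2)[OF u(1), symmetric])
  also have "\<dots> = 1" unfolding u(2)[symmetric] using hcomp_homogeneous[OF h1, of 0] by (simp add: s_def)
  finally have bv: "bour v = 1" .
  let ?A = "mat_of_cols 3 [vec 3 \<nu>, vec 3 v]"
  have A: "?A \<in> carrier_mat 3 2" by (simp add: mat_of_cols_carrier(1)[of 3 "[vec 3 \<nu>, vec 3 v]", simplified] numeral_2_eq_2)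
  have im: "mat_image ?A = syz"
  proof -
    have "x \<in> ideal_span {1}" for x :: "('n, 'k) mpoly" by (simp add: in_ideal_span_1)
    then have "mat_image (mat_of_cols 3 (vec 3 \<nu> # map (vec 3) [v])) = syz"
      by (intro mat_image_syz) (auto simp: vf bv)
    then show ?thesis by simp
  qed
  have g: "graded_mat [int d, int d, int d] [int (d + e), 2 * int d - int e] ?A"
    unfolding graded_mat_def
  proof (intro conjI allI impI)
    fix p q assume "p < length [int d, int d, int d]" "q < length [int (d + e), 2 * int d - int e]"
    then have pq: "p < 3" "q = 0 \<or> q = 1" by auto
    show "homogeneous ([int (d + e), 2 * int d - int e] ! q - [int d, int d, int d] ! p) (?A $$ (p, q))"
      using pq(2) unfolding nth_replicate_3[OF pq(1)]
    proof
      assume "q = 0"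
      then show "homogeneous ([int (d + e), 2 * int d - int e] ! q - int d) (?A $$ (p, q))"
        using pq(1) hom_nu[OF pq(1)] by (simp add: mat_of_cols_index)
    next
      assume "q = 1"
      then show "homogeneous ([int (d + e), 2 * int d - int e] ! q - int d) (?A $$ (p, q))"
        using pq(1) homogeneous_hcomp[of s "u p"] by (simp add: mat_of_cols_index v_def s_def)
    qed
  qed (use A in \<open>simp add: numeral_3_eq_3 numeral_2_eq_2\<close>)
  have "w = 0\<^sub>v 2" if w: "w \<in> carrier_vec 2" "?A *\<^sub>v w = 0\<^sub>v 3" for w
  proof -
    have z: "\<forall>j<3. w $ 0 * \<nu> j + w $ 1 * v j = 0" using w(2) unfolding mat_of_cols_2_mult_vec[OF w(1)] vec_eq_0_3 .
    then have "w $ 1 * bour v + 0 * bour v = 0" by (intro nu_relation[OF vf vf]) simp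
    then have w1: "w $ 1 = 0" by (simp add: bv)
    obtain k where "k < 3" "\<nu> k \<noteq> 0" using nu_nz by blast
    then have "w $ 0 = 0" using z w1 by auto
    then show ?thesis using w(1) w1 by (intro eq_vecI) (auto simp: less_2_cases_iff)
  qed
  moreover have "?A *\<^sub>v 0\<^sub>v 2 = 0\<^sub>v 3" using A by (intro eq_vecI) auto
  ultimately have k: "mat_kernel ?A = {0\<^sub>v 2}" using mat_kernel_iff[OF A] by auto
  have "graded_free_resolution forms_ideal [[0], [int d, int d, int d], [int (d + e), 2 * int d - int e]] [forms_mat, ?A]"
    unfolding graded_free_resolution_length_2
    using graded_forms_mat g mat_image_forms_mat mat_kernel_forms_mat im k by (simp add: numeral_2_eq_2)
  then show ?thesis by (rule that) simp
qed

text \<open>Used in its contrapositive form: if J is not perfect, the Bourbaki ideals of all choices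
  of \<nu> are proper.\<close>

lemma perfect_of_unit:
  assumes h: "ideal_height forms_ideal = 2" and 1: "1 \<in> bour_ideal" shows "perfect_ideal forms_ideal"
proof -
  obtain D As where r: "graded_free_resolution forms_ideal D As" "length As = 2" by (rule resolution_of_unit[OF 1])
  have "proj_dim_quotient forms_ideal \<le> enat (length As)" unfolding proj_dim_quotient_def using r(1) by (intro INF_lower) blast
  moreover have "2 \<le> proj_dim_quotient forms_ideal" unfolding proj_dim_quotient_def
  proof (rule INF_greatest)
    fix As assume "As \<in> {As. \<exists>D. graded_free_resolution forms_ideal D As}"
    then have "2 \<le> length As" using resolution_length_ge_2[OF h] by blast
    then show "2 \<le> enat (length As)" using enat_ord_simps(1)[of 2 "length As"] by (simp add: numeral_eq_enat)
  qed
  ultimately have "proj_dim_quotient forms_ideal = 2" using r(2) by (simp add: numeral_eq_enat)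
  then show ?thesis unfolding perfect_ideal_def using grade_J[OF h] one_notin_of_ideal_height[OF h] by simp
qed

text \<open>The syzygies are generated by \<nu> and f \<times> w1, f \<times> w2, the lifts of the
  two generators of I. A relation among the three maps to a multiple of the Koszul relation of these
  generators, and its coefficient at \<nu> is then determined because \<nu> \<noteq> 0.\<close>

lemma ci_resolution:
  assumes de: "d \<ge> 1" "e \<ge> 1" and w: "\<forall>i. homogeneous 0 (w1 i)" "\<forall>i. homogeneous 0 (w2 i)"
    and ab: "dot \<nu> w1 \<noteq> 0" "no_common_prime (dot \<nu> w1) (dot \<nu> w2)" and I: "bour_ideal = ideal_span {dot \<nu> w1, dot \<nu> w2}"
  shows "\<exists>As. minimal_graded_free_resolution forms_ideal [[0], [int d, int d, int d], [int (d + e), int (2 * d), int (2 * d)], [int (2 * d + e)]] As"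
proof -
  define a where "a = dot \<nu> w1"
  define b where "b = dot \<nu> w2"
  define c where "c = dot f (cross w1 w2)"
  define u1 where "u1 = cross f w1"
  define u2 where "u2 = cross f w2"
  have u: "dot u1 f = 0" "dot u2 f = 0" "bour u1 = a" "bour u2 = b"
    by (simp_all add: u1_def u2_def a_def b_def dot_cross_left bour_cross)
  have rel: "b * u1 j - a * u2 j = c * \<nu> j" if "j < 3" for j
    unfolding a_def b_def c_def u1_def u2_def by (rule cross_relation[OF nu_syz that])
  have ha: "homogeneous (int e) a" "homogeneous (int e) b"
    unfolding a_def b_def by (rule homogeneous_dot_nu, use w in blast)+
  have hu: "homogeneous (int d) (u1 j)" "homogeneous (int d) (u2 j)" for j
    using homogeneous_cross[of "int d" f 0 w1 j] homogeneous_cross[of "int d" f 0 w2 j] hom_f w by (simp_all add: u1_def u2_def)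
  have hc: "homogeneous (int d) c"
    using homogeneous_dot[of "int d" f 0 "cross w1 w2"] homogeneous_cross[of 0 w1 0 w2] hom_f w by (simp add: c_def)
  let ?A = "mat_of_cols 3 [vec 3 \<nu>, vec 3 u1, vec 3 u2]"
  have A: "?A \<in> carrier_mat 3 3" using mat_of_cols_carrier(1)[of 3 "[vec 3 \<nu>, vec 3 u1, vec 3 u2]"] by (simp add: numeral_3_eq_3)
  \<comment> \<open>The column (-c, b, -a) encodes the relation b u1 - a u2 = c \<nu>.\<close>
  let ?B = "mat 3 1 (\<lambda>(i, j). if i = 0 then - c else if i = 1 then b else - a)"
  have B: "?B \<in> carrier_mat 3 1" by simp
  have Bz: "?B *\<^sub>v z = vec 3 (\<lambda>i. (if i = 0 then - c else if i = 1 then b else - a) * z $ 0)" if z: "z \<in> carrier_vec 1" for z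
    using z by (intro eq_vecI) (auto simp: scalar_prod_def)
  have im: "mat_image ?A = syz"
  proof -
    have "mat_image (mat_of_cols 3 (vec 3 \<nu> # map (vec 3) [u1, u2])) = syz"
    proof (rule mat_image_syz)
      show "dot ([u1, u2] ! i) f = 0" if "i < length [u1, u2]" for i using that u by (auto simp: less_Suc_eq)
      show "bour_ideal \<subseteq> ideal_span (set (map bour [u1, u2]))" using I u by (simp add: a_def b_def)
    qed
    then show ?thesis by simp
  qed
  have gA: "graded_mat [int d, int d, int d] [int (d + e), int (2 * d), int (2 * d)] ?A"
    unfolding graded_mat_def
  proof (intro conjI allI impI)
    fix p q assume "p < length [int d, int d, int d]" "q < length [int (d + e), int (2 * d), int (2 * d)]"
    then have pq: "p < 3" "q < 3" by auto
    have "homogeneous ([int (d + e), int (2 * d), int (2 * d)] ! q - int d) (?A $$ (p, q))"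
      using pq hom_nu[OF pq(1)] hu[of p] by (auto simp: less_3_iff[of q] mat_of_cols_index)
    then show "homogeneous ([int (d + e), int (2 * d), int (2 * d)] ! q - [int d, int d, int d] ! p) (?A $$ (p, q))"
      unfolding nth_replicate_3[OF pq(1)] .
  qed (use A in \<open>simp add: numeral_3_eq_3\<close>)
  have gB: "graded_mat [int (d + e), int (2 * d), int (2 * d)] [int (2 * d + e)] ?B"
    unfolding graded_mat_def
  proof (intro conjI allI impI)
    fix p q assume "p < length [int (d + e), int (2 * d), int (2 * d)]" "q < length [int (2 * d + e)]"
    then have pq: "p < 3" "q = 0" by auto
    show "homogeneous ([int (2 * d + e)] ! q - [int (d + e), int (2 * d), int (2 * d)] ! p) (?B $$ (p, q))"
      using pq homogeneous_uminus[OF hc] homogeneous_uminus[OF ha(1)] ha(2) by (auto simp: less_3_iff[of p])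
  qed (simp add: numeral_3_eq_3)
  have kA: "mat_kernel ?A = mat_image ?B"
  proof (intro equalityI subsetI)
    fix w assume "w \<in> mat_kernel ?A"
    then have w: "w \<in> carrier_vec 3" "?A *\<^sub>v w = 0\<^sub>v 3" using mat_kernel_iff[OF A] by simp_all
    have z: "\<forall>j<3. w $ 0 * \<nu> j + w $ 1 * u1 j + w $ 2 * u2 j = 0" using w(2) unfolding mat_of_cols_3_mult_vec[OF w(1)] vec_eq_0_3 .
    have "w $ 1 * a + w $ 2 * b = 0" using nu_relation[OF u(1,2) z] unfolding u(3,4) .
    then obtain h where h: "w $ 1 = h * b" "w $ 2 = - (h * a)" using ci_syzygy[OF ab[folded a_def b_def]] by blast
    obtain k where k: "k < 3" "\<nu> k \<noteq> 0" using nu_nz by blast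
    have "w $ 0 * \<nu> k + h * (b * u1 k - a * u2 k) = 0" using z k(1) h by (simp add: algebra_simps)
    then have "(w $ 0 + h * c) * \<nu> k = 0" unfolding rel[OF k(1)] by (simp add: algebra_simps)
    then have w0: "w $ 0 = - c * h" using k(2) by (simp add: add_eq_0_iff mult.commute)
    have "?B *\<^sub>v vec 1 (\<lambda>_. h) = w" unfolding Bz[OF vec_carrier]
    proof (rule eq_vecI)
      fix i assume "i < dim_vec w"
      then have "i < 3" using w(1) by simp
      then show "vec 3 (\<lambda>i. (if i = 0 then - c else if i = 1 then b else - a) * vec 1 (\<lambda>_. h) $ 0) $ i = w $ i"
        using h w0 by (auto simp: less_3_iff mult.commute)
    qed (use w(1) in simp)
    then show "w \<in> mat_image ?B" using mat_imageI[OF B, of "vec 1 (\<lambda>_. h)"] by simp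
  next
    fix w assume "w \<in> mat_image ?B"
    then obtain z where z: "z \<in> carrier_vec 1" "w = ?B *\<^sub>v z" by (rule mat_imageE[OF _ B])
    define h where "h = z $ 0"
    have w: "w = vec 3 (\<lambda>i. (if i = 0 then - c else if i = 1 then b else - a) * h)" unfolding z(2) Bz[OF z(1)] h_def ..
    have w3: "w \<in> carrier_vec 3" by (simp add: w)
    have "w $ 0 * \<nu> j + w $ 1 * u1 j + w $ 2 * u2 j = 0" if j: "j < 3" for j
    proof -
      have "w $ 0 * \<nu> j + w $ 1 * u1 j + w $ 2 * u2 j = h * (b * u1 j - a * u2 j) - h * (c * \<nu> j)"
        unfolding w by (simp add: algebra_simps)
      then show ?thesis unfolding rel[OF j] by simp
    qed
    then have "?A *\<^sub>v w = 0\<^sub>v 3" unfolding mat_of_cols_3_mult_vec[OF w3] vec_eq_0_3 by blast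
    then show "w \<in> mat_kernel ?A" using mat_kernel_iff[OF A] w3 by simp
  qed
  have "z = 0\<^sub>v 1" if z: "z \<in> carrier_vec 1" "?B *\<^sub>v z = 0\<^sub>v 3" for z
  proof -
    have "\<forall>i<(3::nat). (if i = 0 then - c else if i = 1 then b else - a) * z $ 0 = 0" using z(2) unfolding Bz[OF z(1)] vec_eq_0_3 .
    from this[rule_format, of 2] have "z $ 0 = 0" using ab(1) by (simp add: a_def)
    then show ?thesis using z(1) by (intro eq_vecI) auto
  qed
  moreover have "?B *\<^sub>v 0\<^sub>v 1 = 0\<^sub>v 3" by (intro eq_vecI) auto
  ultimately have kB: "mat_kernel ?B = {0\<^sub>v 1}" using mat_kernel_iff[OF B] by auto
  have res: "graded_free_resolution forms_ideal [[0], [int d, int d, int d], [int (d + e), int (2 * d), int (2 * d)], [int (2 * d + e)]] [forms_mat, ?A, ?B]"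
    unfolding graded_free_resolution_length_3
    using graded_forms_mat gA gB mat_image_forms_mat mat_kernel_forms_mat im kA kB by simp
  have min: "\<forall>p<dim_row M. \<forall>q<dim_col M. Poly_Mapping.lookup (M $$ (p, q)) 0 = 0" if "M \<in> set [forms_mat, ?A, ?B]" for M
  proof -
    have "M = forms_mat \<or> M = ?A \<or> M = ?B" using that by (simp only: list.set insert_iff empty_iff simp_thms)
    then show ?thesis
    proof (elim disjE)
      assume 1: "M = forms_mat"
      have "Poly_Mapping.lookup (forms_mat $$ (p, q)) 0 = 0" if "p < dim_row forms_mat" "q < dim_col forms_mat" for p q
        by (rule graded_mat_minimal[OF graded_forms_mat _ that]) (use de in auto)
      then show ?thesis unfolding 1 by simp
    next
      assume 2: "M = ?A"
      have "Poly_Mapping.lookup (?A $$ (p, q)) 0 = 0" if "p < dim_row ?A" "q < dim_col ?A" for p q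
        by (rule graded_mat_minimal[OF gA _ that]) (use de in auto)
      then show ?thesis unfolding 2 by (intro allI impI)
    next
      assume 3: "M = ?B"
      have "Poly_Mapping.lookup (?B $$ (p, q)) 0 = 0" if "p < dim_row ?B" "q < dim_col ?B" for p q
        by (rule graded_mat_minimal[OF gB _ that]) (use de in auto)
      then show ?thesis unfolding 3 by (intro allI impI)
    qed
  qed
  show ?thesis unfolding minimal_graded_free_resolution_def
    by (rule exI[of _ "[forms_mat, ?A, ?B]"], rule conjI[OF res], rule ballI, rule min)
qed

text \<open>The resolution and \<open>dim_relation\<close> both compute the dimensions of J;
  eliminating these leaves the formula of \<open>dim_ci\<close>.\<close>

lemma dim_bour_ideal_of_resolution:
  assumes r: "graded_free_resolution forms_ideal [[0], [int d, int d, int d], [int (d + e), int (2 * d), int (2 * d)], [int (2 * d + e)]] [A0, A1, A2]"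
  shows "P.dim {p \<in> bour_ideal. homogeneous t p} + P.dim (homog (t - 2 * int e) :: ('n, 'k) mpoly set) = 2 * P.dim (homog (t - int e) :: ('n, 'k) mpoly set)"
proof -
  \<comment> \<open>The degree of the syzygies that \<open>bour\<close> maps to degree t.\<close>
  define s where "s = t + int d - int e"
  have e: "s + (int e - int d) = t" "s + int d - int (d + e) = s - int e" "s + int d - int (2 * d) = t - int e"
    "s + int d - int d = s" "s + int d - int (2 * d + e) = t - 2 * int e" by (simp_all add: s_def)
  have S: "(\<Sum>i<length [x, y, z]. g ([x, y, z] ! i)) = g x + g y + g z" "(\<Sum>i<length [x]. g ([x] ! i)) = g x" for x y z :: int and g :: "int \<Rightarrow> nat"
    by (simp_all add: lessThan_Suc)
  show ?thesis
    using dim_ideal_of_resolution[OF is_ideal_span r, of "s + int d"] dim_relation[of s]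
    unfolding S[of "\<lambda>x. P.dim (homog (s + int d - x) :: ('n, 'k) mpoly set)"] e by simp
qed

text \<open>Each direction must first exclude the perfect case, where the Bourbaki degree is 0 by
  definition: in the first because e^2 > 0, in the second because the resolution forces projective
  dimension at least three against grade two.\<close>

lemma bourbaki_degree_eq_square_iff:
  assumes h: "ideal_height forms_ideal = 2" and i: "indeg syz = e" and de: "d \<ge> 1" "e \<ge> 1"
  shows "bourbaki_degree (f 0) (f 1) (f 2) = of_nat (e ^ 2) \<longleftrightarrow>
    (\<exists>As. minimal_graded_free_resolution forms_ideal [[0], [int d, int d, int d], [int (d + e), int (2 * d), int (2 * d)], [int (2 * d + e)]] As)"
proof
  assume b: "bourbaki_degree (f 0) (f 1) (f 2) = of_nat (e ^ 2)"
  have np: "\<not> (perfect_ideal forms_ideal \<and> ideal_height forms_ideal = 2)"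
  proof
    assume p: "perfect_ideal forms_ideal \<and> ideal_height forms_ideal = 2"
    have "bourbaki_degree (f 0) (f 1) (f 2) = 0" unfolding bourbaki_degree_def Let_def if_P[OF p] ..
    then show False using b de(2) by simp
  qed
  have unit: "1 \<notin> three_forms.bour_ideal f \<nu>'" if t: "three_forms f d e \<nu>'" for \<nu>'
    using three_forms.perfect_of_unit[OF t h] np h by blast
  have "bourbaki_degree (f 0) (f 1) (f 2) = ideal_multiplicity bour_ideal" by (rule bourbaki_degree_eq[OF np i unit])
  then have m: "ideal_multiplicity bour_ideal = of_nat (e ^ 2)" using b by simp
  obtain w1 w2 where w: "\<forall>i. homogeneous 0 (w1 i)" "\<forall>i. homogeneous 0 (w2 i)"
    "dot \<nu> w1 \<noteq> 0" "no_common_prime (dot \<nu> w1) (dot \<nu> w2)" by (rule coprime_in_nu)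
  have hw: "homogeneous (int e) (dot \<nu> w1)" "homogeneous (int e) (dot \<nu> w2)"
    by (rule homogeneous_dot_nu, use w in blast)+
  obtain V where V: "card V = CARD('n) - 2" "indep_vars V {r. r * 1 \<in> bour_ideal}"
    by (rule colon_indep_vars[OF unit[OF three_forms_axioms]])
  have V': "indep_vars V bour_ideal" using V(2) by simp
  have "bour_ideal = ideal_span {dot \<nu> w1, dot \<nu> w2}"
    by (rule ideal_eq_ci_of_multiplicity[OF n3 _ is_ideal_bour_ideal hcomp_bour_ideal V' V(1) w(3,4) hw dot_nu_in_bour_ideal dot_nu_in_bour_ideal m])
      (use de in simp)
  then show "\<exists>As. minimal_graded_free_resolution forms_ideal [[0], [int d, int d, int d], [int (d + e), int (2 * d), int (2 * d)], [int (2 * d + e)]] As"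
    by (rule ci_resolution[OF de w])
next
  assume "\<exists>As. minimal_graded_free_resolution forms_ideal [[0], [int d, int d, int d], [int (d + e), int (2 * d), int (2 * d)], [int (2 * d + e)]] As"
  then obtain As where r': "graded_free_resolution forms_ideal [[0], [int d, int d, int d], [int (d + e), int (2 * d), int (2 * d)], [int (2 * d + e)]] As"
    unfolding minimal_graded_free_resolution_def by blast
  then have "length As = 3" unfolding graded_free_resolution_def by simp
  then obtain A0 A1 A2 where As: "As = [A0, A1, A2]" by (auto simp: length_Suc_conv numeral_3_eq_3)
  note r = r'[unfolded As]
  have len: "3 \<le> length Bs" if "graded_free_resolution forms_ideal D Bs" for D Bs
    by (rule resolution_length_ge_3[OF h r _ _ that]) (use de in auto)
  have "3 \<le> proj_dim_quotient forms_ideal" unfolding proj_dim_quotient_def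
  proof (rule INF_greatest)
    fix Bs assume "Bs \<in> {As. \<exists>D. graded_free_resolution forms_ideal D As}"
    then have "3 \<le> length Bs" using len by blast
    then show "3 \<le> enat (length Bs)" using enat_ord_simps(1)[of 3 "length Bs"] by (simp add: numeral_eq_enat)
  qed
  then have np: "\<not> (perfect_ideal forms_ideal \<and> ideal_height forms_ideal = 2)"
    unfolding perfect_ideal_def grade_J[OF h] by (auto simp: numeral_eq_enat)
  have unit: "1 \<notin> three_forms.bour_ideal f \<nu>'" if t: "three_forms f d e \<nu>'" for \<nu>'
    using three_forms.perfect_of_unit[OF t h] np h by blast
  have "ideal_multiplicity bour_ideal = of_nat (e ^ 2)"
  proof (rule multiplicity_of_ci_hilbert_function(2)[OF n3])
    fix t
    show "P.dim {p \<in> bour_ideal. homogeneous (int t) p} + P.dim (homog (int t - 2 * int e) :: ('n, 'k) mpoly set) = 2 * P.dim (homog (int t - int e) :: ('n, 'k) mpoly set)"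
      by (rule dim_bour_ideal_of_resolution[OF r])
  qed (use de in simp)
  moreover have "bourbaki_degree (f 0) (f 1) (f 2) = ideal_multiplicity bour_ideal" by (rule bourbaki_degree_eq[OF np i unit])
  ultimately show "bourbaki_degree (f 0) (f 1) (f 2) = of_nat (e ^ 2)" by simp
qed

end

section \<open>Constant relations and minimal generation\<close>

lemma in_ideal_span_of_constant_relation:
  fixes a b c :: "('n::{finite,linorder}, 'k::field) mpoly"
  assumes "Poly_Mapping.single 0 x * a + p * b + q * c = 0" "x \<noteq> 0" shows "a \<in> ideal_span {b, c}"
proof -
  let ?i = "Poly_Mapping.single 0 (inverse x) :: ('n, 'k) mpoly"
  have "?i * (Poly_Mapping.single 0 x * a) = a" using assms(2) by (simp add: mult.assoc[symmetric] mult_single)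
  moreover have "Poly_Mapping.single 0 x * a = - (p * b + q * c)" unfolding eq_neg_iff_add_eq_0 using assms(1) by (simp add: add.assoc)
  ultimately have "a = ?i * (- (p * b + q * c))" by simp
  then have "a = (- ?i * p) * b + (- ?i * q) * c" by (simp add: algebra_simps)
  then show ?thesis unfolding ideal_span_2 by blast
qed

lemma minimally_generates_not_in_span:
  assumes "minimally_generates {a, b, c} I" "distinct [a, b, c]" shows "a \<notin> ideal_span {b, c}"
proof
  assume a: "a \<in> ideal_span {b, c}"
  have "{a, b, c} \<subseteq> ideal_span {b, c}" using a ideal_span_superset[of "{b, c}"] by auto
  then have "ideal_span {a, b, c} \<subseteq> ideal_span {b, c}" by (rule ideal_span_least[OF _ is_ideal_span])
  moreover have "{b, c} \<subseteq> ideal_span {a, b, c}" using ideal_span_superset[of "{a, b, c}"] by auto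
  then have "ideal_span {b, c} \<subseteq> ideal_span {a, b, c}" by (rule ideal_span_least[OF _ is_ideal_span])
  ultimately have "ideal_span {b, c} = I" using assms(1) unfolding minimally_generates_def by simp
  moreover have "{b, c} \<subset> {a, b, c}" using assms(2) by auto
  ultimately show False using assms(1) unfolding minimally_generates_def by blast
qed

theorem proposition2p3:
  fixes f1 f2 f3 :: "('n::{finite,linorder}, 'k::{alg_closed_field,field_char_0}) mpoly"
    and J :: "('n, 'k) mpoly set"
    and d e :: nat
  assumes "CARD('n) \<ge> 3"
    and "J = ideal_span {f1, f2, f3}"
    and "homogeneous (int d) f1" "homogeneous (int d) f2" "homogeneous (int d) f3"
    and "distinct [f1, f2, f3]" "minimally_generates {f1, f2, f3} J"
    and "ideal_height J = 2"
    and "e = indeg (syzygies f1 f2 f3)"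
  shows "bourbaki_degree f1 f2 f3 = of_nat (e ^ 2) \<longleftrightarrow>
    (\<exists>As. minimal_graded_free_resolution J
       [[0],
        [int d, int d, int d],
        [int (d + e), int (2 * d), int (2 * d)],
        [int (2 * d + e)]] As)"
proof -
  define f where "f = (\<lambda>i::nat. if i = 0 then f1 else if i = 1 then f2 else if i = 2 then f3 else 0)"
  have f: "f 0 = f1" "f 1 = f2" "f 2 = f3" by (simp_all add: f_def)
  have fi: "f i \<in> J" if "i < 3" for i
    using that ideal_span_superset[of "{f1, f2, f3}"] by (auto simp: assms(2) f_def less_3_iff)
  have hom_f: "homogeneous (int d) (f i)" for i using assms(3-5) by (simp add: f_def)
  have common: "q dvd 1" if q: "\<And>i. i < 3 \<Longrightarrow> q dvd f i" for q
  proof (rule ideal_height_2_common_divisor[OF assms(8)])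
    fix x assume "x \<in> J"
    then obtain r s t where "x = r * f 0 + s * f 1 + t * f 2" unfolding assms(2) ideal_span_3 f by blast
    then show "q dvd x" using q[of 0] q[of 1] q[of 2] by simp
  qed
  have prim_f: "\<exists>i<3. \<not> p dvd f i" if "prime_elem p" for p
    using common[of p] that by (auto simp: prime_elem_def)
  have f_nz: "\<exists>i<3. f i \<noteq> 0" using common[of 0] by auto
  let ?S = "syzygies f1 f2 f3"
  let ?Q = "\<lambda>t. \<exists>v\<in>?S. v \<noteq> 0\<^sub>v (dim_vec v) \<and> homogeneous_vec (int t) v"
  have syz_vec: "vec 3 v \<in> ?S \<longleftrightarrow> dot v f = 0" for v by (simp add: syzygies_def dot_def f_def)
  have nz_vec: "vec 3 v \<noteq> 0\<^sub>v (dim_vec (vec 3 v)) \<longleftrightarrow> (\<exists>i<3. v i \<noteq> 0)" for v :: "nat \<Rightarrow> ('n, 'k) mpoly"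
    by (auto simp: vec_eq_iff)
  \<comment> \<open>The Koszul syzygy (f2, -f1, 0), nonzero because the forms are distinct, shows
    that the least degree is attained and at most d.\<close>
  have Qd: "?Q d"
  proof -
    define v where "v = (\<lambda>i::nat. if i = 0 then f2 else if i = 1 then - f1 else 0)"
    have "f1 \<noteq> 0 \<or> f2 \<noteq> 0" using assms(6) by auto
    then have "\<exists>i<3. v i \<noteq> 0" by (auto simp: v_def intro: exI[of _ 0] exI[of _ 1])
    moreover have "dot v f = 0" by (simp add: dot_def v_def f_def)
    moreover have "homogeneous_vec (int d) (vec 3 v)" using assms(3,4) by (simp add: homogeneous_vec_def v_def homogeneous_uminus)
    ultimately show ?thesis using syz_vec[of v] nz_vec[of v] by (intro bexI[of _ "vec 3 v"]) blast+
  qed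
  have e_def: "e = (LEAST t. ?Q t)" unfolding assms(9) indeg_def by (rule refl)
  have "?Q e" unfolding e_def by (rule LeastI[of ?Q, OF Qd])
  then obtain u where u: "u \<in> ?S" "u \<noteq> 0\<^sub>v (dim_vec u)" "homogeneous_vec (int e) u" by blast
  define \<nu> where "\<nu> = (\<lambda>i. u $ i)"
  have u3: "dim_vec u = 3" using u(1) by (simp add: syzygies_def)
  have uv: "vec 3 \<nu> = u" using u3 by (intro eq_vecI) (simp_all add: \<nu>_def)
  have hom_nu: "homogeneous (int e) (\<nu> i)" if "i < 3" for i using u(3) u3 that by (simp add: homogeneous_vec_def \<nu>_def)
  have nu_nz: "\<exists>i<3. \<nu> i \<noteq> 0" using nz_vec[of \<nu>] u(2) unfolding uv by blast
  have nu_syz: "dot \<nu> f = 0" using syz_vec[of \<nu>] u(1) unfolding uv by blast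
  have min_deg: "\<forall>i<3. v i = 0" if v: "dot v f = 0" "\<And>i. i < 3 \<Longrightarrow> homogeneous t (v i)" "t < int e" for t v
  proof (cases "t < 0")
    case True then show ?thesis using homogeneous_neg v(2) by blast
  next
    case False
    then obtain m where m: "t = int m" "m < e" using v(3) nonneg_int_cases[of t] by auto
    have "\<not> ?Q m" using m(2) unfolding e_def by (rule not_less_Least)
    moreover have "homogeneous_vec (int m) (vec 3 v)" using v(2) m(1) by (simp add: homogeneous_vec_def)
    ultimately show ?thesis using syz_vec[of v] nz_vec[of v] v(1) by blast
  qed
  interpret three_forms f d e \<nu>
  proof
    show "homogeneous (int d) (f i)" if "i < 3" for i by (rule hom_f)
    show "\<forall>i<3. v i = 0" if "dot v f = 0" "\<And>i. i < 3 \<Longrightarrow> homogeneous t (v i)" "t < int e" for t v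
      by (rule min_deg[OF that])
  qed (fact prim_f f_nz hom_nu nu_nz nu_syz assms(1))+
  \<comment> \<open>A syzygy of degree 0 would express one form by the other two, against minimal
    generation. With e \<le> d this gives d, e \<ge> 1, which makes the shifts increase along the
    resolution.\<close>
  have "e \<noteq> 0"
  proof
    assume "e = 0"
    then have c: "\<nu> i = Poly_Mapping.single 0 (Poly_Mapping.lookup (\<nu> i) 0)" if "i < 3" for i
      using homogeneous_0_const hom_nu[OF that] by simp
    obtain k where k: "k < 3" "\<nu> k \<noteq> 0" using nu_nz by blast
    define x where "x = Poly_Mapping.lookup (\<nu> k) 0"
    have kx: "\<nu> k = Poly_Mapping.single 0 x" unfolding x_def by (rule c[OF k(1)])
    have x: "x \<noteq> 0" using k(2) kx by auto
    have z: "\<nu> 0 * f1 + \<nu> 1 * f2 + \<nu> 2 * f3 = 0" using nu_syz by (simp only: dot_def f)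
    have mg: "minimally_generates {f1, f2, f3} J" "minimally_generates {f2, f1, f3} J" "minimally_generates {f3, f1, f2} J"
      using assms(7) by (simp_all add: insert_commute)
    consider "k = 0" | "k = 1" | "k = 2" using k(1) by (auto simp: less_3_iff)
    then show False
    proof cases
      case 1
      have "Poly_Mapping.single 0 x * f1 + \<nu> 1 * f2 + \<nu> 2 * f3 = 0" using z kx[unfolded 1] by simp
      then have "f1 \<in> ideal_span {f2, f3}" by (rule in_ideal_span_of_constant_relation[OF _ x])
      then show False using minimally_generates_not_in_span[OF mg(1)] assms(6) by auto
    next
      case 2
      have "Poly_Mapping.single 0 x * f2 + \<nu> 0 * f1 + \<nu> 2 * f3 = 0" using z unfolding kx[unfolded 2] by (simp add: ac_simps)
      then have "f2 \<in> ideal_span {f1, f3}" by (rule in_ideal_span_of_constant_relation[OF _ x])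
      then show False using minimally_generates_not_in_span[OF mg(2)] assms(6) by auto
    next
      case 3
      have "Poly_Mapping.single 0 x * f3 + \<nu> 0 * f1 + \<nu> 1 * f2 = 0" using z unfolding kx[unfolded 3] by (simp add: ac_simps)
      then have "f3 \<in> ideal_span {f1, f2}" by (rule in_ideal_span_of_constant_relation[OF _ x])
      then show False using minimally_generates_not_in_span[OF mg(3)] assms(6) by auto
    qed
  qed
  moreover have "e \<le> d" unfolding e_def by (rule Least_le[of ?Q, OF Qd])
  ultimately have de: "d \<ge> 1" "e \<ge> 1" by simp_all
  have h: "ideal_height (ideal_span {f 0, f 1, f 2}) = 2" unfolding f using assms(2,8) by simp
  have i: "indeg syz = e" unfolding assms(9) syz_eq[symmetric] f ..
  show ?thesis using bourbaki_degree_eq_square_iff[OF h i de] unfolding f assms(2) .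
qed

end
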